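(* Fix a Jordan curve $\Gamma\subset\mathbb{C}$, an integer $n\ge 2$, and a positive real number $d$. Suppose that $N$ is a regular closed neighbourhood of $\mathbb{C}\times\{0\}$ in $\mathbb{C}^2$ containing $\mathbb{C}\times D_{d^{2n}}$ such that: (i) the map $\Psi_n$ and $\partial N$ are transverse; (ii) the pair $(\partial N,\operatorname{Im}(\Psi_n)\cap\partial N)$ is homeomorphic to $(\mathbb{C}\times S^1,K_{1,2n})$ or to $(\mathbb{C}\times S^1,K_{1,-2n})$. Then there exist $a\neq b$ in $\mathbb{M}$ such that $\Psi_n(a)=\Psi_n(b)\in\mathbb{C}\times(\mathbb{C}\setminus D^\circ_{d^{2n}})$; in other words, there exists an integer $1\le k\le n-1$ such that $\Gamma$ has an inscribed rectangle with aspect ratio $\tan\left(\frac{k\pi}{2n}\right)$ and diameter at least $d$.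
   Context: A Jordan curve is the image $\Gamma$ of a continuous injection $\alpha\colon S^1\to\mathbb{C}$; fix such an $\alpha$. Let $\mathbb{M}=(S^1\times S^1)/((x,y)\sim(y,x))$, a Möbius band whose elements are unordered pairs $\{s,t\}$. For a positive integer $n$ define $\Psi_n\colon\mathbb{M}\to\mathbb{C}^2$ by $\Psi_n(\{s,t\})=\left(\frac{\alpha(s)+\alpha(t)}{2},(\alpha(s)-\alpha(t))^{2n}\right)$; its image does not depend on the choice of $\alpha$. $D_r=\{z\in\mathbb{C}: |z|\le r\}$ and $D_r^\circ$ is its interior. A regular closed neighbourhood of $\mathbb{C}\times\{0\}$ is a subset $N\subset\mathbb{C}^2$ for which there are $r>0$ and a homeomorphism $\mathbb{C}^2\to\mathbb{C}^2$ which maps $N$ onto $\mathbb{C}\times D_r$ and restricts to the identity on $\mathbb{C}\times\{0\}$. $K_{1,q}=\{(e^{2\pi i t},e^{2\pi i q t})\mid t\in\mathbb{R}\}\subset\mathbb{C}\times S^1$. A subset $F$ of an $m$-manifold $X$ is a locally-flat submanifold of dimension $k$ if each $x\in F$ has an open neighbourhood $U\subset X$ such that $(U,U\cap F)$ is homeomorphic to an open subset of $(\mathbb{R}^m,\mathbb{R}_{\ge0}\times\mathbb{R}^{k-1}\times\{0\})$. Two locally-flat submanifolds $F,F'$ without boundary, of dimensions $k,k'$ in an $m$-manifold $X$, intersect transversely if either $F\cap F'=\emptyset$, or $k+k'\ge m$ and every $x\in F\cap F'$ has a neighbourhood $U$ with $(U,U\cap F,U\cap F')$ homeomorphic to an open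 subset of $(\mathbb{R}^m,\mathbb{R}^k\times\{0\},\{0\}\times\mathbb{R}^{k'})$. $\Psi_n$ and $\partial N$ are transverse if every $x\in\Psi_n^{-1}(\partial N)$ has an open neighbourhood $U_x\subset\mathbb{M}$ such that $\Psi_n$ is injective on $U_x$ and $\Psi_n(U_x)$ is a locally-flat surface that intersects $\partial N$ transversely. A rectangle is inscribed in $\Gamma$ if its four corners lie on $\Gamma$; its aspect ratio is the ratio of its side lengths, defined up to reciprocals; its diameter is the length of its diagonals. *)

theory Defs
  imports "HOL-Analysis.Analysis" "HOL-Library.Uprod"
begin

definition quotient_topology :: "'a topology \<Rightarrow> ('a \<Rightarrow> 'b) \<Rightarrow> 'b topology" where
  "quotient_topology X f =
     topology (\<lambda>U. U \<subseteq> f ` topspace X \<and> openin X {x \<in> topspace X. f x \<in> U})"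

lemma openin_quotient_topology:
  "openin (quotient_topology X f) U \<longleftrightarrow> U \<subseteq> f ` topspace X \<and> openin X {x \<in> topspace X. f x \<in> U}"
proof -
  have "istopology (\<lambda>U. U \<subseteq> f ` topspace X \<and> openin X {x \<in> topspace X. f x \<in> U})"
    unfolding istopology_def
  proof (intro conjI allI impI)
    fix A B assume A: "A \<subseteq> f ` topspace X \<and> openin X {x \<in> topspace X. f x \<in> A}"
      and B: "B \<subseteq> f ` topspace X \<and> openin X {x \<in> topspace X. f x \<in> B}"
    show "A \<inter> B \<subseteq> f ` topspace X" using A by blast
    have "{x \<in> topspace X. f x \<in> A \<inter> B} = {x \<in> topspace X. f x \<in> A} \<inter> {x \<in> topspace X. f x \<in> B}"
      by blast
    then show "openin X {x \<in> topspace X. f x \<in> A \<inter> B}"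
      using openin_Int[OF conjunct2[OF A] conjunct2[OF B]] by (simp only:)
  next
    fix \<K> assume K: "\<forall>K\<in>\<K>. K \<subseteq> f ` topspace X \<and> openin X {x \<in> topspace X. f x \<in> K}"
    show "\<Union>\<K> \<subseteq> f ` topspace X" using K by blast
    have "{x \<in> topspace X. f x \<in> \<Union>\<K>} = \<Union>((\<lambda>K. {x \<in> topspace X. f x \<in> K}) ` \<K>)" by blast
    moreover have "openin X (\<Union>((\<lambda>K. {x \<in> topspace X. f x \<in> K}) ` \<K>))"
      using K by (intro openin_Union) blast
    ultimately show "openin X {x \<in> topspace X. f x \<in> \<Union>\<K>}" by (simp only:)
  qed
  then show ?thesis
    unfolding quotient_topology_def by (simp only: topology_inverse')
qed

lemma topspace_quotient_topology: "topspace (quotient_topology X f) = f ` topspace X"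
proof (rule subset_antisym)
  show "topspace (quotient_topology X f) \<subseteq> f ` topspace X"
    using openin_topspace[of "quotient_topology X f"] by (simp only: openin_quotient_topology)
  have "{x \<in> topspace X. f x \<in> f ` topspace X} = topspace X" by blast
  then have "openin (quotient_topology X f) (f ` topspace X)"
    by (simp only: openin_quotient_topology openin_topspace subset_refl simp_thms)
  then show "f ` topspace X \<subseteq> topspace (quotient_topology X f)"
    by (rule openin_subset)
qed

lemma quotient_map_quotient_topology: "quotient_map X (quotient_topology X f) f"
  unfolding quotient_map_def topspace_quotient_topology openin_quotient_topology by simp

abbreviation unit_circle :: "complex set"
  where "unit_circle \<equiv> sphere 0 1"

definition moebius_band :: "complex uprod topology" where
  "moebius_band =
     quotient_topology (top_of_set (unit_circle \<times> unit_circle)) (\<lambda>(s, t). Upair s t)"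

lift_definition Psi :: "(complex \<Rightarrow> complex) \<Rightarrow> nat \<Rightarrow> complex uprod \<Rightarrow> complex \<times> complex"
  is "\<lambda>\<alpha> n (s, t). ((\<alpha> s + \<alpha> t) / 2, (\<alpha> s - \<alpha> t) ^ (2 * n))"
  by (auto simp: power_mult power2_commute add.commute)

lemma Psi_Upair: "Psi \<alpha> n (Upair s t) = ((\<alpha> s + \<alpha> t) / 2, (\<alpha> s - \<alpha> t) ^ (2 * n))"
  by transfer simp

definition regular_closed_nbhd :: "(complex \<times> complex) set \<Rightarrow> bool" where
  "regular_closed_nbhd N \<longleftrightarrow> (\<exists>r>0. \<exists>h :: complex \<times> complex \<Rightarrow> complex \<times> complex.
     homeomorphic_map euclidean euclidean h \<and>
     h ` N = UNIV \<times> cball 0 r \<and> (\<forall>z. h (z, 0) = (z, 0)))"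

definition torus_curve :: "int \<Rightarrow> (complex \<times> complex) set" where
  "torus_curve q = range (\<lambda>t::real. (cis (2 * pi * t), cis (2 * pi * of_int q * t)))"

definition homeomorphic_pairs :: "'a topology \<Rightarrow> 'a set \<Rightarrow> 'b topology \<Rightarrow> 'b set \<Rightarrow> bool" where
  "homeomorphic_pairs X A Y B \<longleftrightarrow> (\<exists>h. homeomorphic_map X Y h \<and> h ` A = B)"

text \<open>
  In the next four definitions \<open>X\<close> is thought of as an \<open>m\<close>-manifold; \<open>Euclidean_space m\<close> consists of
  the sequences vanishing from index \<open>m\<close> on, so the first coordinate has index 0.
  A chart maps \<open>(U, U \<inter> F)\<close> to \<open>(V, V \<inter> H)\<close>, where \<open>V\<close> is open and
  \<open>H\<close> is the half-space of the first \<open>k\<close> coordinates.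
\<close>

definition locally_flat_chart ::
  "nat \<Rightarrow> 'a topology \<Rightarrow> nat \<Rightarrow> 'a set \<Rightarrow> 'a set \<Rightarrow> (nat \<Rightarrow> real) set \<Rightarrow> ('a \<Rightarrow> nat \<Rightarrow> real) \<Rightarrow> bool" where
  "locally_flat_chart m X k F U V h \<longleftrightarrow>
     openin X U \<and> openin (Euclidean_space m) V \<and>
     homeomorphic_map (subtopology X U) (subtopology (Euclidean_space m) V) h \<and>
     h ` (U \<inter> F) = V \<inter> {y. 0 \<le> y 0 \<and> (\<forall>i\<in>{k..<m}. y i = 0)}"

definition locally_flat_submanifold :: "nat \<Rightarrow> 'a topology \<Rightarrow> nat \<Rightarrow> 'a set \<Rightarrow> bool" where
  "locally_flat_submanifold m X k F \<longleftrightarrow> 1 \<le> k \<and> k \<le> m \<and> F \<subseteq> topspace X \<and>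
     (\<forall>x\<in>F. \<exists>U V h. x \<in> U \<and> locally_flat_chart m X k F U V h)"

definition submanifold_boundary :: "nat \<Rightarrow> 'a topology \<Rightarrow> nat \<Rightarrow> 'a set \<Rightarrow> 'a set" where
  "submanifold_boundary m X k F =
     {x \<in> F. \<exists>U V h. x \<in> U \<and> locally_flat_chart m X k F U V h \<and> h x 0 = 0}"

definition intersect_transversely ::
  "nat \<Rightarrow> 'a topology \<Rightarrow> nat \<Rightarrow> 'a set \<Rightarrow> nat \<Rightarrow> 'a set \<Rightarrow> bool" where
  "intersect_transversely m X k F k' F' \<longleftrightarrow>
     locally_flat_submanifold m X k F \<and> submanifold_boundary m X k F = {} \<and>
     locally_flat_submanifold m X k' F' \<and> submanifold_boundary m X k' F' = {} \<and>
     (F \<inter> F' = {} \<or>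
      m \<le> k + k' \<and>
      (\<forall>x\<in>F \<inter> F'. \<exists>U V h. x \<in> U \<and> openin X U \<and> openin (Euclidean_space m) V \<and>
         homeomorphic_map (subtopology X U) (subtopology (Euclidean_space m) V) h \<and>
         h ` (U \<inter> F) = V \<inter> {y. \<forall>i\<in>{k..<m}. y i = 0} \<and>
         h ` (U \<inter> F') = V \<inter> {y. \<forall>i<m - k'. y i = 0}))"

definition Psi_transverse :: "(complex \<Rightarrow> complex) \<Rightarrow> nat \<Rightarrow> (complex \<times> complex) set \<Rightarrow> bool" where
  "Psi_transverse \<alpha> n B \<longleftrightarrow>
     (\<forall>x\<in>topspace moebius_band. Psi \<alpha> n x \<in> B \<longrightarrow>
        (\<exists>U. openin moebius_band U \<and> x \<in> U \<and> inj_on (Psi \<alpha> n) U \<and>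
           locally_flat_submanifold 4 euclidean 2 (Psi \<alpha> n ` U) \<and>
           intersect_transversely 4 euclidean 2 (Psi \<alpha> n ` U) 3 B))"

text \<open>
  \<open>rectangle p q r s\<close> lists the corners in cyclic order and excludes degenerate rectangles; the
  diagonals \<open>p r\<close> and \<open>q s\<close> have the same length.
\<close>

definition rectangle :: "complex \<Rightarrow> complex \<Rightarrow> complex \<Rightarrow> complex \<Rightarrow> bool" where
  "rectangle p q r s \<longleftrightarrow> p \<noteq> q \<and> q \<noteq> r \<and> q - p = r - s \<and> (q - p) \<bullet> (r - q) = 0"

definition has_inscribed_rectangle :: "complex set \<Rightarrow> real \<Rightarrow> real \<Rightarrow> bool" where
  "has_inscribed_rectangle \<Gamma> \<rho> d \<longleftrightarrow>
     (\<exists>p q r s. {p, q, r, s} \<subseteq> \<Gamma> \<and> rectangle p q r s \<and>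
        (dist p q / dist q r = \<rho> \<or> dist q r / dist p q = \<rho>) \<and> d \<le> dist p r)"

end

theory Submission
  imports Defs "HOL-Library.Z2"
begin

text \<open>Suppose that \<open>Psi\<close> is injective outside the interior of \<open>N\<close>. Off the diagonal, the torus of pairs \<open>(s, t)\<close>
  is the plane without the origin, and exchanging \<open>s\<close> and \<open>t\<close> becomes the antipodal map \<open>w \<mapsto> - 1 / cnj w\<close> of the
  Riemann sphere. Straightening the complement of \<open>N\<close> and extracting a \<open>2n\<close>-th root of the second coordinate
  gives an odd map \<open>A\<close> on the part of the sphere outside \<open>N\<close> with \<open>A x \<noteq> \<plusminus> R^j A y\<close> for \<open>0 < j < n\<close>, where
  \<open>R = diag (cis (- pi/n), cis (pi/n))\<close>. The hypothesis on the torus curve says that this part is an annulus between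
  two antipodal Jordan curves, on which \<open>fst A\<close> is constant; hence \<open>A\<close> extends over the two discs by Tietze's theorem.

  Such an odd map from the sphere to \<open>\<complex>\<^sup>2\<close> without zero does not exist. For a generic simplicial approximation, let
  \<open>e j\<close> be the number mod 2 of rays meeting \<open>A\<close> of a fixed half great circle and \<open>R^j A\<close>, the former farther
  from the origin. Borsuk-Ulam parity on the join of two spheres gives \<open>e j + e (- j) = 1\<close>, and on the join of
  three spheres it shows that \<open>{j. e j = 1}\<close> is closed under addition; this is absurd as \<open>R^n = - 1\<close>.\<close>

section \<open>Segments of nonnegative relations\<close>

type_synonym C2 = "complex \<times> complex"

text \<open>The copies \<open>R^j A\<close> are rotations of one map, so they cannot be put in
  general position independently. What helps is scale: on a fine mesh the cones over faces are
  narrow, while the images of one vertex under different rotations are at definite angles. Hence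
  simplices of different copies whose cones meet never share a vertex orbit, and their vertices can
  be moved freely.

  Closure under addition comes from common rays of three copies. Up to antipodes their number is
  odd, and each has one farthest point, so the question is when the rays with a given copy X
  farthest cancel. The parities of crossings of edges of X with the shadow of Y, the part of its
  cone beyond Y, form a cocycle on the projective plane. If the linking parity of X and Y vanishes,
  it is a coboundary, and then so is the count for any third copy. Thus one of any three copies must
  link with both others.

  All counts concern nonnegative relations between finitely many vectors. In general position,
  relations with one degree of freedom form a segment with two ends, and every parity identity below
  is an instance of that.\<close>

type_synonym 'v vecs = "'v \<Rightarrow> nat \<Rightarrow> real"
type_synonym 'v assignment = "'v \<Rightarrow> C2"

definition sols :: "nat \<Rightarrow> 'v vecs \<Rightarrow> 'v set \<Rightarrow> ('v \<Rightarrow> real) set" where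
  "sols k P S = {x. (\<forall>v. 0 \<le> x v) \<and> (\<forall>v. v \<notin> S \<longrightarrow> x v = 0) \<and> (\<exists>v\<in>S. x v \<noteq> 0) \<and>
     (\<forall>i<k. (\<Sum>v\<in>S. x v * P v i) = 0)}"

text \<open>General position for cones: the origin of real dimension \<open>k\<close> is in the
  convex hull of no \<open>k\<close> of the vectors. In this one-sided form it is an open condition,
  and for narrow cones it often holds without perturbation.\<close>

definition gpos :: "nat \<Rightarrow> 'v vecs \<Rightarrow> 'v set \<Rightarrow> bool" where
  "gpos k P S \<longleftrightarrow> (\<forall>S'\<subseteq>S. card S' \<le> k \<longrightarrow> sols k P S' = {})"

lemma solsI:
  assumes "\<And>v. 0 \<le> x v" "\<And>v. v \<notin> S \<Longrightarrow> x v = 0" "w \<in> S" "x w \<noteq> 0"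
    "\<And>i. i < k \<Longrightarrow> (\<Sum>v\<in>S. x v * P v i) = 0"
  shows "x \<in> sols k P S"
  unfolding sols_def mem_Collect_eq
  by (intro conjI allI impI bexI[of _ w]) (fact assms | erule assms)+

lemma sols_sub:
  assumes "finite S" "S' \<subseteq> S" "x \<in> sols k P S" "\<And>v. v \<in> S - S' \<Longrightarrow> x v = 0"
  shows "x \<in> sols k P S'"
proof -
  have "(\<Sum>v\<in>S'. x v * P v i) = (\<Sum>v\<in>S. x v * P v i)" for i
    by (rule sum.mono_neutral_left) (use assms in auto)
  then show ?thesis using assms unfolding sols_def by fastforce
qed

lemma sols_mono:
  assumes "finite S" "S' \<subseteq> S" "x \<in> sols k P S'"
  shows "x \<in> sols k P S"
proof -
  have "(\<Sum>v\<in>S'. x v * P v i) = (\<Sum>v\<in>S. x v * P v i)" for i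
    by (rule sum.mono_neutral_left) (use assms in \<open>auto simp: sols_def\<close>)
  then show ?thesis using assms unfolding sols_def by auto
qed

lemma gpos_sub: "gpos k P S \<Longrightarrow> S' \<subseteq> S \<Longrightarrow> gpos k P S'"
  unfolding gpos_def by blast

lemma sols_pos:
  assumes "finite S" "gpos k P S" "card S \<le> k + 1" "x \<in> sols k P S" "v \<in> S"
  shows "x v > 0"
proof (rule ccontr)
  assume "\<not> x v > 0"
  then have "x v = 0" using assms(4) unfolding sols_def by (metis (mono_tags, lifting) less_eq_real_def mem_Collect_eq)
  then have "x \<in> sols k P (S - {v})" using sols_sub[OF assms(1) _ assms(4), of "S - {v}"] by auto
  moreover have "card (S - {v}) \<le> k" using assms(1,3,5) by simp
  ultimately show False using assms(2) unfolding gpos_def by (metis Diff_subset empty_iff)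
qed

text \<open>Gaussian elimination with pivot \<open>w\<close> in the last coordinate; the coefficient
  of \<open>w\<close> is recovered from the others.\<close>

lemma kernel_exists:
  fixes P :: "'v \<Rightarrow> nat \<Rightarrow> real"
  assumes "finite S" "k < card S"
  shows "\<exists>y. (\<exists>v\<in>S. y v \<noteq> 0) \<and> (\<forall>v. v \<notin> S \<longrightarrow> y v = 0) \<and> (\<forall>i<k. (\<Sum>v\<in>S. y v * P v i) = 0)"
  using assms
proof (induction k arbitrary: P S)
  case 0
  then obtain w where "w \<in> S" by fastforce
  then show ?case by (intro exI[of _ "\<lambda>v. if v = w then 1 else 0"]) auto
next
  case (Suc k)
  show ?case
  proof (cases "\<forall>v\<in>S. P v k = 0")
    case True
    then obtain y where "(\<exists>v\<in>S. y v \<noteq> 0) \<and> (\<forall>v. v \<notin> S \<longrightarrow> y v = 0) \<and> (\<forall>i<k. (\<Sum>v\<in>S. y v * P v i) = 0)"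
      using Suc.IH[of S P] Suc.prems by auto
    then show ?thesis using True by (intro exI[of _ y]) (auto simp: less_Suc_eq)
  next
    case False
    then obtain w where w: "w \<in> S" "P w k \<noteq> 0" by blast
    define P' where "P' = (\<lambda>v i. P v i - P v k / P w k * P w i)"
    have "k < card (S - {w})" using Suc.prems w by simp
    then obtain y where y: "\<exists>v\<in>S-{w}. y v \<noteq> 0" "\<And>v. v \<notin> S-{w} \<Longrightarrow> y v = 0"
      "\<And>i. i<k \<Longrightarrow> (\<Sum>v\<in>S-{w}. y v * P' v i) = 0"
      using Suc.IH[of "S-{w}" P'] Suc.prems by auto
    define c where "c = - (\<Sum>v\<in>S-{w}. y v * P v k) / P w k"
    have c: "(\<Sum>v\<in>S. (y(w:=c)) v * P v i) = c * P w i + (\<Sum>v\<in>S-{w}. y v * P v i)" for i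
      using Suc.prems w by (simp add: sum.remove[of S w])
    have "(\<Sum>v\<in>S. (y(w:=c)) v * P v i) = 0" if "i < Suc k" for i
    proof (cases "i = k")
      case True then show ?thesis using c[of k] w(2) unfolding c_def by simp
    next
      case False
      then have "(\<Sum>v\<in>S-{w}. y v * P' v i) = 0" using that y(3) by simp
      moreover have "(\<Sum>v\<in>S-{w}. y v * P' v i) = (\<Sum>v\<in>S-{w}. y v * P v i) - (\<Sum>v\<in>S-{w}. y v * P v k) / P w k * P w i"
        unfolding P'_def by (simp add: right_diff_distrib sum_subtractf sum_distrib_right sum_divide_distrib mult.assoc)
      ultimately show ?thesis using c[of i] unfolding c_def by simp
    qed
    then show ?thesis using y(1,2) w by (intro exI[of _ "y(w:=c)"]) auto
  qed
qed

text \<open>Subtract from \<open>y\<close> the largest multiple of \<open>x\<close> that leaves a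
  nonnegative vector. The rest vanishes at some vertex, while by \<open>sols_pos\<close> a
  nonnegative relation other than zero is positive on all of \<open>S\<close>. So even a relation
  \<open>y\<close> with arbitrary signs is a multiple of \<open>x\<close>.\<close>

lemma sols_unique:
  assumes "finite S" "gpos k P S" "card S \<le> k + 1" "x \<in> sols k P S"
    and y0: "\<And>v. v \<notin> S \<Longrightarrow> y v = 0" and ye: "\<And>i. i < k \<Longrightarrow> (\<Sum>v\<in>S. y v * P v i) = 0"
  shows "\<exists>c. \<forall>v. y v = c * x v"
proof -
  have "S \<noteq> {}" using assms(4) unfolding sols_def by auto
  define c where "c = Min ((\<lambda>v. y v / x v) ` S)"
  have "c \<in> (\<lambda>v. y v / x v) ` S" unfolding c_def using assms(1) \<open>S \<noteq> {}\<close> by (intro Min_in) auto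
  then obtain w where w: "w \<in> S" "c = y w / x w" by blast
  have pos: "x v > 0" if "v \<in> S" for v using sols_pos[OF assms(1-4) that] .
  have le: "c \<le> y v / x v" if "v \<in> S" for v unfolding c_def using that assms(1) by simp
  define z where "z = (\<lambda>v. y v - c * x v)"
  have zn: "0 \<le> z v" for v
  proof (cases "v \<in> S")
    case True then show ?thesis using le[OF True] pos[OF True] by (simp add: z_def pos_le_divide_eq)
  next
    case False then show ?thesis using y0[OF False] assms(4) by (simp add: z_def sols_def)
  qed
  have zoff: "z v = 0" if "v \<notin> S" for v using that y0 assms(4) by (simp add: z_def sols_def)
  have zw: "z w = 0" using w pos[of w] by (simp add: z_def)
  have ze: "(\<Sum>v\<in>S. z v * P v i) = 0" if "i < k" for i
  proof -
    have "(\<Sum>v\<in>S. z v * P v i) = (\<Sum>v\<in>S. y v * P v i) - c * (\<Sum>v\<in>S. x v * P v i)"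
      unfolding z_def by (simp add: left_diff_distrib sum_subtractf sum_distrib_left mult.assoc)
    then show ?thesis using ye[OF that] assms(4) that by (simp add: sols_def)
  qed
  have "z v = 0" for v
  proof (rule ccontr)
    assume "z v \<noteq> 0"
    then have "z \<in> sols k P S" using zn zoff ze by (intro solsI[of z S v]) auto
    then have "z w > 0" using sols_pos[OF assms(1-3)] w by blast
    then show False using zw by simp
  qed
  then show ?thesis unfolding z_def by (intro exI[of _ c]) simp
qed

lemma lin_sum:
  fixes x y :: "'v \<Rightarrow> real"
  shows "(\<Sum>v\<in>S. (s * x v + t * y v) * G v) = s * (\<Sum>v\<in>S. x v * G v) + t * (\<Sum>v\<in>S. y v * G v)"
  by (simp add: distrib_right sum.distrib sum_distrib_left mult.assoc)

text \<open>From a relation that is positive everywhere, move along a kernel vector until the first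
  coordinate reaches zero. The kernel vector is chosen to vanish at \<open>w\<close>, which keeps
  the relation nonzero.\<close>

lemma segment_facet:
  assumes "finite S" "card S = k + 2" "gpos k P S" "sols k P S \<noteq> {}"
  shows "\<exists>a\<in>S. sols k P (S - {a}) \<noteq> {}"
proof -
  obtain x where x: "x \<in> sols k P S" using assms(4) by blast
  have xn: "0 \<le> x v" for v using x by (simp add: sols_def)
  show ?thesis
  proof (cases "\<exists>a\<in>S. x a = 0")
    case True
    then obtain a where "a \<in> S" "x a = 0" by blast
    then have "x \<in> sols k P (S - {a})" using sols_sub[OF assms(1) _ x, of "S-{a}"] by auto
    then show ?thesis using \<open>a \<in> S\<close> by blast
  next
    case False
    then have xp: "x v > 0" if "v \<in> S" for v using that xn[of v] by (simp add: less_le)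
    obtain w where w: "w \<in> S" using assms(2) by fastforce
    have "k < card (S-{w})" using assms(1,2) w by simp
    then obtain y where y: "\<exists>v\<in>S-{w}. y v \<noteq> 0" "\<And>v. v \<notin> S-{w} \<Longrightarrow> y v = 0"
      "\<And>i. i<k \<Longrightarrow> (\<Sum>v\<in>S-{w}. y v * P v i) = 0"
      using kernel_exists[of "S-{w}" k P] assms(1) by auto
    obtain u where u: "u \<in> S - {w}" "y u \<noteq> 0" using y(1) by blast
    define y' where "y' = (\<lambda>v. sgn (y u) * y v)"
    have y'u: "y' u > 0" using u(2) unfolding y'_def by (simp add: sgn_if)
    have y'e: "(\<Sum>v\<in>S. y' v * P v i) = 0" if "i < k" for i
    proof -
      have "(\<Sum>v\<in>S. y' v * P v i) = sgn (y u) * (\<Sum>v\<in>S. y v * P v i)"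
        unfolding y'_def by (simp add: sum_distrib_left mult.assoc)
      also have "(\<Sum>v\<in>S. y v * P v i) = (\<Sum>v\<in>S-{w}. y v * P v i)"
        by (rule sum.mono_neutral_right) (use assms(1) y(2) in auto)
      finally show ?thesis using y(3)[OF that] by simp
    qed
    define V where "V = {v\<in>S. y' v > 0}"
    have V: "finite V" "V \<noteq> {}" using assms(1) u y'u unfolding V_def by auto
    define t where "t = Min ((\<lambda>v. x v / y' v) ` V)"
    have "t \<in> (\<lambda>v. x v / y' v) ` V" unfolding t_def using V by (intro Min_in) auto
    then obtain a where a: "a \<in> V" "t = x a / y' a" by blast
    have tle: "t \<le> x v / y' v" if "v \<in> V" for v unfolding t_def using that V by simp
    have t0: "t \<ge> 0" using a xn[of a] unfolding V_def by simp
    define z where "z = (\<lambda>v. 1 * x v + (-t) * y' v)"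
    have "z \<in> sols k P S"
    proof (rule solsI[of z S w])
      show "0 \<le> z v" for v
      proof (cases "v \<in> V")
        case True
        then have "y' v > 0" by (simp add: V_def)
        then show ?thesis using tle[OF True] by (simp add: z_def pos_le_divide_eq)
      next
        case False
        then have "y' v \<le> 0" using y(2) unfolding V_def y'_def by fastforce
        then have "t * y' v \<le> 0" using t0 by (simp add: mult_nonneg_nonpos)
        then show ?thesis using xn[of v] by (simp add: z_def)
      qed
      show "z v = 0" if "v \<notin> S" for v using that y(2)[of v] x by (simp add: z_def y'_def sols_def)
      show "w \<in> S" by (rule w)
      show "z w \<noteq> 0" using xp[OF w] y(2)[of w] by (simp add: z_def y'_def)
      show "(\<Sum>v\<in>S. z v * P v i) = 0" if "i < k" for i
        unfolding z_def lin_sum using y'e[OF that] x that by (simp add: sols_def)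
    qed
    moreover have "z a = 0" "a \<in> S" using a by (simp_all add: z_def V_def)
    ultimately have "z \<in> sols k P (S - {a})" using sols_sub[OF assms(1), of "S-{a}" z] by auto
    then show ?thesis using \<open>a \<in> S\<close> by blast
  qed
qed

text \<open>In general position the nonnegative relations on \<open>k + 2\<close> vectors form, up to scale, a segment; its ends
  are supported on the only two facets that carry relations.\<close>

lemma segment_structure:
  assumes fin: "finite S" and card: "card S = k + 2" and gp: "gpos k P S" and ne: "sols k P S \<noteq> {}"
  obtains a b xa xb where "a \<in> S" "b \<in> S" "a \<noteq> b" "xa \<in> sols k P (S - {a})" "xb \<in> sols k P (S - {b})"
    "\<And>x. x \<in> sols k P S \<Longrightarrow> \<exists>s\<ge>0. \<exists>t\<ge>0. x = (\<lambda>v. s * xa v + t * xb v)"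
    "\<And>v x. v \<in> S \<Longrightarrow> x \<in> sols k P (S - {v}) \<Longrightarrow> v = a \<and> (\<exists>s>0. x = (\<lambda>v. s * xa v)) \<or> v = b \<and> (\<exists>s>0. x = (\<lambda>v. s * xb v))"
proof -
  have cardm: "card (S - {v}) \<le> k + 1" if "v \<in> S" for v using fin card that by simp
  have gpm: "gpos k P (S - {v})" for v using gpos_sub[OF gp] by blast
  have finm: "finite (S - {v})" for v using fin by simp
  obtain a xa where a: "a \<in> S" and xa: "xa \<in> sols k P (S - {a})" using segment_facet[OF fin card gp ne] by blast
  have xap: "xa v > 0" if "v \<in> S" "v \<noteq> a" for v using sols_pos[OF finm gpm cardm[OF a] xa] that by blast
  have xa0: "xa a = 0" "\<And>v. v \<notin> S \<Longrightarrow> xa v = 0" using xa by (simp_all add: sols_def)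
  have xaS: "xa \<in> sols k P S" using sols_mono[OF fin _ xa] by blast
  have "\<exists>b\<in>S. b \<noteq> a \<and> sols k P (S - {b}) \<noteq> {}"
  proof -
    have "card (S - {a}) = k + 1" using fin card a by simp
    then have "S - {a} \<noteq> {}" by fastforce
    then obtain w where w: "w \<in> S" "w \<noteq> a" by blast
    have "k < card (S-{w})" using fin card w by simp
    then obtain y where y: "\<exists>v\<in>S-{w}. y v \<noteq> 0" "\<And>v. v \<notin> S-{w} \<Longrightarrow> y v = 0"
      "\<And>i. i<k \<Longrightarrow> (\<Sum>v\<in>S-{w}. y v * P v i) = 0"
      using kernel_exists[of "S-{w}" k P] fin by auto
    have yS: "(\<Sum>v\<in>S. y v * P v i) = 0" if "i < k" for i
    proof -
      have "(\<Sum>v\<in>S. y v * P v i) = (\<Sum>v\<in>S-{w}. y v * P v i)"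
        by (rule sum.mono_neutral_right) (use fin y(2) in auto)
      then show ?thesis using y(3)[OF that] by simp
    qed
    \<comment> \<open>Otherwise \<open>y\<close> would be a multiple of \<open>xa\<close> by
      uniqueness on \<open>S - {a}\<close>; but \<open>y\<close> vanishes at \<open>w\<close> and
      \<open>xa\<close> does not.\<close>
    have ya: "y a \<noteq> 0"
    proof
      assume ya: "y a = 0"
      have "(\<Sum>v\<in>S-{a}. y v * P v i) = (\<Sum>v\<in>S. y v * P v i)" for i
        by (rule sum.mono_neutral_left) (use fin ya in auto)
      then obtain c where c: "\<And>v. y v = c * xa v"
        using sols_unique[OF finm gpm cardm[OF a] xa, of y] yS y(2) ya by auto
      have "c = 0" using c[of w] y(2)[of w] xap[OF w] by auto
      then show False using y(1) c by auto
    qed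
    define y' where "y' = (\<lambda>v. sgn (y a) * y v)"
    have y'a: "y' a > 0" using ya unfolding y'_def by (simp add: sgn_if)
    have y'e: "(\<Sum>v\<in>S. y' v * P v i) = 0" if "i < k" for i
    proof -
      have "(\<Sum>v\<in>S. y' v * P v i) = sgn (y a) * (\<Sum>v\<in>S. y v * P v i)"
        unfolding y'_def by (simp add: sum_distrib_left mult.assoc)
      then show ?thesis using yS[OF that] by simp
    qed
    have y'0: "y' v = 0" if "v \<notin> S" for v using that y(2) by (simp add: y'_def)
    \<comment> \<open>Without negative coordinates \<open>y'\<close> is itself a relation that
      misses \<open>w\<close>. Otherwise follow \<open>y'\<close> from \<open>xa\<close> until the
      first coordinate \<open>b\<close> vanishes; the coordinate at \<open>a\<close> grows on the
      way, so \<open>b\<close> is a new facet.\<close>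
    define V where "V = {v\<in>S. y' v < 0}"
    show ?thesis
    proof (cases "V = {}")
      case True
      then have y'n: "0 \<le> y' v" for v using y'0[of v] unfolding V_def by fastforce
      have "y' \<in> sols k P S" by (rule solsI[of y' S a]) (use y'n y'0 y'e y'a a in auto)
      moreover have "y' w = 0" using y(2)[of w] by (simp add: y'_def)
      ultimately have "y' \<in> sols k P (S - {w})" using sols_sub[OF fin, of "S-{w}" y'] by auto
      then show ?thesis using w by blast
    next
      case False
      have V: "finite V" using fin unfolding V_def by auto
      define t where "t = Min ((\<lambda>v. xa v / (- y' v)) ` V)"
      have "t \<in> (\<lambda>v. xa v / (- y' v)) ` V" unfolding t_def using V False by (intro Min_in) auto
      then obtain b where b: "b \<in> V" "t = xa b / (- y' b)" by blast
      have ba: "b \<noteq> a" "b \<in> S" "y' b < 0" using b y'a unfolding V_def by auto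
      have tle: "t \<le> xa v / (- y' v)" if "v \<in> V" for v unfolding t_def using that V by simp
      have t0: "t > 0" unfolding b(2) using ba xap by (auto intro!: divide_pos_neg simp: divide_neg_pos)
      have xan: "0 \<le> xa v" for v using xa by (simp add: sols_def)
      define z where "z = (\<lambda>v. 1 * xa v + t * y' v)"
      have "z \<in> sols k P S"
      proof (rule solsI[of z S a])
        show "0 \<le> z v" for v
        proof (cases "v \<in> V")
          case True
          then have "- y' v > 0" by (simp add: V_def)
          then have "t * (- y' v) \<le> xa v" using tle[OF True] pos_le_divide_eq by metis
          then show ?thesis by (simp add: z_def)
        next
          case False
          then have "y' v \<ge> 0" using y'0[of v] unfolding V_def by fastforce
          then show ?thesis using t0 xan[of v] by (simp add: z_def)
        qed
        show "z v = 0" if "v \<notin> S" for v using that y'0[of v] xa0 by (simp add: z_def)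
        show "a \<in> S" by (rule a)
        show "z a \<noteq> 0" using xa0 t0 y'a by (simp add: z_def)
        show "(\<Sum>v\<in>S. z v * P v i) = 0" if "i < k" for i
          unfolding z_def lin_sum using y'e[OF that] xaS that by (simp add: sols_def)
      qed
      moreover have "z b = 0" using b(2) ba by (simp add: z_def)
      ultimately have "z \<in> sols k P (S - {b})" using sols_sub[OF fin, of "S-{b}" z] by auto
      then show ?thesis using ba by blast
    qed
  qed
  then obtain b xb where b: "b \<in> S" "b \<noteq> a" and xb: "xb \<in> sols k P (S - {b})" by blast
  have xbp: "xb v > 0" if "v \<in> S" "v \<noteq> b" for v using sols_pos[OF finm gpm cardm[OF b(1)] xb] that by blast
  have xb0: "xb b = 0" using xb by (simp add: sols_def)
  have xbS: "xb \<in> sols k P S" using sols_mono[OF fin _ xb] by blast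
  have comb: "\<exists>s\<ge>0. \<exists>t\<ge>0. x = (\<lambda>v. s * xa v + t * xb v)" if x: "x \<in> sols k P S" for x
  proof -
    have xn: "0 \<le> x v" for v using x by (simp add: sols_def)
    define t where "t = x a / xb a"
    have xba: "xb a > 0" using xbp[of a] a b by blast
    have t0: "t \<ge> 0" unfolding t_def using xn[of a] xba by simp
    define z where "z = (\<lambda>v. 1 * x v + (-t) * xb v)"
    have za: "z a = 0" using xba by (simp add: z_def t_def)
    have z0: "z v = 0" if "v \<notin> S" for v using that x xbS by (simp add: z_def sols_def)
    have "(\<Sum>v\<in>S. z v * P v i) = 0" if "i < k" for i
      unfolding z_def lin_sum using x xbS that by (simp add: sols_def)
    moreover have "(\<Sum>v\<in>S-{a}. z v * P v i) = (\<Sum>v\<in>S. z v * P v i)" for i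
      by (rule sum.mono_neutral_left) (use fin za in auto)
    ultimately obtain c where c: "\<And>v. z v = c * xa v"
      using sols_unique[OF finm gpm cardm[OF a] xa, of z] za z0 by auto
    have "c * xa b = x b" using c[of b] xb0 by (simp add: z_def)
    then have "c \<ge> 0" using xn[of b] xap[OF b] by (metis mult_neg_pos not_less)
    moreover have "x v = c * xa v + t * xb v" for v using c[of v] by (simp add: z_def)
    ultimately show ?thesis using t0 by blast
  qed
  have fac: "v = a \<and> (\<exists>s>0. x = (\<lambda>v. s * xa v)) \<or> v = b \<and> (\<exists>s>0. x = (\<lambda>v. s * xb v))"
    if v: "v \<in> S" and x: "x \<in> sols k P (S - {v})" for v x
  proof -
    have "x \<in> sols k P S" using sols_mono[OF fin _ x] by blast
    then obtain s t where st: "s \<ge> 0" "t \<ge> 0" "x = (\<lambda>v. s * xa v + t * xb v)" using comb by blast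
    have xv: "x v = 0" and nz: "\<exists>w. x w \<noteq> 0" using x by (auto simp: sols_def)
    have n: "xa v \<ge> 0" "xb v \<ge> 0" using xa xb by (simp_all add: sols_def)
    have "s * xa v = 0" "t * xb v = 0" using xv st n by (simp_all add: add_nonneg_eq_0_iff)
    moreover have "\<not> (s = 0 \<and> t = 0)" using nz st by auto
    ultimately consider "xa v = 0" "s > 0" "xb v > 0" "t = 0" | "xb v = 0" "t > 0" "xa v > 0" "s = 0"
      using xap[of v] xbp[of v] v b st(1,2) n by fastforce
    then show ?thesis
    proof cases
      case 1 then show ?thesis using xap[of v] v st(3) by force
    next
      case 2 then show ?thesis using xbp[of v] v st(3) by force
    qed
  qed
  show thesis using that[OF a b(1) _ xa xb comb fac] b(2) by blast
qed

text \<open>A linear functional that is nonzero at both ends of a segment has a zero on it exactly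
  if the two signs differ. Only the two facets that carry the ends contribute to the sum.\<close>

lemma segment_parity:
  fixes G :: "'v \<Rightarrow> real"
  assumes fin: "finite S" and card: "card S = k + 2" and gp: "gpos k P S"
    and nz: "\<And>v x. v \<in> S \<Longrightarrow> x \<in> sols k P (S - {v}) \<Longrightarrow> (\<Sum>u\<in>S. x u * G u) \<noteq> 0"
  shows "(\<Sum>v\<in>S. of_bool (\<exists>x\<in>sols k P (S - {v}). (\<Sum>u\<in>S. x u * G u) > 0) :: bit) =
    of_bool (\<exists>x\<in>sols k P S. (\<Sum>u\<in>S. x u * G u) = 0)"
proof (cases "sols k P S = {}")
  case True
  then have "sols k P (S - {v}) = {}" for v using sols_mono[OF fin, of "S-{v}" _ k P] by blast
  then show ?thesis using True by simp
next
  case False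
  obtain a b xa xb where ab: "a \<in> S" "b \<in> S" "a \<noteq> b" and xa: "xa \<in> sols k P (S - {a})" and xb: "xb \<in> sols k P (S - {b})"
    and comb: "\<And>x. x \<in> sols k P S \<Longrightarrow> \<exists>s\<ge>0. \<exists>t\<ge>0. x = (\<lambda>v. s * xa v + t * xb v)"
    and fac: "\<And>v x. v \<in> S \<Longrightarrow> x \<in> sols k P (S - {v}) \<Longrightarrow> v = a \<and> (\<exists>s>0. x = (\<lambda>v. s * xa v)) \<or> v = b \<and> (\<exists>s>0. x = (\<lambda>v. s * xb v))"
    by (rule segment_structure[OF fin card gp False]) blast
  define g where "g = (\<lambda>x. \<Sum>u\<in>S. x u * G u)"
  have gs: "g (\<lambda>v. s * x v + t * y v) = s * g x + t * g y" for s t x y unfolding g_def by (rule lin_sum)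
  have gs1: "g (\<lambda>v. s * x v) = s * g x" for s x using gs[of s x 0 x] by simp
  have ga: "g xa \<noteq> 0" and gb: "g xb \<noteq> 0" using nz[OF ab(1) xa] nz[OF ab(2) xb] unfolding g_def .
  define h where "h = (\<lambda>v. of_bool (\<exists>x\<in>sols k P (S - {v}). g x > 0) :: bit)"
  have h0: "h v = 0" if "v \<in> S - {a,b}" for v using fac[of v] that unfolding h_def by auto
  have "(\<exists>x\<in>sols k P (S - {a}). g x > 0) \<longleftrightarrow> g xa > 0"
  proof
    assume "\<exists>x\<in>sols k P (S - {a}). g x > 0"
    then obtain x where x: "x \<in> sols k P (S - {a})" "g x > 0" by blast
    then obtain s where "s > 0" "x = (\<lambda>v. s * xa v)" using fac[OF ab(1) x(1)] ab(3) by blast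
    then show "g xa > 0" using x(2) gs1 by (simp add: zero_less_mult_iff)
  qed (use xa in blast)
  then have ha: "h a = of_bool (g xa > 0)" unfolding h_def by simp
  have "(\<exists>x\<in>sols k P (S - {b}). g x > 0) \<longleftrightarrow> g xb > 0"
  proof
    assume "\<exists>x\<in>sols k P (S - {b}). g x > 0"
    then obtain x where x: "x \<in> sols k P (S - {b})" "g x > 0" by blast
    then obtain s where "s > 0" "x = (\<lambda>v. s * xb v)" using fac[OF ab(2) x(1)] ab(3) by blast
    then show "g xb > 0" using x(2) gs1 by (simp add: zero_less_mult_iff)
  qed (use xb in blast)
  then have hb: "h b = of_bool (g xb > 0)" unfolding h_def by simp
  have "sum h S = sum h {a,b}" by (rule sum.mono_neutral_right) (use fin ab h0 in auto)
  also have "\<dots> = of_bool (g xa > 0) + of_bool (g xb > 0)" using ab ha hb by simp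
  also have "\<dots> = of_bool (\<exists>x\<in>sols k P S. g x = 0)"
  proof -
    have "(\<exists>x\<in>sols k P S. g x = 0) \<longleftrightarrow> (g xa > 0) \<noteq> (g xb > 0)"
    proof
      assume "\<exists>x\<in>sols k P S. g x = 0"
      then obtain x where x: "x \<in> sols k P S" "g x = 0" by blast
      then obtain s t where st: "s \<ge> 0" "t \<ge> 0" "x = (\<lambda>v. s * xa v + t * xb v)" using comb by blast
      have e: "s * g xa + t * g xb = 0" using x(2) st(3) gs by metis
      have nst: "s > 0 \<or> t > 0" using x(1) st unfolding sols_def by (auto simp: less_le)
      show "(g xa > 0) \<noteq> (g xb > 0)"
      proof
        assume eq: "(g xa > 0) = (g xb > 0)"
        show False
        proof (cases "g xa > 0")
          case True
          then have "s * g xa \<ge> 0" "t * g xb \<ge> 0" "s * g xa > 0 \<or> t * g xb > 0" using eq st nst by auto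
          then show False using e by linarith
        next
          case False
          then have "g xa < 0" "g xb < 0" using eq ga gb by auto
          then have "s * g xa \<le> 0" "t * g xb \<le> 0" "s * g xa < 0 \<or> t * g xb < 0" using st nst
            by (auto simp: mult_nonneg_nonpos mult_pos_neg)
          then show False using e by linarith
        qed
      qed
    next
      assume ne: "(g xa > 0) \<noteq> (g xb > 0)"
      \<comment> \<open>Each end is weighted by the absolute value at the opposite end, so that the
        two values of opposite sign cancel.\<close>
      define z where "z = (\<lambda>v. \<bar>g xb\<bar> * xa v + \<bar>g xa\<bar> * xb v)"
      have xaS: "xa \<in> sols k P S" and xbS: "xb \<in> sols k P S" using sols_mono[OF fin _ xa] sols_mono[OF fin _ xb] by blast+
      have "xb a > 0" using sols_pos[OF _ gpos_sub[OF gp] _ xb, of a] ab fin card by auto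
      have "z \<in> sols k P S"
      proof (rule solsI[of z S a])
        show "0 \<le> z v" for v using xaS xbS by (simp add: z_def sols_def)
        show "z v = 0" if "v \<notin> S" for v using that xaS xbS by (simp add: z_def sols_def)
        show "z a \<noteq> 0" using \<open>xb a > 0\<close> ga xaS unfolding z_def sols_def
          by (auto intro!: add_nonneg_pos less_imp_neq[symmetric])
        show "(\<Sum>v\<in>S. z v * P v i) = 0" if "i < k" for i
          unfolding z_def lin_sum using xaS xbS that by (simp add: sols_def)
      qed (rule ab)
      moreover have "g z = 0" unfolding z_def gs using ne ga gb by (auto simp: abs_if)
      ultimately show "\<exists>x\<in>sols k P S. g x = 0" by blast
    qed
    then show ?thesis by auto
  qed
  finally show ?thesis unfolding h_def g_def .
qed

section \<open>Borsuk-Ulam parity\<close>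

lemma poly_nontrivial_finite:
  fixes \<psi> :: "nat \<Rightarrow> real"
  assumes "j \<le> k" "\<psi> j \<noteq> 0"
  shows "finite {t. \<psi> k + (\<Sum>i<k. \<psi> i * t ^ Suc i) = 0}"
proof -
  define a where "a = (\<lambda>i. if i = 0 then \<psi> k else \<psi> (i - 1))"
  have "\<psi> k + (\<Sum>i<k. \<psi> i * t ^ Suc i) = (\<Sum>i\<le>k. a i * t ^ i)" for t
  proof (cases k)
    case (Suc m)
    show ?thesis unfolding Suc sum.atMost_shift by (simp add: a_def lessThan_Suc_atMost Suc)
  qed (simp add: a_def)
  moreover have "\<exists>i\<le>k. a i \<noteq> 0"
    using assms by (cases "j = k") (auto simp: a_def intro: exI[of _ 0] exI[of _ "Suc j"])
  ultimately show ?thesis using polyfun_finite_roots[of a k] by auto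
qed

text \<open>Shearing along the moment curve makes the projections to the first coordinates generic as well.\<close>

definition shear :: "nat \<Rightarrow> real \<Rightarrow> 'v vecs \<Rightarrow> 'v \<Rightarrow> nat \<Rightarrow> real" where
  "shear k t P v i = (if i < k then P v i - t ^ Suc i * P v k else P v i)"

lemma shear_sum:
  "i < k \<Longrightarrow> (\<Sum>v\<in>S. x v * shear k t P v i) = (\<Sum>v\<in>S. x v * P v i) - t ^ Suc i * (\<Sum>v\<in>S. x v * P v k)"
  unfolding shear_def by (simp add: right_diff_distrib sum_subtractf sum_distrib_left algebra_simps)

text \<open>The shear is an invertible change of the first \<open>k + 1\<close> coordinates, so it
  cannot affect relations that involve all of them.\<close>

lemma sols_shear: "k < m \<Longrightarrow> sols m (shear k t P) S = sols m P S"
proof -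
  assume km: "k < m"
  have "(\<forall>i<m. (\<Sum>v\<in>S. x v * shear k t P v i) = 0) \<longleftrightarrow> (\<forall>i<m. (\<Sum>v\<in>S. x v * P v i) = 0)" for x :: "'a \<Rightarrow> real"
  proof -
    have k: "(\<Sum>v\<in>S. x v * shear k t P v i) = (\<Sum>v\<in>S. x v * P v i)" if "\<not> i < k" for i
      using that by (simp add: shear_def)
    show ?thesis
    proof (intro iffI allI impI)
      fix i assume *: "\<forall>i<m. (\<Sum>v\<in>S. x v * shear k t P v i) = 0" "i < m"
      have "(\<Sum>v\<in>S. x v * P v k) = 0" using *(1) km k[of k] by simp
      then show "(\<Sum>v\<in>S. x v * P v i) = 0" using * k[of i] shear_sum[of i k x t P S] by (cases "i < k") auto
    next
      fix i assume *: "\<forall>i<m. (\<Sum>v\<in>S. x v * P v i) = 0" "i < m"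
      then show "(\<Sum>v\<in>S. x v * shear k t P v i) = 0" using km k[of i] shear_sum[of i k x t P S] by (cases "i < k") auto
    qed
  qed
  then show ?thesis unfolding sols_def by simp
qed

text \<open>At most \<open>k\<close> vectors in dimension \<open>k + 1\<close> lie in a hyperplane
  with some normal \<psi>. A relation after shearing has its sum on the line through the point
  \<open>(t, t^2, ..., t^k, 1)\<close>, and the sum is nonzero by \<open>gpos (Suc k)\<close>. So
  this point is in the hyperplane, and \<open>t\<close> is a root of a nontrivial polynomial with
  coefficients from \<psi>.\<close>

lemma shear_bad_finite:
  assumes fin: "finite S" and card: "card S \<le> k" and gp: "gpos (Suc k) P S"
  shows "finite {t. sols k (shear k t P) S \<noteq> {}}"
proof -
  obtain e :: "'a \<Rightarrow> nat" where e: "inj_on e S" "e ` S = {..<card S}"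
    using ex_bij_betw_finite_nat[OF fin] unfolding bij_betw_def by (metis atLeast0LessThan)
  \<comment> \<open>The transposed system: its unknowns are the coefficients of a functional that
    vanishes on the vectors of \<open>S\<close>.\<close>
  define Q where "Q = (\<lambda>i l. if l < card S then P (inv_into S e l) i else 0)"
  obtain \<psi> where psi: "\<exists>i\<in>{..k}. \<psi> i \<noteq> 0" "\<And>l. l < card S \<Longrightarrow> (\<Sum>i\<in>{..k}. \<psi> i * Q i l) = 0"
    using kernel_exists[of "{..k}" "card S" Q] card by auto
  have eqv: "(\<Sum>i\<in>{..k}. \<psi> i * P v i) = 0" if "v \<in> S" for v
  proof -
    have "e v < card S" "inv_into S e (e v) = v" using e that by auto
    then show ?thesis using psi(2)[of "e v"] by (simp add: Q_def)
  qed
  have "{t. sols k (shear k t P) S \<noteq> {}} \<subseteq> {t. \<psi> k + (\<Sum>i<k. \<psi> i * t ^ Suc i) = 0}"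
  proof
    fix t assume "t \<in> {t. sols k (shear k t P) S \<noteq> {}}"
    then obtain x where x: "x \<in> sols k (shear k t P) S" by blast
    define s where "s = (\<Sum>v\<in>S. x v * P v k)"
    have xi: "(\<Sum>v\<in>S. x v * P v i) = t ^ Suc i * s" if "i < k" for i
      using x that shear_sum[OF that, of x t P S] unfolding s_def sols_def by simp
    have "s \<noteq> 0"
    proof
      assume "s = 0"
      then have "x \<in> sols (Suc k) P S" using x xi unfolding sols_def s_def by (auto simp: less_Suc_eq)
      then show False using gp card unfolding gpos_def by (metis empty_iff le_SucI order_refl)
    qed
    have "0 = (\<Sum>v\<in>S. x v * (\<Sum>i\<in>{..k}. \<psi> i * P v i))" using eqv by simp
    also have "\<dots> = (\<Sum>i\<in>{..k}. \<psi> i * (\<Sum>v\<in>S. x v * P v i))"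
      by (simp add: sum_distrib_left algebra_simps) (rule sum.swap)
    also have "\<dots> = \<psi> k * s + (\<Sum>i<k. \<psi> i * (t ^ Suc i * s))"
      by (simp add: lessThan_Suc_atMost[symmetric] xi s_def[symmetric] del: power_Suc)
    also have "\<dots> = s * (\<psi> k + (\<Sum>i<k. \<psi> i * t ^ Suc i))"
      by (simp add: distrib_left sum_distrib_left algebra_simps)
    finally show "t \<in> {t. \<psi> k + (\<Sum>i<k. \<psi> i * t ^ Suc i) = 0}" using \<open>s \<noteq> 0\<close> by simp
  qed
  moreover obtain j where "j \<le> k" "\<psi> j \<noteq> 0" using psi(1) by blast
  ultimately show ?thesis using poly_nontrivial_finite finite_subset by blast
qed

lemma flag_step:
  assumes "finite \<S>" "\<And>S. S \<in> \<S> \<Longrightarrow> finite S" "\<And>S. S \<in> \<S> \<Longrightarrow> gpos (Suc k) P S"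
  obtains t where "\<And>S. S \<in> \<S> \<Longrightarrow> gpos k (shear k t P) S"
proof -
  define B where "B = (\<Union>S\<in>\<S>. \<Union>S'\<in>{S'\<in>Pow S. card S' \<le> k}. {t. sols k (shear k t P) S' \<noteq> {}})"
  have f: "finite {t. sols k (shear k t P) S' \<noteq> {}}" if S: "S \<in> \<S>" "S' \<in> {S'\<in>Pow S. card S' \<le> k}" for S S'
    using shear_bad_finite[of S' k P] gpos_sub[OF assms(3)[OF S(1)], of S'] assms(2)[OF S(1)] S finite_subset by auto
  have "finite B" unfolding B_def
    by (intro finite_UN_I assms(1) f) (use assms(2) in auto)
  then obtain t where t: "t \<notin> B" using ex_new_if_finite[OF infinite_UNIV_char_0] by blast
  have "gpos k (shear k t P) S" if "S \<in> \<S>" for S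
    using t that unfolding B_def gpos_def by blast
  then show thesis using that by blast
qed

text \<open>Shears are applied at the levels \<open>m - 1, m - 2, ...\<close>. The shear at level
  \<open>k\<close> leaves the relations at higher levels alone, so the genericity obtained there
  persists; being linear, it also preserves oddness.\<close>

lemma flag_exists:
  assumes fin: "finite \<S>" "\<And>S. S \<in> \<S> \<Longrightarrow> finite S" and gp: "\<And>S. S \<in> \<S> \<Longrightarrow> gpos m P S"
  shows "\<exists>Q. (\<forall>S. sols m Q S = sols m P S) \<and> (\<forall>i\<le>m. \<forall>S\<in>\<S>. gpos i Q S) \<and>
    (\<forall>v w. (\<forall>i. P w i = - P v i) \<longrightarrow> (\<forall>i. Q w i = - Q v i))"
proof -
  have "\<exists>Q. (\<forall>S. sols m Q S = sols m P S) \<and> (\<forall>i\<le>m. m \<le> i + j \<longrightarrow> (\<forall>S\<in>\<S>. gpos i Q S)) \<and>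
    (\<forall>v w. (\<forall>i. P w i = - P v i) \<longrightarrow> (\<forall>i. Q w i = - Q v i))" for j
  proof (induction j)
    case 0
    show ?case by (rule exI[of _ P]) (use gp in auto)
  next
    case (Suc j)
    then obtain Q where Q: "\<And>S. sols m Q S = sols m P S" "\<And>i S. i \<le> m \<Longrightarrow> m \<le> i + j \<Longrightarrow> S \<in> \<S> \<Longrightarrow> gpos i Q S"
      "\<And>v w. (\<forall>i. P w i = - P v i) \<Longrightarrow> (\<forall>i. Q w i = - Q v i)" by blast
    show ?case
    proof (cases "Suc j \<le> m")
      case False
      then show ?thesis using Q by (intro exI[of _ Q]) auto
    next
      case True
      define k where "k = m - Suc j"
      have k: "k < m" "Suc k \<le> m" "m \<le> Suc k + j" using True by (auto simp: k_def)
      obtain t where t: "\<And>S. S \<in> \<S> \<Longrightarrow> gpos k (shear k t Q) S"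
        using flag_step[OF fin, where k=k and P=Q] Q(2)[OF k(2,3)] by blast
      have "gpos i (shear k t Q) S" if i: "i \<le> m" "m \<le> i + Suc j" "S \<in> \<S>" for i S
      proof (cases "i = k")
        case False
        then have "k < i" "m \<le> i + j" using i by (auto simp: k_def)
        then show ?thesis using Q(2)[OF i(1) _ i(3)] sols_shear[of k i t Q] unfolding gpos_def by simp
      qed (use t i in auto)
      moreover have "shear k t Q w i = - shear k t Q v i" if "\<forall>i. P w i = - P v i" for v w i
        using Q(3)[OF that] by (simp add: shear_def)
      ultimately show ?thesis using Q(1) sols_shear[OF k(1), of t Q]
        by (intro exI[of _ "shear k t Q"]) auto
    qed
  qed
  from this[of m] show ?thesis by auto
qed

lemma sols_image:
  assumes T: "\<And>v. T (T v) = v" and P: "\<And>v i. P (T v) i = - P v i" and x: "x \<in> sols k P S"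
  shows "(\<lambda>v. x (T v)) \<in> sols k P (T ` S)"
    "(\<Sum>v\<in>T ` S. x (T v) * P v i) = - (\<Sum>v\<in>S. x v * P v i)"
proof -
  have inj: "inj_on T S" by (metis T inj_onI)
  show eq: "(\<Sum>v\<in>T ` S. x (T v) * P v i) = - (\<Sum>v\<in>S. x v * P v i)" for i
    by (simp add: sum.reindex[OF inj] T P sum_negf)
  obtain w where w: "w \<in> S" "x w \<noteq> 0" using x unfolding sols_def by blast
  show "(\<lambda>v. x (T v)) \<in> sols k P (T ` S)"
  proof (rule solsI[of _ _ "T w"])
    show "x (T v) = 0" if "v \<notin> T ` S" for v
      using x that T unfolding sols_def by (metis (mono_tags, lifting) image_eqI mem_Collect_eq)
  qed (use x w T eq in \<open>auto simp: sols_def\<close>)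
qed

text \<open>The relations for the first \<open>i\<close> coordinates are counted on the cell of dimension \<open>i\<close>; the next coordinate
  changes sign under \<open>T\<close> and plays the role of \<open>G\<close> in \<open>segment_parity\<close>.\<close>

lemma antipodal_ladder:
  fixes c :: "nat \<Rightarrow> ('v set \<Rightarrow> bit) \<Rightarrow> bit"
  assumes fin: "finite \<S>" "\<And>S. S \<in> \<S> \<Longrightarrow> finite S"
    and T: "\<And>v. T (T v) = v" and TS: "\<And>S. S \<in> \<S> \<Longrightarrow> T ` S \<in> \<S>" and P: "\<And>v i. P (T v) i = - P v i"
    and gp: "\<And>S. S \<in> \<S> \<Longrightarrow> gpos m P S"
    and cong: "\<And>i f g. i \<le> m \<Longrightarrow> (\<And>S. S \<in> \<S> \<Longrightarrow> card S = Suc i \<Longrightarrow> f S = g S) \<Longrightarrow> c i f = c i g"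
    and bd: "\<And>i f. i < m \<Longrightarrow> c (Suc i) (\<lambda>S. \<Sum>v\<in>S. f (S - {v})) = c i (\<lambda>S. f S + f (T ` S))"
    and c0: "\<And>f. c 0 f = f {pt}"
  shows "c m (\<lambda>S. of_bool (sols m P S \<noteq> {})) = 1"
proof -
  obtain Q where Q: "\<And>S. sols m Q S = sols m P S" "\<And>i S. i \<le> m \<Longrightarrow> S \<in> \<S> \<Longrightarrow> gpos i Q S"
    and Qn: "\<And>v w. (\<forall>i. P w i = - P v i) \<Longrightarrow> (\<forall>i. Q w i = - Q v i)"
    using flag_exists[OF fin, where m=m and P=P] gp by blast
  have QT: "Q (T v) i = - Q v i" for v i using Qn[of "T v" v] P by blast
  have "c i (\<lambda>S. of_bool (sols i Q S \<noteq> {})) = 1" if "i \<le> m" for i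
    using that
  proof (induction i)
    case 0
    have "(\<lambda>v. if v = pt then 1 else 0) \<in> sols 0 Q {pt}" by (simp add: sols_def)
    then show ?case by (auto simp: c0)
  next
    case (Suc i)
    define Y where "Y = (\<lambda>S. of_bool (\<exists>x\<in>sols i Q S. (\<Sum>u\<in>S. x u * Q u i) > 0) :: bit)"
    \<comment> \<open>On a simplex with \<open>i + 2\<close> vertices, a zero of coordinate
      \<open>i\<close> on the segment of relations is a sum of \<open>Y\<close> over the facets.
      This is a coboundary, which \<open>bd\<close> turns into a sum over the cell of dimension
      \<open>i\<close> and its antipode.\<close>
    have "c (Suc i) (\<lambda>S. of_bool (sols (Suc i) Q S \<noteq> {})) = c (Suc i) (\<lambda>S. \<Sum>v\<in>S. Y (S - {v}))"
    proof (rule cong[OF Suc.prems])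
      fix S assume S: "S \<in> \<S>" "card S = Suc (Suc i)"
      have finS: "finite S" using fin S by blast
      have sub: "(\<Sum>u\<in>S. x u * Q u i) = (\<Sum>u\<in>S-{v}. x u * Q u i)" if "x \<in> sols i Q (S-{v})" for x v
        by (rule sum.mono_neutral_right) (use finS that in \<open>auto simp: sols_def\<close>)
      have Yeq: "Y (S-{v}) = of_bool (\<exists>x\<in>sols i Q (S - {v}). (\<Sum>u\<in>S. x u * Q u i) > 0)" for v
      proof -
        have "(\<exists>x\<in>sols i Q (S - {v}). (\<Sum>u\<in>S-{v}. x u * Q u i) > 0) \<longleftrightarrow> (\<exists>x\<in>sols i Q (S - {v}). (\<Sum>u\<in>S. x u * Q u i) > 0)"
          using sub[of _ v] by auto
        then show ?thesis unfolding Y_def by simp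
      qed
      have "(\<Sum>u\<in>S. x u * Q u i) \<noteq> 0" if v: "v \<in> S" and x: "x \<in> sols i Q (S-{v})" for v x
      proof
        assume "(\<Sum>u\<in>S. x u * Q u i) = 0"
        then have "x \<in> sols (Suc i) Q (S-{v})" using sub[OF x] x by (auto simp: sols_def less_Suc_eq)
        moreover have "gpos (Suc i) Q S" using Q(2)[OF Suc.prems S(1)] .
        moreover have "card (S-{v}) \<le> Suc i" using v S finS by simp
        ultimately show False unfolding gpos_def by (metis Diff_subset empty_iff)
      qed
      then have "(\<Sum>v\<in>S. Y (S - {v})) = of_bool (\<exists>x\<in>sols i Q S. (\<Sum>u\<in>S. x u * Q u i) = 0)"
        unfolding Yeq using segment_parity[OF finS, of i Q "\<lambda>u. Q u i"] S(2) Q(2)[of i, OF _ S(1)] Suc.prems by auto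
      also have "(\<exists>x\<in>sols i Q S. (\<Sum>u\<in>S. x u * Q u i) = 0) \<longleftrightarrow> sols (Suc i) Q S \<noteq> {}"
        by (auto simp: sols_def less_Suc_eq)
      finally show "of_bool (sols (Suc i) Q S \<noteq> {}) = (\<Sum>v\<in>S. Y (S - {v}))" by simp
    qed
    also have "\<dots> = c i (\<lambda>S. Y S + Y (T ` S))" using bd Suc.prems by simp
    \<comment> \<open>On \<open>i + 1\<close> vertices there is at most one ray of relations, and
      coordinate \<open>i\<close> is nonzero on it. If it is negative, the antipodal simplex carries
      a ray where it is positive. So exactly one of \<open>S\<close> and its antipode is counted by
      \<open>Y\<close> if there is a ray at all.\<close>
    also have "\<dots> = c i (\<lambda>S. of_bool (sols i Q S \<noteq> {}))"
    proof (rule cong)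
      fix S assume S: "S \<in> \<S>" "card S = Suc i"
      have finS: "finite S" using fin S by blast
      have inj: "inj_on T S" by (metis T inj_onI)
      have nz: "(\<Sum>u\<in>S. x u * Q u i) \<noteq> 0" if x: "x \<in> sols i Q S" for x
      proof
        assume "(\<Sum>u\<in>S. x u * Q u i) = 0"
        then have "x \<in> sols (Suc i) Q S" using x by (auto simp: sols_def less_Suc_eq)
        then show False using Q(2)[OF Suc.prems S(1)] S(2) unfolding gpos_def by (metis empty_iff order_refl)
      qed
      have TT: "T ` T ` S = S" by (simp add: image_image T)
      have YT: "Y (T ` S) = of_bool (\<exists>x\<in>sols i Q S. (\<Sum>u\<in>S. x u * Q u i) < 0)"
      proof -
        have "(\<exists>x\<in>sols i Q (T ` S). (\<Sum>u\<in>T ` S. x u * Q u i) > 0) \<longleftrightarrow> (\<exists>x\<in>sols i Q S. (\<Sum>u\<in>S. x u * Q u i) < 0)"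
        proof
          assume "\<exists>x\<in>sols i Q (T ` S). (\<Sum>u\<in>T ` S. x u * Q u i) > 0"
          then obtain x where x: "x \<in> sols i Q (T ` S)" "(\<Sum>u\<in>T ` S. x u * Q u i) > 0" by blast
          show "\<exists>x\<in>sols i Q S. (\<Sum>u\<in>S. x u * Q u i) < 0"
            using sols_image(1)[OF T QT x(1)] sols_image(2)[OF T QT x(1), of i] x(2) unfolding TT by (intro bexI[of _ "\<lambda>v. x (T v)"]) auto
        next
          assume "\<exists>x\<in>sols i Q S. (\<Sum>u\<in>S. x u * Q u i) < 0"
          then obtain x where x: "x \<in> sols i Q S" "(\<Sum>u\<in>S. x u * Q u i) < 0" by blast
          show "\<exists>x\<in>sols i Q (T ` S). (\<Sum>u\<in>T ` S. x u * Q u i) > 0"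
            using sols_image(1)[OF T QT x(1)] sols_image(2)[OF T QT x(1), of i] x(2) by (intro bexI[of _ "\<lambda>v. x (T v)"]) auto
        qed
        then show ?thesis unfolding Y_def by simp
      qed
      have excl: "\<not> (\<exists>y\<in>sols i Q S. (\<Sum>u\<in>S. y u * Q u i) < 0)"
        if ex: "\<exists>x\<in>sols i Q S. (\<Sum>u\<in>S. x u * Q u i) > 0"
      proof
        obtain x where x: "x \<in> sols i Q S" "(\<Sum>u\<in>S. x u * Q u i) > 0" using ex by blast
        assume "\<exists>y\<in>sols i Q S. (\<Sum>u\<in>S. y u * Q u i) < 0"
        then obtain y where y: "y \<in> sols i Q S" "(\<Sum>u\<in>S. y u * Q u i) < 0" by blast
        have gpi: "gpos i Q S" using Q(2)[of i S] S Suc.prems by simp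
        obtain c where c: "\<And>v. y v = c * x v"
          using sols_unique[OF finS gpi _ x(1), of y] y(1) S(2) by (auto simp: sols_def)
        obtain w where w: "w \<in> S" "y w \<noteq> 0" using y(1) by (auto simp: sols_def)
        have "y w \<ge> 0" "x w \<ge> 0" using x y by (simp_all add: sols_def)
        then have "c \<ge> 0" using w c[of w] by (metis less_eq_real_def mult_neg_pos mult_zero_right not_le)
        moreover have "(\<Sum>u\<in>S. y u * Q u i) = c * (\<Sum>u\<in>S. x u * Q u i)"
          by (simp add: c sum_distrib_left mult.assoc)
        ultimately show False using x y by (simp add: mult_less_0_iff)
      qed
      have "sols i Q S \<noteq> {} \<longleftrightarrow> (\<exists>x\<in>sols i Q S. (\<Sum>u\<in>S. x u * Q u i) > 0) \<or> (\<exists>x\<in>sols i Q S. (\<Sum>u\<in>S. x u * Q u i) < 0)"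
        using nz by fastforce
      then show "Y S + Y (T ` S) = of_bool (sols i Q S \<noteq> {})"
        unfolding YT unfolding Y_def using excl by auto
    qed (use Suc.prems in auto)
    also have "\<dots> = 1" using Suc by simp
    finally show ?case .
  qed
  from this[of m] show ?thesis by (simp add: Q(1))
qed

section \<open>Joins and pairs of cones\<close>

declare add_bit_eq_xor [simp del] mult_bit_eq_and [simp del]

lemma bit_add_self [simp]: "(a::bit) + a = 0" by (cases a) auto

lemma bit_add_eq_0: "(a::bit) + b = 0 \<longleftrightarrow> a = b" by (cases a; cases b) auto

text \<open>The simplicial coboundary mod 2, augmented by the empty simplex so that it obeys a
  Leibniz rule on joins.\<close>

definition cobd :: "('w set \<Rightarrow> bit) \<Rightarrow> 'w set \<Rightarrow> bit" where
  "cobd f S = (\<Sum>v\<in>S. f (S - {v}))"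

text \<open>The tags keep the three factors apart even if they share vertices; an empty last factor
  gives the join of two simplices.\<close>

definition join :: "'v set \<Rightarrow> 'v set \<Rightarrow> 'v set \<Rightarrow> ('v \<times> nat) set" where
  "join s t r = s \<times> {0} \<union> t \<times> {1} \<union> r \<times> {2}"

lemma join_diff:
  "join s t r - {(v, 0)} = join (s - {v}) t r"
  "join s t r - {(v, Suc 0)} = join s (t - {v}) r"
  "join s t r - {(v, 2)} = join s t (r - {v})"
  unfolding join_def by auto

lemma finite_join: "finite s \<Longrightarrow> finite t \<Longrightarrow> finite r \<Longrightarrow> finite (join s t r)"
  unfolding join_def by simp

lemma sum_join:
  assumes "finite s" "finite t" "finite r"
  shows "(\<Sum>u\<in>join s t r. F u) = (\<Sum>v\<in>s. F (v, 0)) + (\<Sum>v\<in>t. F (v, 1)) + (\<Sum>v\<in>r. F (v, 2))"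
proof -
  have 1: "(\<Sum>u\<in>x \<times> {n}. F u) = (\<Sum>v\<in>x. F (v, n))" for x n
  proof -
    have "x \<times> {n} = (\<lambda>v. (v, n)) ` x" by auto
    then show ?thesis by (simp add: sum.reindex inj_on_def)
  qed
  have "(\<Sum>u\<in>join s t r. F u) = (\<Sum>u\<in>s \<times> {0} \<union> t \<times> {1}. F u) + (\<Sum>u\<in>r \<times> {2}. F u)"
    unfolding join_def by (rule sum.union_disjoint) (use assms in auto)
  also have "(\<Sum>u\<in>s \<times> {0} \<union> t \<times> {1}. F u) = (\<Sum>u\<in>s \<times> {0}. F u) + (\<Sum>u\<in>t \<times> {1}. F u)"
    by (rule sum.union_disjoint) (use assms in auto)
  finally show ?thesis by (simp only: 1)
qed

lemma card_join:
  assumes "finite s" "finite t" "finite r"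
  shows "card (join s t r) = card s + card t + card r"
  using sum_join[OF assms, of "\<lambda>_. 1::nat"] by simp

lemma cobd_join:
  assumes "finite s" "finite t" "finite r"
  shows "cobd f (join s t r) = cobd (\<lambda>s. f (join s t r)) s + cobd (\<lambda>t. f (join s t r)) t + cobd (\<lambda>r. f (join s t r)) r"
  unfolding cobd_def sum_join[OF assms] by (simp add: join_diff)

lemma cobd_empty [simp]: "cobd f {} = 0" by (simp add: cobd_def)

lemma cobd_single [simp]: "cobd f {v} = f {}" by (simp add: cobd_def)

section \<open>Common points of two or three cones as nonnegative relations\<close>

definition wt :: "'v set \<Rightarrow> ('v \<Rightarrow> real) \<Rightarrow> bool" where
  "wt s lam \<longleftrightarrow> (\<forall>v. 0 \<le> lam v) \<and> (\<forall>v. v \<notin> s \<longrightarrow> lam v = 0)"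

definition cmb :: "'v vecs \<Rightarrow> 'v set \<Rightarrow> ('v \<Rightarrow> real) \<Rightarrow> nat \<Rightarrow> real" where
  "cmb A s lam i = (\<Sum>v\<in>s. lam v * A v i)"

definition sol2 :: "'v vecs \<Rightarrow> 'w vecs \<Rightarrow> 'v set \<Rightarrow> 'w set \<Rightarrow> ('v \<Rightarrow> real) \<Rightarrow> ('w \<Rightarrow> real) \<Rightarrow> bool" where
  "sol2 A B s t lam mu \<longleftrightarrow> wt s lam \<and> wt t mu \<and> ((\<exists>v. lam v \<noteq> 0) \<or> (\<exists>v. mu v \<noteq> 0)) \<and> (\<forall>i<4. cmb A s lam i = cmb B t mu i)"

definition sol3 where
  "sol3 A B C s t r lam mu nu \<longleftrightarrow> wt s lam \<and> wt t mu \<and> wt r nu \<and> (\<exists>v. lam v \<noteq> 0 \<or> mu v \<noteq> 0 \<or> nu v \<noteq> 0) \<and>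
     (\<forall>i<4. cmb A s lam i = cmb B t mu i) \<and> (\<forall>i<4. cmb A s lam i = cmb C r nu i)"

definition pair_config :: "'v vecs \<Rightarrow> 'v vecs \<Rightarrow> ('v \<times> nat) \<Rightarrow> nat \<Rightarrow> real" where
  "pair_config A B u i = (if snd u = 0 then A (fst u) i else - B (fst u) i)"

text \<open>Eight equations: the four coordinates of the difference between \<open>A\<close> and
  \<open>B\<close>, followed by those of the difference between \<open>A\<close> and
  \<open>C\<close>. The vectors of \<open>A\<close> enter both blocks, hence the index mod
  4.\<close>

definition triple_config where
  "triple_config A B C u i = (if snd u = (0::nat) then A (fst u) (i mod 4) else
     if snd u = 1 then (if i < 4 then - B (fst u) i else 0) else (if i < 4 then 0 else - C (fst u) (i - 4)))"

lemma sols_pair_config: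
  fixes x :: "'v \<times> nat \<Rightarrow> real"
  assumes fin: "finite s" "finite t"
  shows "x \<in> sols 4 (pair_config A B) (join s t {}) \<longleftrightarrow>
    sol2 A B s t (\<lambda>v. x (v, 0)) (\<lambda>v. x (v, 1)) \<and> (\<forall>v n. n \<ge> 2 \<longrightarrow> x (v, n) = 0)"
proof -
  have e: "(\<Sum>u\<in>join s t {}. x u * pair_config A B u i) = cmb A s (\<lambda>v. x (v,0)) i - cmb B t (\<lambda>v. x (v,1)) i" for i
    using fin by (simp add: sum_join pair_config_def cmb_def sum_negf)
  have off: "(\<forall>u. u \<notin> join s t {} \<longrightarrow> x u = 0) \<longleftrightarrow>
      (\<forall>v. v \<notin> s \<longrightarrow> x (v,0) = 0) \<and> (\<forall>v. v \<notin> t \<longrightarrow> x (v,1) = 0) \<and> (\<forall>v n. n \<ge> 2 \<longrightarrow> x (v,n) = 0)" (is "?L = ?R")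
  proof
    assume ?L then show ?R by (auto simp: join_def)
  next
    assume R: ?R
    show ?L
    proof (intro allI impI)
      fix u assume u: "u \<notin> join s t {}"
      obtain v n where vn: "u = (v,n)" by (cases u)
      consider "n = 0" | "n = 1" | "n \<ge> 2" by linarith
      then show "x u = 0" using R u vn by cases (auto simp: join_def)
    qed
  qed
  have nn: "(\<forall>u. 0 \<le> x u) \<longleftrightarrow> (\<forall>v. 0 \<le> x (v,0)) \<and> (\<forall>v. 0 \<le> x (v,1))" if "\<forall>v n. n \<ge> 2 \<longrightarrow> x (v,n) = 0"
  proof (intro iffI allI)
    fix u :: "'v \<times> nat" assume h: "(\<forall>v. 0 \<le> x (v,0)) \<and> (\<forall>v. 0 \<le> x (v,1))"
    obtain v n where vn: "u = (v,n)" by (cases u)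
    consider "n = 0" | "n = 1" | "n \<ge> 2" by linarith
    then show "0 \<le> x u" using h that vn by cases auto
  qed auto
  have ex: "(\<exists>u\<in>join s t {}. x u \<noteq> 0) \<longleftrightarrow> (\<exists>v. x (v,0) \<noteq> 0) \<or> (\<exists>v. x (v,1) \<noteq> 0)" if "\<forall>u. u \<notin> join s t {} \<longrightarrow> x u = 0"
    using that by (auto simp: join_def)
  show ?thesis
    unfolding sols_def sol2_def wt_def mem_Collect_eq e right_minus_eq using off nn ex by blast
qed

lemma sols_triple_config:
  fixes x :: "'v \<times> nat \<Rightarrow> real"
  assumes fin: "finite s" "finite t" "finite r"
  shows "x \<in> sols 8 (triple_config A B C) (join s t r) \<longleftrightarrow>
    sol3 A B C s t r (\<lambda>v. x (v, 0)) (\<lambda>v. x (v, 1)) (\<lambda>v. x (v, 2)) \<and> (\<forall>v n. n \<ge> 3 \<longrightarrow> x (v, n) = 0)"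
proof -
  have e: "(\<Sum>u\<in>join s t r. x u * triple_config A B C u i) =
      cmb A s (\<lambda>v. x (v,0)) (i mod 4) - (if i < 4 then cmb B t (\<lambda>v. x (v,1)) i else cmb C r (\<lambda>v. x (v,2)) (i - 4))" for i
    using fin by (simp add: sum_join triple_config_def cmb_def sum_negf)
  have e8: "(\<forall>i<8. (\<Sum>u\<in>join s t r. x u * triple_config A B C u i) = 0) \<longleftrightarrow>
      (\<forall>i<4. cmb A s (\<lambda>v. x (v,0)) i = cmb B t (\<lambda>v. x (v,1)) i) \<and>
      (\<forall>i<4. cmb A s (\<lambda>v. x (v,0)) i = cmb C r (\<lambda>v. x (v,2)) i)" (is "?L = ?R")
  proof
    assume L: ?L
    show ?R
    proof (intro conjI allI impI)
      fix i :: nat assume "i < 4"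
      then show "cmb A s (\<lambda>v. x (v,0)) i = cmb B t (\<lambda>v. x (v,1)) i" using L[rule_format, of i] unfolding e by simp
    next
      fix i :: nat assume "i < 4"
      then show "cmb A s (\<lambda>v. x (v,0)) i = cmb C r (\<lambda>v. x (v,2)) i" using L[rule_format, of "i + 4"] unfolding e by simp
    qed
  next
    assume R: ?R
    show ?L
    proof (intro allI impI)
      fix i :: nat assume i: "i < 8"
      show "(\<Sum>u\<in>join s t r. x u * triple_config A B C u i) = 0"
      proof (cases "i < 4")
        case False
        then have "i mod 4 = i - 4" using i by (simp add: mod_if)
        moreover have "i - 4 < 4" using i False by simp
        ultimately show ?thesis using conjunct2[OF R, rule_format, of "i - 4"] False unfolding e by simp
      qed (use R in \<open>simp add: e\<close>)
    qed
  qed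
  have off: "(\<forall>u. u \<notin> join s t r \<longrightarrow> x u = 0) \<longleftrightarrow>
      (\<forall>v. v \<notin> s \<longrightarrow> x (v,0) = 0) \<and> (\<forall>v. v \<notin> t \<longrightarrow> x (v,1) = 0) \<and> (\<forall>v. v \<notin> r \<longrightarrow> x (v,2) = 0) \<and> (\<forall>v n. n \<ge> 3 \<longrightarrow> x (v,n) = 0)" (is "?L = ?R")
  proof
    assume ?L then show ?R by (auto simp: join_def)
  next
    assume R: ?R
    show ?L
    proof (intro allI impI)
      fix u assume u: "u \<notin> join s t r"
      obtain v n where vn: "u = (v,n)" by (cases u)
      consider "n = 0" | "n = 1" | "n = 2" | "n \<ge> 3" by linarith
      then show "x u = 0" using R u vn by cases (auto simp: join_def)
    qed
  qed
  have nn: "(\<forall>u. 0 \<le> x u) \<longleftrightarrow> (\<forall>v. 0 \<le> x (v,0)) \<and> (\<forall>v. 0 \<le> x (v,1)) \<and> (\<forall>v. 0 \<le> x (v,2))" if "\<forall>v n. n \<ge> 3 \<longrightarrow> x (v,n) = 0"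
  proof (intro iffI allI)
    fix u :: "'v \<times> nat" assume h: "(\<forall>v. 0 \<le> x (v,0)) \<and> (\<forall>v. 0 \<le> x (v,1)) \<and> (\<forall>v. 0 \<le> x (v,2))"
    obtain v n where vn: "u = (v,n)" by (cases u)
    consider "n = 0" | "n = 1" | "n = 2" | "n \<ge> 3" by linarith
    then show "0 \<le> x u" using h that vn by cases auto
  qed auto
  have ex: "(\<exists>u\<in>join s t r. x u \<noteq> 0) \<longleftrightarrow> (\<exists>v. x (v,0) \<noteq> 0 \<or> x (v,1) \<noteq> 0 \<or> x (v,2) \<noteq> 0)" if "\<forall>u. u \<notin> join s t r \<longrightarrow> x u = 0"
    using that by (auto simp: join_def)
  show ?thesis
    unfolding sols_def sol3_def wt_def mem_Collect_eq e8 using off nn ex by blast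
qed

definition join_weights :: "('v \<Rightarrow> real) \<Rightarrow> ('v \<Rightarrow> real) \<Rightarrow> ('v \<Rightarrow> real) \<Rightarrow> 'v \<times> nat \<Rightarrow> real" where
  "join_weights lam mu nu u = (if snd u = 0 then lam (fst u) else if snd u = 1 then mu (fst u) else if snd u = 2 then nu (fst u) else 0)"

lemma join_weights_simps [simp]: "join_weights lam mu nu (v, 0) = lam v" "join_weights lam mu nu (v, Suc 0) = mu v" "join_weights lam mu nu (v, 2) = nu v"
  "n \<ge> 3 \<Longrightarrow> join_weights lam mu nu (v, n) = 0"
  by (auto simp: join_weights_def)

text \<open>The analogue of \<open>pair_config\<close> on a disjoint sum; the two simplices may then
  have vertices of different types, as in \<open>antipodal_sphere_cocycle\<close>.\<close>

definition diff_config :: "'v vecs \<Rightarrow> 'w vecs \<Rightarrow> ('v + 'w) \<Rightarrow> nat \<Rightarrow> real" where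
  "diff_config A B u i = (case u of Inl v \<Rightarrow> A v i | Inr v \<Rightarrow> - B v i)"

lemma sum_diff_config:
  assumes "finite s" "finite t"
  shows "(\<Sum>u\<in>s <+> t. F u) = (\<Sum>v\<in>s. F (Inl v)) + (\<Sum>v\<in>t. F (Inr v))"
  using assms by (simp add: sum.Plus)

lemma sols_diff_config:
  assumes "finite s" "finite t"
  shows "x \<in> sols 4 (diff_config A B) (s <+> t) \<longleftrightarrow> sol2 A B s t (\<lambda>v. x (Inl v)) (\<lambda>v. x (Inr v))"
proof -
  have e: "(\<Sum>u\<in>s <+> t. x u * diff_config A B u i) = cmb A s (\<lambda>v. x (Inl v)) i - cmb B t (\<lambda>v. x (Inr v)) i" for i
    using assms by (simp add: sum_diff_config diff_config_def cmb_def sum_negf)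
  have off: "(\<forall>u. u \<notin> s <+> t \<longrightarrow> x u = 0) \<longleftrightarrow> (\<forall>v. v \<notin> s \<longrightarrow> x (Inl v) = 0) \<and> (\<forall>v. v \<notin> t \<longrightarrow> x (Inr v) = 0)"
    by (auto simp: split_sum_all)
  have nn: "(\<forall>u. 0 \<le> x u) \<longleftrightarrow> (\<forall>v. 0 \<le> x (Inl v)) \<and> (\<forall>v. 0 \<le> x (Inr v))"
    by (auto simp: split_sum_all)
  have ex: "(\<exists>u\<in>s <+> t. x u \<noteq> 0) \<longleftrightarrow> (\<exists>v. x (Inl v) \<noteq> 0) \<or> (\<exists>v. x (Inr v) \<noteq> 0)"
    if "\<forall>u. u \<notin> s <+> t \<longrightarrow> x u = 0"
    using that by (auto simp: split_sum_all)
  show ?thesis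
    unfolding sols_def sol2_def wt_def mem_Collect_eq e right_minus_eq using off nn ex by blast
qed

lemma Plus_subset:
  assumes "S \<subseteq> s <+> t"
  obtains s' t' where "s' \<subseteq> s" "t' \<subseteq> t" "S = s' <+> t'"
proof
  show "Inl -` S \<subseteq> s" "Inr -` S \<subseteq> t" using assms by auto
  show "S = Inl -` S <+> Inr -` S" using assms by auto
qed

lemma Plus_diff: "(s <+> t) - {Inl v} = (s - {v}) <+> t" "(s <+> t) - {Inr w} = s <+> (t - {w})"
  by auto

text \<open>Use \<open>segment_parity\<close> with the difference of the two weights as functional.
  By \<open>dis\<close> it has no zero on the segment of common points, so the number of facets
  where it is positive is even; the facets obtained by deleting a vertex of \<open>s\<close> or of
  \<open>t\<close> give the two coboundaries.\<close>

lemma segment_parity_pair: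
  fixes A :: "'v \<Rightarrow> nat \<Rightarrow> real" and B :: "'w \<Rightarrow> nat \<Rightarrow> real"
  assumes fin: "finite s" "finite t" and card: "card s + card t = 6"
    and gp: "\<And>s' t' lam mu. s' \<subseteq> s \<Longrightarrow> t' \<subseteq> t \<Longrightarrow> sol2 A B s' t' lam mu \<Longrightarrow> 5 \<le> card s' + card t'"
    and dis: "\<And>lam mu. sol2 A B s t lam mu \<Longrightarrow> (\<Sum>v\<in>s. lam v * wa v) \<noteq> (\<Sum>v\<in>t. mu v * wb v)"
  shows "cobd (\<lambda>s. of_bool (\<exists>lam mu. sol2 A B s t lam mu \<and> (\<Sum>v\<in>s. lam v * wa v) < (\<Sum>v\<in>t. mu v * wb v))) s +
    cobd (\<lambda>t. of_bool (\<exists>lam mu. sol2 A B s t lam mu \<and> (\<Sum>v\<in>s. lam v * wa v) < (\<Sum>v\<in>t. mu v * wb v))) t = 0"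
proof -
  define W where "W = (\<lambda>u. case u of Inl v \<Rightarrow> - wa v | Inr v \<Rightarrow> wb v)"
  let ?z = "\<lambda>s t. of_bool (\<exists>lam mu. sol2 A B s t lam mu \<and> (\<Sum>v\<in>s. lam v * wa v) < (\<Sum>v\<in>t. mu v * wb v)) :: bit"
  have finS: "finite (s <+> t)" using fin by simp
  have W: "(\<Sum>u\<in>s' <+> t'. x u * W u) = (\<Sum>v\<in>t'. x (Inr v) * wb v) - (\<Sum>v\<in>s'. x (Inl v) * wa v)"
    if "s' \<subseteq> s" "t' \<subseteq> t" for x s' t'
    using that fin by (simp add: sum_diff_config W_def sum_negf finite_subset)
  have sup: "(\<Sum>u\<in>s <+> t. x u * W u) = (\<Sum>u\<in>S'. x u * W u)" if "S' \<subseteq> s <+> t" "x \<in> sols 4 (diff_config A B) S'" for x S'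
    by (rule sum.mono_neutral_right) (use that finS in \<open>auto simp: sols_def\<close>)
  have z: "?z s' t' = of_bool (\<exists>x\<in>sols 4 (diff_config A B) (s' <+> t'). (\<Sum>u\<in>s <+> t. x u * W u) > 0)"
    if st: "s' \<subseteq> s" "t' \<subseteq> t" for s' t'
  proof -
    have f: "finite s'" "finite t'" and sub: "s' <+> t' \<subseteq> s <+> t" using st fin finite_subset by auto
    have "(\<exists>lam mu. sol2 A B s' t' lam mu \<and> (\<Sum>v\<in>s'. lam v * wa v) < (\<Sum>v\<in>t'. mu v * wb v)) \<longleftrightarrow>
      (\<exists>x\<in>sols 4 (diff_config A B) (s' <+> t'). (\<Sum>u\<in>s <+> t. x u * W u) > 0)"
    proof
      assume "\<exists>lam mu. sol2 A B s' t' lam mu \<and> (\<Sum>v\<in>s'. lam v * wa v) < (\<Sum>v\<in>t'. mu v * wb v)"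
      then obtain lam mu where h: "sol2 A B s' t' lam mu" "(\<Sum>v\<in>s'. lam v * wa v) < (\<Sum>v\<in>t'. mu v * wb v)" by blast
      define x where "x = case_sum lam mu"
      have x: "x \<in> sols 4 (diff_config A B) (s' <+> t')" using h(1) unfolding sols_diff_config[OF f] x_def by simp
      then show "\<exists>x\<in>sols 4 (diff_config A B) (s' <+> t'). (\<Sum>u\<in>s <+> t. x u * W u) > 0"
        using sup[OF sub x] W[OF st, of x] h(2) by (intro bexI[OF _ x]) (simp add: x_def)
    next
      assume "\<exists>x\<in>sols 4 (diff_config A B) (s' <+> t'). (\<Sum>u\<in>s <+> t. x u * W u) > 0"
      then obtain x where x: "x \<in> sols 4 (diff_config A B) (s' <+> t')" "(\<Sum>u\<in>s <+> t. x u * W u) > 0" by blast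
      show "\<exists>lam mu. sol2 A B s' t' lam mu \<and> (\<Sum>v\<in>s'. lam v * wa v) < (\<Sum>v\<in>t'. mu v * wb v)"
        using x(1)[unfolded sols_diff_config[OF f]] sup[OF sub x(1)] W[OF st, of x] x(2) by (intro exI conjI) auto
    qed
    then show ?thesis by simp
  qed
  have gpS: "gpos 4 (diff_config A B) (s <+> t)"
    unfolding gpos_def
  proof (intro allI impI)
    fix S' assume S': "S' \<subseteq> s <+> t" "card S' \<le> 4"
    obtain s' t' where st: "s' \<subseteq> s" "t' \<subseteq> t" "S' = s' <+> t'" using Plus_subset[OF S'(1)] .
    have f: "finite s'" "finite t'" using st fin finite_subset by auto
    show "sols 4 (diff_config A B) S' = {}"
    proof (rule equals0I)
      fix x assume "x \<in> sols 4 (diff_config A B) S'"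
      then have "5 \<le> card s' + card t'" using gp[OF st(1,2)] unfolding st(3) sols_diff_config[OF f] by blast
      then show False using S'(2) f unfolding st(3) by (simp add: card_Plus)
    qed
  qed
  have nz: "(\<Sum>u\<in>s <+> t. x u * W u) \<noteq> 0" if "x \<in> sols 4 (diff_config A B) (s <+> t)" for x
    using dis[OF that[unfolded sols_diff_config[OF fin]]] W[of s t x] by auto
  have "(\<Sum>u\<in>s <+> t. of_bool (\<exists>x\<in>sols 4 (diff_config A B) ((s <+> t) - {u}). (\<Sum>u\<in>s <+> t. x u * W u) > 0) :: bit) =
    of_bool (\<exists>x\<in>sols 4 (diff_config A B) (s <+> t). (\<Sum>u\<in>s <+> t. x u * W u) = 0)"
  proof (rule segment_parity[OF finS _ gpS])
    show "card (s <+> t) = 4 + 2" using card fin by (simp add: card_Plus)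
    fix v x assume "x \<in> sols 4 (diff_config A B) ((s <+> t) - {v})"
    then have "x \<in> sols 4 (diff_config A B) (s <+> t)" using sols_mono[OF finS] by blast
    then show "(\<Sum>u\<in>s <+> t. x u * W u) \<noteq> 0" by (rule nz)
  qed
  also have "\<dots> = 0" using nz by auto
  finally have "sum (\<lambda>u. of_bool (\<exists>x\<in>sols 4 (diff_config A B) ((s <+> t) - {u}). (\<Sum>u\<in>s <+> t. x u * W u) > 0) :: bit) (s <+> t) = 0" .
  then have "(\<Sum>u\<in>s. ?z (s - {u}) t) + (\<Sum>u\<in>t. ?z s (t - {u})) = 0"
    unfolding sum.Plus[OF fin] o_def Plus_diff z[OF Diff_subset subset_refl] z[OF subset_refl Diff_subset] .
  then show ?thesis unfolding cobd_def .
qed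

lemma join_subset:
  assumes "S \<subseteq> join s t r"
  obtains s' t' r' where "s' \<subseteq> s" "t' \<subseteq> t" "r' \<subseteq> r" "S = join s' t' r'"
proof
  let ?f = "\<lambda>n. {v. (v, n) \<in> S}"
  show "?f 0 \<subseteq> s" "?f 1 \<subseteq> t" "?f 2 \<subseteq> r" using assms by (auto simp: join_def)
  show "S = join (?f 0) (?f 1) (?f 2)" using assms by (auto simp: join_def)
qed

section \<open>Triangulated spheres with an antipodal map\<close>

text \<open>Chains mod 2 are represented by the functionals that sum a cochain over their simplices.\<close>

definition chsum :: "'i set \<Rightarrow> ('i \<Rightarrow> 'v set) \<Rightarrow> ('v set \<Rightarrow> bit) \<Rightarrow> bit" where
  "chsum I s f = (\<Sum>p\<in>I. f (s p))"

lemma chsum_add: "chsum I s (\<lambda>x. f x + g x) = chsum I s f + chsum I s g"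
  by (simp add: chsum_def sum.distrib)

lemma chsum_swap: "chsum I s (\<lambda>x. chsum J t (\<lambda>y. F x y)) = chsum J t (\<lambda>y. chsum I s (\<lambda>x. F x y))"
  unfolding chsum_def by (rule sum.swap)

lemma chsum_zero [simp]: "chsum I s (\<lambda>x. 0) = 0"
  by (simp add: chsum_def)

lemma chsum_cong: "(\<And>p. p \<in> I \<Longrightarrow> f (s p) = g (s p)) \<Longrightarrow> chsum I s f = chsum I s g"
  by (simp add: chsum_def)

text \<open>\<open>I2\<close> indexes the triangles of a hemisphere, \<open>I1\<close> the edges of half of its boundary circle. The
  condition \<open>H1\<close> states that the first cohomology of the quotient by \<open>T\<close> is detected by that half circle.\<close>

locale antipodal_sphere =
  fixes I2 :: "'i set" and s2 :: "'i \<Rightarrow> 'v set" and I1 :: "'j set" and s1 :: "'j \<Rightarrow> 'v set"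
    and v0 :: 'v and T :: "'v \<Rightarrow> 'v"
  assumes fin: "finite I2" "finite I1"
    and TT [simp]: "\<And>v. T (T v) = v"
    and card3: "\<And>i. i \<in> I2 \<Longrightarrow> card (s2 i) = 3" and card2: "\<And>j. j \<in> I1 \<Longrightarrow> card (s1 j) = 2"
    and s1_face: "\<And>j. j \<in> I1 \<Longrightarrow> \<exists>i\<in>I2. s1 j \<subseteq> s2 i" and v0_face: "\<exists>i\<in>I2. v0 \<in> s2 i"
    and bd2: "\<And>f. chsum I2 s2 (cobd f) = chsum I1 s1 (\<lambda>s. f s + f (T ` s))"
    and bd1: "\<And>f. chsum I1 s1 (cobd f) = f {v0} + f {T v0}"
    and H1: "\<And>\<gamma>. \<lbrakk>\<And>e. \<gamma> (T ` e) = \<gamma> e; \<And>i. i \<in> I2 \<Longrightarrow> cobd \<gamma> (s2 i) = 0; chsum I1 s1 \<gamma> = 0\<rbrakk> \<Longrightarrow>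
      \<exists>f::'v \<Rightarrow> bit. (\<forall>v. f (T v) = f v) \<and> (\<forall>i\<in>I2. \<forall>v\<in>s2 i. \<forall>w\<in>s2 i. v \<noteq> w \<longrightarrow> \<gamma> {v, w} = f v + f w)"
begin

abbreviation "k2 \<equiv> chsum I2 s2"
abbreviation "k1 \<equiv> chsum I1 s1"
abbreviation "k0 \<equiv> chsum {()} (\<lambda>_. {v0})"
abbreviation "sph \<equiv> chsum (I2 \<times> (UNIV::bool set)) (\<lambda>(i, b). if b then T ` s2 i else s2 i)"

definition faces :: "'v set set" where
  "faces = {s. \<exists>i\<in>I2. s \<subseteq> s2 i \<or> s \<subseteq> T ` s2 i}"

lemma injT: "inj_on T A" by (metis TT inj_onI)

lemma TTim [simp]: "T ` T ` s = s" by (simp add: image_image)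

lemma fin_s2: "i \<in> I2 \<Longrightarrow> finite (s2 i)" using card3 card_ge_0_finite[of "s2 i"] by simp

lemma fin_face: "s \<in> faces \<Longrightarrow> finite s"
  unfolding faces_def using fin_s2 by (auto intro: finite_subset)

lemma face_sub: "s \<in> faces \<Longrightarrow> s' \<subseteq> s \<Longrightarrow> s' \<in> faces"
  unfolding faces_def by blast

lemma face_T: assumes "s \<in> faces" shows "T ` s \<in> faces"
proof -
  obtain i where i: "i \<in> I2" "s \<subseteq> s2 i \<or> s \<subseteq> T ` s2 i" using assms unfolding faces_def by blast
  then have "T ` s \<subseteq> s2 i \<or> T ` s \<subseteq> T ` s2 i" using image_mono[of s "T ` s2 i" T] image_mono[of s "s2 i" T] by auto
  then show ?thesis using i unfolding faces_def by blast
qed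

lemma face_s2: "i \<in> I2 \<Longrightarrow> s2 i \<in> faces" unfolding faces_def by blast

lemma face_s1: "j \<in> I1 \<Longrightarrow> s1 j \<in> faces" using s1_face unfolding faces_def by blast

lemma face_v0: "{v0} \<in> faces" using v0_face unfolding faces_def by blast

lemma face_empty: "{} \<in> faces" using v0_face unfolding faces_def by blast

lemma finite_faces: "finite faces"
proof -
  have "faces \<subseteq> (\<Union>i\<in>I2. Pow (s2 i) \<union> Pow (T ` s2 i))" unfolding faces_def by blast
  moreover have "finite (\<Union>i\<in>I2. Pow (s2 i) \<union> Pow (T ` s2 i))" using fin fin_s2 by auto
  ultimately show ?thesis using finite_subset by blast
qed

lemma face_card: assumes "s \<in> faces" shows "card s \<le> 3"
proof -
  obtain i where "i \<in> I2" "s \<subseteq> s2 i \<or> s \<subseteq> T ` s2 i" using assms unfolding faces_def by blast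
  then show ?thesis using card3[of i] fin_s2[of i] card_mono[of "s2 i" s] card_mono[of "T ` s2 i" s] card_image[OF injT, of "s2 i"] by auto
qed

lemma card_T: "card (T ` s) = card s" by (rule card_image[OF injT])

lemma sph_index:
  assumes "p \<in> I2 \<times> (UNIV::bool set)"
  shows "(case p of (i, b) \<Rightarrow> if b then T ` s2 i else s2 i) \<in> faces"
    "card (case p of (i, b) \<Rightarrow> if b then T ` s2 i else s2 i) = 3"
  using assms by (auto simp: face_s2 face_T card_T card3)

lemma sph_cong: "(\<And>s. s \<in> faces \<Longrightarrow> card s = 3 \<Longrightarrow> f s = g s) \<Longrightarrow> sph f = sph g"
  by (rule chsum_cong) (use sph_index in blast)

lemma k2_cong: "(\<And>s. s \<in> faces \<Longrightarrow> card s = 3 \<Longrightarrow> f s = g s) \<Longrightarrow> k2 f = k2 g"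
  by (rule chsum_cong) (simp add: face_s2 card3)

lemma k1_cong: "(\<And>s. s \<in> faces \<Longrightarrow> card s = 2 \<Longrightarrow> f s = g s) \<Longrightarrow> k1 f = k1 g"
  by (rule chsum_cong) (simp add: face_s1 card2)

lemma k0_eq [simp]: "k0 f = f {v0}" by (simp add: chsum_def)

lemma sph_split: "sph f = k2 (\<lambda>s. f s + f (T ` s))"
proof -
  have "sph f = (\<Sum>i\<in>I2. \<Sum>b\<in>(UNIV::bool set). f (if b then T ` s2 i else s2 i))"
    unfolding chsum_def by (subst sum.cartesian_product) (rule sum.cong, auto)
  then show ?thesis by (simp add: chsum_def UNIV_bool add.commute)
qed

lemma sph_T: "sph (\<lambda>s. f (T ` s)) = sph f"
  unfolding sph_split by (simp add: add.commute)

lemma cobd_T: "cobd f (T ` s) = cobd (\<lambda>s. f (T ` s)) s"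
proof -
  have "T ` s - {T v} = T ` (s - {v})" for v using injT[of UNIV] by (auto simp: inj_on_def)
  then show ?thesis unfolding cobd_def sum.reindex[OF injT] by (simp add: o_def)
qed

text \<open>The boundary of the hemisphere is the half circle and its antipode. This is invariant
  under \<open>T\<close>, so it cancels against the boundary of the other hemisphere.\<close>

lemma sph_cobd: "sph (cobd f) = 0"
  unfolding sph_split chsum_add cobd_T bd2 by (simp add: add.commute flip: chsum_add)

lemma k1_cobd: "k1 (cobd f) = k0 (\<lambda>s. f s + f (T ` s))" by (simp add: bd1)

definition join_T :: "'v \<times> nat \<Rightarrow> 'v \<times> nat" where "join_T u = (T (fst u), snd u)"

lemma join_T_join: "join_T ` join s t r = join (T ` s) (T ` t) (T ` r)"
  unfolding join_def join_T_def by force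

lemma join_T_join_T: "join_T (join_T u) = u" by (simp add: join_T_def)

text \<open>The antipodal cell structure of the join of three spheres.\<close>

definition join_chain :: "nat \<Rightarrow> (('v \<times> nat) set \<Rightarrow> bit) \<Rightarrow> bit" where
  "join_chain i f = (if i = 0 then k0 (\<lambda>s. f (join s {} {}))
    else if i = 1 then k1 (\<lambda>s. f (join s {} {}))
    else if i = 2 then k2 (\<lambda>s. f (join s {} {}))
    else if i = 3 then sph (\<lambda>s. k0 (\<lambda>t. f (join s t {})))
    else if i = 4 then sph (\<lambda>s. k1 (\<lambda>t. f (join s t {})))
    else if i = 5 then sph (\<lambda>s. k2 (\<lambda>t. f (join s t {})))
    else if i = 6 then sph (\<lambda>s. sph (\<lambda>t. k0 (\<lambda>r. f (join s t r))))
    else if i = 7 then sph (\<lambda>s. sph (\<lambda>t. k1 (\<lambda>r. f (join s t r))))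
    else sph (\<lambda>s. sph (\<lambda>t. k2 (\<lambda>r. f (join s t r)))))"

lemma cobd_join3:
  assumes "s \<in> faces" "t \<in> faces" "r \<in> faces"
  shows "cobd f (join s t r) = cobd (\<lambda>s. f (join s t r)) s + cobd (\<lambda>t. f (join s t r)) t + cobd (\<lambda>r. f (join s t r)) r"
  using cobd_join assms fin_face by blast

text \<open>In the Leibniz rule for joins the closed spheres contribute nothing, and the last factor
  yields the next smaller hemisphere and its antipode. If the last factor is the vertex
  \<open>v0\<close>, deleting it leaves a full sphere, which is split into two hemispheres. Sums
  over full spheres are invariant under \<open>T\<close>, so antipodes may be taken in all factors
  at once.\<close>

lemma join_chain_bd:
  assumes "i < 8"
  shows "join_chain (Suc i) (cobd f) = join_chain i (\<lambda>S. f S + f (join_T ` S))"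
proof -
  have c0: "join_chain 1 (cobd f) = join_chain 0 (\<lambda>S. f S + f (join_T ` S))"
  proof -
    have "join_chain 1 (cobd f) = k1 (cobd (\<lambda>s. f (join s {} {})))"
      unfolding join_chain_def by (simp, rule k1_cong) (simp add: cobd_join3 face_empty)
    then show ?thesis unfolding k1_cobd by (simp add: join_chain_def join_T_join)
  qed
  have c1: "join_chain 2 (cobd f) = join_chain 1 (\<lambda>S. f S + f (join_T ` S))"
  proof -
    have "join_chain 2 (cobd f) = k2 (cobd (\<lambda>s. f (join s {} {})))"
      unfolding join_chain_def by (simp, rule k2_cong) (simp add: cobd_join3 face_empty)
    then show ?thesis unfolding bd2 by (simp add: join_chain_def join_T_join)
  qed
  have c2: "join_chain 3 (cobd f) = join_chain 2 (\<lambda>S. f S + f (join_T ` S))"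
  proof -
    have "join_chain 3 (cobd f) = sph (\<lambda>s. cobd (\<lambda>s. f (join s {v0} {})) s + f (join s {} {}))"
      unfolding join_chain_def by (simp, rule sph_cong) (simp add: cobd_join3 face_empty face_v0)
    also have "\<dots> = sph (\<lambda>s. f (join s {} {}))" unfolding chsum_add sph_cobd by simp
    finally show ?thesis unfolding sph_split by (simp add: join_chain_def join_T_join)
  qed
  have c3: "join_chain 4 (cobd f) = join_chain 3 (\<lambda>S. f S + f (join_T ` S))"
  proof -
    have "join_chain 4 (cobd f) = sph (\<lambda>s. k1 (\<lambda>t. cobd (\<lambda>s. f (join s t {})) s + cobd (\<lambda>t. f (join s t {})) t))"
      unfolding join_chain_def by (simp, rule sph_cong, rule k1_cong) (simp add: cobd_join3 face_empty)
    also have "\<dots> = k1 (\<lambda>t. sph (cobd (\<lambda>s. f (join s t {})))) + sph (\<lambda>s. k1 (cobd (\<lambda>t. f (join s t {}))))"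
      unfolding chsum_add by (subst chsum_swap) simp
    also have "\<dots> = sph (\<lambda>s. f (join s {v0} {})) + sph (\<lambda>s. f (join s {T v0} {}))"
      unfolding sph_cobd bd1 chsum_add by simp
    also have "sph (\<lambda>s. f (join s {T v0} {})) = sph (\<lambda>s. f (join (T ` s) {T v0} {}))"
      by (rule sph_T[symmetric])
    finally show ?thesis by (simp add: join_chain_def join_T_join chsum_add)
  qed
  have c4: "join_chain 5 (cobd f) = join_chain 4 (\<lambda>S. f S + f (join_T ` S))"
  proof -
    have "join_chain 5 (cobd f) = sph (\<lambda>s. k2 (\<lambda>t. cobd (\<lambda>s. f (join s t {})) s + cobd (\<lambda>t. f (join s t {})) t))"
      unfolding join_chain_def by (simp, rule sph_cong, rule k2_cong) (simp add: cobd_join3 face_empty)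
    also have "\<dots> = k2 (\<lambda>t. sph (cobd (\<lambda>s. f (join s t {})))) + sph (\<lambda>s. k2 (cobd (\<lambda>t. f (join s t {}))))"
      unfolding chsum_add by (subst chsum_swap) simp
    also have "\<dots> = sph (\<lambda>s. k1 (\<lambda>t. f (join s t {}))) + sph (\<lambda>s. k1 (\<lambda>t. f (join s (T ` t) {})))"
      unfolding sph_cobd bd2 chsum_add by simp
    also have "sph (\<lambda>s. k1 (\<lambda>t. f (join s (T ` t) {}))) = sph (\<lambda>s. k1 (\<lambda>t. f (join (T ` s) (T ` t) {})))"
      by (rule sph_T[symmetric])
    finally show ?thesis by (simp add: join_chain_def join_T_join chsum_add)
  qed
  have c5: "join_chain 6 (cobd f) = join_chain 5 (\<lambda>S. f S + f (join_T ` S))"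
  proof -
    have "join_chain 6 (cobd f) = sph (\<lambda>s. sph (\<lambda>t. cobd (\<lambda>s. f (join s t {v0})) s + cobd (\<lambda>t. f (join s t {v0})) t + f (join s t {})))"
      unfolding join_chain_def by (simp, rule sph_cong, rule sph_cong) (simp add: cobd_join3 face_v0)
    also have "\<dots> = sph (\<lambda>t. sph (cobd (\<lambda>s. f (join s t {v0})))) + sph (\<lambda>s. sph (cobd (\<lambda>t. f (join s t {v0})))) + sph (\<lambda>s. sph (\<lambda>t. f (join s t {})))"
      unfolding chsum_add by (subst chsum_swap) simp
    also have "\<dots> = sph (\<lambda>s. k2 (\<lambda>t. f (join s t {}))) + sph (\<lambda>s. k2 (\<lambda>t. f (join s (T ` t) {})))"
      unfolding sph_cobd by (subst (3) sph_split) (simp add: chsum_add)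
    also have "sph (\<lambda>s. k2 (\<lambda>t. f (join s (T ` t) {}))) = sph (\<lambda>s. k2 (\<lambda>t. f (join (T ` s) (T ` t) {})))"
      by (rule sph_T[symmetric])
    finally show ?thesis by (simp add: join_chain_def join_T_join chsum_add)
  qed
  have TTr: "sph (\<lambda>s. sph (\<lambda>t. F (T ` s) (T ` t))) = sph (\<lambda>s. sph (\<lambda>t. F s t))" for F
    by (subst sph_T) (subst sph_T, rule refl)
  have c6: "join_chain 7 (cobd f) = join_chain 6 (\<lambda>S. f S + f (join_T ` S))"
  proof -
    have "join_chain 7 (cobd f) = sph (\<lambda>s. sph (\<lambda>t. k1 (\<lambda>r. cobd (\<lambda>s. f (join s t r)) s + cobd (\<lambda>t. f (join s t r)) t + cobd (\<lambda>r. f (join s t r)) r)))"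
      unfolding join_chain_def by (simp, rule sph_cong, rule sph_cong, rule k1_cong) (simp add: cobd_join3)
    also have "\<dots> = sph (\<lambda>t. k1 (\<lambda>r. sph (cobd (\<lambda>s. f (join s t r))))) + sph (\<lambda>s. k1 (\<lambda>r. sph (cobd (\<lambda>t. f (join s t r))))) + sph (\<lambda>s. sph (\<lambda>t. k1 (cobd (\<lambda>r. f (join s t r)))))"
      unfolding chsum_add by (subst chsum_swap, subst (2) chsum_swap, subst (4) chsum_swap) simp
    also have "\<dots> = sph (\<lambda>s. sph (\<lambda>t. f (join s t {v0}))) + sph (\<lambda>s. sph (\<lambda>t. f (join s t {T v0})))"
      unfolding sph_cobd bd1 chsum_add by simp
    also have "sph (\<lambda>s. sph (\<lambda>t. f (join s t {T v0}))) = sph (\<lambda>s. sph (\<lambda>t. f (join (T ` s) (T ` t) {T v0})))"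
      by (rule TTr[symmetric])
    finally show ?thesis by (simp add: join_chain_def join_T_join chsum_add)
  qed
  have c7: "join_chain 8 (cobd f) = join_chain 7 (\<lambda>S. f S + f (join_T ` S))"
  proof -
    have "join_chain 8 (cobd f) = sph (\<lambda>s. sph (\<lambda>t. k2 (\<lambda>r. cobd (\<lambda>s. f (join s t r)) s + cobd (\<lambda>t. f (join s t r)) t + cobd (\<lambda>r. f (join s t r)) r)))"
      unfolding join_chain_def by (simp, rule sph_cong, rule sph_cong, rule k2_cong) (simp add: cobd_join3)
    also have "\<dots> = sph (\<lambda>t. k2 (\<lambda>r. sph (cobd (\<lambda>s. f (join s t r))))) + sph (\<lambda>s. k2 (\<lambda>r. sph (cobd (\<lambda>t. f (join s t r))))) + sph (\<lambda>s. sph (\<lambda>t. k2 (cobd (\<lambda>r. f (join s t r)))))"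
      unfolding chsum_add by (subst chsum_swap, subst (2) chsum_swap, subst (4) chsum_swap) simp
    also have "\<dots> = sph (\<lambda>s. sph (\<lambda>t. k1 (\<lambda>r. f (join s t r)))) + sph (\<lambda>s. sph (\<lambda>t. k1 (\<lambda>r. f (join s t (T ` r)))))"
      unfolding sph_cobd bd2 chsum_add by simp
    also have "sph (\<lambda>s. sph (\<lambda>t. k1 (\<lambda>r. f (join s t (T ` r))))) = sph (\<lambda>s. sph (\<lambda>t. k1 (\<lambda>r. f (join (T ` s) (T ` t) (T ` r)))))"
      by (rule TTr[symmetric])
    finally show ?thesis by (simp add: join_chain_def join_T_join chsum_add)
  qed
  have "i = 0 \<or> i = 1 \<or> i = 2 \<or> i = 3 \<or> i = 4 \<or> i = 5 \<or> i = 6 \<or> i = 7" using assms by linarith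
  then show ?thesis using c0 c1 c2 c3 c4 c5 c6 c7 by (auto simp: eval_nat_numeral)
qed

lemma join_chain_cong3:
  assumes "\<And>s t r. s \<in> faces \<Longrightarrow> t \<in> faces \<Longrightarrow> r \<in> faces \<Longrightarrow> card s + card t + card r = Suc i \<Longrightarrow> f (join s t r) = g (join s t r)"
    and "i \<le> 8"
  shows "join_chain i f = join_chain i g"
proof -
  have "i = 0 \<or> i = 1 \<or> i = 2 \<or> i = 3 \<or> i = 4 \<or> i = 5 \<or> i = 6 \<or> i = 7 \<or> i = 8" using assms(2) by linarith
  then show ?thesis
    unfolding join_chain_def
    by (elim disjE) (simp; (intro sph_cong k2_cong k1_cong)?; use assms(1) face_empty face_v0 in force)+
qed

end

lemma sol2_swap: "sol2 A B s t lam mu \<longleftrightarrow> sol2 B A t s mu lam"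
  unfolding sol2_def by auto

section \<open>Linking parity of two odd fields\<close>

context antipodal_sphere
begin

definition odd_field :: "'v vecs \<Rightarrow> bool" where
  "odd_field A \<longleftrightarrow> (\<forall>v i. A (T v) i = - A v i)"

text \<open>A solution of \<open>sol2\<close> is a common point of the cones over two simplices, one of \<open>sol3\<close> a common ray of three
  cones. The bounds on cardinalities are the dimension counts for maps to real dimension 4; \<open>good4\<close> is needed
  for the segment that joins a vertex of a simplex to a point in the cone over it.\<close>

definition good2 :: "'v vecs \<Rightarrow> 'v vecs \<Rightarrow> bool" where
  "good2 A B \<longleftrightarrow> (\<forall>s\<in>faces. \<forall>t\<in>faces. \<forall>lam mu. sol2 A B s t lam mu \<longrightarrow>
     5 \<le> card s + card t \<and> sum lam s \<noteq> sum mu t)"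

definition good3 :: "'v vecs \<Rightarrow> 'v vecs \<Rightarrow> 'v vecs \<Rightarrow> bool" where
  "good3 A B C \<longleftrightarrow> (\<forall>s\<in>faces. \<forall>t\<in>faces. \<forall>r\<in>faces. \<forall>lam mu nu. sol3 A B C s t r lam mu nu \<longrightarrow>
     9 \<le> card s + card t + card r)"

definition good4 :: "'v vecs \<Rightarrow> 'v vecs \<Rightarrow> 'v vecs \<Rightarrow> bool" where
  "good4 A B C \<longleftrightarrow> (\<forall>s\<in>faces. \<forall>v\<in>s. \<forall>s'. s' \<subseteq> s \<longrightarrow> (\<forall>t\<in>faces. \<forall>r\<in>faces. \<forall>c lam mu nu.
     0 \<le> c \<longrightarrow> wt s' lam \<longrightarrow> wt t mu \<longrightarrow> wt r nu \<longrightarrow> (\<exists>v. lam v \<noteq> 0) \<longrightarrow>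
     (\<forall>i<4. c * A v i + cmb A s' lam i = cmb B t mu i) \<longrightarrow> (\<forall>i<4. cmb A s' lam i = cmb C r nu i) \<longrightarrow>
     8 \<le> card s' + card t + card r))"

text \<open>The common point is \<open>sum lam s\<close> times a point of the simplex of
  \<open>A\<close>, and \<open>sum mu t\<close> times one of the simplex of \<open>B\<close>. So the
  smaller weight belongs to the simplex that is farther from the origin on this ray.\<close>

definition below :: "'v vecs \<Rightarrow> 'v vecs \<Rightarrow> 'v set \<Rightarrow> 'v set \<Rightarrow> bit" where
  "below A B s t = of_bool (\<exists>lam mu. sol2 A B s t lam mu \<and> sum lam s < sum mu t)"

definition linking :: "'v vecs \<Rightarrow> 'v vecs \<Rightarrow> bit" where
  "linking A B = k1 (\<lambda>s. sph (\<lambda>t. below A B s t))"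

lemma sum_T: "sum (\<lambda>v. f (T v)) (T ` s) = sum f s"
  by (simp add: sum.reindex[OF injT])

lemma cmb_T: "odd_field A \<Longrightarrow> cmb A (T ` s) (\<lambda>v. lam (T v)) i = - cmb A s lam i"
  unfolding cmb_def by (simp add: sum.reindex[OF injT] odd_field_def sum_negf)

lemma wt_T: "wt s lam \<Longrightarrow> wt (T ` s) (\<lambda>v. lam (T v))"
  unfolding wt_def by (metis TT image_eqI)

lemma nz_T: "(\<exists>v. lam (T v) \<noteq> 0) \<longleftrightarrow> (\<exists>v. lam v \<noteq> (0::real))"
  by (metis TT)

lemma sol2_T: "odd_field A \<Longrightarrow> odd_field B \<Longrightarrow> sol2 A B s t lam mu \<Longrightarrow> sol2 A B (T ` s) (T ` t) (\<lambda>v. lam (T v)) (\<lambda>v. mu (T v))"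
  unfolding sol2_def by (simp add: cmb_T wt_T nz_T)

lemma below_T: assumes "odd_field A" "odd_field B" shows "below A B (T ` s) (T ` t) = below A B s t"
proof -
  have imp: "\<exists>lam mu. sol2 A B (T ` s) (T ` t) lam mu \<and> sum lam (T ` s) < sum mu (T ` t)"
    if "\<exists>lam mu. sol2 A B s t lam mu \<and> sum lam s < sum mu t" for s t
    using that sol2_T[OF assms] sum_T by metis
  have "(\<exists>lam mu. sol2 A B (T ` s) (T ` t) lam mu \<and> sum lam (T ` s) < sum mu (T ` t)) \<longleftrightarrow>
     (\<exists>lam mu. sol2 A B s t lam mu \<and> sum lam s < sum mu t)"
    using imp[of s t] imp[of "T ` s" "T ` t"] by auto
  then show ?thesis unfolding below_def by simp
qed

lemma good2D:
  assumes "good2 A B" "s \<in> faces" "t \<in> faces" "sol2 A B s t lam mu"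
  shows "5 \<le> card s + card t" "sum lam s \<noteq> sum mu t"
  using assms unfolding good2_def by blast+

lemma good2_swap: "good2 A B \<Longrightarrow> good2 B A"
  unfolding good2_def by (metis add.commute sol2_swap)

text \<open>If one side vanished, the other would be a relation on a single face. Faces have at most
  three vertices, but \<open>good2\<close> asks for five.\<close>

lemma good2_nz:
  assumes g: "good2 A B" and st: "s \<in> faces" "t \<in> faces" and sol: "sol2 A B s t lam mu"
  shows "\<exists>v. lam v \<noteq> 0" "\<exists>v. mu v \<noteq> 0"
proof -
  have w: "wt s lam" "wt t mu" using sol by (auto simp: sol2_def)
  have e: "\<And>i. i < 4 \<Longrightarrow> cmb A s lam i = cmb B t mu i" using sol by (simp add: sol2_def)
  show "\<exists>v. lam v \<noteq> 0"
  proof (rule ccontr)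
    assume "\<not> ?thesis"
    then have "sol2 A B {} t lam mu" using sol by (auto simp: sol2_def wt_def cmb_def)
    then show False using good2D(1)[OF g face_empty st(2)] face_card[OF st(2)] by fastforce
  qed
  show "\<exists>v. mu v \<noteq> 0"
  proof (rule ccontr)
    assume "\<not> ?thesis"
    then have "sol2 A B s {} lam mu" using sol by (auto simp: sol2_def wt_def cmb_def)
    then show False using good2D(1)[OF g st(1) face_empty] face_card[OF st(1)] by fastforce
  qed
qed

lemma below_cobd:
  assumes g: "good2 A B" and st: "s \<in> faces" "t \<in> faces" "card s = 3" "card t = 3"
  shows "cobd (\<lambda>s. below A B s t) s + cobd (\<lambda>t. below A B s t) t = 0"
proof -
  have "cobd (\<lambda>s. of_bool (\<exists>lam mu. sol2 A B s t lam mu \<and> (\<Sum>v\<in>s. lam v * 1) < (\<Sum>v\<in>t. mu v * 1))) s +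
    cobd (\<lambda>t. of_bool (\<exists>lam mu. sol2 A B s t lam mu \<and> (\<Sum>v\<in>s. lam v * 1) < (\<Sum>v\<in>t. mu v * 1))) t = 0"
  proof (rule segment_parity_pair)
    show "finite s" "finite t" using fin_face st by auto
    show "card s + card t = 6" using st by simp
    show "5 \<le> card s' + card t'" if "s' \<subseteq> s" "t' \<subseteq> t" "sol2 A B s' t' lam mu" for s' t' lam mu
      using good2D(1)[OF g face_sub[OF st(1) that(1)] face_sub[OF st(2) that(2)] that(3)] .
    show "(\<Sum>v\<in>s. lam v * 1) \<noteq> (\<Sum>v\<in>t. mu v * 1)" if "sol2 A B s t lam mu" for lam mu
      using good2D(2)[OF g st(1,2) that] by simp
  qed
  then show ?thesis unfolding below_def by simp
qed

text \<open>Sum \<open>below_cobd\<close> over the hemisphere in both factors. Each coboundary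
  becomes a sum over the half circle and its antipode, and with the invariance under simultaneous
  antipodes the other hemisphere is completed to a sphere. So the half circle may be taken in either
  factor.\<close>

lemma linking_alt:
  assumes o: "odd_field A" "odd_field B" and g: "good2 A B"
  shows "linking A B = sph (\<lambda>s. k1 (\<lambda>t. below A B s t))"
proof -
  have "0 = k2 (\<lambda>s. k2 (\<lambda>t. cobd (\<lambda>s. below A B s t) s + cobd (\<lambda>t. below A B s t) t))"
    by (subst k2_cong[where g="\<lambda>_. 0"], subst k2_cong[where g="\<lambda>_. 0"]) (simp_all add: below_cobd[OF g])
  also have "\<dots> = k2 (\<lambda>t. k2 (cobd (\<lambda>s. below A B s t))) + k2 (\<lambda>s. k2 (cobd (\<lambda>t. below A B s t)))"
    unfolding chsum_add by (subst chsum_swap) simp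
  also have "k2 (\<lambda>t. k2 (cobd (\<lambda>s. below A B s t))) = k1 (\<lambda>s. k2 (\<lambda>t. below A B s t)) + k1 (\<lambda>s. k2 (\<lambda>t. below A B (T ` s) t))"
    unfolding bd2 chsum_add by (subst chsum_swap, subst (2) chsum_swap) simp
  also have "k1 (\<lambda>s. k2 (\<lambda>t. below A B (T ` s) t)) = k1 (\<lambda>s. k2 (\<lambda>t. below A B s (T ` t)))"
    using below_T[OF o, of _ "T ` _"] by simp
  also have "k1 (\<lambda>s. k2 (\<lambda>t. below A B s t)) + k1 (\<lambda>s. k2 (\<lambda>t. below A B s (T ` t))) = linking A B"
    unfolding linking_def sph_split chsum_add ..
  also have "k2 (\<lambda>s. k2 (cobd (\<lambda>t. below A B s t))) = k2 (\<lambda>s. k1 (\<lambda>t. below A B s t)) + k2 (\<lambda>s. k1 (\<lambda>t. below A B s (T ` t)))"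
    unfolding bd2 chsum_add by simp
  also have "k2 (\<lambda>s. k1 (\<lambda>t. below A B s (T ` t))) = k2 (\<lambda>s. k1 (\<lambda>t. below A B (T ` s) t))"
    using below_T[OF o, of "T ` _"] by simp
  also have "k2 (\<lambda>s. k1 (\<lambda>t. below A B s t)) + k2 (\<lambda>s. k1 (\<lambda>t. below A B (T ` s) t)) = sph (\<lambda>s. k1 (\<lambda>t. below A B s t))"
    unfolding sph_split chsum_add by simp
  finally show ?thesis by (simp add: bit_add_eq_0 eq_commute[of 0])
qed

lemma sols_unique_pos:
  assumes fin: "finite S" and gp: "gpos k P S" and card: "card S = Suc k" and x: "x \<in> sols k P S" and y: "y \<in> sols k P S"
  obtains c where "c > 0" "y = (\<lambda>v. c * x v)"
proof -
  obtain c where c: "\<And>v. y v = c * x v"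
    using sols_unique[OF fin gp _ x, of y] y card by (auto simp: sols_def)
  obtain w where w: "w \<in> S" "y w \<noteq> 0" using y by (auto simp: sols_def)
  have "y w > 0" "x w \<ge> 0" using x y w by (auto simp: sols_def less_le)
  then have "c > 0" using c[of w] by (metis zero_less_mult_pos2 less_eq_real_def mult_zero_right)
  then show thesis using that c by blast
qed

lemma antipodal_ladder_join_T: "odd_field A \<Longrightarrow> odd_field B \<Longrightarrow> pair_config A B (join_T u) i = - pair_config A B u i"
  by (simp add: pair_config_def join_T_def odd_field_def)

lemma gpos_pair_config:
  assumes g: "good2 A B" and st: "s \<in> faces" "t \<in> faces"
  shows "gpos 4 (pair_config A B) (join s t {})"
  unfolding gpos_def
proof (intro allI impI equals0I)
  fix S' x assume S': "S' \<subseteq> join s t {}" "card S' \<le> 4" "x \<in> sols 4 (pair_config A B) S'"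
  obtain s' t' where s': "s' \<subseteq> s" "t' \<subseteq> t" "S' = join s' t' {}" using join_subset[OF S'(1)] by (metis subset_empty)
  have f: "s' \<in> faces" "t' \<in> faces" using face_sub st s' by auto
  have "5 \<le> card s' + card t'" using good2D(1)[OF g f] S'(3) unfolding s'(3) sols_pair_config[OF fin_face[OF f(1)] fin_face[OF f(2)]] by blast
  then show False using S'(2) fin_face f by (simp add: s'(3) card_join)
qed

text \<open>The ladder on the join of two spheres, in dimension four, shows that the number of rays
  common to the sphere of \<open>A\<close> and the half circle of \<open>B\<close> is odd. On each
  of them exactly one of the two points is farther out, so each contributes to exactly one of the
  two parities; \<open>linking_alt\<close> brings both to the same cells.\<close>

lemma linking_sum:
  assumes o: "odd_field A" "odd_field B" and g: "good2 A B"
  shows "linking A B + linking B A = 1"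
proof -
  define \<S> where "\<S> = {join s t {} |s t. s \<in> faces \<and> t \<in> faces}"
  have "join_chain 4 (\<lambda>S. of_bool (sols 4 (pair_config A B) S \<noteq> {})) = 1"
  proof (rule antipodal_ladder[where T = join_T and \<S> = \<S> and pt = "(v0, 0)"])
    have "\<S> = (\<lambda>(s,t). join s t {}) ` (faces \<times> faces)" unfolding \<S>_def by auto
    then show "finite \<S>" using finite_faces by simp
    show "finite S" if "S \<in> \<S>" for S using that fin_face by (auto simp: \<S>_def intro: finite_join)
    show "join_T ` S \<in> \<S>" if "S \<in> \<S>" for S using that face_T unfolding \<S>_def by (force simp: join_T_join)
    show "gpos 4 (pair_config A B) S" if "S \<in> \<S>" for S using that gpos_pair_config[OF g] by (auto simp: \<S>_def)
    show "join_chain i f = join_chain i h" if i: "i \<le> 4" and e: "\<And>S. S \<in> \<S> \<Longrightarrow> card S = Suc i \<Longrightarrow> f S = h S" for i f h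
    proof -
      have e': "f (join s t {}) = h (join s t {})" if "s \<in> faces" "t \<in> faces" "card s + card t = Suc i" for s t
        using e[of "join s t {}"] that fin_face by (auto simp: \<S>_def card_join)
      have "i = 0 \<or> i = 1 \<or> i = 2 \<or> i = 3 \<or> i = 4" using i by linarith
      then show ?thesis
        unfolding join_chain_def
        by (elim disjE) (simp; (intro sph_cong k2_cong k1_cong)?; use e' face_empty face_v0 in force)+
    qed
    show "join_chain (Suc i) (\<lambda>S. \<Sum>v\<in>S. f (S - {v})) = join_chain i (\<lambda>S. f S + f (join_T ` S))" if "i < 4" for i f
      using join_chain_bd[of i f] that unfolding cobd_def[abs_def] by simp
    show "join_chain 0 f = f {(v0, 0)}" for f by (simp add: join_chain_def join_def)
  qed (auto simp: join_T_join_T antipodal_ladder_join_T[OF o])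
  then have 1: "sph (\<lambda>s. k1 (\<lambda>t. of_bool (sols 4 (pair_config A B) (join s t {}) \<noteq> {}))) = 1" by (simp add: join_chain_def)
  have pt: "of_bool (sols 4 (pair_config A B) (join s t {}) \<noteq> {}) = below A B s t + below B A t s"
    if st: "s \<in> faces" "t \<in> faces" "card s = 3" "card t = 2" for s t
  proof (cases "sols 4 (pair_config A B) (join s t {}) = {}")
    case True
    have "\<not> sol2 A B s t lam mu" for lam mu
      using True sols_pair_config[OF fin_face[OF st(1)] fin_face[OF st(2)], of "join_weights lam mu (\<lambda>_. 0)" A B] by (auto simp: join_weights_def)
    then show ?thesis using True by (auto simp: below_def sol2_swap[of B A])
  next
    case False
    then obtain x where x: "x \<in> sols 4 (pair_config A B) (join s t {})" by blast
    note sP = sols_pair_config[OF fin_face[OF st(1)] fin_face[OF st(2)]]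
    let ?l = "\<lambda>v. x (v, 0)" and ?m = "\<lambda>v. x (v, 1)"
    have lm: "sol2 A B s t ?l ?m" using x sP by blast
    have ne: "sum ?l s \<noteq> sum ?m t" using good2D(2)[OF g st(1,2) lm] .
    \<comment> \<open>Five vectors in dimension four: the common ray is unique, so the comparison of
      the weights does not depend on the solution.\<close>
    have uq: "\<exists>c>0. sum lam s = c * sum ?l s \<and> sum mu t = c * sum ?m t" if "sol2 A B s t lam mu" for lam mu
    proof -
      have y: "join_weights lam mu (\<lambda>_. 0) \<in> sols 4 (pair_config A B) (join s t {})" using that unfolding sP by (auto simp: join_weights_def)
      obtain c where c: "c > 0" "join_weights lam mu (\<lambda>_. 0) = (\<lambda>v. c * x v)"
        by (rule sols_unique_pos[OF _ gpos_pair_config[OF g st(1,2)] _ x y]) (use st fin_face in \<open>auto intro: finite_join simp: card_join\<close>)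
      have "lam v = c * x (v,0)" "mu v = c * x (v,1)" for v
        using fun_cong[OF c(2), of "(v,0)"] fun_cong[OF c(2), of "(v,1)"] by (simp_all add: join_weights_def)
      then show ?thesis using c(1) by (auto simp: sum_distrib_left)
    qed
    have z1: "below A B s t = of_bool (sum ?l s < sum ?m t)"
    proof -
      have "(\<exists>lam mu. sol2 A B s t lam mu \<and> sum lam s < sum mu t) \<longleftrightarrow> sum ?l s < sum ?m t"
        using uq lm by (metis mult_less_cancel_left_pos)
      then show ?thesis unfolding below_def by simp
    qed
    have z2: "below B A t s = of_bool (sum ?m t < sum ?l s)"
    proof -
      have "(\<exists>mu lam. sol2 B A t s mu lam \<and> sum mu t < sum lam s) \<longleftrightarrow> sum ?m t < sum ?l s"
        using uq lm unfolding sol2_swap[of B A] by (metis mult_less_cancel_left_pos)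
      then show ?thesis unfolding below_def by simp
    qed
    show ?thesis using False ne by (auto simp: z1 z2)
  qed
  have "linking A B + linking B A = sph (\<lambda>s. k1 (\<lambda>t. below A B s t)) + sph (\<lambda>s. k1 (\<lambda>t. below B A t s))"
    unfolding linking_alt[OF o g] unfolding linking_def[of B A] by (subst (2) chsum_swap) simp
  also have "\<dots> = sph (\<lambda>s. k1 (\<lambda>t. of_bool (sols 4 (pair_config A B) (join s t {}) \<noteq> {})))"
    unfolding chsum_add[symmetric] by (intro sph_cong k1_cong) (use pt in auto)
  finally show ?thesis using 1 by simp
qed

section \<open>Common rays of three odd fields\<close>

definition below2 :: "'v vecs \<Rightarrow> 'v vecs \<Rightarrow> 'v vecs \<Rightarrow> 'v set \<Rightarrow> 'v set \<Rightarrow> 'v set \<Rightarrow> bit" where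
  "below2 A B C s t r = of_bool (\<exists>lam mu nu. sol3 A B C s t r lam mu nu \<and> sum lam s < sum mu t \<and> sum lam s < sum nu r)"

lemma sol3_perm:
  "sol3 A B C s t r lam mu nu \<longleftrightarrow> sol3 A C B s r t lam nu mu"
  "sol3 A B C s t r lam mu nu \<longleftrightarrow> sol3 B A C t s r mu lam nu"
  "sol3 A B C s t r lam mu nu \<longleftrightarrow> sol3 C A B r s t nu lam mu"
  unfolding sol3_def by (auto; metis)+

lemma sol3_T:
  assumes "odd_field A" "odd_field B" "odd_field C" "sol3 A B C s t r lam mu nu"
  shows "sol3 A B C (T ` s) (T ` t) (T ` r) (\<lambda>v. lam (T v)) (\<lambda>v. mu (T v)) (\<lambda>v. nu (T v))"
proof -
  have "\<exists>v. lam (T v) \<noteq> 0 \<or> mu (T v) \<noteq> 0 \<or> nu (T v) \<noteq> 0"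
    using assms(4) unfolding sol3_def by (metis TT)
  moreover have "cmb A (T ` s) (\<lambda>v. lam (T v)) i = cmb B (T ` t) (\<lambda>v. mu (T v)) i"
    "cmb A (T ` s) (\<lambda>v. lam (T v)) i = cmb C (T ` r) (\<lambda>v. nu (T v)) i" if "i < 4" for i
    using assms(4) that unfolding cmb_T[OF assms(1)] cmb_T[OF assms(2)] cmb_T[OF assms(3)] by (auto simp: sol3_def)
  ultimately show ?thesis using assms(4) unfolding sol3_def by (simp add: wt_T)
qed

lemma below2_T: assumes "odd_field A" "odd_field B" "odd_field C" shows "below2 A B C (T ` s) (T ` t) (T ` r) = below2 A B C s t r"
proof -
  let ?Q = "\<lambda>s t r. \<exists>lam mu nu. sol3 A B C s t r lam mu nu \<and> sum lam s < sum mu t \<and> sum lam s < sum nu r"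
  have imp: "?Q (T ` s) (T ` t) (T ` r)" if ex: "?Q s t r" for s t r
  proof -
    obtain lam mu nu where h: "sol3 A B C s t r lam mu nu" "sum lam s < sum mu t" "sum lam s < sum nu r" using ex by blast
    show ?thesis using sol3_T[OF assms h(1)] h(2,3)
      by (intro exI[of _ "\<lambda>v. lam (T v)"] exI[of _ "\<lambda>v. mu (T v)"] exI[of _ "\<lambda>v. nu (T v)"]) (simp add: sum_T)
  qed
  have "?Q (T ` s) (T ` t) (T ` r) \<longleftrightarrow> ?Q s t r"
  proof
    assume "?Q (T ` s) (T ` t) (T ` r)"
    from imp[OF this] show "?Q s t r" by (simp only: TTim)
  qed (rule imp)
  then show ?thesis unfolding below2_def by simp
qed

lemma gpos_triple_config:
  assumes g: "good3 A B C" and st: "s \<in> faces" "t \<in> faces" "r \<in> faces"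
  shows "gpos 8 (triple_config A B C) (join s t r)"
  unfolding gpos_def
proof (intro allI impI equals0I)
  fix S' x assume S': "S' \<subseteq> join s t r" "card S' \<le> 8" "x \<in> sols 8 (triple_config A B C) S'"
  obtain s' t' r' where s': "s' \<subseteq> s" "t' \<subseteq> t" "r' \<subseteq> r" "S' = join s' t' r'" using join_subset[OF S'(1)] .
  have f: "s' \<in> faces" "t' \<in> faces" "r' \<in> faces" using face_sub st s' by auto
  note fi = fin_face[OF f(1)] fin_face[OF f(2)] fin_face[OF f(3)]
  have "9 \<le> card s' + card t' + card r'" using g f S'(3) unfolding s'(4) sols_triple_config[OF fi] good3_def by blast
  then show False using S'(2) fi by (simp add: s'(4) card_join)
qed

lemma sol3_pairs:
  assumes sol: "sol3 A B C s t r lam mu nu" and st: "s \<in> faces" "t \<in> faces" "r \<in> faces"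
    and g: "good2 A B" "good2 A C" "good2 B C"
  shows "sol2 A B s t lam mu" "sol2 A C s r lam nu" "sol2 B C t r mu nu"
proof -
  have d: "sol2 A B s t lam mu \<or> sol2 A C s r lam nu" "sol2 A B s t lam mu \<or> sol2 B C t r mu nu"
    using sol unfolding sol3_def sol2_def by metis+
  then have "\<exists>v. lam v \<noteq> 0" using good2_nz[OF g(1) st(1,2)] good2_nz[OF g(2) st(1,3)] by blast
  then show 1: "sol2 A B s t lam mu" "sol2 A C s r lam nu" using sol unfolding sol3_def sol2_def by auto
  then show "sol2 B C t r mu nu" using good2_nz[OF g(1) st(1,2) 1(1)] sol unfolding sol3_def sol2_def by auto
qed

text \<open>The ladder on the join of three spheres, in dimension eight: the number of rays common
  to a sphere, a sphere and a hemisphere is odd, and on each of them exactly one of the three points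
  is the farthest.\<close>

lemma below2_total:
  assumes o: "odd_field A" "odd_field B" "odd_field C" and g: "good2 A B" "good2 A C" "good2 B C" "good3 A B C"
  shows "sph (\<lambda>s. sph (\<lambda>t. k2 (\<lambda>r. below2 A B C s t r))) + sph (\<lambda>s. sph (\<lambda>t. k2 (\<lambda>r. below2 B A C t s r)))
    + sph (\<lambda>s. sph (\<lambda>t. k2 (\<lambda>r. below2 C A B r s t))) = 1"
proof -
  define \<S> where "\<S> = {join s t r |s t r. s \<in> faces \<and> t \<in> faces \<and> r \<in> faces}"
  have "join_chain 8 (\<lambda>S. of_bool (sols 8 (triple_config A B C) S \<noteq> {})) = 1"
  proof (rule antipodal_ladder[where T = join_T and \<S> = \<S> and pt = "(v0, 0)"])
    have "\<S> = (\<lambda>(s,t,r). join s t r) ` (faces \<times> faces \<times> faces)" unfolding \<S>_def by auto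
    then show "finite \<S>" using finite_faces by simp
    show "finite S" if "S \<in> \<S>" for S using that fin_face by (auto simp: \<S>_def intro: finite_join)
    show "join_T ` S \<in> \<S>" if "S \<in> \<S>" for S using that face_T unfolding \<S>_def by (force simp: join_T_join)
    show "gpos 8 (triple_config A B C) S" if "S \<in> \<S>" for S using that gpos_triple_config[OF g(4)] by (auto simp: \<S>_def)
    show "join_chain i f = join_chain i h" if i: "i \<le> 8" and e: "\<And>S. S \<in> \<S> \<Longrightarrow> card S = Suc i \<Longrightarrow> f S = h S" for i f h
    proof (rule join_chain_cong3[OF _ i])
      fix s t r assume "s \<in> faces" "t \<in> faces" "r \<in> faces" "card s + card t + card r = Suc i"
      then show "f (join s t r) = h (join s t r)"
        using e[of "join s t r"] fin_face by (auto simp: \<S>_def card_join)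
    qed
    show "join_chain (Suc i) (\<lambda>S. \<Sum>v\<in>S. f (S - {v})) = join_chain i (\<lambda>S. f S + f (join_T ` S))" if "i < 8" for i f
      using join_chain_bd[of i f] that unfolding cobd_def[abs_def] by simp
    show "join_chain 0 f = f {(v0, 0)}" for f by (simp add: join_chain_def join_def)
    show "triple_config A B C (join_T v) i = - triple_config A B C v i" for v i
      using o by (simp add: triple_config_def join_T_def odd_field_def)
  qed (auto simp: join_T_join_T)
  then have 1: "sph (\<lambda>s. sph (\<lambda>t. k2 (\<lambda>r. of_bool (sols 8 (triple_config A B C) (join s t r) \<noteq> {})))) = 1" by (simp add: join_chain_def)
  have pt: "of_bool (sols 8 (triple_config A B C) (join s t r) \<noteq> {}) = below2 A B C s t r + below2 B A C t s r + below2 C A B r s t"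
    if st: "s \<in> faces" "t \<in> faces" "r \<in> faces" "card s = 3" "card t = 3" "card r = 3" for s t r
  proof -
    note sP = sols_triple_config[OF fin_face[OF st(1)] fin_face[OF st(2)] fin_face[OF st(3)]]
    show ?thesis
    proof (cases "sols 8 (triple_config A B C) (join s t r) = {}")
      case True
      have "\<not> sol3 A B C s t r lam mu nu" for lam mu nu
        using True sP[of "join_weights lam mu nu" A B C] by (auto simp: join_weights_def)
      moreover have "\<not> sol3 B A C t s r mu lam nu" "\<not> sol3 C A B r s t nu lam mu" for lam mu nu
        using calculation sol3_perm(2)[of A B C s t r] sol3_perm(3)[of A B C s t r] by blast+
      ultimately show ?thesis using True by (simp add: below2_def)
    next
      case False
      then obtain x where x: "x \<in> sols 8 (triple_config A B C) (join s t r)" by blast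
      let ?l = "\<lambda>v. x (v, 0)" and ?m = "\<lambda>v. x (v, 1)" and ?n = "\<lambda>v. x (v, 2)"
      have lm: "sol3 A B C s t r ?l ?m ?n" using x sP by blast
      note sp = sol3_pairs[OF lm st(1-3) g(1-3)]
      have ne: "sum ?l s \<noteq> sum ?m t" "sum ?l s \<noteq> sum ?n r" "sum ?m t \<noteq> sum ?n r"
        using good2D(2)[OF g(1) st(1,2) sp(1)] good2D(2)[OF g(2) st(1,3) sp(2)] good2D(2)[OF g(3) st(2,3) sp(3)] by auto
      have uq: "\<exists>c>0. sum lam s = c * sum ?l s \<and> sum mu t = c * sum ?m t \<and> sum nu r = c * sum ?n r" if "sol3 A B C s t r lam mu nu" for lam mu nu
      proof -
        have y: "join_weights lam mu nu \<in> sols 8 (triple_config A B C) (join s t r)" using that unfolding sP by (auto simp: join_weights_def)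
        obtain c where c: "c > 0" "join_weights lam mu nu = (\<lambda>v. c * x v)"
          by (rule sols_unique_pos[OF _ gpos_triple_config[OF g(4) st(1-3)] _ x y]) (use st fin_face in \<open>auto intro: finite_join simp: card_join\<close>)
        have "lam v = c * x (v,0)" "mu v = c * x (v,1)" "nu v = c * x (v,2)" for v
          using fun_cong[OF c(2), of "(v,0)"] fun_cong[OF c(2), of "(v,1)"] fun_cong[OF c(2), of "(v,2)"] by (simp_all add: join_weights_def)
        then show ?thesis using c(1) by (auto simp: sum_distrib_left)
      qed
      have z1: "below2 A B C s t r = of_bool (sum ?l s < sum ?m t \<and> sum ?l s < sum ?n r)"
      proof -
        have "(\<exists>lam mu nu. sol3 A B C s t r lam mu nu \<and> sum lam s < sum mu t \<and> sum lam s < sum nu r) \<longleftrightarrow> sum ?l s < sum ?m t \<and> sum ?l s < sum ?n r"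
          using uq lm by (metis mult_less_cancel_left_pos)
        then show ?thesis unfolding below2_def by simp
      qed
      have z2: "below2 B A C t s r = of_bool (sum ?m t < sum ?l s \<and> sum ?m t < sum ?n r)"
      proof -
        have "(\<exists>mu lam nu. sol3 B A C t s r mu lam nu \<and> sum mu t < sum lam s \<and> sum mu t < sum nu r) \<longleftrightarrow> sum ?m t < sum ?l s \<and> sum ?m t < sum ?n r"
          using uq lm unfolding sol3_perm(2)[of B A] by (metis mult_less_cancel_left_pos)
        then show ?thesis unfolding below2_def by simp
      qed
      have z3: "below2 C A B r s t = of_bool (sum ?n r < sum ?l s \<and> sum ?n r < sum ?m t)"
      proof -
        have "(\<exists>nu lam mu. sol3 C A B r s t nu lam mu \<and> sum nu r < sum lam s \<and> sum nu r < sum mu t) \<longleftrightarrow> sum ?n r < sum ?l s \<and> sum ?n r < sum ?m t"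
          using uq lm unfolding sol3_perm(3)[of A B C, symmetric] by (metis mult_less_cancel_left_pos)
        then show ?thesis unfolding below2_def by simp
      qed
      show ?thesis using False ne unfolding z1 z2 z3 by (cases "sum ?l s < sum ?m t"; cases "sum ?l s < sum ?n r"; cases "sum ?m t < sum ?n r") auto
    qed
  qed
  show ?thesis
    unfolding chsum_add[symmetric] using 1 by (subst sph_cong, subst sph_cong, subst k2_cong) (use pt in auto)
qed

text \<open>Triples are counted up to simultaneous antipodes; the hemisphere that serves as a
  fundamental domain may be taken in any factor.\<close>

lemma sph_rotate:
  assumes "\<And>a b c. F (T ` a) (T ` b) (T ` c) = F a b c"
  shows "sph (\<lambda>a. sph (\<lambda>b. k2 (\<lambda>c. F a b c))) = k2 (\<lambda>a. sph (\<lambda>b. sph (\<lambda>c. F a b c)))"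
proof -
  have "sph (\<lambda>a. sph (\<lambda>b. k2 (\<lambda>c. F a b c))) = k2 (\<lambda>a. sph (\<lambda>b. k2 (\<lambda>c. F a b c))) + k2 (\<lambda>a. sph (\<lambda>b. k2 (\<lambda>c. F (T ` a) b c)))"
    by (subst sph_split) (simp add: chsum_add)
  also have "k2 (\<lambda>a. sph (\<lambda>b. k2 (\<lambda>c. F (T ` a) b c))) = k2 (\<lambda>a. sph (\<lambda>b. k2 (\<lambda>c. F (T ` a) (T ` b) c)))"
  proof -
    have "sph (\<lambda>b. k2 (\<lambda>c. F (T ` a) b c)) = sph (\<lambda>b. k2 (\<lambda>c. F (T ` a) (T ` b) c))" for a by (rule sph_T[symmetric])
    then show ?thesis by simp
  qed
  also have "\<dots> = k2 (\<lambda>a. sph (\<lambda>b. k2 (\<lambda>c. F a b (T ` c))))"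
    using assms[of _ _ "T ` _"] by simp
  finally show ?thesis by (simp add: sph_split[of "\<lambda>c. F _ _ c"] chsum_add)
qed

end

lemma cmb_mono: "wt s' lam \<Longrightarrow> s' \<subseteq> s \<Longrightarrow> finite s \<Longrightarrow> cmb A s' lam i = cmb A s lam i"
  unfolding cmb_def by (rule sum.mono_neutral_left) (auto simp: wt_def)

lemma wsum_mono: "wt s' lam \<Longrightarrow> s' \<subseteq> s \<Longrightarrow> finite s \<Longrightarrow> sum lam s' = sum lam s"
  by (rule sum.mono_neutral_left) (auto simp: wt_def)

lemma cmb_lin: "cmb A s (\<lambda>v. c * x v + d * y v) i = c * cmb A s x i + d * cmb A s y i"
  unfolding cmb_def by (rule lin_sum)

lemma sum_lin: "(\<Sum>v\<in>s. c * x v + d * y v) = c * sum x s + d * sum y s" for c d :: real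
  by (simp add: sum.distrib sum_distrib_left)

lemma cmb_single: "finite s \<Longrightarrow> v \<in> s \<Longrightarrow> cmb A s (\<lambda>u. if u = v then c else 0) i = c * A v i"
proof -
  assume "finite s" "v \<in> s"
  have "cmb A s (\<lambda>u. if u = v then c else 0) i = (\<Sum>u\<in>s. if u = v then c * A v i else 0)"
    unfolding cmb_def by (rule sum.cong) auto
  then show ?thesis using \<open>finite s\<close> \<open>v \<in> s\<close> by simp
qed

text \<open>The edge is given by two vectors with arbitrary weights and not by vertices, since
  segments that end inside a cone have to be counted too.\<close>

definition segment_below where
  "segment_below B p wp q wq t = (of_bool (\<exists>c d mu. 0 \<le> c \<and> 0 \<le> d \<and> wt t mu \<and> (c \<noteq> 0 \<or> d \<noteq> 0 \<or> (\<exists>v. mu v \<noteq> 0)) \<and>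
     (\<forall>i<4. c * p i + d * q i = cmb B t mu i) \<and> c * wp + d * wq < sum mu t) :: bit)"

section \<open>The cocycle of cone crossings\<close>

lemma pair_set:
  assumes "a \<noteq> b"
  shows "of_bool (\<exists>lam mu. sol2 A B {a,b} t lam mu \<and> (\<Sum>v\<in>{a,b}. lam v * wa v) < (\<Sum>v\<in>t. mu v * 1)) = segment_below B (A a) (wa a) (A b) (wa b) t"
proof -
  have "(\<exists>lam mu. sol2 A B {a,b} t lam mu \<and> (\<Sum>v\<in>{a,b}. lam v * wa v) < (\<Sum>v\<in>t. mu v * 1)) \<longleftrightarrow>
    (\<exists>c d mu. 0 \<le> c \<and> 0 \<le> d \<and> wt t mu \<and> (c \<noteq> 0 \<or> d \<noteq> 0 \<or> (\<exists>v. mu v \<noteq> 0)) \<and>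
     (\<forall>i<4. c * A a i + d * A b i = cmb B t mu i) \<and> c * wa a + d * wa b < sum mu t)" (is "?L \<longleftrightarrow> ?R")
  proof
    assume ?L
    then obtain lam mu where h: "sol2 A B {a,b} t lam mu" "(\<Sum>v\<in>{a,b}. lam v * wa v) < (\<Sum>v\<in>t. mu v * 1)" by blast
    have "lam a \<noteq> 0 \<or> lam b \<noteq> 0 \<or> (\<exists>v. mu v \<noteq> 0)" using h(1) unfolding sol2_def wt_def by (metis insert_iff empty_iff)
    moreover have "0 \<le> lam a" "0 \<le> lam b" "wt t mu" using h(1) by (auto simp: sol2_def wt_def)
    moreover have "\<forall>i<4. lam a * A a i + lam b * A b i = cmb B t mu i"
      using h(1) assms by (simp add: sol2_def cmb_def)
    moreover have "lam a * wa a + lam b * wa b < sum mu t" using h(2) assms by simp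
    ultimately show ?R by blast
  next
    assume ?R
    then obtain c d mu where h: "0 \<le> c" "0 \<le> d" "wt t mu" "c \<noteq> 0 \<or> d \<noteq> 0 \<or> (\<exists>v. mu v \<noteq> 0)"
      "\<forall>i<4. c * A a i + d * A b i = cmb B t mu i" "c * wa a + d * wa b < sum mu t" by blast
    show ?L
    proof (intro exI conjI)
      show "sol2 A B {a,b} t (\<lambda>v. if v = a then c else if v = b then d else 0) mu"
        using h assms unfolding sol2_def wt_def cmb_def by auto
      show "(\<Sum>v\<in>{a,b}. (if v = a then c else if v = b then d else 0) * wa v) < (\<Sum>v\<in>t. mu v * 1)"
        using h(6) assms by simp
    qed
  qed
  then show ?thesis unfolding segment_below_def by simp
qed

context antipodal_sphere
begin

definition crossings :: "'v vecs \<Rightarrow> (nat \<Rightarrow> real) \<Rightarrow> real \<Rightarrow> (nat \<Rightarrow> real) \<Rightarrow> real \<Rightarrow> bit" where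
  "crossings B p wp q wq = sph (segment_below B p wp q wq)"

text \<open>Ends of segments of common rays are determined only up to a positive factor, which
  scales the vector and its weight together.\<close>

lemma crossings_scale:
  assumes "k > 0"
  shows "crossings B p wp (\<lambda>i. k * q i) (k * wq) = crossings B p wp q wq"
proof -
  have "segment_below B p wp (\<lambda>i. k * q i) (k * wq) t = segment_below B p wp q wq t" for t
  proof -
    let ?P = "\<lambda>q wq c d mu. 0 \<le> c \<and> 0 \<le> d \<and> wt t mu \<and> (c \<noteq> 0 \<or> d \<noteq> 0 \<or> (\<exists>v. mu v \<noteq> 0)) \<and>
     (\<forall>i<4. c * p i + d * q i = cmb B t mu i) \<and> c * wp + d * wq < sum mu t"
    have 1: "?P (\<lambda>i. k * q i) (k * wq) c d mu \<longleftrightarrow> ?P q wq c (d * k) mu" for c d mu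
      using assms by (simp add: mult.assoc zero_le_mult_iff)
    have 2: "?P q wq c d mu \<longleftrightarrow> ?P (\<lambda>i. k * q i) (k * wq) c (d / k) mu" for c d mu
    proof -
      have "0 \<le> d / k \<longleftrightarrow> 0 \<le> d" "d / k = 0 \<longleftrightarrow> d = 0" "d / k * (k * x) = d * x" for x
        using assms by (simp_all add: zero_le_divide_iff)
      then show ?thesis by simp
    qed
    have "(\<exists>c d mu. ?P (\<lambda>i. k * q i) (k * wq) c d mu) \<longleftrightarrow> (\<exists>c d mu. ?P q wq c d mu)"
    proof
      assume "\<exists>c d mu. ?P (\<lambda>i. k * q i) (k * wq) c d mu"
      then obtain c d mu where "?P (\<lambda>i. k * q i) (k * wq) c d mu" by (elim exE)
      then have "?P q wq c (d * k) mu" by (rule 1[THEN iffD1])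
      then show "\<exists>c d mu. ?P q wq c d mu" by (intro exI)
    next
      assume "\<exists>c d mu. ?P q wq c d mu"
      then obtain c d mu where "?P q wq c d mu" by (elim exE)
      then have "?P (\<lambda>i. k * q i) (k * wq) c (d / k) mu" by (rule 2[THEN iffD1])
      then show "\<exists>c d mu. ?P (\<lambda>i. k * q i) (k * wq) c d mu" by (intro exI)
    qed
    then show ?thesis unfolding segment_below_def by simp
  qed
  then have "segment_below B p wp (\<lambda>i. k * q i) (k * wq) = segment_below B p wp q wq" by (rule ext)
  then show ?thesis unfolding crossings_def by (rule arg_cong)
qed

lemma crossings_T:
  assumes "odd_field B"
  shows "crossings B (\<lambda>i. - p i) wp (\<lambda>i. - q i) wq = crossings B p wp q wq"
proof -
  let ?P = "\<lambda>p q t c d mu. 0 \<le> c \<and> 0 \<le> d \<and> wt t mu \<and> (c \<noteq> 0 \<or> d \<noteq> 0 \<or> (\<exists>v. mu v \<noteq> 0)) \<and>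
     (\<forall>i<4. c * p i + d * q i = cmb B t mu i) \<and> c * wp + d * wq < sum mu t"
  have imp: "\<exists>c d mu. ?P (\<lambda>i. - p i) (\<lambda>i. - q i) (T ` t) c d mu" if ex: "\<exists>c d mu. ?P p q t c d mu" for p q t
  proof -
    obtain c d mu where P: "?P p q t c d mu" using ex by blast
    have "c * - p i + d * - q i = cmb B (T ` t) (\<lambda>v. mu (T v)) i" if "i < 4" for i
      using P that unfolding cmb_T[OF assms] by (simp add: algebra_simps)
    then have "?P (\<lambda>i. - p i) (\<lambda>i. - q i) (T ` t) c d (\<lambda>v. mu (T v))"
      using P by (simp add: wt_T sum_T nz_T)
    then show ?thesis by blast
  qed
  have "segment_below B (\<lambda>i. - p i) wp (\<lambda>i. - q i) wq (T ` t) = segment_below B p wp q wq t" for t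
  proof -
    have "(\<exists>c d mu. ?P (\<lambda>i. - p i) (\<lambda>i. - q i) (T ` t) c d mu) \<longleftrightarrow> (\<exists>c d mu. ?P p q t c d mu)"
    proof
      assume "\<exists>c d mu. ?P (\<lambda>i. - p i) (\<lambda>i. - q i) (T ` t) c d mu"
      from imp[OF this] show "\<exists>c d mu. ?P p q t c d mu" by simp
    qed (rule imp)
    then show ?thesis unfolding segment_below_def by simp
  qed
  then have "sph (\<lambda>t. segment_below B (\<lambda>i. - p i) wp (\<lambda>i. - q i) wq (T ` t)) = sph (segment_below B p wp q wq)" by simp
  then show ?thesis unfolding crossings_def sph_T .
qed

text \<open>The three vectors form a triangle on the indices 0, 1, 2. Summing
  \<open>segment_parity_pair\<close> over the closed sphere of \<open>B\<close> kills the coboundary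
  in \<open>t\<close>; what is left is the sum over the three edges of the triangle.\<close>

lemma antipodal_sphere_cocycle:
  assumes H: "\<And>t c0 c1 c2 mu. t \<in> faces \<Longrightarrow> 0 \<le> c0 \<Longrightarrow> 0 \<le> c1 \<Longrightarrow> 0 \<le> c2 \<Longrightarrow> wt t mu \<Longrightarrow>
      c0 \<noteq> 0 \<or> c1 \<noteq> 0 \<or> c2 \<noteq> 0 \<or> (\<exists>v. mu v \<noteq> 0) \<Longrightarrow>
      (\<And>i. i < 4 \<Longrightarrow> c0 * p0 i + c1 * p1 i + c2 * p2 i = cmb B t mu i) \<Longrightarrow>
      5 \<le> of_bool (c0 \<noteq> 0) + of_bool (c1 \<noteq> 0) + of_bool (c2 \<noteq> 0) + card t \<and> c0 * w0 + c1 * w1 + c2 * w2 \<noteq> sum mu t"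
  shows "crossings B p0 w0 p1 w1 + crossings B p1 w1 p2 w2 + crossings B p0 w0 p2 w2 = 0"
proof -
  define A where "A = (\<lambda>l::nat. if l = 0 then p0 else if l = 1 then p1 else p2)"
  define wa where "wa = (\<lambda>l::nat. if l = 0 then w0 else if l = 1 then w1 else w2)"
  define Z where "Z = (\<lambda>s t. of_bool (\<exists>lam mu. sol2 A B s t lam mu \<and> (\<Sum>v\<in>s. lam v * wa v) < (\<Sum>v\<in>t. mu v * 1)) :: bit)"
  have c3: "cmb A {0,1,2} lam i = lam 0 * p0 i + lam 1 * p1 i + lam 2 * p2 i" for lam i
    by (simp add: cmb_def A_def)
  have Hs: "5 \<le> card s' + card t \<and> (\<Sum>v\<in>{0,1,2}. lam v * wa v) \<noteq> sum mu t"
    if s': "s' \<subseteq> {0,1,2}" and t: "t \<in> faces" and sol: "sol2 A B s' t lam mu" for s' t lam mu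
  proof -
    have lam: "wt s' lam" "wt t mu" using sol by (auto simp: sol2_def)
    have e: "lam 0 * p0 i + lam 1 * p1 i + lam 2 * p2 i = cmb B t mu i" if "i < 4" for i
      using cmb_mono[OF lam(1) s', of A i] sol that unfolding c3 by (simp add: sol2_def)
    have s0: "lam l = 0" if "l \<notin> s'" for l using lam(1) that by (simp add: wt_def)
    have ex: "lam 0 \<noteq> 0 \<or> lam 1 \<noteq> 0 \<or> lam 2 \<noteq> 0 \<or> (\<exists>v. mu v \<noteq> 0)"
      using sol s0 s' unfolding sol2_def by (metis empty_iff insertE subsetD)
    have f: "finite s'" using s' finite_subset by blast
    have cnt: "of_bool (lam 0 \<noteq> 0) + of_bool (lam 1 \<noteq> 0) + of_bool (lam 2 \<noteq> 0) \<le> card s'"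
    proof -
      have "of_bool (lam 0 \<noteq> 0) + of_bool (lam 1 \<noteq> 0) + of_bool (lam 2 \<noteq> 0) = card {l\<in>{0,1,2}. lam l \<noteq> 0}"
      proof -
        have "card {l\<in>{0,1,2::nat}. lam l \<noteq> 0} = (\<Sum>l\<in>{0,1,2}. of_bool (lam l \<noteq> 0))"
          by (subst card_eq_sum, subst sum.inter_filter) (auto simp: of_bool_def)
        then show ?thesis by simp
      qed
      also have "\<dots> \<le> card s'" using s0 by (intro card_mono f) auto
      finally show ?thesis .
    qed
    have H': "5 \<le> of_bool (lam 0 \<noteq> 0) + of_bool (lam 1 \<noteq> 0) + of_bool (lam 2 \<noteq> 0) + card t \<and>
      lam 0 * w0 + lam 1 * w1 + lam 2 * w2 \<noteq> sum mu t"
      by (rule H[OF t _ _ _ lam(2) ex e]) (use lam(1) in \<open>auto simp: wt_def\<close>)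
    then show ?thesis using cnt by (auto simp: wa_def)
  qed
  have "cobd (\<lambda>s. Z s t) {0,1,2} + cobd (\<lambda>t. Z {0,1,2} t) t = 0" if t: "t \<in> faces" "card t = 3" for t
    unfolding Z_def
  proof (rule segment_parity_pair)
    show "finite {0,1,2::nat}" "finite t" using fin_face t by auto
    show "card {0,1,2::nat} + card t = 6" using t by simp
    show "5 \<le> card s' + card t'" if "s' \<subseteq> {0, 1, 2}" "t' \<subseteq> t" "sol2 A B s' t' lam mu" for s' t' lam mu
      using Hs[OF that(1) face_sub[OF t(1) that(2)] that(3)] by blast
    show "(\<Sum>v\<in>{0, 1, 2}. lam v * wa v) \<noteq> (\<Sum>v\<in>t. mu v * 1)" if "sol2 A B {0, 1, 2} t lam mu" for lam mu
      using Hs[OF subset_refl t(1) that] by simp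
  qed
  then have "sph (\<lambda>t. cobd (\<lambda>s. Z s t) {0,1,2} + cobd (\<lambda>t. Z {0,1,2} t) t) = sph (\<lambda>t. 0)"
    by (intro sph_cong)
  then have "sph (\<lambda>t. cobd (\<lambda>s. Z s t) {0,1,2}) = 0" unfolding chsum_add sph_cobd by simp
  moreover have "cobd (\<lambda>s. Z s t) {0,1,2} = Z {1,2} t + Z {0,2} t + Z {0,1} t" for t
  proof -
    have "{0,1,2::nat} - {0} = {1,2}" "{0,1,2::nat} - {1} = {0,2}" "{0,1,2::nat} - {2} = {0,1}" by auto
    then show ?thesis unfolding cobd_def by (simp add: add.assoc)
  qed
  ultimately have a: "sph (Z {1,2}) + sph (Z {0,2}) + sph (Z {0,1}) = 0"
    by (simp add: chsum_add)
  have eqs: "Z {1,2} = segment_below B p1 w1 p2 w2" "Z {0,2} = segment_below B p0 w0 p2 w2" "Z {0,1} = segment_below B p0 w0 p1 w1"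
  proof -
    have "Z {a,b} = segment_below B (A a) (wa a) (A b) (wa b)" if "a \<noteq> b" for a b
      by (rule ext) (unfold Z_def, rule pair_set[OF that])
    from this[of 1 2] this[of 0 2] this[of 0 1] show "Z {1,2} = segment_below B p1 w1 p2 w2" "Z {0,2} = segment_below B p0 w0 p2 w2" "Z {0,1} = segment_below B p0 w0 p1 w1"
      by (simp_all add: A_def wa_def)
  qed
  show ?thesis using a unfolding crossings_def eqs by (simp only: add.commute add.left_commute)
qed

lemma good3D: "good3 A B C \<Longrightarrow> s \<in> faces \<Longrightarrow> t \<in> faces \<Longrightarrow> r \<in> faces \<Longrightarrow> sol3 A B C s t r lam mu nu \<Longrightarrow>
    9 \<le> card s + card t + card r"
  unfolding good3_def by blast

lemma good4D:
  assumes "good4 A B C" "s \<in> faces" "v \<in> s" "s' \<subseteq> s" "t \<in> faces" "r \<in> faces"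
    "0 \<le> c" "wt s' lam" "wt t mu" "wt r nu" "\<exists>v. lam v \<noteq> 0"
    "\<forall>i<4. c * A v i + cmb A s' lam i = cmb B t mu i" "\<forall>i<4. cmb A s' lam i = cmb C r nu i"
  shows "8 \<le> card s' + card t + card r"
  by (rule assms(1)[unfolded good4_def, THEN bspec, THEN bspec, THEN spec, THEN mp, THEN bspec, THEN bspec, THEN spec, THEN spec, THEN spec, THEN spec, THEN mp, THEN mp, THEN mp, THEN mp, THEN mp, THEN mp, THEN mp]) (fact assms)+

text \<open>The vertices in \<open>s\<close> and the points in the cone over \<open>s\<close> satisfy the hypothesis of the cocycle
  identity as soon as the supports are generic.\<close>

lemma cone_cocycle:
  assumes g: "good2 A B" and s: "s \<in> faces" and l: "wt s l0" "wt s l1" "wt s l2"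
    "\<exists>v. l0 v \<noteq> 0" "\<exists>v. l1 v \<noteq> 0" "\<exists>v. l2 v \<noteq> 0"
    and H: "\<And>t c0 c1 c2 mu. t \<in> faces \<Longrightarrow> 0 \<le> c0 \<Longrightarrow> 0 \<le> c1 \<Longrightarrow> 0 \<le> c2 \<Longrightarrow> c0 = 0 \<or> c1 = 0 \<or> c2 = 0 \<Longrightarrow>
      c0 \<noteq> 0 \<or> c1 \<noteq> 0 \<or> c2 \<noteq> 0 \<Longrightarrow> wt t mu \<Longrightarrow>
      (\<And>i. i < 4 \<Longrightarrow> c0 * cmb A s l0 i + c1 * cmb A s l1 i + c2 * cmb A s l2 i = cmb B t mu i) \<Longrightarrow>
      5 \<le> of_bool (c0 \<noteq> 0) + of_bool (c1 \<noteq> 0) + of_bool (c2 \<noteq> 0) + card t"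
  shows "crossings B (cmb A s l0) (sum l0 s) (cmb A s l1) (sum l1 s) + crossings B (cmb A s l1) (sum l1 s) (cmb A s l2) (sum l2 s)
    + crossings B (cmb A s l0) (sum l0 s) (cmb A s l2) (sum l2 s) = 0"
proof (rule antipodal_sphere_cocycle)
  fix t c0 c1 c2 mu
  assume t: "t \<in> faces" and c: "0 \<le> c0" "0 \<le> c1" "0 \<le> c2" and mu: "wt t mu"
    and nz: "c0 \<noteq> 0 \<or> c1 \<noteq> 0 \<or> c2 \<noteq> 0 \<or> (\<exists>v. mu v \<noteq> 0)"
    and e: "\<And>i. i < 4 \<Longrightarrow> c0 * cmb A s l0 i + c1 * cmb A s l1 i + c2 * cmb A s l2 i = cmb B t mu i"
  define lam where "lam = (\<lambda>v. 1 * (c0 * l0 v + c1 * l1 v) + c2 * l2 v)"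
  have ce: "cmb A s lam i = c0 * cmb A s l0 i + c1 * cmb A s l1 i + c2 * cmb A s l2 i" for i
    unfolding lam_def cmb_lin by simp
  have se: "sum lam s = c0 * sum l0 s + c1 * sum l1 s + c2 * sum l2 s"
    unfolding lam_def by (simp add: sum.distrib sum_distrib_left)
  have nn: "l0 v \<ge> 0" "l1 v \<ge> 0" "l2 v \<ge> 0" for v using l by (simp_all add: wt_def)
  have wl: "wt s lam" using l c unfolding wt_def lam_def by auto
  have lnz: "\<exists>v. lam v \<noteq> 0" if "c0 \<noteq> 0 \<or> c1 \<noteq> 0 \<or> c2 \<noteq> 0"
  proof -
    have ge: "lam v \<ge> c0 * l0 v" "lam v \<ge> c1 * l1 v" "lam v \<ge> c2 * l2 v" for v unfolding lam_def using c nn[of v] by auto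
    show ?thesis using that
    proof (elim disjE)
      assume "c0 \<noteq> 0"
      obtain v where "l0 v \<noteq> 0" using l by blast
      then have "c0 * l0 v > 0" using \<open>c0 \<noteq> 0\<close> c nn[of v] by (simp add: less_le)
      then show ?thesis using ge(1)[of v] by (intro exI[of _ v]) linarith
    next
      assume "c1 \<noteq> 0"
      obtain v where "l1 v \<noteq> 0" using l by blast
      then have "c1 * l1 v > 0" using \<open>c1 \<noteq> 0\<close> c nn[of v] by (simp add: less_le)
      then show ?thesis using ge(2)[of v] by (intro exI[of _ v]) linarith
    next
      assume "c2 \<noteq> 0"
      obtain v where "l2 v \<noteq> 0" using l by blast
      then have "c2 * l2 v > 0" using \<open>c2 \<noteq> 0\<close> c nn[of v] by (simp add: less_le)
      then show ?thesis using ge(3)[of v] by (intro exI[of _ v]) linarith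
    qed
  qed
  have sol: "sol2 A B s t lam mu"
    unfolding sol2_def using wl mu nz lnz e by (auto simp: ce)
  have dis: "sum lam s \<noteq> sum mu t" using good2D(2)[OF g s t sol] .
  have c012: "c0 \<noteq> 0 \<or> c1 \<noteq> 0 \<or> c2 \<noteq> 0"
  proof (rule ccontr)
    assume "\<not> ?thesis"
    then have "lam v = 0" for v by (simp add: lam_def)
    then show False using good2_nz(1)[OF g s t sol] by simp
  qed
  \<comment> \<open>If all three coefficients are nonzero, the left count is
    \<open>3 + card t\<close>, and \<open>good2\<close> together with \<open>card s \<le> 3\<close>
    bounds it. Degenerate combinations are left to \<open>H\<close>.\<close>
  have "5 \<le> of_bool (c0 \<noteq> 0) + of_bool (c1 \<noteq> 0) + of_bool (c2 \<noteq> 0) + card t"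
  proof (cases "c0 = 0 \<or> c1 = 0 \<or> c2 = 0")
    case True then show ?thesis using H[OF t c True c012 mu e] by blast
  next
    case False
    then show ?thesis using good2D(1)[OF g s t sol] face_card[OF s] by simp
  qed
  then show "5 \<le> of_bool (c0 \<noteq> 0) + of_bool (c1 \<noteq> 0) + of_bool (c2 \<noteq> 0) + card t \<and>
      c0 * sum l0 s + c1 * sum l1 s + c2 * sum l2 s \<noteq> sum mu t"
    using dis se by simp
qed

end

section \<open>Consequences of a vanishing linking parity\<close>

context antipodal_sphere
begin

text \<open>If \<open>linking A B = 0\<close>, then \<open>\<lambda>v w. crossings B (A v) 1 (A w) 1\<close> is the coboundary of a \<open>T\<close>-invariant \<open>f\<close>; \<open>chi\<close>
  extends \<open>f\<close> from the vertices to points of the cone, independently of the vertex \<open>v\<close> of the simplex.\<close>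

definition chi :: "('v \<Rightarrow> bit) \<Rightarrow> 'v vecs \<Rightarrow> 'v vecs \<Rightarrow> 'v \<Rightarrow> (nat \<Rightarrow> real) \<Rightarrow> real \<Rightarrow> bit" where
  "chi f A B v p w = f v + crossings B (A v) 1 p w"

abbreviation "single v \<equiv> (\<lambda>u. if u = v then 1 else 0 :: real)"

lemma single:
  assumes "finite s" "v \<in> s"
  shows "wt s (single v)" "\<exists>u. single v u \<noteq> 0" "cmb A s (single v) = A v" "sum (single v) s = 1"
  using assms cmb_single[OF assms, of A 1] by (auto simp: wt_def)

text \<open>Detects a common ray of \<open>A\<close> and \<open>C\<close> with \<open>A\<close>
  farther out, weighted by \<open>chi\<close> at the point of \<open>A\<close>. In the dimension
  where it is used, \<open>chi_const\<close> makes the choice of \<open>v\<close>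
  immaterial.\<close>

definition chi_below :: "('v \<Rightarrow> bit) \<Rightarrow> 'v vecs \<Rightarrow> 'v vecs \<Rightarrow> 'v vecs \<Rightarrow> 'v set \<Rightarrow> 'v set \<Rightarrow> bit" where
  "chi_below f A B C s r = of_bool (\<exists>lam nu. sol2 A C s r lam nu \<and> sum lam s < sum nu r \<and>
     (\<exists>v\<in>s. chi f A B v (cmb A s lam) (sum lam s) = 1))"

lemma chi_below_T:
  assumes o: "odd_field A" "odd_field B" "odd_field C" and fT: "\<And>v. f (T v) = f v"
  shows "chi_below f A B C (T ` s) (T ` r) = chi_below f A B C s r"
proof -
  let ?Q = "\<lambda>s r. \<exists>lam nu. sol2 A C s r lam nu \<and> sum lam s < sum nu r \<and> (\<exists>v\<in>s. chi f A B v (cmb A s lam) (sum lam s) = 1)"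
  have imp: "?Q (T ` s) (T ` r)" if ex: "?Q s r" for s r
  proof -
    obtain lam nu v where h: "sol2 A C s r lam nu" "sum lam s < sum nu r" "v \<in> s" "chi f A B v (cmb A s lam) (sum lam s) = 1"
      using ex by blast
    have c: "cmb A (T ` s) (\<lambda>v. lam (T v)) = (\<lambda>i. - cmb A s lam i)" using cmb_T[OF o(1)] by blast
    have a: "A (T v) = (\<lambda>i. - A v i)" using o(1) by (auto simp: odd_field_def)
    have "chi f A B (T v) (cmb A (T ` s) (\<lambda>v. lam (T v))) (sum (\<lambda>v. lam (T v)) (T ` s)) = 1"
      using h(4) unfolding chi_def c a crossings_T[OF o(2)] sum_T fT .
    then show ?thesis using sol2_T[OF o(1,3) h(1)] h(2,3)
      by (intro exI[of _ "\<lambda>v. lam (T v)"] exI[of _ "\<lambda>v. nu (T v)"]) (auto simp: sum_T)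
  qed
  have "?Q (T ` s) (T ` r) \<longleftrightarrow> ?Q s r"
  proof
    assume "?Q (T ` s) (T ` r)"
    from imp[OF this] show "?Q s r" by (simp only: TTim)
  qed (rule imp)
  then show ?thesis unfolding chi_below_def by simp
qed

text \<open>Cocycle identity for the triangle with corners \<open>v\<close>, \<open>w\<close> and
  the common point of \<open>A\<close> and \<open>C\<close>, combined with the formula for the edge
  from \<open>v\<close> to \<open>w\<close>. The dimension counts for degenerate combinations come
  from \<open>good2\<close> on the edge, from \<open>good3\<close> at the common ray, and from
  \<open>good4\<close> on the segments between a vertex and that ray.\<close>

lemma chi_const:
  assumes g: "good2 A B" "good2 A C" "good3 A B C" "good4 A B C"
    and f: "\<And>s v w. s \<in> faces \<Longrightarrow> v \<in> s \<Longrightarrow> w \<in> s \<Longrightarrow> v \<noteq> w \<Longrightarrow> crossings B (A v) 1 (A w) 1 = f v + f w"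
    and s: "s \<in> faces" "s' \<subseteq> s" "r \<in> faces" "card s' + card r = 5" "sol2 A C s' r lam nu" "v \<in> s" "w \<in> s"
  shows "chi f A B v (cmb A s' lam) (sum lam s') = chi f A B w (cmb A s' lam) (sum lam s')"
proof (cases "v = w")
  case False
  have fs: "finite s" "finite s'" using fin_face s finite_subset by auto
  have wl: "wt s' lam" "wt r nu" and en: "\<And>i. i < 4 \<Longrightarrow> cmb A s' lam i = cmb C r nu i" using s(5) by (auto simp: sol2_def)
  have wls: "wt s lam" using wl s(2) by (auto simp: wt_def)
  have lnz: "\<exists>v. lam v \<noteq> 0" using good2_nz(1)[OF g(2) face_sub[OF s(1,2)] s(3,5)] .
  have cs: "cmb A s lam = cmb A s' lam" "sum lam s = sum lam s'"
    using cmb_mono[OF wl(1) s(2) fs(1)] wsum_mono[OF wl(1) s(2) fs(1)] by auto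
  note sv = single[OF fs(1) s(6)] and sw = single[OF fs(1) s(7)]
  have "crossings B (cmb A s (single v)) (sum (single v) s) (cmb A s (single w)) (sum (single w) s)
    + crossings B (cmb A s (single w)) (sum (single w) s) (cmb A s lam) (sum lam s)
    + crossings B (cmb A s (single v)) (sum (single v) s) (cmb A s lam) (sum lam s) = 0"
  proof (rule cone_cocycle[OF g(1) s(1) sv(1) sw(1) wls sv(2) sw(2) lnz])
    fix t c0 c1 c2 mu
    assume t: "t \<in> faces" and c: "0 \<le> c0" "0 \<le> c1" "0 \<le> c2" and z: "c0 = 0 \<or> c1 = 0 \<or> c2 = 0"
      and nz: "c0 \<noteq> 0 \<or> c1 \<noteq> 0 \<or> c2 \<noteq> 0" and mu: "wt t mu"
      and e: "\<And>i. i < 4 \<Longrightarrow> c0 * cmb A s (single v) i + c1 * cmb A s (single w) i + c2 * cmb A s lam i = cmb B t mu i"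
    have e': "c0 * A v i + c1 * A w i + c2 * cmb A s' lam i = cmb B t mu i" if "i < 4" for i
      using e[OF that] by (simp only: sv(3) sw(3) cs)
    show "5 \<le> of_bool (c0 \<noteq> 0) + of_bool (c1 \<noteq> 0) + of_bool (c2 \<noteq> 0) + card t"
    proof (cases "c2 = 0")
      case True
      define u where "u = (if c0 = 0 then {} else {v}) \<union> (if c1 = 0 then {} else {w})"
      define l where "l = (\<lambda>x. c0 * single v x + c1 * single w x)"
      have u: "u \<subseteq> s" "finite u" "card u = of_bool (c0 \<noteq> 0) + of_bool (c1 \<noteq> 0)" using s False by (auto simp: u_def)
      have wl: "wt u l" using c by (auto simp: wt_def l_def u_def)
      have "cmb A u l i = c0 * A v i + c1 * A w i" for i
      proof -
        have "cmb A s l i = c0 * A v i + c1 * A w i" unfolding l_def cmb_lin sv(3) sw(3) ..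
        then show ?thesis unfolding cmb_mono[OF wl u(1) fs(1)] .
      qed
      moreover have "\<exists>x. l x \<noteq> 0"
      proof (cases "c0 = 0")
        case True then show ?thesis using nz \<open>c2 = 0\<close> by (intro exI[of _ w]) (simp add: l_def)
      next
        case F: False then show ?thesis using False by (intro exI[of _ v]) (simp add: l_def)
      qed
      ultimately have "sol2 A B u t l mu" using e' True wl mu by (simp add: sol2_def)
      then show ?thesis using good2D(1)[OF g(1) face_sub[OF s(1) u(1)] t] u(3) True by simp
    next
      case c2: False
      define l where "l = (\<lambda>x. c2 * lam x)"
      define n where "n = (\<lambda>x. c2 * nu x)"
      have wl2: "wt s' l" "wt r n" using wl c by (auto simp: wt_def l_def n_def)
      have lz: "\<exists>x. l x \<noteq> 0" using lnz c2 by (auto simp: l_def)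
      have cl: "cmb A s' l i = c2 * cmb A s' lam i" "cmb C r n i = c2 * cmb C r nu i" for i
        using cmb_lin[of A s' c2 lam 0 lam i] cmb_lin[of C r c2 nu 0 nu i] by (simp_all add: l_def n_def)
      have ln: "\<forall>i<4. cmb A s' l i = cmb C r n i" using en cl by simp
      consider "c0 = 0" "c1 = 0" | "c0 \<noteq> 0" "c1 = 0" | "c0 = 0" "c1 \<noteq> 0" using z c2 by blast
      then show ?thesis
      proof cases
        case 1
        have "sol3 A B C s' t r l mu n" using e' 1 cl ln wl2 mu lz by (auto simp: sol3_def)
        from good3D[OF g(3) face_sub[OF s(1,2)] t s(3) this] show ?thesis using s(4) 1 c2 by simp
      next
        case 2
        have "\<forall>i<4. c0 * A v i + cmb A s' l i = cmb B t mu i" using e' 2 cl by simp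
        then show ?thesis using good4D[OF g(4) s(1,6,2) t s(3) c(1) wl2(1) mu wl2(2) lz _ ln] s(4) 2 c2 by simp
      next
        case 3
        have "\<forall>i<4. c1 * A w i + cmb A s' l i = cmb B t mu i" using e' 3 cl by simp
        then show ?thesis using good4D[OF g(4) s(1,7,2) t s(3) c(2) wl2(1) mu wl2(2) lz _ ln] s(4) 3 c2 by simp
      qed
    qed
  qed
  then have "crossings B (A v) 1 (A w) 1 + crossings B (A w) 1 (cmb A s' lam) (sum lam s') + crossings B (A v) 1 (cmb A s' lam) (sum lam s') = 0"
    by (simp only: sv(3,4) sw(3,4) cs)
  then have "f v + f w + crossings B (A w) 1 (cmb A s' lam) (sum lam s') + crossings B (A v) 1 (cmb A s' lam) (sum lam s') = 0"
    using f[OF s(1,6,7) False] by simp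
  then show ?thesis unfolding chi_def
    by (cases "f v"; cases "f w"; cases "crossings B (A w) 1 (cmb A s' lam) (sum lam s')"; cases "crossings B (A v) 1 (cmb A s' lam) (sum lam s')") auto
qed simp

text \<open>Cocycle identity for the triangle whose corners are the vertex \<open>v\<close> and the
  two ends of a segment of rays common to \<open>A\<close> and \<open>C\<close>. On the side between
  the two ends every point is again on a common ray, so there \<open>good3\<close> controls the
  crossings with \<open>B\<close>.\<close>

lemma crossings_facets:
  assumes g: "good2 A B" "good2 A C" "good3 A B C" "good4 A B C"
    and s: "s \<in> faces" "r \<in> faces" "card s = 3" "card r = 3" "v \<in> s"
    and 1: "s1' \<subseteq> s" "r1 \<subseteq> r" "card s1' + card r1 = 5" "sol2 A C s1' r1 lam1 nu1"
    and 2: "s2' \<subseteq> s" "r2 \<subseteq> r" "card s2' + card r2 = 5" "sol2 A C s2' r2 lam2 nu2"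
  shows "crossings B (cmb A s lam1) (sum lam1 s) (cmb A s lam2) (sum lam2 s) =
    chi f A B v (cmb A s lam1) (sum lam1 s) + chi f A B v (cmb A s lam2) (sum lam2 s)"
proof -
  have fs: "finite s" "finite r" using fin_face s by auto
  have w1: "wt s1' lam1" "wt r1 nu1" "\<And>i. i < 4 \<Longrightarrow> cmb A s1' lam1 i = cmb C r1 nu1 i" using 1(4) by (auto simp: sol2_def)
  have w2: "wt s2' lam2" "wt r2 nu2" "\<And>i. i < 4 \<Longrightarrow> cmb A s2' lam2 i = cmb C r2 nu2 i" using 2(4) by (auto simp: sol2_def)
  have W: "wt s lam1" "wt r nu1" "wt s lam2" "wt r nu2" using w1 w2 1 2 by (auto simp: wt_def)
  have r12: "r1 \<in> faces" "r2 \<in> faces" using face_sub s 1 2 by auto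
  have lnz: "\<exists>v. lam1 v \<noteq> 0" "\<exists>v. lam2 v \<noteq> 0"
    using good2_nz(1)[OF g(2) face_sub[OF s(1) 1(1)] r12(1) 1(4)] good2_nz(1)[OF g(2) face_sub[OF s(1) 2(1)] r12(2) 2(4)] by auto
  have cs: "cmb A s lam1 i = cmb A s1' lam1 i" "cmb A s lam2 i = cmb A s2' lam2 i"
    "cmb C r nu1 i = cmb C r1 nu1 i" "cmb C r nu2 i = cmb C r2 nu2 i" for i
    using cmb_mono w1 w2 1 2 fs by metis+
  note sv = single[OF fs(1) s(5)]
  have "crossings B (cmb A s (single v)) (sum (single v) s) (cmb A s lam1) (sum lam1 s)
    + crossings B (cmb A s lam1) (sum lam1 s) (cmb A s lam2) (sum lam2 s)
    + crossings B (cmb A s (single v)) (sum (single v) s) (cmb A s lam2) (sum lam2 s) = 0"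
  proof (rule cone_cocycle[OF g(1) s(1) sv(1) W(1) W(3) sv(2) lnz])
    fix t c0 c1 c2 mu
    assume t: "t \<in> faces" and c: "0 \<le> c0" "0 \<le> c1" "0 \<le> c2" and z: "c0 = 0 \<or> c1 = 0 \<or> c2 = 0"
      and nz: "c0 \<noteq> 0 \<or> c1 \<noteq> 0 \<or> c2 \<noteq> 0" and mu: "wt t mu"
      and e: "\<And>i. i < 4 \<Longrightarrow> c0 * cmb A s (single v) i + c1 * cmb A s lam1 i + c2 * cmb A s lam2 i = cmb B t mu i"
    have e': "c0 * A v i + c1 * cmb A s lam1 i + c2 * cmb A s lam2 i = cmb B t mu i" if "i < 4" for i
      using e[OF that] by (simp only: sv(3))
    have one: "5 \<le> of_bool (c0 \<noteq> 0) + of_bool (k \<noteq> 0) + card t"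
      if k: "k > 0" and st: "s' \<subseteq> s" "r' \<in> faces" "card s' + card r' = 5" and w: "wt s' lam" "wt r' nu" "\<And>i. i < 4 \<Longrightarrow> cmb A s' lam i = cmb C r' nu i"
        and lz: "\<exists>v. lam v \<noteq> 0" and ee: "\<And>i. i < 4 \<Longrightarrow> c0 * A v i + k * cmb A s' lam i = cmb B t mu i"
      for k s' r' lam nu
    proof -
      define l where "l = (\<lambda>x. k * lam x)"
      define n where "n = (\<lambda>x. k * nu x)"
      have wl2: "wt s' l" "wt r' n" using w k by (auto simp: wt_def l_def n_def)
      have lz: "\<exists>x. l x \<noteq> 0" using lz k by (auto simp: l_def)
      have cl: "cmb A s' l i = k * cmb A s' lam i" "cmb C r' n i = k * cmb C r' nu i" for i
        using cmb_lin[of A s' k lam 0 lam i] cmb_lin[of C r' k nu 0 nu i] by (simp_all add: l_def n_def)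
      have ln: "\<forall>i<4. cmb A s' l i = cmb C r' n i" using w(3) cl by simp
      show ?thesis
      proof (cases "c0 = 0")
        case True
        have "sol3 A B C s' t r' l mu n" using ee True cl ln wl2 mu lz by (auto simp: sol3_def)
        from good3D[OF g(3) face_sub[OF s(1) st(1)] t st(2) this] show ?thesis using st(3) True k by simp
      next
        case False
        have "\<forall>i<4. c0 * A v i + cmb A s' l i = cmb B t mu i" using ee cl by simp
        then show ?thesis using good4D[OF g(4) s(1,5) st(1) t st(2) c(1) wl2(1) mu wl2(2) lz _ ln] st(3) False k by simp
      qed
    qed
    show "5 \<le> of_bool (c0 \<noteq> 0) + of_bool (c1 \<noteq> 0) + of_bool (c2 \<noteq> 0) + card t"
    proof (cases "c1 = 0")
      case c1: True
      show ?thesis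
      proof (cases "c2 = 0")
        case True
        define l where "l = (\<lambda>x. c0 * single v x + 0 * single v x)"
        have wl: "wt {v} l" using c by (auto simp: wt_def l_def)
        have "cmb A {v} l i = c0 * A v i" for i by (simp add: cmb_def l_def)
        then have "sol2 A B {v} t l mu" using e' True c1 wl mu nz by (auto simp: sol2_def l_def)
        from good2D(1)[OF g(1) face_sub[OF s(1)] t this] show ?thesis using s(5) True c1 nz by simp
      next
        case False
        have "5 \<le> of_bool (c0 \<noteq> 0) + of_bool (c2 \<noteq> 0) + card t"
          by (rule one[OF _ 2(1) r12(2) 2(3) w2 lnz(2)]) (use False c e' c1 in \<open>auto simp: cs\<close>)
        then show ?thesis by simp
      qed
    next
      case c1: False
      show ?thesis
      proof (cases "c2 = 0")
        case True
        have "5 \<le> of_bool (c0 \<noteq> 0) + of_bool (c1 \<noteq> 0) + card t"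
          by (rule one[OF _ 1(1) r12(1) 1(3) w1 lnz(1)]) (use True c e' c1 in \<open>auto simp: cs\<close>)
        then show ?thesis by simp
      next
        case c2: False
        then have c0: "c0 = 0" using z c1 by blast
        define l where "l = (\<lambda>x. c1 * lam1 x + c2 * lam2 x)"
        define n where "n = (\<lambda>x. c1 * nu1 x + c2 * nu2 x)"
        have wl: "wt s l" "wt r n" using W c by (auto simp: wt_def l_def n_def)
        obtain x where x: "lam1 x \<noteq> 0" using lnz by blast
        have "lam1 x > 0" "lam2 x \<ge> 0" using x W by (auto simp: wt_def less_le)
        then have "c1 * lam1 x > 0" "c2 * lam2 x \<ge> 0" using c1 c by auto
        then have "l x > 0" unfolding l_def by linarith
        then have lz: "\<exists>x. l x \<noteq> 0" by (metis less_irrefl)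
        have "sol3 A B C s t r l mu n"
          unfolding sol3_def using wl mu lz e' w1(3) w2(3) c0 by (auto simp: l_def n_def cmb_lin cs)
        from good3D[OF g(3) s(1) t s(2) this] show ?thesis using s(3,4) c0 c1 c2 by simp
      qed
    qed
  qed
  then have "crossings B (A v) 1 (cmb A s lam1) (sum lam1 s) + crossings B (cmb A s lam1) (sum lam1 s) (cmb A s lam2) (sum lam2 s)
    + crossings B (A v) 1 (cmb A s lam2) (sum lam2 s) = 0"
    by (simp only: sv(3,4))
  then show ?thesis unfolding chi_def
    by (cases "f v"; cases "crossings B (A v) 1 (cmb A s lam1) (sum lam1 s)"; cases "crossings B (A v) 1 (cmb A s lam2) (sum lam2 s)";
        cases "crossings B (cmb A s lam1) (sum lam1 s) (cmb A s lam2) (sum lam2 s)") auto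
qed

text \<open>The rays common to the triangles \<open>s\<close> of \<open>A\<close> and
  \<open>r\<close> of \<open>C\<close> form a segment with its ends over two facets. Either
  \<open>A\<close> is farther out than \<open>C\<close> along all of it or nowhere. In the first
  case the crossings of this segment with the shadow of \<open>B\<close> are counted by the
  difference of \<open>chi\<close> at the two ends, which is the contribution of the two facets to
  the coboundary.\<close>

lemma sph_below2:
  assumes g: "good2 A B" "good2 A C" "good2 B C" "good3 A B C" "good4 A B C"
    and f: "\<And>s v w. s \<in> faces \<Longrightarrow> v \<in> s \<Longrightarrow> w \<in> s \<Longrightarrow> v \<noteq> w \<Longrightarrow> crossings B (A v) 1 (A w) 1 = f v + f w"
    and s: "s \<in> faces" "r \<in> faces" "card s = 3" "card r = 3"
  shows "sph (\<lambda>t. below2 A B C s t r) = cobd (\<lambda>s. chi_below f A B C s r) s + cobd (\<lambda>r. chi_below f A B C s r) r"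
proof -
  have fs: "finite s" "finite r" using fin_face s by auto
  obtain v where v: "v \<in> s" using s(3) by fastforce
  define S where "S = s <+> r"
  define P where "P = diff_config A C"
  have finS: "finite S" and cardS: "card S = 4 + 2" using fs s by (auto simp: S_def card_Plus)
  have gp: "gpos 4 P S"
    unfolding gpos_def
  proof (intro allI impI equals0I)
    fix S' x assume S': "S' \<subseteq> S" "card S' \<le> 4" "x \<in> sols 4 P S'"
    obtain s' r' where st: "s' \<subseteq> s" "r' \<subseteq> r" "S' = s' <+> r'" using Plus_subset S'(1) unfolding S_def by metis
    have fi: "finite s'" "finite r'" using st fs finite_subset by auto
    have "sol2 A C s' r' (\<lambda>v. x (Inl v)) (\<lambda>v. x (Inr v))" using S'(3) unfolding st(3) P_def sols_diff_config[OF fi] .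
    then have "5 \<le> card s' + card r'" using good2D(1)[OF g(2) face_sub[OF s(1) st(1)] face_sub[OF s(2) st(2)]] by blast
    then show False using S'(2) fi unfolding st(3) by (simp add: card_Plus)
  qed
  define R where "R = (\<lambda>x::'v + 'v \<Rightarrow> real. sum (\<lambda>v. x (Inr v)) r - sum (\<lambda>v. x (Inl v)) s)"
  define pp where "pp = (\<lambda>x::'v + 'v \<Rightarrow> real. cmb A s (\<lambda>v. x (Inl v)))"
  define ww where "ww = (\<lambda>x::'v + 'v \<Rightarrow> real. sum (\<lambda>v. x (Inl v)) s)"
  define ci where "ci = (\<lambda>x. chi f A B v (pp x) (ww x))"
  have solS: "x \<in> sols 4 P S \<longleftrightarrow> sol2 A C s r (\<lambda>v. x (Inl v)) (\<lambda>v. x (Inr v))" for x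
    unfolding P_def S_def by (rule sols_diff_config[OF fs])
  have Rlin: "R (\<lambda>u. c * x u + d * y u) = c * R x + d * R y" for c d x y
    unfolding R_def sum_lin by (simp add: algebra_simps)
  have Rnz: "R x \<noteq> 0" if "x \<in> sols 4 P S" for x
    using good2D(2)[OF g(2) s(1,2)] that unfolding solS R_def by fastforce
  define h where "h = (\<lambda>u. of_bool (\<exists>x\<in>sols 4 P (S - {u}). R x > 0 \<and> ci x = 1) :: bit)"
  have ph: "chi_below f A B C s' r' = of_bool (\<exists>x\<in>sols 4 P (s' <+> r'). R x > 0 \<and> ci x = 1)"
    if st: "s' \<subseteq> s" "r' \<subseteq> r" "card s' + card r' = 5" for s' r'
  proof -
    have fi: "finite s'" "finite r'" using st fs finite_subset by auto
    have rf: "r' \<in> faces" using face_sub[OF s(2) st(2)] .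
    have "card r' \<le> 3" using face_card[OF rf] .
    then obtain v' where v': "v' \<in> s'" using st(3) by fastforce
    have eq: "sum lam s' < sum nu r' \<and> (\<exists>v\<in>s'. chi f A B v (cmb A s' lam) (sum lam s') = 1) \<longleftrightarrow>
        sum nu r - sum lam s > 0 \<and> chi f A B v (cmb A s lam) (sum lam s) = 1"
      if sol: "sol2 A C s' r' lam nu" for lam nu
    proof -
      have join_chain: "chi f A B w (cmb A s' lam) (sum lam s') = chi f A B v (cmb A s' lam) (sum lam s')" if "w \<in> s'" for w
        by (rule chi_const[OF g(1,2,4,5) f s(1) st(1) rf st(3) sol _ v]) (use that st in auto)
      have w: "wt s' lam" "wt r' nu" using sol by (auto simp: sol2_def)
      have "cmb A s' lam = cmb A s lam" "sum lam s' = sum lam s" "sum nu r' = sum nu r"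
        using cmb_mono[OF w(1) st(1) fs(1)] wsum_mono[OF w(1) st(1) fs(1)] wsum_mono[OF w(2) st(2) fs(2)] by auto
      then show ?thesis using join_chain v' by auto
    qed
    have "(\<exists>lam nu. sol2 A C s' r' lam nu \<and> sum lam s' < sum nu r' \<and> (\<exists>v\<in>s'. chi f A B v (cmb A s' lam) (sum lam s') = 1)) \<longleftrightarrow>
      (\<exists>x\<in>sols 4 P (s' <+> r'). R x > 0 \<and> ci x = 1)"
    proof
      assume "\<exists>lam nu. sol2 A C s' r' lam nu \<and> sum lam s' < sum nu r' \<and> (\<exists>v\<in>s'. chi f A B v (cmb A s' lam) (sum lam s') = 1)"
      then obtain lam nu where 1: "sol2 A C s' r' lam nu" "sum lam s' < sum nu r' \<and> (\<exists>v\<in>s'. chi f A B v (cmb A s' lam) (sum lam s') = 1)" by blast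
      have x: "case_sum lam nu \<in> sols 4 P (s' <+> r')" using 1(1) unfolding P_def sols_diff_config[OF fi] by simp
      show "\<exists>x\<in>sols 4 P (s' <+> r'). R x > 0 \<and> ci x = 1"
        using eq[OF 1(1)] 1(2) by (intro bexI[OF _ x]) (simp add: R_def ci_def pp_def ww_def)
    next
      assume "\<exists>x\<in>sols 4 P (s' <+> r'). R x > 0 \<and> ci x = 1"
      then obtain x where x: "x \<in> sols 4 P (s' <+> r')" "R x > 0" "ci x = 1" by blast
      have sol: "sol2 A C s' r' (\<lambda>v. x (Inl v)) (\<lambda>v. x (Inr v))" using x(1) unfolding P_def sols_diff_config[OF fi] .
      show "\<exists>lam nu. sol2 A C s' r' lam nu \<and> sum lam s' < sum nu r' \<and> (\<exists>v\<in>s'. chi f A B v (cmb A s' lam) (sum lam s') = 1)"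
        using eq[OF sol] x(2,3) sol unfolding R_def ci_def pp_def ww_def by blast
    qed
    then show ?thesis unfolding chi_below_def by simp
  qed
  have "cobd (\<lambda>s. chi_below f A B C s r) s + cobd (\<lambda>r. chi_below f A B C s r) r = sum h S"
  proof -
    have "chi_below f A B C (s - {u}) r = h (Inl u)" if "u \<in> s" for u
      unfolding h_def S_def Plus_diff using that s fs by (intro ph) auto
    moreover have "chi_below f A B C s (r - {u}) = h (Inr u)" if "u \<in> r" for u
      unfolding h_def S_def Plus_diff using that s fs by (intro ph) auto
    ultimately show ?thesis unfolding S_def sum.Plus[OF fs] cobd_def by simp
  qed
  also have "sum h S = sph (\<lambda>t. below2 A B C s t r)"
  proof (cases "sols 4 P S = {}")
    case True
    then have "sols 4 P (S - {u}) = {}" for u using sols_mono[OF finS, of "S-{u}" _ 4 P] by blast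
    then have "sum h S = 0" by (simp add: h_def)
    moreover have "sph (\<lambda>t. below2 A B C s t r) = sph (\<lambda>t. 0)"
    proof (rule sph_cong)
      fix t assume t: "t \<in> faces" "card t = 3"
      have "\<not> sol3 A B C s t r lam mu nu" for lam mu nu
      proof
        assume "sol3 A B C s t r lam mu nu"
        then have "sol2 A C s r lam nu" using sol3_pairs(2)[OF _ s(1) t(1) s(2) g(1-3)] by blast
        then have "case_sum lam nu \<in> sols 4 P S" unfolding solS by simp
        then show False using True by blast
      qed
      then show "below2 A B C s t r = 0" by (simp add: below2_def)
    qed
    ultimately show ?thesis by simp
  next
    case False
    obtain a b xa xb where ab: "a \<in> S" "b \<in> S" "a \<noteq> b" and xa: "xa \<in> sols 4 P (S - {a})" and xb: "xb \<in> sols 4 P (S - {b})"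
      and comb: "\<And>x. x \<in> sols 4 P S \<Longrightarrow> \<exists>s\<ge>0. \<exists>t\<ge>0. x = (\<lambda>v. s * xa v + t * xb v)"
      and fac: "\<And>v x. v \<in> S \<Longrightarrow> x \<in> sols 4 P (S - {v}) \<Longrightarrow> v = a \<and> (\<exists>s>0. x = (\<lambda>v. s * xa v)) \<or> v = b \<and> (\<exists>s>0. x = (\<lambda>v. s * xb v))"
      by (rule segment_structure[OF finS cardS gp False]) blast
    have xaS: "xa \<in> sols 4 P S" and xbS: "xb \<in> sols 4 P S" using sols_mono[OF finS _ xa] sols_mono[OF finS _ xb] by blast+
    have ksc: "R (\<lambda>v. k * x v) > 0 \<longleftrightarrow> R x > 0" "ci (\<lambda>v. k * x v) = ci x" if "k > 0" for k x
    proof -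
      show "R (\<lambda>v. k * x v) > 0 \<longleftrightarrow> R x > 0" using Rlin[of k x 0 x] that by (simp add: zero_less_mult_iff)
      have "pp (\<lambda>v. k * x v) = (\<lambda>i. k * pp x i)" "ww (\<lambda>v. k * x v) = k * ww x"
        unfolding pp_def ww_def cmb_def by (auto simp: sum_distrib_left mult.assoc)
      then show "ci (\<lambda>v. k * x v) = ci x" unfolding ci_def chi_def using crossings_scale[OF that] by simp
    qed
    have ha: "h a = of_bool (R xa > 0 \<and> ci xa = 1)"
    proof -
      have "(\<exists>x\<in>sols 4 P (S - {a}). R x > 0 \<and> ci x = 1) \<longleftrightarrow> R xa > 0 \<and> ci xa = 1"
      proof
        assume "\<exists>x\<in>sols 4 P (S - {a}). R x > 0 \<and> ci x = 1"
        then obtain x where x: "x \<in> sols 4 P (S - {a})" "R x > 0" "ci x = 1" by blast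
        then obtain k where "k > 0" "x = (\<lambda>v. k * xa v)" using fac[OF ab(1) x(1)] ab(3) by blast
        then show "R xa > 0 \<and> ci xa = 1" using x(2,3) ksc[of k xa] by simp
      next
        assume "R xa > 0 \<and> ci xa = 1"
        then show "\<exists>x\<in>sols 4 P (S - {a}). R x > 0 \<and> ci x = 1" using xa by (intro bexI[of _ xa])
      qed
      then show ?thesis unfolding h_def by simp
    qed
    have hb: "h b = of_bool (R xb > 0 \<and> ci xb = 1)"
    proof -
      have "(\<exists>x\<in>sols 4 P (S - {b}). R x > 0 \<and> ci x = 1) \<longleftrightarrow> R xb > 0 \<and> ci xb = 1"
      proof
        assume "\<exists>x\<in>sols 4 P (S - {b}). R x > 0 \<and> ci x = 1"
        then obtain x where x: "x \<in> sols 4 P (S - {b})" "R x > 0" "ci x = 1" by blast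
        then obtain k where "k > 0" "x = (\<lambda>v. k * xb v)" using fac[OF ab(2) x(1)] ab(3) by blast
        then show "R xb > 0 \<and> ci xb = 1" using x(2,3) ksc[of k xb] by simp
      next
        assume "R xb > 0 \<and> ci xb = 1"
        then show "\<exists>x\<in>sols 4 P (S - {b}). R x > 0 \<and> ci x = 1" using xb by (intro bexI[of _ xb])
      qed
      then show ?thesis unfolding h_def by simp
    qed
    have h0: "h u = 0" if "u \<in> S - {a,b}" for u using fac[of u] that unfolding h_def by auto
    have sh: "sum h S = h a + h b"
    proof -
      have "sum h S = sum h {a,b}" by (rule sum.mono_neutral_right) (use finS ab h0 in auto)
      then show ?thesis using ab by simp
    qed
    have comb_sol: "(\<lambda>v. c * xa v + d * xb v) \<in> sols 4 P S" if cd: "c \<ge> 0" "d \<ge> 0" "c \<noteq> 0 \<or> d \<noteq> 0" for c d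
    proof -
      have n: "xa u \<ge> 0" "xb u \<ge> 0" for u using xaS xbS by (auto simp: sols_def)
      obtain p where p: "p \<in> S" "xa p \<noteq> 0" using xaS by (auto simp: sols_def)
      obtain q where q: "q \<in> S" "xb q \<noteq> 0" using xbS by (auto simp: sols_def)
      have "\<exists>w\<in>S. c * xa w + d * xb w \<noteq> 0"
      proof (cases "c = 0")
        case True then show ?thesis using q cd by auto
      next
        case False
        then have "c * xa p + d * xb p > 0" using p n[of p] cd by (intro add_pos_nonneg) (auto simp: less_le)
        then show ?thesis using p by (metis less_irrefl)
      qed
      then obtain w where w: "w \<in> S" "c * xa w + d * xb w \<noteq> 0" by blast
      show ?thesis
        by (rule solsI[of _ _ w]) (use w n cd xaS xbS in \<open>auto simp: sols_def lin_sum\<close>)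
    qed
    \<comment> \<open>A change of sign would give a ray on which the points of \<open>A\<close> and
      \<open>C\<close> coincide, contrary to \<open>good2\<close>.\<close>
    have sgn: "(R xa > 0) = (R xb > 0)"
    proof (rule ccontr)
      assume ne: "(R xa > 0) \<noteq> (R xb > 0)"
      have "(\<lambda>v. \<bar>R xb\<bar> * xa v + \<bar>R xa\<bar> * xb v) \<in> sols 4 P S"
        by (rule comb_sol) (use Rnz[OF xaS] in auto)
      then have "\<bar>R xb\<bar> * R xa + \<bar>R xa\<bar> * R xb \<noteq> 0" using Rnz Rlin by metis
      then show False using ne Rnz[OF xaS] Rnz[OF xbS] by (auto simp: abs_if)
    qed
    show ?thesis
    proof (cases "R xa > 0")
      case False
      have "sph (\<lambda>t. below2 A B C s t r) = sph (\<lambda>t. 0)"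
      proof (rule sph_cong)
        fix t assume t: "t \<in> faces" "card t = 3"
        have "\<not> (sol3 A B C s t r lam mu nu \<and> sum lam s < sum nu r)" for lam mu nu
        proof
          assume a: "sol3 A B C s t r lam mu nu \<and> sum lam s < sum nu r"
          then have "sol2 A C s r lam nu" using sol3_pairs(2)[OF _ s(1) t(1) s(2) g(1-3)] by blast
          then have x: "case_sum lam nu \<in> sols 4 P S" unfolding solS by simp
          then obtain c d where cd: "c \<ge> 0" "d \<ge> 0" "case_sum lam nu = (\<lambda>v. c * xa v + d * xb v)" using comb by blast
          have "R (case_sum lam nu) = c * R xa + d * R xb" using cd(3) Rlin by metis
          also have "\<dots> \<le> 0" using False sgn cd(1,2) by (simp add: mult_nonneg_nonpos add_nonpos_nonpos)
          finally show False using a by (simp add: R_def)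
        qed
        then show "below2 A B C s t r = 0" unfolding below2_def by auto
      qed
      then show ?thesis using sh ha hb False sgn by simp
    next
      case True
      obtain sa ra where sa: "sa \<subseteq> s" "ra \<subseteq> r" "S - {a} = sa <+> ra" using Plus_subset[of "S-{a}" s r] unfolding S_def by blast
      obtain sb rb where sb: "sb \<subseteq> s" "rb \<subseteq> r" "S - {b} = sb <+> rb" using Plus_subset[of "S-{b}" s r] unfolding S_def by blast
      have fi: "finite sa" "finite ra" "finite sb" "finite rb"
        using finite_subset[OF sa(1) fs(1)] finite_subset[OF sa(2) fs(2)] finite_subset[OF sb(1) fs(1)] finite_subset[OF sb(2) fs(2)] by auto
      have "card (S - {a}) = 5" "card (S - {b}) = 5" using cardS finS ab by auto
      then have ca: "card sa + card ra = 5" and cb: "card sb + card rb = 5"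
        unfolding sa(3) sb(3) using fi by (auto simp: card_Plus)
      have sola: "sol2 A C sa ra (\<lambda>v. xa (Inl v)) (\<lambda>v. xa (Inr v))" using xa unfolding sa(3) P_def sols_diff_config[OF fi(1,2)] .
      have solb: "sol2 A C sb rb (\<lambda>v. xb (Inl v)) (\<lambda>v. xb (Inr v))" using xb unfolding sb(3) P_def sols_diff_config[OF fi(3,4)] .
      have gga: "crossings B (pp xa) (ww xa) (pp xb) (ww xb) = ci xa + ci xb"
        unfolding pp_def ww_def ci_def
        by (rule crossings_facets[OF g(1,2,4,5) s v sa(1,2) ca sola sb(1,2) cb solb])
      have "sph (\<lambda>t. below2 A B C s t r) = crossings B (pp xa) (ww xa) (pp xb) (ww xb)"
        unfolding crossings_def
      proof (rule sph_cong)
        fix t assume t: "t \<in> faces" "card t = 3"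
        have "(\<exists>lam mu nu. sol3 A B C s t r lam mu nu \<and> sum lam s < sum mu t \<and> sum lam s < sum nu r) \<longleftrightarrow>
         (\<exists>c d mu. 0 \<le> c \<and> 0 \<le> d \<and> wt t mu \<and> (c \<noteq> 0 \<or> d \<noteq> 0 \<or> (\<exists>v. mu v \<noteq> 0)) \<and>
           (\<forall>i<4. c * pp xa i + d * pp xb i = cmb B t mu i) \<and> c * ww xa + d * ww xb < sum mu t)" (is "?L \<longleftrightarrow> ?R")
        proof
          assume ?L
          then obtain lam mu nu where l: "sol3 A B C s t r lam mu nu" "sum lam s < sum mu t" by blast
          then have "sol2 A C s r lam nu" using sol3_pairs(2)[OF _ s(1) t(1) s(2) g(1-3)] by blast
          then have x: "case_sum lam nu \<in> sols 4 P S" unfolding solS by simp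
          then obtain c d where cd: "c \<ge> 0" "d \<ge> 0" "case_sum lam nu = (\<lambda>v. c * xa v + d * xb v)" using comb by blast
          have lam: "lam = (\<lambda>v. c * xa (Inl v) + d * xb (Inl v))"
          proof
            fix v show "lam v = c * xa (Inl v) + d * xb (Inl v)" using fun_cong[OF cd(3), of "Inl v"] by simp
          qed
          have "c \<noteq> 0 \<or> d \<noteq> 0" using x unfolding cd(3) by (auto simp: sols_def)
          moreover have "cmb A s lam i = c * pp xa i + d * pp xb i" for i unfolding lam pp_def by (rule cmb_lin)
          moreover have "sum lam s = c * ww xa + d * ww xb" unfolding lam ww_def by (rule sum_lin)
          ultimately show ?R using cd l by (intro exI[of _ c] exI[of _ d] exI[of _ mu]) (auto simp: sol3_def)
        next
          assume ?R
          then obtain c d mu where c: "0 \<le> c" "0 \<le> d" "wt t mu" "c \<noteq> 0 \<or> d \<noteq> 0 \<or> (\<exists>v. mu v \<noteq> 0)"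
            and e: "\<forall>i<4. c * pp xa i + d * pp xb i = cmb B t mu i" "c * ww xa + d * ww xb < sum mu t" by blast
          have cd: "c \<noteq> 0 \<or> d \<noteq> 0"
          proof (rule ccontr)
            assume n: "\<not> (c \<noteq> 0 \<or> d \<noteq> 0)"
            have "sol2 A B {} t (\<lambda>_. 0) mu" unfolding sol2_def using n c e by (auto simp: wt_def cmb_def)
            then show False using good2_nz(1)[OF g(1) face_empty t(1)] by blast
          qed
          have x: "(\<lambda>v. c * xa v + d * xb v) \<in> sols 4 P S" using comb_sol[OF c(1,2) cd] .
          define lam where "lam = (\<lambda>v. c * xa (Inl v) + d * xb (Inl v))"
          define nu where "nu = (\<lambda>v. c * xa (Inr v) + d * xb (Inr v))"
          have sol: "sol2 A C s r lam nu" using x unfolding solS lam_def nu_def .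
          have ce: "cmb A s lam i = c * pp xa i + d * pp xb i" for i unfolding lam_def pp_def by (rule cmb_lin)
          have se: "sum lam s = c * ww xa + d * ww xb" unfolding lam_def ww_def by (rule sum_lin)
          have "R (\<lambda>v. c * xa v + d * xb v) > 0"
          proof -
            have "c * R xa \<ge> 0" "d * R xb \<ge> 0" using True sgn c by simp_all
            moreover have "c * R xa > 0 \<or> d * R xb > 0" using True sgn c(1,2) cd by auto
            ultimately show ?thesis unfolding Rlin by linarith
          qed
          then have "sum lam s < sum nu r" by (simp add: R_def lam_def nu_def)
          moreover have "sol3 A B C s t r lam mu nu"
            using sol c(3) e(1) ce good2_nz(1)[OF g(2) s(1,2) sol] by (auto simp: sol3_def sol2_def)
          ultimately show ?L using e(2) se by (intro exI[of _ lam] exI[of _ mu] exI[of _ nu]) simp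
        qed
        then show "below2 A B C s t r = segment_below B (pp xa) (ww xa) (pp xb) (ww xb) t"
          unfolding below2_def segment_below_def by simp
      qed
      also have "\<dots> = h a + h b" unfolding gga ha hb using True sgn by (cases "ci xa"; cases "ci xb") auto
      finally show ?thesis using sh by simp
    qed
  qed
  finally show ?thesis ..
qed

text \<open>The crossings \<gamma> of edges of \<open>A\<close> with the shadow of \<open>B\<close>
  form an invariant cocycle, and \<open>linking A B = 0\<close> says that it vanishes on the half
  circle. By \<open>H1\<close> it is the coboundary of an invariant function, so
  \<open>sph_below2\<close> applies. The coboundary in \<open>r\<close> sums to zero over a closed
  sphere; the one in \<open>s\<close> gives the half circle and its antipode, with equal
  sums.\<close>

lemma below2_vanishes:
  assumes o: "odd_field A" "odd_field B" "odd_field C"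
    and g: "good2 A B" "good2 A C" "good2 B C" "good3 A B C" "good4 A B C" and e: "linking A B = 0"
  shows "k2 (\<lambda>s. sph (\<lambda>t. sph (\<lambda>r. below2 A B C s t r))) = 0"
proof -
  define \<gamma> where "\<gamma> = (\<lambda>s. sph (\<lambda>t. below A B s t))"
  have gT: "\<gamma> (T ` s) = \<gamma> s" for s
  proof -
    have "\<gamma> (T ` s) = sph (\<lambda>t. below A B (T ` s) (T ` t))" unfolding \<gamma>_def by (rule sph_T[symmetric])
    then show ?thesis by (simp add: below_T[OF o(1,2)] \<gamma>_def)
  qed
  have gb: "cobd \<gamma> s = 0" if s: "s \<in> faces" "card s = 3" for s
  proof -
    have "sph (\<lambda>t. cobd (\<lambda>s. below A B s t) s + cobd (\<lambda>t. below A B s t) t) = sph (\<lambda>t. 0)"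
      by (rule sph_cong) (simp add: below_cobd[OF g(1)] s)
    then have "sph (\<lambda>t. cobd (\<lambda>s. below A B s t) s) = 0" unfolding chsum_add sph_cobd by simp
    moreover have "sph (\<lambda>t. cobd (\<lambda>s. below A B s t) s) = cobd \<gamma> s"
      unfolding \<gamma>_def cobd_def chsum_def by (rule sum.swap)
    ultimately show ?thesis by simp
  qed
  obtain f where fT: "\<And>v. f (T v) = f v" and fe: "\<And>i v w. i \<in> I2 \<Longrightarrow> v \<in> s2 i \<Longrightarrow> w \<in> s2 i \<Longrightarrow> v \<noteq> w \<Longrightarrow> \<gamma> {v,w} = f v + f w"
    using H1[of \<gamma>] gT gb face_s2 card3 e unfolding linking_def \<gamma>_def[symmetric] by metis
  have fg: "crossings B (A v) 1 (A w) 1 = f v + f w" if s: "s \<in> faces" "v \<in> s" "w \<in> s" "v \<noteq> w" for s v w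
  proof -
    obtain i where i: "i \<in> I2" "s \<subseteq> s2 i \<or> s \<subseteq> T ` s2 i" using s(1) unfolding faces_def by blast
    have "\<gamma> {v,w} = f v + f w"
      using i(2)
    proof
      assume "s \<subseteq> s2 i" then show ?thesis using fe[OF i(1)] s by blast
    next
      assume "s \<subseteq> T ` s2 i"
      then have tv: "T v \<in> s2 i" "T w \<in> s2 i" using s(2,3) by auto
      have "T v \<noteq> T w" using s(4) by (metis TT)
      with tv have "\<gamma> {T v, T w} = f v + f w" using fe[OF i(1)] fT by metis
      then show ?thesis using gT[of "{v,w}"] by simp
    qed
    moreover have "below A B {v,w} t = segment_below B (A v) 1 (A w) 1 t" for t
      using pair_set[OF s(4), of A B t "\<lambda>_. 1"] unfolding below_def by simp
    then have "below A B {v,w} = segment_below B (A v) 1 (A w) 1" by (rule ext)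
    ultimately show ?thesis unfolding crossings_def \<gamma>_def by simp
  qed
  have "k2 (\<lambda>s. sph (\<lambda>t. sph (\<lambda>r. below2 A B C s t r))) = k2 (\<lambda>s. sph (\<lambda>r. sph (\<lambda>t. below2 A B C s t r)))"
    by (subst (2) chsum_swap) (rule refl)
  also have "\<dots> = k2 (\<lambda>s. sph (\<lambda>r. cobd (\<lambda>s. chi_below f A B C s r) s + cobd (\<lambda>r. chi_below f A B C s r) r))"
    by (rule k2_cong, rule sph_cong, rule sph_below2[OF g fg]) auto
  also have "\<dots> = sph (\<lambda>r. k2 (cobd (\<lambda>s. chi_below f A B C s r))) + k2 (\<lambda>s. sph (cobd (\<lambda>r. chi_below f A B C s r)))"
    unfolding chsum_add by (subst chsum_swap) simp
  also have "\<dots> = sph (\<lambda>r. k1 (\<lambda>s. chi_below f A B C s r)) + sph (\<lambda>r. k1 (\<lambda>s. chi_below f A B C (T ` s) r))"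
    unfolding sph_cobd bd2 chsum_add by simp
  also have "sph (\<lambda>r. k1 (\<lambda>s. chi_below f A B C (T ` s) r)) = sph (\<lambda>r. k1 (\<lambda>s. chi_below f A B C (T ` s) (T ` r)))"
    by (rule sph_T[symmetric])
  also have "\<dots> = sph (\<lambda>r. k1 (\<lambda>s. chi_below f A B C s r))" by (simp add: chi_below_T[where f = f, OF o fT])
  finally show ?thesis by simp
qed

text \<open>The total in \<open>below2_total\<close> is odd and splits according to the farthest
  point. If each field had a vanishing linking parity with one of the other two, all three terms
  would be zero.\<close>

theorem linking_triple:
  assumes o: "odd_field A" "odd_field B" "odd_field C"
    and g2: "good2 A B" "good2 A C" "good2 B C"
    and g3: "good3 A B C" "good3 A C B" "good3 B A C" "good3 B C A" "good3 C A B" "good3 C B A"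
    and g4: "good4 A B C" "good4 A C B" "good4 B A C" "good4 B C A" "good4 C A B" "good4 C B A"
  shows "\<not> ((linking A B = 0 \<or> linking A C = 0) \<and> (linking B A = 0 \<or> linking B C = 0) \<and> (linking C A = 0 \<or> linking C B = 0))"
proof
  assume *: "(linking A B = 0 \<or> linking A C = 0) \<and> (linking B A = 0 \<or> linking B C = 0) \<and> (linking C A = 0 \<or> linking C B = 0)"
  have z: "k2 (\<lambda>s. sph (\<lambda>t. sph (\<lambda>r. below2 X Y Z s t r))) = 0"
    if "odd_field X" "odd_field Y" "odd_field Z" "good2 X Y" "good2 X Z" "good2 Y Z" "good3 X Y Z" "good4 X Y Z"
      "good3 X Z Y" "good4 X Z Y" "linking X Y = 0 \<or> linking X Z = 0" for X Y Z
  proof (cases "linking X Y = 0")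
    case True show ?thesis by (rule below2_vanishes) (fact that True)+
  next
    case False
    then have "linking X Z = 0" using that by blast
    then have "k2 (\<lambda>s. sph (\<lambda>r. sph (\<lambda>t. below2 X Z Y s r t))) = 0"
      by (intro below2_vanishes) (use that good2_swap in simp_all)
    moreover have "below2 X Z Y s r t = below2 X Y Z s t r" for s t r
      unfolding below2_def sol3_perm(1)[of X Z Y s r t] by (rule arg_cong[where f = of_bool]) blast
    ultimately show ?thesis by (subst (2) chsum_swap) simp
  qed
  have A: "sph (\<lambda>s. sph (\<lambda>t. k2 (\<lambda>r. below2 A B C s t r))) = 0"
    by (subst sph_rotate) (use below2_T o z[of A B C] g2 g3 g4 * in auto)
  have B: "sph (\<lambda>s. sph (\<lambda>t. k2 (\<lambda>r. below2 B A C t s r))) = 0"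
    by (subst chsum_swap, subst sph_rotate) (use below2_T o z[of B A C] g2 good2_swap g3 g4 * in auto)
  have C: "sph (\<lambda>s. sph (\<lambda>t. k2 (\<lambda>r. below2 C A B r s t))) = 0"
  proof -
    have "sph (\<lambda>s. sph (\<lambda>t. k2 (\<lambda>r. below2 C A B r s t))) = sph (\<lambda>s. k2 (\<lambda>r. sph (\<lambda>t. below2 C A B r s t)))"
      by (subst (2) chsum_swap) (rule refl)
    also have "\<dots> = k2 (\<lambda>r. sph (\<lambda>s. sph (\<lambda>t. below2 C A B r s t)))" by (rule chsum_swap)
    also have "\<dots> = 0" by (rule z) (use o g2 good2_swap g3 g4 * in auto)
    finally show ?thesis .
  qed
  show False using below2_total[OF o g2 g3(1)] A B C by simp
qed

end

section \<open>Cyclic families of odd fields\<close>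

context antipodal_sphere
begin

text \<open>Negating \<open>A\<close> amounts to applying \<open>T\<close> to its simplices, and the
  sum over the sphere of \<open>B\<close> is unchanged if \<open>T\<close> is applied there as
  well.\<close>

lemma linking_neg:
  assumes o: "odd_field A" "odd_field B" and A': "\<And>v i. A' v i = - A v i"
  shows "linking A' B = linking A B"
proof -
  have c: "cmb A' s lam i = cmb A (T ` s) (\<lambda>v. lam (T v)) i" for s lam i
    unfolding cmb_T[OF o(1)] unfolding cmb_def by (simp add: A' sum_negf)
  have 1: "below A B (T ` s) t = 1" if "below A' B s t = 1" for s t
  proof -
    obtain lam mu where h: "sol2 A' B s t lam mu" "sum lam s < sum mu t" using \<open>below A' B s t = 1\<close> unfolding below_def by (auto split: if_splits simp: of_bool_def)
    have "sol2 A B (T ` s) t (\<lambda>v. lam (T v)) mu" using h(1) c wt_T[of s lam] nz_T[of lam] unfolding sol2_def by metis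
    moreover have "sum (\<lambda>v. lam (T v)) (T ` s) < sum mu t" using h(2) by (simp only: sum_T)
    ultimately have "\<exists>lam mu. sol2 A B (T ` s) t lam mu \<and> sum lam (T ` s) < sum mu t" by blast
    then show ?thesis unfolding below_def by simp
  qed
  have 2: "below A' B s t = 1" if "below A B (T ` s) t = 1" for s t
  proof -
    obtain lam mu where h: "sol2 A B (T ` s) t lam mu" "sum lam (T ` s) < sum mu t" using \<open>below A B (T ` s) t = 1\<close> unfolding below_def by (auto split: if_splits simp: of_bool_def)
    have l: "(\<lambda>v. lam (T (T v))) = lam" by simp
    have "sol2 A' B s t (\<lambda>v. lam (T v)) mu"
      using h(1) c[of s "\<lambda>v. lam (T v)"] wt_T[of "T ` s" lam] nz_T[of lam] unfolding sol2_def by (simp add: l)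
    moreover have "sum (\<lambda>v. lam (T v)) s = sum lam (T ` s)" using sum_T[of "\<lambda>v. lam (T v)" s] by simp
    ultimately have "\<exists>lam mu. sol2 A' B s t lam mu \<and> sum lam s < sum mu t" using h(2) by metis
    then show ?thesis unfolding below_def by simp
  qed
  have z: "below A' B s t = below A B (T ` s) t" for s t using 1[of s t] 2[of s t] by (metis bit_not_one_iff)
  have "linking A' B = k1 (\<lambda>s. sph (\<lambda>t. below A B (T ` s) t))" unfolding linking_def z ..
  also have "\<dots> = k1 (\<lambda>s. sph (\<lambda>t. below A B (T ` s) (T ` t)))"
  proof -
    have "sph (\<lambda>t. below A B (T ` s) t) = sph (\<lambda>t. below A B (T ` s) (T ` t))" for s by (rule sph_T[symmetric])
    then show ?thesis by simp
  qed
  finally show ?thesis unfolding below_T[OF o] linking_def .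
qed

theorem cyclic_impossible:
  fixes F :: "nat \<Rightarrow> 'v \<Rightarrow> nat \<Rightarrow> real"
  assumes n: "n \<ge> 2" and o: "\<And>j. odd_field (F j)" and neg: "\<And>v i. F n v i = - F 0 v i"
    and inv: "\<And>i j. linking (F (Suc i)) (F (Suc j)) = linking (F i) (F j)"
    and g2: "\<And>i j. i < n \<Longrightarrow> j < n \<Longrightarrow> i \<noteq> j \<Longrightarrow> good2 (F i) (F j)"
    and g3: "\<And>i j k. i < n \<Longrightarrow> j < n \<Longrightarrow> k < n \<Longrightarrow> distinct [i,j,k] \<Longrightarrow> good3 (F i) (F j) (F k)"
    and g4: "\<And>i j k. i < n \<Longrightarrow> j < n \<Longrightarrow> k < n \<Longrightarrow> distinct [i,j,k] \<Longrightarrow> good4 (F i) (F j) (F k)"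
  shows False
proof -
  define e where "e = (\<lambda>j. linking (F 0) (F j))"
  have sh: "linking (F (i + k)) (F (j + k)) = linking (F i) (F j)" for i j k
    by (induction k) (simp_all add: inv)
  \<comment> \<open>Shift by \<open>n - j\<close> steps: the first argument becomes the
    \<open>n\<close>-th field, which is the negative of the zeroth.\<close>
  have en: "linking (F j) (F 0) = e (n - j)" if "j \<le> n" for j
  proof -
    have "linking (F j) (F 0) = linking (F n) (F (n - j))" using sh[of j "n - j" 0] that by simp
    also have "\<dots> = e (n - j)" unfolding e_def by (rule linking_neg[OF o o neg])
    finally show ?thesis .
  qed
  have sum1: "e j + e (n - j) = 1" if "0 < j" "j < n" for j
    using linking_sum[OF o o g2[of 0 j]] en[of j] that n unfolding e_def by simp
  have comp: "linking (F j) (F i) = 1 + linking (F i) (F j)" if "i < n" "j < n" "i \<noteq> j" for i j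
    using linking_sum[OF o o g2[OF that]] by (cases "linking (F i) (F j)"; cases "linking (F j) (F i)") auto
  have eij: "linking (F i) (F j) = e (j - i)" if "i \<le> j" for i j
    using sh[of 0 i "j - i"] that unfolding e_def by simp
  \<comment> \<open>Among the fields \<open>0\<close>, \<open>1\<close> and \<open>k + 1\<close> the
    middle one always has a vanishing parity, since its two parities are \<open>1 + e 1\<close> and
    \<open>e k = e 1\<close>. So one of the outer fields links with both others, which means that
    \<open>e 1\<close> and \<open>e (Suc k)\<close> are both 1 or both 0.\<close>
  have step: "e (Suc k) = e 1" if k: "e k = e 1" "0 < k" "Suc k < n" for k
  proof -
    have d: "0 < n" "1 < n" "Suc k < n" using k by auto
    have t: "\<not> ((linking (F 0) (F 1) = 0 \<or> linking (F 0) (F (Suc k)) = 0) \<and> (linking (F 1) (F 0) = 0 \<or> linking (F 1) (F (Suc k)) = 0) \<and>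
        (linking (F (Suc k)) (F 0) = 0 \<or> linking (F (Suc k)) (F 1) = 0))"
      by (rule linking_triple) (use o d k in \<open>auto intro!: g2 g3 g4\<close>)
    have "linking (F 0) (F 1) = e 1" "linking (F 0) (F (Suc k)) = e (Suc k)" "linking (F 1) (F 0) = 1 + e 1"
      "linking (F 1) (F (Suc k)) = e 1" "linking (F (Suc k)) (F 0) = 1 + e (Suc k)" "linking (F (Suc k)) (F 1) = 1 + e 1"
      using comp[of 0 1] comp[of 0 "Suc k"] comp[of 1 "Suc k"] eij[of 1 "Suc k"] k d by (auto simp: e_def)
    then show ?thesis using t by (cases "e 1"; cases "e (Suc k)") auto
  qed
  have "0 < k \<Longrightarrow> k < n \<Longrightarrow> e k = e 1" for k
  proof (induction k)
    case (Suc k)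
    then show ?case using step[of k] by (cases "k = 0") auto
  qed simp
  from this[of "n - 1"] have "e (n - 1) = e 1" using n by simp
  then show False using sum1[of 1] n by simp
qed

end

section \<open>Rotations of the target and real coordinates\<close>

text \<open>The components turn in opposite directions because the map to be twisted is
  \<open>(Z * cnj V, V)\<close>: a root of unity on \<open>V\<close> comes with its conjugate on the
  first component as long as \<open>Z\<close> is the same.\<close>

definition twist :: "real \<Rightarrow> C2 \<Rightarrow> C2" where
  "twist \<theta> x = (cis (- \<theta>) * fst x, cis \<theta> * snd x)"

lemma twist_add: "twist (\<theta> + \<phi>) x = twist \<theta> (twist \<phi> x)"
proof -
  have "cis (- (\<theta> + \<phi>)) = cis (- \<theta>) * cis (- \<phi>)" by (simp add: cis_mult)
  then show ?thesis by (simp add: twist_def cis_mult[symmetric] mult.assoc)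
qed

lemma twist_0 [simp]: "twist 0 x = x" by (simp add: twist_def)

lemma twist_pi: "twist pi x = - x"
  by (simp add: twist_def cis.ctr complex_eq_iff prod_eq_iff)

lemma twist_linear: "twist \<theta> (x + y) = twist \<theta> x + twist \<theta> y" "twist \<theta> (c *\<^sub>R x) = c *\<^sub>R twist \<theta> x" "twist \<theta> (- x) = - twist \<theta> x"
  "twist \<theta> (x - y) = twist \<theta> x - twist \<theta> y" "twist \<theta> 0 = 0"
  by (auto simp: twist_def algebra_simps prod_eq_iff scaleR_conv_of_real)

lemma twist_sum: "twist \<theta> (\<Sum>v\<in>s. c v *\<^sub>R f v) = (\<Sum>v\<in>s. c v *\<^sub>R twist \<theta> (f v))"
  by (induction s rule: infinite_finite_induct) (auto simp: twist_linear)

lemma norm_twist [simp]: "norm (twist \<theta> x) = norm x"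
  by (simp add: twist_def norm_prod_def norm_mult)

lemma twist_inverse [simp]: "twist \<theta> (twist (- \<theta>) x) = x" "twist (- \<theta>) (twist \<theta> x) = x"
  by (simp_all add: twist_add[symmetric])

definition coords :: "C2 \<Rightarrow> nat \<Rightarrow> real" where
  "coords x i = (if i = 0 then Re (fst x) else if i = 1 then Im (fst x) else if i = 2 then Re (snd x) else Im (snd x))"

lemma coords_eq: "(\<forall>i<4. coords x i = coords y i) \<longleftrightarrow> x = y"
proof
  assume h: "\<forall>i<4. coords x i = coords y i"
  have "coords x 0 = coords y 0" "coords x 1 = coords y 1" "coords x 2 = coords y 2" "coords x 3 = coords y 3" using h by auto
  then show "x = y" by (simp add: coords_def prod_eq_iff complex_eq_iff)
qed simp

lemma coords_sum: "cmb (\<lambda>v. coords (p v)) s lam i = coords (\<Sum>v\<in>s. lam v *\<^sub>R p v) i"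
  unfolding cmb_def coords_def by (simp add: fst_sum snd_sum)

lemma coords_minus: "coords (- x) i = - coords x i" by (simp add: coords_def)

lemma coords_lin: "c * coords x i + coords y i = coords (c *\<^sub>R x + y) i" by (simp add: coords_def)

lemma sol2_coords:
  "sol2 (\<lambda>v. coords (p v)) (\<lambda>v. coords (q v)) s t lam mu \<longleftrightarrow> wt s lam \<and> wt t mu \<and> ((\<exists>v. lam v \<noteq> 0) \<or> (\<exists>v. mu v \<noteq> 0)) \<and>
     (\<Sum>v\<in>s. lam v *\<^sub>R p v) = (\<Sum>v\<in>t. mu v *\<^sub>R q v)"
  unfolding sol2_def coords_sum coords_eq ..

lemma sol3_coords:
  "sol3 (\<lambda>v. coords (p v)) (\<lambda>v. coords (q v)) (\<lambda>v. coords (z v)) s t r lam mu nu \<longleftrightarrow> wt s lam \<and> wt t mu \<and> wt r nu \<and>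
     (\<exists>v. lam v \<noteq> 0 \<or> mu v \<noteq> 0 \<or> nu v \<noteq> 0) \<and>
     (\<Sum>v\<in>s. lam v *\<^sub>R p v) = (\<Sum>v\<in>t. mu v *\<^sub>R q v) \<and> (\<Sum>v\<in>s. lam v *\<^sub>R p v) = (\<Sum>v\<in>r. nu v *\<^sub>R z v)"
  unfolding sol3_def coords_sum coords_eq ..

lemma orth_exists:
  fixes X :: "'e::euclidean_space set"
  assumes "finite X" "card X < DIM('e)"
  obtains w where "w \<noteq> 0" "\<And>x. x \<in> X \<Longrightarrow> w \<bullet> x = 0"
proof -
  have "dim X < DIM('e)" using dim_le_card'[OF assms(1)] assms(2) by linarith
  then obtain w where "w \<noteq> 0" "\<And>y. y \<in> span X \<Longrightarrow> orthogonal w y"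
    using orthogonal_to_subspace_exists by metis
  then show thesis using that span_base unfolding orthogonal_def by metis
qed

section \<open>General position\<close>

lemma small_tau:
  fixes f g e :: real
  assumes "g \<noteq> 0" "e > 0"
  obtains \<tau> where "0 \<le> \<tau>" "\<tau> < e" "f + \<tau> * g \<noteq> 0"
proof (cases "f = 0")
  case True
  show thesis by (rule that[of "e / 2"]) (use assms True in auto)
next
  case False
  show thesis by (rule that[of 0]) (use assms False in auto)
qed

lemma perturb_inner:
  fixes x d :: "'e::euclidean_space"
  assumes "d \<noteq> 0" "e > 0"
  obtains x' where "norm (x' - x) < e" "x' \<bullet> d \<noteq> 0"
proof -
  obtain \<tau> where t: "0 \<le> \<tau>" "\<tau> < e / norm d" "x \<bullet> d + \<tau> * (d \<bullet> d) \<noteq> 0"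
    using small_tau[of "d \<bullet> d" "e / norm d" "x \<bullet> d"] assms by auto
  show thesis
  proof (rule that[of "x + \<tau> *\<^sub>R d"])
    show "norm (x + \<tau> *\<^sub>R d - x) < e" using t(1,2) assms by (simp add: pos_less_divide_eq)
    show "(x + \<tau> *\<^sub>R d) \<bullet> d \<noteq> 0" using t(3) by (simp add: inner_add_left)
  qed
qed

text \<open>By dimension the vectors \<open>B u\<close> and \<open>Y\<close> have a common normal.
  If it is parallel to \<alpha>, it is tilted to \<open>\<alpha> + \<tau> *\<^sub>R \<gamma>\<close>
  with \<gamma> orthogonal to \<alpha> and \<open>Y\<close>, and the \<open>B u\<close> are
  projected to the new hyperplane.\<close>

lemma perturb_normal:
  fixes B :: "'v \<Rightarrow> 'e::euclidean_space"
  assumes "\<alpha> \<noteq> 0" "finite t" "finite Y" "card t + card Y < DIM('e)" "card Y + 1 < DIM('e)" "e > 0"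
  obtains B' \<beta> where "\<And>u. u \<in> t \<Longrightarrow> norm (B' u - B u) < e" "\<beta> \<notin> span {\<alpha>}"
    "\<And>u. u \<in> t \<Longrightarrow> \<beta> \<bullet> B' u = 0" "\<And>y. y \<in> Y \<Longrightarrow> \<beta> \<bullet> y = 0"
proof -
  have "card (B ` t \<union> Y) \<le> card t + card Y"
    using card_Un_le[of "B ` t" Y] card_image_le[OF assms(2), of B] by linarith
  then obtain \<beta> where b: "\<beta> \<noteq> 0" "\<And>x. x \<in> B ` t \<union> Y \<Longrightarrow> \<beta> \<bullet> x = 0"
    using orth_exists[of "B ` t \<union> Y"] assms by auto
  show thesis
  proof (cases "\<beta> \<in> span {\<alpha>}")
    case False
    show thesis by (rule that[of B \<beta>]) (use b False assms in auto)
  next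
    case True
    then obtain k where k: "\<beta> = k *\<^sub>R \<alpha>" unfolding span_singleton by blast
    then have k0: "k \<noteq> 0" using b(1) by auto
    have aB: "\<alpha> \<bullet> x = 0" if "x \<in> B ` t \<union> Y" for x using b(2)[OF that] k k0 by simp
    have "card (insert \<alpha> Y) < DIM('e)" using assms(3,5) card_insert_le_m1 by (metis Suc_eq_plus1 card_insert_if le_less_trans lessI less_imp_le_nat)
    then obtain \<gamma> where g: "\<gamma> \<noteq> 0" "\<And>x. x \<in> insert \<alpha> Y \<Longrightarrow> \<gamma> \<bullet> x = 0"
      using orth_exists[of "insert \<alpha> Y"] assms(3) by auto
    define M where "M = 1 + (\<Sum>u\<in>t. \<bar>B u \<bullet> \<gamma>\<bar>)"
    have M: "M > 0" "\<bar>B u \<bullet> \<gamma>\<bar> < M" if "u \<in> t" for u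
    proof -
      have "\<bar>B u \<bullet> \<gamma>\<bar> \<le> (\<Sum>u\<in>t. \<bar>B u \<bullet> \<gamma>\<bar>)" using member_le_sum[of u t "\<lambda>u. \<bar>B u \<bullet> \<gamma>\<bar>"] that assms(2) by simp
      then show "\<bar>B u \<bullet> \<gamma>\<bar> < M" "M > 0" unfolding M_def using abs_ge_zero[of "B u \<bullet> \<gamma>"] by linarith+
    qed
    have M1: "M > 0" unfolding M_def by (intro add_pos_nonneg sum_nonneg) auto
    \<comment> \<open>The projection moves \<open>B u\<close> by at most
      \<open>\<tau> * \<bar>B u \<bullet> \<gamma>\<bar> / norm \<alpha>\<close>, and
      \<open>M\<close> exceeds all these inner products.\<close>
    define \<tau> where "\<tau> = e * norm \<alpha> / M"
    have tau: "\<tau> > 0" using M1 assms by (simp add: \<tau>_def)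
    define \<beta>' where "\<beta>' = \<alpha> + \<tau> *\<^sub>R \<gamma>"
    have ag: "\<alpha> \<bullet> \<gamma> = 0" using g(2)[of \<alpha>] by (simp add: inner_commute)
    have nb: "\<beta>' \<bullet> \<beta>' = (norm \<alpha>)\<^sup>2 + \<tau>\<^sup>2 * (norm \<gamma>)\<^sup>2"
      unfolding \<beta>'_def using ag by (simp add: inner_add inner_commute dot_square_norm[symmetric] power2_eq_square) (simp add: dot_square_norm power2_eq_square)
    have nb2: "norm \<beta>' \<ge> norm \<alpha>"
      using nb by (metis power2_norm_eq_inner abs_le_square_iff abs_norm_cancel le_add_same_cancel1 zero_le_mult_iff zero_le_power2)
    have b0: "\<beta>' \<noteq> 0" using nb2 assms(1) by auto
    define B' where "B' = (\<lambda>u. B u - ((B u \<bullet> \<beta>') / (\<beta>' \<bullet> \<beta>')) *\<^sub>R \<beta>')"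
    show thesis
    proof (rule that[of B' \<beta>'])
      fix u assume u: "u \<in> t"
      show "\<beta>' \<bullet> B' u = 0" unfolding B'_def using b0 by (simp add: inner_diff_right inner_commute)
      have "B u \<bullet> \<beta>' = \<tau> * (B u \<bullet> \<gamma>)"
        unfolding \<beta>'_def using aB[of "B u"] u by (simp add: inner_add_right inner_commute)
      then have "norm (B' u - B u) = \<tau> * \<bar>B u \<bullet> \<gamma>\<bar> / norm \<beta>'"
        unfolding B'_def using b0 tau by (simp add: abs_mult power2_norm_eq_inner[symmetric] power2_eq_square)
      also have "\<dots> \<le> \<tau> * \<bar>B u \<bullet> \<gamma>\<bar> / norm \<alpha>"
        using nb2 assms(1) tau b0 by (intro divide_left_mono) auto
      also have "\<dots> < \<tau> * M / norm \<alpha>" using M(2)[OF u] tau assms(1) by (simp add: divide_strict_right_mono)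
      also have "\<dots> = e" using M1 assms(1) by (simp add: \<tau>_def)
      finally show "norm (B' u - B u) < e" .
    next
      show "\<beta>' \<notin> span {\<alpha>}"
      proof
        assume "\<beta>' \<in> span {\<alpha>}"
        then obtain l where "\<beta>' = l *\<^sub>R \<alpha>" unfolding span_singleton by blast
        then have "\<beta>' \<bullet> \<gamma> = 0" using ag by simp
        then show False using ag g(1) tau unfolding \<beta>'_def by (simp add: inner_add_left)
      qed
      show "\<beta>' \<bullet> y = 0" if "y \<in> Y" for y
        using aB[of y] g(2)[of y] that unfolding \<beta>'_def by (simp add: inner_add_left)
    qed
  qed
qed

text \<open>The vector \<delta> is the combination of \<alpha> and \<beta> orthogonal to the first
  new vector. With \<open>G1' \<bullet> \<alpha>\<close> and \<open>G2' \<bullet> \<delta>\<close>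
  nonzero, the matrix of inner products with \<alpha> and \<delta> is triangular and
  invertible.\<close>

lemma two_generators:
  fixes G1 G2 \<alpha> \<beta> :: "'e::euclidean_space"
  assumes "\<alpha> \<noteq> 0" "\<beta> \<notin> span {\<alpha>}" "e > 0"
  obtains G1' G2' where "norm (G1' - G1) < e" "norm (G2' - G2) < e"
    "\<And>x y. (x *\<^sub>R G1' + y *\<^sub>R G2') \<bullet> \<alpha> = 0 \<Longrightarrow> (x *\<^sub>R G1' + y *\<^sub>R G2') \<bullet> \<beta> = 0 \<Longrightarrow> x *\<^sub>R G1' + y *\<^sub>R G2' = 0"
proof -
  obtain G1' where 1: "norm (G1' - G1) < e" "G1' \<bullet> \<alpha> \<noteq> 0" using perturb_inner[OF assms(1,3)] .
  define \<delta> where "\<delta> = (G1' \<bullet> \<alpha>) *\<^sub>R \<beta> - (G1' \<bullet> \<beta>) *\<^sub>R \<alpha>"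
  have d: "\<delta> \<noteq> 0"
  proof
    assume "\<delta> = 0"
    then have "(G1' \<bullet> \<alpha>) *\<^sub>R \<beta> = (G1' \<bullet> \<beta>) *\<^sub>R \<alpha>" unfolding \<delta>_def by simp
    then have "\<beta> = ((G1' \<bullet> \<beta>) / (G1' \<bullet> \<alpha>)) *\<^sub>R \<alpha>" using 1(2)
      by (metis divideR_right scaleR_scaleR divide_inverse mult.commute)
    then show False using assms(2) unfolding span_singleton by blast
  qed
  obtain G2' where 2: "norm (G2' - G2) < e" "G2' \<bullet> \<delta> \<noteq> 0" using perturb_inner[OF d assms(3)] .
  have "x *\<^sub>R G1' + y *\<^sub>R G2' = 0" if "(x *\<^sub>R G1' + y *\<^sub>R G2') \<bullet> \<alpha> = 0" "(x *\<^sub>R G1' + y *\<^sub>R G2') \<bullet> \<beta> = 0" for x y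
  proof -
    have "(x *\<^sub>R G1' + y *\<^sub>R G2') \<bullet> \<delta> = 0" using that unfolding \<delta>_def by (simp add: inner_diff_right)
    moreover have "G1' \<bullet> \<delta> = 0" unfolding \<delta>_def by (simp add: inner_diff_right)
    ultimately have "y = 0" using 2(2) by (simp add: inner_add_left)
    then have "x = 0" using that(1) 1(2) by simp
    then show ?thesis using \<open>y = 0\<close> by simp
  qed
  then show thesis using that 1(1) 2(1) by blast
qed

lemma perturb_independent:
  fixes X :: "'u \<Rightarrow> 'e::euclidean_space"
  assumes "finite S" "card S \<le> DIM('e)" "e > 0"
  shows "\<exists>X'. (\<forall>u. norm (X' u - X u) < e) \<and> (\<forall>c. (\<Sum>u\<in>S. c u *\<^sub>R X' u) = 0 \<longrightarrow> (\<forall>u\<in>S. c u = 0))"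
  using assms(1,2)
proof (induction S rule: finite_induct)
  case empty
  then show ?case using assms(3) by (intro exI[of _ X]) simp
next
  case (insert v S)
  then obtain X' where X': "\<And>u. norm (X' u - X u) < e" "\<And>c. (\<Sum>u\<in>S. c u *\<^sub>R X' u) = 0 \<Longrightarrow> \<forall>u\<in>S. c u = 0"
    by auto
  have "card (X' ` S) < DIM('e)" using insert card_image_le[OF insert(1), of X'] by simp
  then obtain w where w: "w \<noteq> 0" "\<And>x. x \<in> X' ` S \<Longrightarrow> w \<bullet> x = 0" using orth_exists[of "X' ` S"] insert(1) by auto
  obtain y where y: "norm (y - X v) < e" "y \<bullet> w \<noteq> 0" using perturb_inner[OF w(1) assms(3)] .
  define X2 where "X2 = X'(v := y)"
  have "\<forall>u\<in>insert v S. c u = 0" if "(\<Sum>u\<in>insert v S. c u *\<^sub>R X2 u) = 0" for c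
  proof -
    have "(\<Sum>u\<in>S. c u *\<^sub>R X2 u) = (\<Sum>u\<in>S. c u *\<^sub>R X' u)"
      by (rule sum.cong) (use insert(2) in \<open>auto simp: X2_def\<close>)
    then have e: "c v *\<^sub>R y + (\<Sum>u\<in>S. c u *\<^sub>R X' u) = 0" using that insert(1,2) by (simp add: X2_def)
    have "w \<bullet> (\<Sum>u\<in>S. c u *\<^sub>R X' u) = 0" by (simp add: inner_sum_right w(2))
    then have "w \<bullet> (c v *\<^sub>R y) = 0" using arg_cong[OF e, of "\<lambda>x. w \<bullet> x"] by (simp add: inner_add_right)
    then have "c v = 0" using y(2) by (simp add: inner_commute)
    then show ?thesis using e X'(2)[of c] by auto
  qed
  moreover have "norm (X2 u - X u) < e" for u unfolding X2_def using X'(1) y(1) by simp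
  ultimately show ?case by (intro exI[of _ X2]) blast
qed

lemma hull_weights:
  assumes "finite S" "y \<in> convex hull (f ` S)"
  obtains x where "\<And>u. u \<in> S \<Longrightarrow> 0 \<le> x u" "sum x S = 1" "(\<Sum>u\<in>S. x u *\<^sub>R f u) = y"
proof -
  define C where "C = {y. \<exists>x. (\<forall>u\<in>S. 0 \<le> x u) \<and> sum x S = 1 \<and> (\<Sum>u\<in>S. x u *\<^sub>R f u) = y}"
  have "f ` S \<subseteq> C"
  proof clarify
    fix v assume v: "v \<in> S"
    then show "f v \<in> C" unfolding C_def mem_Collect_eq
      using assms(1) by (intro exI[of _ "\<lambda>u. if u = v then 1 else 0"]) (auto simp: if_distrib[of "\<lambda>c. c *\<^sub>R _"] cong: if_cong)
  qed
  moreover have "convex C"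
  proof (rule convexI)
    fix p q and a b :: real assume pq: "p \<in> C" "q \<in> C" and ab: "0 \<le> a" "0 \<le> b" "a + b = 1"
    obtain x where x: "\<forall>u\<in>S. 0 \<le> x u" "sum x S = 1" "(\<Sum>u\<in>S. x u *\<^sub>R f u) = p" using pq unfolding C_def by blast
    obtain z where z: "\<forall>u\<in>S. 0 \<le> z u" "sum z S = 1" "(\<Sum>u\<in>S. z u *\<^sub>R f u) = q" using pq unfolding C_def by blast
    have "(\<Sum>u\<in>S. (a * x u + b * z u) *\<^sub>R f u) = a *\<^sub>R p + b *\<^sub>R q"
      unfolding x(3)[symmetric] z(3)[symmetric] by (simp add: scaleR_add_left sum.distrib scaleR_sum_right)
    moreover have "(\<Sum>u\<in>S. a * x u + b * z u) = 1" using x z ab by (simp add: sum.distrib sum_distrib_left[symmetric])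
    ultimately show "a *\<^sub>R p + b *\<^sub>R q \<in> C" unfolding C_def mem_Collect_eq
      using x z ab by (intro exI[of _ "\<lambda>u. a * x u + b * z u"]) auto
  qed
  ultimately have "convex hull (f ` S) \<subseteq> C" by (rule hull_minimal)
  then show thesis using assms(2) that unfolding C_def by blast
qed

definition unsolvable :: "'u set \<Rightarrow> ('u \<Rightarrow> 'e::real_vector) \<Rightarrow> bool" where
  "unsolvable S P \<longleftrightarrow> \<not> (\<exists>x. (\<forall>u\<in>S. 0 \<le> x u) \<and> (\<exists>u\<in>S. x u \<noteq> 0) \<and> (\<Sum>u\<in>S. x u *\<^sub>R P u) = (0::'e))"

text \<open>Unsolvability says that the origin is outside the convex hull of the vectors. The hull
  is compact, and its distance from the origin serves as tolerance.\<close>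

lemma unsolvable_open:
  fixes P :: "'u \<Rightarrow> 'e::euclidean_space"
  assumes "finite S" "unsolvable S P"
  obtains d where "d > 0" "\<And>P'. (\<And>u. u \<in> S \<Longrightarrow> norm (P' u - P u) < d) \<Longrightarrow> unsolvable S P'"
proof -
  define K where "K = convex hull (P ` S)"
  have K: "compact K" unfolding K_def using assms(1) by (intro compact_convex_hull finite_imp_compact) auto
  have "0 \<notin> K"
  proof
    assume "0 \<in> K"
    then obtain x where x: "\<And>u. u \<in> S \<Longrightarrow> 0 \<le> x u" "sum x S = 1" "(\<Sum>u\<in>S. x u *\<^sub>R P u) = 0"
      using hull_weights[OF assms(1)] unfolding K_def by metis
    then have "\<exists>u\<in>S. x u \<noteq> 0" by (metis sum.neutral zero_neq_one)
    then show False using assms(2) x unfolding unsolvable_def by blast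
  qed
  then obtain d where d: "d > 0" "\<And>y. y \<in> K \<Longrightarrow> d \<le> norm y"
    using separate_point_closed[OF compact_imp_closed[OF K], of 0] by (auto simp: dist_norm)
  have "unsolvable S P'" if P': "\<And>u. u \<in> S \<Longrightarrow> norm (P' u - P u) < d" for P'
    unfolding unsolvable_def
  proof
    assume "\<exists>x. (\<forall>u\<in>S. 0 \<le> x u) \<and> (\<exists>u\<in>S. x u \<noteq> 0) \<and> (\<Sum>u\<in>S. x u *\<^sub>R P' u) = 0"
    then obtain x where x: "\<forall>u\<in>S. 0 \<le> x u" "\<exists>u\<in>S. x u \<noteq> 0" "(\<Sum>u\<in>S. x u *\<^sub>R P' u) = 0" by blast
    define L where "L = sum x S"
    obtain w where w: "w \<in> S" "x w \<noteq> 0" using x(2) by blast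
    have L: "L > 0" unfolding L_def using x(1) w assms(1) by (intro sum_pos2[of S w]) (auto simp: less_le)
    have "(\<Sum>u\<in>S. (x u / L) *\<^sub>R P u) \<in> K"
      unfolding K_def by (rule convex_sum) (use assms(1) x L in \<open>auto simp: L_def sum_divide_distrib[symmetric] hull_inc\<close>)
    then have "d \<le> norm (\<Sum>u\<in>S. (x u / L) *\<^sub>R P u)" using d by blast
    also have "(\<Sum>u\<in>S. (x u / L) *\<^sub>R P u) = (1 / L) *\<^sub>R (\<Sum>u\<in>S. x u *\<^sub>R P u)"
      by (simp add: scaleR_sum_right)
    also have "(\<Sum>u\<in>S. x u *\<^sub>R P u) = (\<Sum>u\<in>S. x u *\<^sub>R (P u - P' u))"
      using x(3) by (simp add: scaleR_diff_right sum_subtractf)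
    also have "norm ((1 / L) *\<^sub>R (\<Sum>u\<in>S. x u *\<^sub>R (P u - P' u))) < d"
    proof -
      have "norm (\<Sum>u\<in>S. x u *\<^sub>R (P u - P' u)) \<le> (\<Sum>u\<in>S. x u * norm (P u - P' u))"
        using x(1) by (intro sum_norm_le) simp
      also have "\<dots> < (\<Sum>u\<in>S. x u * d)"
      proof (rule sum_strict_mono_ex1[OF assms(1)])
        show "\<forall>u\<in>S. x u * norm (P u - P' u) \<le> x u * d"
          using x(1) P' by (auto intro!: mult_left_mono simp: norm_minus_commute less_imp_le)
        show "\<exists>u\<in>S. x u * norm (P u - P' u) < x u * d"
          using w x(1) P' by (intro bexI[of _ w] mult_strict_left_mono) (auto simp: norm_minus_commute less_le)
      qed
      also have "\<dots> = L * d" by (simp add: L_def sum_distrib_right)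
      finally show ?thesis using L by (simp add: pos_divide_less_eq mult.commute)
    qed
    finally show False by simp
  qed
  then show thesis using that d(1) by blast
qed

lemma cis_sin_le: "\<bar>sin (a - b)\<bar> \<le> norm (cis a - cis b)" "\<bar>sin (a - b)\<bar> \<le> norm (cis a + cis b)"
proof -
  have 1: "cis a - cis b = cis b * (cis (a - b) - 1)" "cis a + cis b = cis b * (cis (a - b) + 1)"
    by (simp_all add: algebra_simps cis_mult)
  show "\<bar>sin (a - b)\<bar> \<le> norm (cis a - cis b)" "\<bar>sin (a - b)\<bar> \<le> norm (cis a + cis b)"
    unfolding 1 norm_mult using abs_Im_le_cmod[of "cis (a - b) - 1"] abs_Im_le_cmod[of "cis (a - b) + 1"] by simp_all
qed

text \<open>The sum is bounded as well as the difference, since an orbit consists of a vertex and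
  its antipode with the negative value.\<close>

lemma twist_diff_ge: "\<bar>sin (a - b)\<bar> * norm x \<le> norm (twist a x - twist b x)" "\<bar>sin (a - b)\<bar> * norm x \<le> norm (twist a x + twist b x)"
proof -
  define s where "s = \<bar>sin (a - b)\<bar>"
  have s': "\<bar>sin (- a - - b)\<bar> = s" unfolding s_def by (metis abs_minus_cancel minus_diff_minus sin_minus)
  have key: "s * norm x \<le> norm y" if "norm (fst y) \<ge> s * norm (fst x)" "norm (snd y) \<ge> s * norm (snd x)" for y :: C2
  proof -
    have s0: "s \<ge> 0" by (simp add: s_def)
    have "s * norm x = sqrt ((s * norm (fst x))\<^sup>2 + (s * norm (snd x))\<^sup>2)"
      unfolding norm_prod_def power_mult_distrib distrib_left[symmetric] using s0 by (simp add: real_sqrt_mult)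
    also have "\<dots> \<le> norm y"
      unfolding norm_prod_def using that s0 by (intro real_sqrt_le_mono add_mono power_mono) auto
    finally show ?thesis .
  qed
  show "\<bar>sin (a - b)\<bar> * norm x \<le> norm (twist a x - twist b x)"
    unfolding s_def[symmetric]
  proof (rule key)
    have "fst (twist a x - twist b x) = (cis (- a) - cis (- b)) * fst x" "snd (twist a x - twist b x) = (cis a - cis b) * snd x"
      by (simp_all add: twist_def algebra_simps)
    then show "s * norm (fst x) \<le> norm (fst (twist a x - twist b x))" "s * norm (snd x) \<le> norm (snd (twist a x - twist b x))"
      using cis_sin_le(1)[of a b] cis_sin_le(1)[of "-a" "-b"] s' unfolding s_def
      by (auto simp: norm_mult intro!: mult_right_mono)
  qed
  show "\<bar>sin (a - b)\<bar> * norm x \<le> norm (twist a x + twist b x)"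
    unfolding s_def[symmetric]
  proof (rule key)
    have "fst (twist a x + twist b x) = (cis (- a) + cis (- b)) * fst x" "snd (twist a x + twist b x) = (cis a + cis b) * snd x"
      by (simp_all add: twist_def algebra_simps)
    then show "s * norm (fst x) \<le> norm (fst (twist a x + twist b x))" "s * norm (snd x) \<le> norm (snd (twist a x + twist b x))"
      using cis_sin_le(2)[of a b] cis_sin_le(2)[of "-a" "-b"] s' unfolding s_def
      by (auto simp: norm_mult intro!: mult_right_mono)
  qed
qed

lemma kappa_exists:
  fixes n :: nat
  shows "\<exists>\<kappa>>0. \<kappa> \<le> 1 \<and> (\<forall>i<n. \<forall>j<n. i \<noteq> j \<longrightarrow> \<kappa> \<le> \<bar>sin (pi * real i / real n - pi * real j / real n)\<bar>)"
proof -
  define D where "D = (\<lambda>(i,j). \<bar>sin (pi * real i / real n - pi * real j / real n)\<bar>) ` {(i,j). i < n \<and> j < n \<and> i \<noteq> j}"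
  have "{(i,j). i < n \<and> j < n \<and> i \<noteq> j} \<subseteq> {..<n} \<times> {..<n}" by auto
  then have fin: "finite (insert 1 D)" unfolding D_def by (simp add: finite_subset)
  have pos: "x > 0" if "x \<in> insert 1 D" for x
  proof (cases "x = 1")
    case False
    then obtain i j where ij: "i < n" "j < n" "i \<noteq> j" "x = \<bar>sin (pi * real i / real n - pi * real j / real n)\<bar>"
      using \<open>x \<in> insert 1 D\<close> unfolding D_def by auto
    have p: "sin (pi * real k / real n) > 0" if "0 < k" "k < n" for k
      using that by (intro sin_gt_zero) (auto simp: field_simps)
    consider "i > j" | "j > i" using ij(3) by linarith
    then show ?thesis
    proof cases
      case 1
      have "pi * real i / real n - pi * real j / real n = pi * real (i - j) / real n"
        using 1 by (simp add: of_nat_diff diff_divide_distrib algebra_simps)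
      then show ?thesis using p[of "i - j"] 1 ij by (simp add: of_nat_diff less_imp_diff_less)
    next
      case 2
      have "pi * real i / real n - pi * real j / real n = - (pi * real (j - i) / real n)"
        using 2 by (simp add: of_nat_diff diff_divide_distrib algebra_simps)
      then show ?thesis using p[of "j - i"] 2 ij by (simp add: of_nat_diff less_imp_diff_less)
    qed
  qed simp
  show ?thesis
  proof (intro exI[of _ "Min (insert 1 D)"] conjI allI impI)
    show "Min (insert 1 D) > 0" using pos Min_in[OF fin] by blast
    show "Min (insert 1 D) \<le> 1" using fin by simp
    fix i j assume "i < n" "j < n" "i \<noteq> j"
    then show "Min (insert 1 D) \<le> \<bar>sin (pi * real i / real n - pi * real j / real n)\<bar>"
      using fin by (intro Min_le) (auto simp: D_def)
  qed
qed

text \<open>In the expansion of the squares, the right-hand side exceeds the left-hand side by at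
  least \<open>(L - M)^2 * r^2 * (1 - \<kappa>^2 / 4)\<close>.\<close>

lemma two_rays:
  fixes x y :: "'e::real_inner"
  assumes "norm x = r" "norm y = r" "\<kappa> * r \<le> norm (x - y)" "0 < \<kappa>" "\<kappa> \<le> 1" "0 \<le> L" "0 \<le> M"
  shows "\<kappa> / 2 * (L + M) * r \<le> norm (L *\<^sub>R x - M *\<^sub>R y)"
proof (rule power2_le_imp_le)
  have xy: "(norm (x - y))\<^sup>2 = 2 * r\<^sup>2 - 2 * (x \<bullet> y)"
    unfolding power2_norm_eq_inner inner_diff using assms(1,2) by (simp add: inner_commute[of y x] dot_square_norm)
  have "r \<ge> 0" using assms(1) by auto
  then have "(\<kappa> * r)\<^sup>2 \<le> (norm (x - y))\<^sup>2" using assms by (intro power_mono) auto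
  then have i: "2 * (x \<bullet> y) \<le> 2 * r\<^sup>2 - \<kappa>\<^sup>2 * r\<^sup>2" using xy by (simp add: power_mult_distrib)
  have "(norm (L *\<^sub>R x - M *\<^sub>R y))\<^sup>2 = (L\<^sup>2 + M\<^sup>2) * r\<^sup>2 - L * M * (2 * (x \<bullet> y))"
  proof -
    have "(norm (L *\<^sub>R x - M *\<^sub>R y))\<^sup>2 = L\<^sup>2 * (x \<bullet> x) + M\<^sup>2 * (y \<bullet> y) - L * M * (2 * (x \<bullet> y))"
      unfolding power2_norm_eq_inner inner_diff by (simp add: inner_commute[of y x] power2_eq_square)
    then show ?thesis using assms(1,2) by (simp add: dot_square_norm distrib_right)
  qed
  also have "\<dots> \<ge> (L\<^sup>2 + M\<^sup>2) * r\<^sup>2 - L * M * (2 * r\<^sup>2 - \<kappa>\<^sup>2 * r\<^sup>2)"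
    using i assms by (intro diff_left_mono mult_left_mono) auto
  also have "(L\<^sup>2 + M\<^sup>2) * r\<^sup>2 - L * M * (2 * r\<^sup>2 - \<kappa>\<^sup>2 * r\<^sup>2) = (\<kappa> / 2 * (L + M) * r)\<^sup>2 + (L - M)\<^sup>2 * r\<^sup>2 * (1 - \<kappa>\<^sup>2 / 4)"
    by (simp add: power2_eq_square field_simps)
  also have "\<dots> \<ge> (\<kappa> / 2 * (L + M) * r)\<^sup>2"
  proof -
    have "\<kappa>\<^sup>2 \<le> 1" using assms(4,5) by (simp add: power_le_one)
    then have "(L - M)\<^sup>2 * r\<^sup>2 * (1 - \<kappa>\<^sup>2 / 4) \<ge> 0" by simp
    then show ?thesis by simp
  qed
  finally show "(\<kappa> / 2 * (L + M) * r)\<^sup>2 \<le> (norm (L *\<^sub>R x - M *\<^sub>R y))\<^sup>2" .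
qed simp

section \<open>Generic odd vertex assignments\<close>

text \<open>The norms of the vertex images lie between \<open>m\<close> and \<open>Mx\<close>, the
  images of a face have diameter at most \<eta>, and \<kappa> bounds from below the sines of the
  angles between distinct rotations. The condition \<open>eta_small\<close> is the inequality on
  which \<open>trip_disj\<close> rests; it also implies \<open>eta_kap\<close>, which suffices for
  pairs.\<close>

locale fine_mesh = antipodal_sphere I2 s2 I1 s1 v0 T
  for I2 :: "'i set" and s2 :: "'i \<Rightarrow> 'v set" and I1 :: "'j set" and s1 :: "'j \<Rightarrow> 'v set" and v0 :: 'v and T :: "'v \<Rightarrow> 'v" +
  fixes n :: nat and \<kappa> m Mx \<eta> :: real
  assumes n2: "n \<ge> 2" and kap: "0 < \<kappa>" "\<kappa> \<le> 1"
    and kap_sin: "\<And>i j. i < n \<Longrightarrow> j < n \<Longrightarrow> i \<noteq> j \<Longrightarrow> \<kappa> \<le> \<bar>sin (pi * real i / real n - pi * real j / real n)\<bar>"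
    and eta: "0 < \<eta>" "\<eta> < m" and mMx: "m \<le> Mx" and eta_small: "(1 + (Mx + \<eta>) / (m - \<eta>)) * \<eta> < \<kappa> / 2 * m"
begin

definition R :: "nat \<Rightarrow> C2 \<Rightarrow> C2" where
  "R j = twist (pi * real j / real n)"

definition V where "V = \<Union>faces"

definition odd_assign :: "'v assignment \<Rightarrow> bool" where
  "odd_assign a \<longleftrightarrow> (\<forall>v. a (T v) = - a v)"

definition spread :: "'v assignment \<Rightarrow> bool" where
  "spread a \<longleftrightarrow> odd_assign a \<and> (\<forall>v\<in>V. m \<le> norm (a v) \<and> norm (a v) \<le> Mx) \<and> (\<forall>s\<in>faces. \<forall>v\<in>s. \<forall>w\<in>s. norm (a v - a w) \<le> \<eta>) \<and>
     (\<forall>v\<in>V. \<forall>w\<in>V. \<forall>i<n. \<forall>j<n. i \<noteq> j \<longrightarrow> 2 * \<eta> < norm (R i (a v) - R j (a w)))"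

definition vs :: "'v set \<Rightarrow> ('v \<Rightarrow> real) \<Rightarrow> nat \<Rightarrow> 'v assignment \<Rightarrow> C2" where
  "vs s lam j a = (\<Sum>v\<in>s. lam v *\<^sub>R R j (a v))"

lemma norm_R [simp]: "norm (R j x) = norm x" by (simp add: R_def)

lemma R_lin: "R j (x + y) = R j x + R j y" "R j (c *\<^sub>R x) = c *\<^sub>R R j x" "R j (- x) = - R j x" "R j (x - y) = R j x - R j y"
  by (auto simp: R_def twist_linear)

lemma R_kap:
  assumes "i < n" "j < n" "i \<noteq> j"
  shows "\<kappa> * norm x \<le> norm (R i x - R j x)" "\<kappa> * norm x \<le> norm (R i x + R j x)"
proof -
  have "\<kappa> * norm x \<le> \<bar>sin (pi * real i / real n - pi * real j / real n)\<bar> * norm x"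
    using kap_sin[OF assms] by (intro mult_right_mono) auto
  then show "\<kappa> * norm x \<le> norm (R i x - R j x)" "\<kappa> * norm x \<le> norm (R i x + R j x)"
    unfolding R_def using twist_diff_ge by (meson order_trans)+
qed

lemma okD:
  assumes "spread a"
  shows "a (T v) = - a v" "v \<in> V \<Longrightarrow> m \<le> norm (a v)" "v \<in> V \<Longrightarrow> norm (a v) \<le> Mx"
    "s \<in> faces \<Longrightarrow> v \<in> s \<Longrightarrow> w \<in> s \<Longrightarrow> norm (a v - a w) \<le> \<eta>"
    "v \<in> V \<Longrightarrow> w \<in> V \<Longrightarrow> i < n \<Longrightarrow> j < n \<Longrightarrow> i \<noteq> j \<Longrightarrow> 2 * \<eta> < norm (R i (a v) - R j (a w))"
  using assms by (simp_all add: spread_def odd_assign_def)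

lemma face_V: "s \<in> faces \<Longrightarrow> v \<in> s \<Longrightarrow> v \<in> V" unfolding V_def by blast

lemma wt_sum: "wt s lam \<Longrightarrow> finite s \<Longrightarrow> sum lam s \<ge> 0" "wt s lam \<Longrightarrow> finite s \<Longrightarrow> \<exists>v. lam v \<noteq> 0 \<Longrightarrow> sum lam s > 0"
proof -
  show "wt s lam \<Longrightarrow> finite s \<Longrightarrow> sum lam s \<ge> 0" unfolding wt_def by (simp add: sum_nonneg)
  assume a: "wt s lam" "finite s" "\<exists>v. lam v \<noteq> 0"
  then obtain v where "v \<in> s" "lam v > 0" unfolding wt_def by (metis less_le)
  then show "sum lam s > 0" using a unfolding wt_def by (intro sum_pos2[of s v]) auto
qed

lemma cone_near:
  assumes "spread a" "s \<in> faces" "v \<in> s" "wt s lam"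
  shows "norm (vs s lam i a - sum lam s *\<^sub>R R i (a v)) \<le> sum lam s * \<eta>"
proof -
  have "vs s lam i a - sum lam s *\<^sub>R R i (a v) = (\<Sum>u\<in>s. lam u *\<^sub>R R i (a u - a v))"
    unfolding vs_def by (simp add: R_lin scaleR_diff_right sum_subtractf scaleR_sum_left)
  also have "norm \<dots> \<le> (\<Sum>u\<in>s. lam u * \<eta>)"
    using assms okD(4)[OF assms(1,2)] by (intro sum_norm_le) (auto simp: wt_def intro!: mult_left_mono)
  finally show ?thesis by (simp add: sum_distrib_right)
qed

lemma cone0:
  assumes spread: "spread a" and s: "s \<in> faces" and w: "wt s lam" and z: "vs s lam i a = 0"
  shows "lam v = 0"
proof (rule ccontr)
  assume nz: "lam v \<noteq> 0"
  then have v: "v \<in> s" using w by (auto simp: wt_def)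
  have L: "sum lam s > 0" using wt_sum(2)[OF w fin_face[OF s]] nz by blast
  have "sum lam s * norm (a v) \<le> sum lam s * \<eta>" using cone_near[OF spread s v w, of i] L unfolding z by simp
  then show False using L okD(2)[OF spread face_V[OF s v]] eta by simp
qed

lemma pair_pos:
  assumes spread: "spread a" and st: "s \<in> faces" "t \<in> faces" and w: "wt s lam" "wt t mu"
    and nz: "(\<exists>v. lam v \<noteq> 0) \<or> (\<exists>v. mu v \<noteq> 0)" and e: "vs s lam i a = vs t mu j a"
  shows "\<exists>v. lam v \<noteq> 0" "\<exists>v. mu v \<noteq> 0" "sum lam s > 0" "sum mu t > 0"
proof -
  have z: "vs r (\<lambda>_. 0) k a = 0" for r k by (simp add: vs_def)
  show 1: "\<exists>v. lam v \<noteq> 0"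
  proof (rule ccontr)
    assume "\<not> (\<exists>v. lam v \<noteq> 0)"
    then have "lam = (\<lambda>_. 0)" by auto
    then show False using cone0[OF spread st(2) w(2), of j] e z nz by auto
  qed
  show 2: "\<exists>v. mu v \<noteq> 0"
  proof (rule ccontr)
    assume "\<not> (\<exists>v. mu v \<noteq> 0)"
    then have "mu = (\<lambda>_. 0)" by auto
    then show False using cone0[OF spread st(1) w(1), of i] e z nz by auto
  qed
  show "sum lam s > 0" "sum mu t > 0" using wt_sum(2) w fin_face st 1 2 by auto
qed

text \<open>With equal weights, points of the two simplices themselves would coincide, and vertices
  of the two copies would be within \<open>2 * \<eta>\<close>. This half of \<open>good2\<close>
  thus comes from the separation of the copies in \<open>spread\<close> and not from
  genericity.\<close>

lemma pair_sum:
  assumes spread: "spread a" and ij: "i < n" "j < n" "i \<noteq> j" and st: "s \<in> faces" "t \<in> faces" and w: "wt s lam" "wt t mu"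
    and nz: "(\<exists>v. lam v \<noteq> 0) \<or> (\<exists>v. mu v \<noteq> 0)" and e: "vs s lam i a = vs t mu j a"
  shows "sum lam s \<noteq> sum mu t"
proof
  assume eq: "sum lam s = sum mu t"
  note pp = pair_pos[OF spread st w nz e]
  obtain v u where "lam v \<noteq> 0" "mu u \<noteq> 0" using pp(1,2) by blast
  then have v: "v \<in> s" and u: "u \<in> t" using w by (auto simp: wt_def)
  define L where "L = sum lam s"
  have "norm (L *\<^sub>R R i (a v) - L *\<^sub>R R j (a u)) \<le> norm (vs s lam i a - L *\<^sub>R R i (a v)) + norm (vs t mu j a - L *\<^sub>R R j (a u))"
    unfolding e using norm_triangle_ineq4[of "vs t mu j a - L *\<^sub>R R j (a u)" "vs t mu j a - L *\<^sub>R R i (a v)"] by (simp add: add.commute)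
  also have "\<dots> \<le> L * \<eta> + L * \<eta>"
  proof (rule add_mono)
    show "norm (vs s lam i a - L *\<^sub>R R i (a v)) \<le> L * \<eta>" using cone_near[OF spread st(1) v w(1), of i] unfolding L_def .
    show "norm (vs t mu j a - L *\<^sub>R R j (a u)) \<le> L * \<eta>" using cone_near[OF spread st(2) u w(2), of j] unfolding L_def eq .
  qed
  finally have "L * norm (R i (a v) - R j (a u)) \<le> L * (2 * \<eta>)"
    using pp(3) unfolding L_def by (simp add: scaleR_diff_right[symmetric])
  then show False using pp(3) okD(5)[OF spread face_V[OF st(1) v] face_V[OF st(2) u] ij] unfolding L_def by simp
qed

lemma eta_kap: "\<eta> < \<kappa> / 2 * m"
proof -
  have "0 \<le> (Mx + \<eta>) / (m - \<eta>)" using eta mMx by simp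
  then have "1 * \<eta> \<le> (1 + (Mx + \<eta>) / (m - \<eta>)) * \<eta>" using eta by (intro mult_right_mono) auto
  then show ?thesis using eta_small by linarith
qed

lemma two_cones:
  assumes spread: "spread a" and ij: "i < n" "j < n" "i \<noteq> j" and v: "v \<in> V" and w: "w = v \<or> w = T v"
    and LM: "0 \<le> L" "0 \<le> M"
  shows "\<kappa> / 2 * (L + M) * m \<le> norm (L *\<^sub>R R i (a v) - M *\<^sub>R R j (a w))"
proof -
  have "\<kappa> / 2 * (L + M) * norm (a v) \<le> norm (L *\<^sub>R R i (a v) - M *\<^sub>R R j (a w))"
    by (rule two_rays) (use w okD(1)[OF spread, of v] kap LM R_kap[OF ij, of "a v"] in \<open>auto simp: R_lin\<close>)
  moreover have "\<kappa> / 2 * (L + M) * m \<le> \<kappa> / 2 * (L + M) * norm (a v)"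
    using okD(2)[OF spread v] kap LM by (intro mult_left_mono) auto
  ultimately show ?thesis by linarith
qed

text \<open>Cones over faces are narrow, with aperture governed by \<eta>, while the rays through
  the images of a vertex or its antipode in two different copies are separated by \<kappa>. So cones
  that meet have no vertex orbit in common, and their vertices can be perturbed independently
  although all copies rotate the same assignment.\<close>

lemma pair_disj:
  assumes spread: "spread a" and ij: "i < n" "j < n" "i \<noteq> j" and st: "s \<in> faces" "t \<in> faces" and w: "wt s lam" "wt t mu"
    and nz: "(\<exists>v. lam v \<noteq> 0) \<or> (\<exists>v. mu v \<noteq> 0)" and e: "vs s lam i a = vs t mu j a"
    and v: "v \<in> s" and u: "u \<in> t"
  shows "u \<noteq> v" "u \<noteq> T v"
proof -
  note pp = pair_pos[OF spread st w nz e]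
  define L where "L = sum lam s"
  define M where "M = sum mu t"
  have "\<not> (u = v \<or> u = T v)"
  proof
    assume uv: "u = v \<or> u = T v"
    have "norm (L *\<^sub>R R i (a v) - M *\<^sub>R R j (a u)) \<le> norm (vs s lam i a - L *\<^sub>R R i (a v)) + norm (vs t mu j a - M *\<^sub>R R j (a u))"
      unfolding e using norm_triangle_ineq4[of "vs t mu j a - M *\<^sub>R R j (a u)" "vs t mu j a - L *\<^sub>R R i (a v)"] by (simp add: add.commute)
    also have "\<dots> \<le> L * \<eta> + M * \<eta>"
      using cone_near[OF spread st(1) v w(1), of i] cone_near[OF spread st(2) u w(2), of j] unfolding L_def M_def by simp
    finally have "\<kappa> / 2 * (L + M) * m \<le> (L + M) * \<eta>"
      using two_cones[OF spread ij face_V[OF st(1) v] uv, of L M] pp(3,4) unfolding L_def M_def by (simp add: distrib_right)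
    then have "(L + M) * (\<kappa> / 2 * m) \<le> (L + M) * \<eta>" by (simp add: algebra_simps)
    moreover have "L + M > 0" using pp(3,4) unfolding L_def M_def by simp
    ultimately show False using eta_kap by simp
  qed
  then show "u \<noteq> v" "u \<noteq> T v" by auto
qed

text \<open>The cones over \<open>t\<close> and \<open>r\<close> are close only because both meet
  the cone over \<open>s\<close>, possibly at different points. With the weights on \<open>s\<close>
  scaled to 1, \<open>K1\<close> and \<open>K2\<close> are the weights on \<open>t\<close> and
  \<open>r\<close>. Comparison of norms bounds them below by
  \<open>(m - \<eta>) / (Mx + \<eta>)\<close>, which is where the factor in \<open>eta_small\<close>
  comes from.\<close>

lemma trip_disj:
  assumes spread: "spread a" and ij: "i < n" "j < n" "k < n" "distinct [i,j,k]" and st: "s \<in> faces" "t \<in> faces" "r \<in> faces"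
    and w: "wt s l1" "wt s l2" "wt t mu" "wt r nu"
    and nz: "\<exists>v. l1 v \<noteq> 0" "\<exists>v. l2 v \<noteq> 0" and e: "vs s l1 i a = vs t mu j a" "vs s l2 i a = vs r nu k a"
    and v: "v \<in> t" and u: "u \<in> r"
  shows "u \<noteq> v" "u \<noteq> T v"
proof -
  obtain x where x: "x \<in> s" using nz w by (auto simp: wt_def)
  note p1 = pair_pos[OF spread st(1,2) w(1,3) disjI1[OF nz(1)] e(1)]
  note p2 = pair_pos[OF spread st(1,3) w(2,4) disjI1[OF nz(2)] e(2)]
  define K1 where "K1 = sum mu t / sum l1 s"
  define K2 where "K2 = sum nu r / sum l2 s"
  have Kp: "K1 > 0" "K2 > 0" using p1 p2 unfolding K1_def K2_def by simp_all
  have ray: "norm (R i (a x) - (sum q t / sum l s) *\<^sub>R R j (a z)) \<le> (1 + sum q t / sum l s) * \<eta>"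
    if "t \<in> faces" "wt s l" "wt t q" "vs s l i a = vs t q j a" "sum l s > 0" "z \<in> t" for l q t z j
  proof -
    define L where "L = sum l s"
    define M where "M = sum q t"
    have L: "L > 0" using that L_def by simp
    have "norm (L *\<^sub>R R i (a x) - M *\<^sub>R R j (a z)) \<le> norm (vs s l i a - L *\<^sub>R R i (a x)) + norm (vs t q j a - M *\<^sub>R R j (a z))"
      unfolding that(4) using norm_triangle_ineq4[of "vs t q j a - M *\<^sub>R R j (a z)" "vs t q j a - L *\<^sub>R R i (a x)"] by (simp add: add.commute)
    also have "\<dots> \<le> L * \<eta> + M * \<eta>"
      using cone_near[OF spread st(1) x that(2), of i] cone_near[OF spread that(1,6,3), of j] unfolding L_def M_def by simp
    finally have *: "norm (L *\<^sub>R R i (a x) - M *\<^sub>R R j (a z)) \<le> L * \<eta> + M * \<eta>" .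
    have "R i (a x) - (M / L) *\<^sub>R R j (a z) = (1 / L) *\<^sub>R (L *\<^sub>R R i (a x) - M *\<^sub>R R j (a z))"
      using L by (simp add: scaleR_diff_right)
    then have "norm (R i (a x) - (M / L) *\<^sub>R R j (a z)) = norm (L *\<^sub>R R i (a x) - M *\<^sub>R R j (a z)) / L"
      using L by simp
    also have "\<dots> \<le> (L * \<eta> + M * \<eta>) / L" using * L by (intro divide_right_mono) auto
    also have "\<dots> = (1 + M / L) * \<eta>" using L by (simp add: field_simps)
    finally show ?thesis unfolding L_def M_def .
  qed
  have r1: "norm (R i (a x) - K1 *\<^sub>R R j (a v)) \<le> (1 + K1) * \<eta>"
    unfolding K1_def by (rule ray[OF st(2) w(1,3) e(1) p1(3) v])
  have r2: "norm (R i (a x) - K2 *\<^sub>R R k (a u)) \<le> (1 + K2) * \<eta>"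
    unfolding K2_def by (rule ray[OF st(3) w(2,4) e(2) p2(3) u])
  have low: "K \<ge> (m - \<eta>) / (Mx + \<eta>)" if "norm (R i (a x) - K *\<^sub>R R l (a z)) \<le> (1 + K) * \<eta>" "K > 0" "z \<in> V" for K l z
  proof -
    have "norm (R i (a x)) \<le> norm (R i (a x) - K *\<^sub>R R l (a z)) + norm (K *\<^sub>R R l (a z))"
      using norm_triangle_sub by (metis add.commute)
    then have "norm (a x) \<le> (1 + K) * \<eta> + K * norm (a z)" using that by simp
    moreover have "K * norm (a z) \<le> K * Mx" using okD(3)[OF spread that(3)] that(2) by simp
    ultimately have "m - \<eta> \<le> K * (Mx + \<eta>)" using okD(2)[OF spread face_V[OF st(1) x]] by (simp add: algebra_simps)
    then show ?thesis using eta mMx by (simp add: pos_divide_le_eq)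
  qed
  have l1: "K1 \<ge> (m - \<eta>) / (Mx + \<eta>)" using low[OF r1 Kp(1) face_V[OF st(2) v]] .
  have l2: "K2 \<ge> (m - \<eta>) / (Mx + \<eta>)" using low[OF r2 Kp(2) face_V[OF st(3) u]] .
  have "\<not> (u = v \<or> u = T v)"
  proof
    assume uv: "u = v \<or> u = T v"
    have "\<kappa> / 2 * (K1 + K2) * m \<le> norm (K1 *\<^sub>R R j (a v) - K2 *\<^sub>R R k (a u))"
      using two_cones[OF spread _ _ _ face_V[OF st(2) v] uv, of j k K1 K2] ij Kp by simp
    also have "\<dots> \<le> (1 + K2) * \<eta> + (1 + K1) * \<eta>"
      using norm_triangle_ineq4[of "R i (a x) - K2 *\<^sub>R R k (a u)" "R i (a x) - K1 *\<^sub>R R j (a v)"] r1 r2 by simp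
    also have "\<dots> = (2 + (K1 + K2)) * \<eta>" by (simp add: algebra_simps)
    also have "\<dots> \<le> ((K1 + K2) * (1 + (Mx + \<eta>) / (m - \<eta>))) * \<eta>"
    proof (rule mult_right_mono)
      have "2 = 2 * ((m - \<eta>) / (Mx + \<eta>)) * ((Mx + \<eta>) / (m - \<eta>))"
      proof -
        have "m - \<eta> \<noteq> 0" "Mx + \<eta> \<noteq> 0" using eta mMx by auto
        then have "(m - \<eta>) / (Mx + \<eta>) * ((Mx + \<eta>) / (m - \<eta>)) = 1" by simp
        then show ?thesis by (simp only: mult.assoc)
      qed
      also have "\<dots> \<le> (K1 + K2) * ((Mx + \<eta>) / (m - \<eta>))"
      proof (rule mult_right_mono)
        show "2 * ((m - \<eta>) / (Mx + \<eta>)) \<le> K1 + K2" using l1 l2 by linarith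
      qed (use eta mMx in simp)
      finally show "2 + (K1 + K2) \<le> (K1 + K2) * (1 + (Mx + \<eta>) / (m - \<eta>))" by (simp add: distrib_left)
    qed (use eta in simp)
    finally have "(K1 + K2) * (\<kappa> / 2 * m) \<le> (K1 + K2) * ((1 + (Mx + \<eta>) / (m - \<eta>)) * \<eta>)"
      by (simp only: mult.assoc mult.left_commute mult.commute)
    then show False using Kp eta_small by simp
  qed
  then show "u \<noteq> v" "u \<noteq> T v" by auto
qed

text \<open>An antipodal pair in a face would have values of norm at most
  \<open>\<eta> / 2\<close>.\<close>

lemma face_orbit:
  assumes "spread a" "s \<in> faces" "v \<in> s" "u \<in> s"
  shows "u \<noteq> T v"
proof
  assume "u = T v"
  then have "norm (a v - - a v) \<le> \<eta>" using okD(4)[OF assms(1,2,3,4)] okD(1)[OF assms(1)] by simp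
  then have "2 * norm (a v) \<le> \<eta>" by (simp flip: scaleR_2)
  then show False using okD(2)[OF assms(1) face_V[OF assms(2,3)]] eta by linarith
qed

end

lemma unsolvable_wt: "unsolvable S P \<longleftrightarrow> \<not> (\<exists>x. wt S x \<and> (\<exists>u. x u \<noteq> 0) \<and> (\<Sum>u\<in>S. x u *\<^sub>R P u) = 0)"
proof -
  have "(\<exists>x. (\<forall>u\<in>S. 0 \<le> x u) \<and> (\<exists>u\<in>S. x u \<noteq> 0) \<and> (\<Sum>u\<in>S. x u *\<^sub>R P u) = 0) \<longleftrightarrow>
    (\<exists>x. wt S x \<and> (\<exists>u. x u \<noteq> 0) \<and> (\<Sum>u\<in>S. x u *\<^sub>R P u) = 0)" (is "?L \<longleftrightarrow> ?R")
  proof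
    assume ?L
    then obtain x where x: "\<forall>u\<in>S. 0 \<le> x u" "\<exists>u\<in>S. x u \<noteq> 0" "(\<Sum>u\<in>S. x u *\<^sub>R P u) = 0" by blast
    define y where "y = (\<lambda>u. if u \<in> S then x u else 0)"
    have "(\<Sum>u\<in>S. y u *\<^sub>R P u) = (\<Sum>u\<in>S. x u *\<^sub>R P u)" by (rule sum.cong) (auto simp: y_def)
    then show ?R using x by (intro exI[of _ y]) (auto simp: y_def wt_def)
  next
    assume ?R then show ?L unfolding wt_def by metis
  qed
  then show ?thesis unfolding unsolvable_def by simp
qed

lemma pair0: "(x, y) = 0 \<longleftrightarrow> x = 0 \<and> y = 0" by (simp add: zero_prod_def)

lemma wt_Plus: "wt (s <+> t) x \<longleftrightarrow> wt s (\<lambda>v. x (Inl v)) \<and> wt t (\<lambda>v. x (Inr v))"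
  unfolding wt_def by (auto simp: split_sum_all)

lemma ex_sum: "(\<exists>u. x u \<noteq> (0::real)) \<longleftrightarrow> (\<exists>v. x (Inl v) \<noteq> 0) \<or> (\<exists>v. x (Inr v) \<noteq> 0)"
  by (auto simp: split_sum_ex)

context fine_mesh
begin

text \<open>\<open>robust P\<close> is the interior of \<open>P\<close> in the space of odd assignments, restricted to the vertices of the sphere.\<close>

definition near :: "real \<Rightarrow> 'v assignment \<Rightarrow> 'v assignment \<Rightarrow> bool" where
  "near d a a' \<longleftrightarrow> odd_assign a' \<and> (\<forall>v\<in>V. norm (a' v - a v) < d)"

definition robust :: "('v assignment \<Rightarrow> bool) \<Rightarrow> 'v assignment \<Rightarrow> bool" where
  "robust P a \<longleftrightarrow> odd_assign a \<and> (\<exists>d>0. \<forall>a'. near d a a' \<longrightarrow> P a')"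

lemma near_refl: "odd_assign a \<Longrightarrow> d > 0 \<Longrightarrow> near d a a" by (simp add: near_def)

lemma near_trans:
  assumes "near d a b" "near e b c"
  shows "near (d + e) a c"
  unfolding near_def
proof (intro conjI ballI)
  show "odd_assign c" using assms by (simp add: near_def)
  fix v assume v: "v \<in> V"
  have "norm (b v - a v) < d" "norm (c v - b v) < e" using assms v by (auto simp: near_def)
  then show "norm (c v - a v) < d + e" using norm_triangle_ineq[of "c v - b v" "b v - a v"] by simp
qed

lemma near_mono: "near d a b \<Longrightarrow> d \<le> e \<Longrightarrow> near e a b"
  unfolding near_def by force

lemma robust_D: "robust P a \<Longrightarrow> P a" unfolding robust_def using near_refl by blast

lemma robust_odd: "robust P a \<Longrightarrow> odd_assign a" unfolding robust_def by blast

lemma robust_open: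
  assumes "robust P a"
  obtains d where "d > 0" "\<And>a'. near d a a' \<Longrightarrow> robust P a'"
proof -
  obtain d where d: "d > 0" "\<And>a'. near d a a' \<Longrightarrow> P a'" using assms unfolding robust_def by blast
  show thesis
  proof (rule that[of "d / 2"])
    fix b assume b: "near (d / 2) a b"
    have "P c" if "near (d / 2) b c" for c using d(2) near_trans[OF b that] by simp
    then show "robust P b" unfolding robust_def using b d(1) by (auto simp: near_def intro!: exI[of _ "d / 2"])
  qed (use d in simp)
qed

lemma robust_conj:
  assumes "robust P a" "robust Q a"
  shows "robust (\<lambda>a. P a \<and> Q a) a"
proof -
  obtain d where d: "d > 0" "\<And>a'. near d a a' \<Longrightarrow> P a'" using assms(1) unfolding robust_def by blast
  obtain e where e: "e > 0" "\<And>a'. near e a a' \<Longrightarrow> Q a'" using assms(2) unfolding robust_def by blast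
  have "P a' \<and> Q a'" if "near (min d e) a a'" for a' using d(2) e(2) near_mono[OF that] by auto
  then show ?thesis unfolding robust_def using robust_odd[OF assms(1)] d(1) e(1) by (intro conjI exI[of _ "min d e"]) auto
qed

lemma robust_mono: "robust P a \<Longrightarrow> (\<And>a. P a \<Longrightarrow> Q a) \<Longrightarrow> robust Q a"
  unfolding robust_def by blast

text \<open>A finite intersection of open dense conditions: the perturbations are made one after the
  other, each within the tolerance left by the previous ones.\<close>

lemma dense_all:
  assumes fin: "finite I" and dens: "\<And>i a d. i \<in> I \<Longrightarrow> robust W a \<Longrightarrow> 0 < d \<Longrightarrow> \<exists>a'. near d a a' \<and> robust (Q i) a'"
    and a: "robust W a" and d: "0 < d"
  shows "\<exists>a'. near d a a' \<and> robust (\<lambda>a. W a \<and> (\<forall>i\<in>I. Q i a)) a'"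
  using fin dens d
proof (induction I arbitrary: d rule: finite_induct)
  case empty
  show ?case using a near_refl[OF robust_odd[OF a] empty(2)] by (intro exI[of _ a]) simp
next
  case (insert i I)
  have "0 < d / 2" using insert.prems(2) by simp
  then have "\<exists>a'. near (d / 2) a a' \<and> robust (\<lambda>a. W a \<and> (\<forall>i\<in>I. Q i a)) a'"
    by (intro insert.IH insert.prems(1)) auto
  then obtain a1 where a1: "near (d / 2) a a1" "robust (\<lambda>a. W a \<and> (\<forall>i\<in>I. Q i a)) a1" by blast
  obtain e where e: "e > 0" "\<And>b. near e a1 b \<Longrightarrow> robust (\<lambda>a. W a \<and> (\<forall>i\<in>I. Q i a)) b" by (rule robust_open[OF a1(2)]) blast
  have "robust W a1" using robust_mono[OF a1(2)] by simp
  moreover have "0 < min (d / 2) e" using e(1) insert.prems(2) by simp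
  ultimately obtain a2 where a2: "near (min (d / 2) e) a1 a2" "robust (Q i) a2" using insert.prems(1)[of i a1] by blast
  have "robust (\<lambda>a. (W a \<and> (\<forall>i\<in>I. Q i a)) \<and> Q i a) a2"
    using robust_conj[OF e(2)[OF near_mono[OF a2(1)]] a2(2)] by simp
  then have "robust (\<lambda>a. W a \<and> (\<forall>i\<in>insert i I. Q i a)) a2" by (rule robust_mono) auto
  moreover have "near d a a2" using near_trans[OF a1(1) near_mono[OF a2(1), of "d / 2"]] by simp
  ultimately show ?case by blast
qed

definition odd_update :: "'v set \<Rightarrow> 'v assignment \<Rightarrow> 'v assignment \<Rightarrow> 'v \<Rightarrow> C2" where
  "odd_update X p a v = (if v \<in> X then p v else if T v \<in> X then - p (T v) else a v)"

lemma odd_update: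
  assumes X: "\<And>v. v \<in> X \<Longrightarrow> T v \<notin> X" and p: "\<And>v. v \<in> X \<Longrightarrow> norm (p v - a v) < d" and a: "odd_assign a" and d: "0 < d"
  shows "near d a (odd_update X p a)" "v \<in> X \<Longrightarrow> odd_update X p a v = p v" "v \<notin> X \<Longrightarrow> T v \<notin> X \<Longrightarrow> odd_update X p a v = a v"
proof -
  have aT: "a (T v) = - a v" for v using a by (simp add: odd_assign_def)
  have "odd_assign (odd_update X p a)" unfolding odd_assign_def odd_update_def using X aT by auto
  moreover have "norm (odd_update X p a v - a v) < d" for v
  proof -
    have "norm (- p (T v) - a v) < d" if "T v \<in> X"
      using p[OF that] aT[of v] by (metis add.commute minus_add_distrib norm_minus_cancel diff_conv_add_uminus minus_minus)
    then show ?thesis unfolding odd_update_def using p d by auto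
  qed
  ultimately show "near d a (odd_update X p a)" by (simp add: near_def)
qed (simp_all add: odd_update_def)

definition R_inverse :: "nat \<Rightarrow> C2 \<Rightarrow> C2" where
  "R_inverse j = twist (- (pi * real j / real n))"

lemma R_R_inverse [simp]: "R j (R_inverse j x) = x" unfolding R_def R_inverse_def by simp

lemma R_inverse_near: "norm (x - R j y) < d \<Longrightarrow> norm (R_inverse j x - y) < d"
proof -
  have "norm (R_inverse j x - y) = norm (R j (R_inverse j x - y))" by simp
  then show "norm (x - R j y) < d \<Longrightarrow> norm (R_inverse j x - y) < d" by (simp only: R_lin R_R_inverse)
qed

text \<open>The Lipschitz constant 2 allows for \<open>sys3\<close>, where a vertex of the first
  simplex occurs in both blocks.\<close>

lemma open_unsolvable:
  fixes P :: "'v assignment \<Rightarrow> 'u \<Rightarrow> 'e::euclidean_space"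
  assumes fin: "finite S" and ns: "unsolvable S (P a)" and a: "odd_assign a"
    and lip: "\<And>a' u. u \<in> S \<Longrightarrow> norm (P a' u - P a u) \<le> 2 * norm (a' (w u) - a (w u))" and w: "\<And>u. u \<in> S \<Longrightarrow> w u \<in> V"
  shows "robust (\<lambda>a. unsolvable S (P a)) a"
proof -
  obtain d where d: "d > 0" "\<And>P'. (\<And>u. u \<in> S \<Longrightarrow> norm (P' u - P a u) < d) \<Longrightarrow> unsolvable S P'"
    by (rule unsolvable_open[OF fin ns]) blast
  have "unsolvable S (P b)" if b: "near (d / 2) a b" for b
  proof (rule d(2))
    fix u assume u: "u \<in> S"
    have "norm (b (w u) - a (w u)) < d / 2" using b w[OF u] by (simp add: near_def)
    then show "norm (P b u - P a u) < d" using lip[OF u, of b] by simp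
  qed
  then show ?thesis unfolding robust_def using a d(1) by (intro conjI exI[of _ "d / 2"]) auto
qed

section \<open>Linear systems for coincidences of cones\<close>

definition sys2 :: "nat \<Rightarrow> nat \<Rightarrow> 'v assignment \<Rightarrow> 'v + 'v \<Rightarrow> C2" where
  "sys2 i j a u = (case u of Inl v \<Rightarrow> R i (a v) | Inr v \<Rightarrow> - R j (a v))"

definition sys3 :: "nat \<Rightarrow> nat \<Rightarrow> nat \<Rightarrow> 'v assignment \<Rightarrow> 'v + 'v + 'v \<Rightarrow> C2 \<times> C2" where
  "sys3 i j k a u = (case u of Inl v \<Rightarrow> (R i (a v), R i (a v)) | Inr (Inl v) \<Rightarrow> (- R j (a v), 0) | Inr (Inr v) \<Rightarrow> (0, - R k (a v)))"

text \<open>The additional unknown is the coefficient of the vertex \<open>v\<close>; as in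
  \<open>good4\<close>, it enters only the equation that involves \<open>R j\<close>.\<close>

definition sys4 :: "nat \<Rightarrow> nat \<Rightarrow> nat \<Rightarrow> 'v \<Rightarrow> 'v assignment \<Rightarrow> unit + 'v + 'v + 'v \<Rightarrow> C2 \<times> C2" where
  "sys4 i j k v a u = (case u of Inl x \<Rightarrow> (R i (a v), 0) | Inr y \<Rightarrow> sys3 i j k a y)"

lemma sys2_iff:
  assumes "finite s" "finite t"
  shows "unsolvable (s <+> t) (sys2 i j a) \<longleftrightarrow> \<not> (\<exists>lam mu. wt s lam \<and> wt t mu \<and> ((\<exists>v. lam v \<noteq> 0) \<or> (\<exists>v. mu v \<noteq> 0)) \<and> vs s lam i a = vs t mu j a)"
proof -
  have e: "(\<Sum>u\<in>s <+> t. x u *\<^sub>R sys2 i j a u) = vs s (\<lambda>v. x (Inl v)) i a - vs t (\<lambda>v. x (Inr v)) j a" for x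
    using assms by (simp add: sum_diff_config sys2_def vs_def sum_negf)
  have "(\<exists>x. wt (s <+> t) x \<and> (\<exists>u. x u \<noteq> 0) \<and> (\<Sum>u\<in>s <+> t. x u *\<^sub>R sys2 i j a u) = 0) \<longleftrightarrow>
    (\<exists>lam mu. wt s lam \<and> wt t mu \<and> ((\<exists>v. lam v \<noteq> 0) \<or> (\<exists>v. mu v \<noteq> 0)) \<and> vs s lam i a = vs t mu j a)" (is "?L \<longleftrightarrow> ?E")
  proof
    assume ?L then show ?E unfolding e wt_Plus ex_sum right_minus_eq by blast
  next
    assume ?E
    then obtain lam mu where h: "wt s lam \<and> wt t mu \<and> ((\<exists>v. lam v \<noteq> 0) \<or> (\<exists>v. mu v \<noteq> 0)) \<and> vs s lam i a = vs t mu j a" by blast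
    then show ?L unfolding e wt_Plus ex_sum right_minus_eq by (intro exI[of _ "case_sum lam mu"]) simp
  qed
  then show ?thesis unfolding unsolvable_wt by simp
qed

lemma sys3_sum:
  assumes "finite s" "finite t" "finite r"
  shows "(\<Sum>u\<in>s <+> (t <+> r). x u *\<^sub>R sys3 i j k a u) =
    (vs s (\<lambda>v. x (Inl v)) i a - vs t (\<lambda>v. x (Inr (Inl v))) j a, vs s (\<lambda>v. x (Inl v)) i a - vs r (\<lambda>v. x (Inr (Inr v))) k a)"
  using assms by (simp add: sum_diff_config sys3_def vs_def sum_negf prod_eq_iff fst_sum snd_sum)

lemma sys3_iff:
  assumes "finite s" "finite t" "finite r"
  shows "unsolvable (s <+> (t <+> r)) (sys3 i j k a) \<longleftrightarrow> \<not> (\<exists>lam mu nu. wt s lam \<and> wt t mu \<and> wt r nu \<and>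
    ((\<exists>v. lam v \<noteq> 0) \<or> (\<exists>v. mu v \<noteq> 0) \<or> (\<exists>v. nu v \<noteq> 0)) \<and> vs s lam i a = vs t mu j a \<and> vs s lam i a = vs r nu k a)" (is "_ \<longleftrightarrow> \<not> ?E")
proof -
  have "(\<exists>x. wt (s <+> (t <+> r)) x \<and> (\<exists>u. x u \<noteq> 0) \<and> (\<Sum>u\<in>s <+> (t <+> r). x u *\<^sub>R sys3 i j k a u) = 0) \<longleftrightarrow> ?E"
  proof
    assume "\<exists>x. wt (s <+> (t <+> r)) x \<and> (\<exists>u. x u \<noteq> 0) \<and> (\<Sum>u\<in>s <+> (t <+> r). x u *\<^sub>R sys3 i j k a u) = 0"
    then show ?E unfolding sys3_sum[OF assms] wt_Plus ex_sum pair0 right_minus_eq by blast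
  next
    assume ?E
    then obtain lam mu nu where h: "wt s lam \<and> wt t mu \<and> wt r nu \<and>
      ((\<exists>v. lam v \<noteq> 0) \<or> (\<exists>v. mu v \<noteq> 0) \<or> (\<exists>v. nu v \<noteq> 0)) \<and> vs s lam i a = vs t mu j a \<and> vs s lam i a = vs r nu k a" by blast
    then show "\<exists>x. wt (s <+> (t <+> r)) x \<and> (\<exists>u. x u \<noteq> 0) \<and> (\<Sum>u\<in>s <+> (t <+> r). x u *\<^sub>R sys3 i j k a u) = 0"
      unfolding sys3_sum[OF assms] wt_Plus ex_sum pair0 right_minus_eq
      by (intro exI[of _ "case_sum lam (case_sum mu nu)"], simp only: sum.case)
  qed
  then show ?thesis unfolding unsolvable_wt by simp
qed

lemma sys4_iff:
  assumes "finite s" "finite t" "finite r"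
  shows "unsolvable ({()} <+> (s <+> (t <+> r))) (sys4 i j k v a) \<longleftrightarrow> \<not> (\<exists>c lam mu nu. 0 \<le> c \<and> wt s lam \<and> wt t mu \<and> wt r nu \<and>
    (c \<noteq> 0 \<or> (\<exists>v. lam v \<noteq> 0) \<or> (\<exists>v. mu v \<noteq> 0) \<or> (\<exists>v. nu v \<noteq> 0)) \<and>
    c *\<^sub>R R i (a v) + vs s lam i a = vs t mu j a \<and> vs s lam i a = vs r nu k a)" (is "_ \<longleftrightarrow> \<not> ?E")
proof -
  have e: "(\<Sum>u\<in>{()} <+> (s <+> (t <+> r)). x u *\<^sub>R sys4 i j k v a u) =
    (x (Inl ()) *\<^sub>R R i (a v) + vs s (\<lambda>v. x (Inr (Inl v))) i a - vs t (\<lambda>v. x (Inr (Inr (Inl v)))) j a,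
     vs s (\<lambda>v. x (Inr (Inl v))) i a - vs r (\<lambda>v. x (Inr (Inr (Inr v)))) k a)" for x
    using assms sys3_sum[OF assms, of "\<lambda>u. x (Inr u)" i j k a] by (subst sum.Plus) (simp_all add: sys4_def o_def)
  have ue: "(\<exists>v. y v \<noteq> 0) \<longleftrightarrow> y () \<noteq> 0" for y :: "unit \<Rightarrow> real" by auto
  have w: "wt {()} y \<longleftrightarrow> 0 \<le> y ()" for y :: "unit \<Rightarrow> real" by (simp add: wt_def)
  have "(\<exists>x. wt ({()} <+> (s <+> (t <+> r))) x \<and> (\<exists>u. x u \<noteq> 0) \<and> (\<Sum>u\<in>{()} <+> (s <+> (t <+> r)). x u *\<^sub>R sys4 i j k v a u) = 0) \<longleftrightarrow> ?E"
  proof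
    assume "\<exists>x. wt ({()} <+> (s <+> (t <+> r))) x \<and> (\<exists>u. x u \<noteq> 0) \<and> (\<Sum>u\<in>{()} <+> (s <+> (t <+> r)). x u *\<^sub>R sys4 i j k v a u) = 0"
    then obtain x where x: "0 \<le> x (Inl ())" "wt s (\<lambda>v. x (Inr (Inl v)))" "wt t (\<lambda>v. x (Inr (Inr (Inl v))))" "wt r (\<lambda>v. x (Inr (Inr (Inr v))))"
      "x (Inl ()) \<noteq> 0 \<or> (\<exists>v. x (Inr (Inl v)) \<noteq> 0) \<or> (\<exists>v. x (Inr (Inr (Inl v))) \<noteq> 0) \<or> (\<exists>v. x (Inr (Inr (Inr v))) \<noteq> 0)"
      "x (Inl ()) *\<^sub>R R i (a v) + vs s (\<lambda>v. x (Inr (Inl v))) i a = vs t (\<lambda>v. x (Inr (Inr (Inl v)))) j a"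
      "vs s (\<lambda>v. x (Inr (Inl v))) i a = vs r (\<lambda>v. x (Inr (Inr (Inr v)))) k a"
      unfolding e wt_Plus ex_sum pair0 right_minus_eq w ue by blast
    show ?E
      by (rule exI[of _ "x (Inl ())"], rule exI[of _ "\<lambda>v. x (Inr (Inl v))"], rule exI[of _ "\<lambda>v. x (Inr (Inr (Inl v)))"],
          rule exI[of _ "\<lambda>v. x (Inr (Inr (Inr v)))"], intro conjI) (fact x)+
  next
    assume ?E
    then obtain c lam mu nu where h: "0 \<le> c" "wt s lam" "wt t mu" "wt r nu"
      "c \<noteq> 0 \<or> (\<exists>v. lam v \<noteq> 0) \<or> (\<exists>v. mu v \<noteq> 0) \<or> (\<exists>v. nu v \<noteq> 0)"
      "c *\<^sub>R R i (a v) + vs s lam i a = vs t mu j a" "vs s lam i a = vs r nu k a" by blast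
    show "\<exists>x. wt ({()} <+> (s <+> (t <+> r))) x \<and> (\<exists>u. x u \<noteq> 0) \<and> (\<Sum>u\<in>{()} <+> (s <+> (t <+> r)). x u *\<^sub>R sys4 i j k v a u) = 0"
      unfolding e wt_Plus ex_sum pair0 right_minus_eq w ue
      by (rule exI[of _ "case_sum (\<lambda>_. c) (case_sum lam (case_sum mu nu))"], simp only: sum.case) (use h in blast)
  qed
  then show ?thesis unfolding unsolvable_wt by simp
qed

definition disj_orbits :: "'v set \<Rightarrow> 'v set \<Rightarrow> bool" where
  "disj_orbits s t \<longleftrightarrow> (\<forall>v\<in>s. \<forall>u\<in>t. u \<noteq> v \<and> u \<noteq> T v)"

lemma disj_orbits_notin: "disj_orbits s t \<Longrightarrow> v \<in> s \<Longrightarrow> v \<notin> t \<and> T v \<notin> t" "disj_orbits s t \<Longrightarrow> v \<in> t \<Longrightarrow> v \<notin> s \<and> T v \<notin> s"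
  unfolding disj_orbits_def by (blast, metis TT)

text \<open>If the two simplices share an orbit, \<open>pair_disj\<close> makes the system
  unsolvable for all assignments nearby. Otherwise their vertices move freely, and at most four
  vectors in real dimension four can be made independent.\<close>

lemma dense_sys2:
  assumes ij: "i < n" "j < n" "i \<noteq> j" and st: "s \<in> faces" "t \<in> faces" and card: "card s + card t \<le> 4"
    and a: "robust spread a" and d: "0 < d"
  shows "\<exists>a'. near d a a' \<and> robust (\<lambda>a. unsolvable (s <+> t) (sys2 i j a)) a'"
proof -
  have fin: "finite s" "finite t" using fin_face st by auto
  obtain e where e: "e > 0" "\<And>b. near e a b \<Longrightarrow> spread b" using a unfolding robust_def by blast
  have o: "odd_assign a" using robust_odd[OF a] .
  show ?thesis
  proof (cases "disj_orbits s t")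
    case False
    then obtain v u where vu: "v \<in> s" "u \<in> t" "u = v \<or> u = T v" unfolding disj_orbits_def by blast
    have "unsolvable (s <+> t) (sys2 i j b)" if "near e a b" for b
      unfolding sys2_iff[OF fin] using pair_disj[OF e(2)[OF that] ij st] vu by blast
    then have "robust (\<lambda>a. unsolvable (s <+> t) (sys2 i j a)) a" unfolding robust_def using o e(1) by blast
    then show ?thesis using near_refl[OF o d] by blast
  next
    case True
    have "card (s <+> t) \<le> DIM(C2)" using card fin by (simp add: card_Plus)
    then obtain X' where X': "\<And>u. norm (X' u - sys2 i j a u) < d" "\<And>c. (\<Sum>u\<in>s <+> t. c u *\<^sub>R X' u) = 0 \<Longrightarrow> \<forall>u\<in>s <+> t. c u = 0"
      using perturb_independent[of "s <+> t" d "sys2 i j a"] fin d by auto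
    define p where "p = (\<lambda>v. if v \<in> s then R_inverse i (X' (Inl v)) else R_inverse j (- X' (Inr v)))"
    define X where "X = s \<union> t"
    have oka: "spread a" using robust_D[OF a] .
    have XT: "T v \<notin> X" if "v \<in> X" for v
      using that disj_orbits_notin[OF True] face_orbit[OF oka st(1)] face_orbit[OF oka st(2)] unfolding X_def by (metis Un_iff)
    have pn: "norm (p v - a v) < d" if "v \<in> X" for v
    proof (cases "v \<in> s")
      case True
      then show ?thesis using X'(1)[of "Inl v"] R_inverse_near by (simp add: p_def sys2_def)
    next
      case False
      have "norm (- X' (Inr v) - R j (a v)) = norm (X' (Inr v) - sys2 i j a (Inr v))"
        by (simp add: sys2_def) (metis add.commute minus_add_distrib norm_minus_cancel diff_conv_add_uminus minus_minus)
      then show ?thesis using False X'(1)[of "Inr v"] R_inverse_near by (simp add: p_def)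
    qed
    define b where "b = odd_update X p a"
    note ub = odd_update[where X = X and p = p and a = a and d = d, OF XT pn o d, folded b_def]
    have Qb: "sys2 i j b u = X' u" if "u \<in> s <+> t" for u
    proof (cases u)
      case (Inl v)
      then have "v \<in> s" using that by auto
      then show ?thesis using ub(2)[of v] unfolding Inl by (simp add: sys2_def p_def X_def)
    next
      case (Inr v)
      then have "v \<in> t" "v \<notin> s" using that disj_orbits_notin[OF True] by auto
      then show ?thesis using ub(2)[of v] unfolding Inr by (simp add: sys2_def p_def X_def)
    qed
    have "unsolvable (s <+> t) (sys2 i j b)" unfolding unsolvable_def using X'(2) Qb by (metis (no_types, lifting) sum.cong)
    moreover have "odd_assign b" using ub(1) by (simp add: near_def)
    ultimately have "robust (\<lambda>a. unsolvable (s <+> t) (sys2 i j a)) b"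
    proof (intro open_unsolvable[where w = "case_sum id id"])
      show "finite (s <+> t)" using fin by simp
      fix a' u assume u: "u \<in> s <+> t"
      show "norm (sys2 i j a' u - sys2 i j b u) \<le> 2 * norm (a' (case_sum id id u) - b (case_sum id id u))"
      proof (cases u)
        case (Inl v)
        have "norm (R i (a' v) - R i (b v)) = norm (a' v - b v)" using norm_R[of i "a' v - b v"] by (simp only: R_lin)
        then show ?thesis unfolding Inl by (simp add: sys2_def)
      next
        case (Inr v)
        have "norm (- R j (a' v) - - R j (b v)) = norm (a' v - b v)" using norm_R[of j "b v - a' v"] by (simp add: R_lin norm_minus_commute)
        then show ?thesis unfolding Inr by (simp add: sys2_def)
      qed
      show "case_sum id id u \<in> V" using u st face_V by auto
    qed
    then show ?thesis using ub(1) by blast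
  qed
qed

end

context fine_mesh
begin

lemma sol3_pos:
  assumes spread: "spread b" and st: "s \<in> faces" "t \<in> faces" "r \<in> faces" and w: "wt s lam" "wt t mu" "wt r nu"
    and nz: "(\<exists>v. lam v \<noteq> 0) \<or> (\<exists>v. mu v \<noteq> 0) \<or> (\<exists>v. nu v \<noteq> 0)"
    and e: "vs s lam i b = vs t mu j b" "vs s lam i b = vs r nu k b"
  shows "\<exists>v. lam v \<noteq> 0"
  using nz pair_pos(1)[OF spread st(1,2) w(1,2) _ e(1)] pair_pos(1)[OF spread st(1,3) w(1,3) _ e(2)] by blast

lemma R_dist: "norm (R i x - R i y) = norm (x - y)"
  using norm_R[of i "x - y"] by (simp only: R_lin)

lemma sys3_lip:
  assumes "u \<in> s <+> (t <+> r)"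
  shows "norm (sys3 i j k a' u - sys3 i j k b u) \<le> 2 * norm (a' (case_sum id (case_sum id id) u) - b (case_sum id (case_sum id id) u))"
proof -
  have n: "norm (- R l x - - R l y) = norm (x - y)" for l x y using R_dist[of l y x] by (simp add: norm_minus_commute)
  have n2: "norm (y, y') \<le> norm y + norm y'" for y y' :: C2 by (rule norm_Pair_le)
  consider v where "u = Inl v" | v where "u = Inr (Inl v)" | v where "u = Inr (Inr v)" using assms by auto
  then show ?thesis
  proof cases
    case 1
    then show ?thesis using n2[of "R i (a' v) - R i (b v)" "R i (a' v) - R i (b v)"] by (simp add: sys3_def R_dist)
  next
    case 2
    then show ?thesis using n2[of "- R j (a' v) - - R j (b v)" 0] n[of j "a' v" "b v"] by (simp add: sys3_def)
  next
    case 3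
    then show ?thesis using n2[of 0 "- R k (a' v) - - R k (b v)"] n[of k "a' v" "b v"] by (simp add: sys3_def)
  qed
qed

lemma sys3_open:
  assumes "s \<in> faces" "t \<in> faces" "r \<in> faces" "odd_assign b" "unsolvable (s <+> (t <+> r)) (sys3 i j k b)"
  shows "robust (\<lambda>a. unsolvable (s <+> (t <+> r)) (sys3 i j k a)) b"
proof (rule open_unsolvable[where P = "sys3 i j k" and a = b, OF _ assms(5,4), where w = "case_sum id (case_sum id id)"])
  show "finite (s <+> (t <+> r))" using fin_face assms by simp
  fix u assume "u \<in> s <+> (t <+> r)"
  then show "case_sum id (case_sum id id) u \<in> V" using assms face_V by auto
qed (rule sys3_lip)

lemma sys4_open:
  assumes "s \<in> faces" "t \<in> faces" "r \<in> faces" "odd_assign b" "v \<in> V" "unsolvable ({()} <+> (s <+> (t <+> r))) (sys4 i j k v b)"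
  shows "robust (\<lambda>a. unsolvable ({()} <+> (s <+> (t <+> r))) (sys4 i j k v a)) b"
proof (rule open_unsolvable[where P = "sys4 i j k v" and a = b, OF _ assms(6,4), where w = "case_sum (\<lambda>_. v) (case_sum id (case_sum id id))"])
  show "finite ({()} <+> (s <+> (t <+> r)))" using fin_face assms by simp
  fix u assume u: "u \<in> {()} <+> (s <+> (t <+> r))"
  then show "case_sum (\<lambda>_. v) (case_sum id (case_sum id id)) u \<in> V" using assms face_V by auto
  fix a'
  show "norm (sys4 i j k v a' u - sys4 i j k v b u) \<le>
    2 * norm (a' (case_sum (\<lambda>_. v) (case_sum id (case_sum id id)) u) - b (case_sum (\<lambda>_. v) (case_sum id (case_sum id id)) u))"
  proof (cases u)
    case (Inl x)
    have "norm (R i (a' v) - R i (b v), 0 :: C2) \<le> norm (a' v - b v) + 0"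
      using norm_Pair_le[of "R i (a' v) - R i (b v)" "0 :: C2"] by (simp add: R_dist)
    moreover have "0 \<le> norm (a' v - b v)" by simp
    ultimately have "norm (R i (a' v) - R i (b v), 0 :: C2) \<le> 2 * norm (a' v - b v)" by linarith
    then show ?thesis unfolding Inl by (simp add: sys4_def)
  next
    case (Inr y)
    then have "y \<in> s <+> (t <+> r)" using u by auto
    from sys3_lip[OF this] show ?thesis unfolding Inr by (simp add: sys4_def)
  qed
qed

lemma vs_inner0: "(\<And>u. u \<in> s \<Longrightarrow> \<alpha> \<bullet> R i (a u) = 0) \<Longrightarrow> vs s lam i a \<bullet> \<alpha> = 0"
  unfolding vs_def inner_commute[of _ \<alpha>] inner_sum_right by simp

lemma normal_exists:
  assumes "s \<in> faces"
  obtains \<alpha> where "\<alpha> \<noteq> 0" "\<And>u. u \<in> s \<Longrightarrow> \<alpha> \<bullet> R i (a u) = 0"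
proof -
  have "card ((\<lambda>u. R i (a u)) ` s) \<le> card s" by (rule card_image_le[OF fin_face[OF assms]])
  also have "\<dots> \<le> 3" by (rule face_card[OF assms])
  finally have "card ((\<lambda>u. R i (a u)) ` s) < DIM(C2)" by simp
  then show thesis
    using orth_exists[of "(\<lambda>u. R i (a u)) ` s"] fin_face[OF assms] that by (metis finite_imageI image_eqI)
qed

text \<open>The common perturbation behind both kinds of genericity: the families \<open>t\<close> and \<open>{g1, g2}\<close> are moved so
  that a vector in the span of \<open>g1, g2\<close> orthogonal to \<open>\<alpha>\<close> and to the new normal \<open>\<beta>\<close> of \<open>t\<close> vanishes.\<close>

lemma perturb_three:
  assumes spread: "spread a" and al: "\<alpha> \<noteq> 0" and t: "t \<in> faces" and g: "g1 \<noteq> g2" "g \<in> faces" "g = {g1, g2}"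
    and tg: "disj_orbits t g" and Y: "finite Y" "card t + card Y < 4" "card Y + 1 < 4" and d: "0 < d"
  obtains b \<beta> where "near d a b" "\<And>v. v \<notin> t \<Longrightarrow> T v \<notin> t \<Longrightarrow> v \<notin> g \<Longrightarrow> T v \<notin> g \<Longrightarrow> b v = a v"
    "\<And>u. u \<in> t \<Longrightarrow> \<beta> \<bullet> R j (b u) = 0" "\<And>y. y \<in> Y \<Longrightarrow> \<beta> \<bullet> y = 0"
    "\<And>nu. vs g nu k b \<bullet> \<alpha> = 0 \<Longrightarrow> vs g nu k b \<bullet> \<beta> = 0 \<Longrightarrow> vs g nu k b = 0"
proof -
  have o: "odd_assign a" using spread by (simp add: spread_def)
  have ft: "finite t" using fin_face[OF t] .
  have c: "card t + card Y < DIM(C2)" "card Y + 1 < DIM(C2)" using Y by simp_all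
  obtain B' \<beta> where B: "\<And>u. u \<in> t \<Longrightarrow> norm (B' u - R j (a u)) < d" "\<beta> \<notin> span {\<alpha>}"
    "\<And>u. u \<in> t \<Longrightarrow> \<beta> \<bullet> B' u = 0" "\<And>y. y \<in> Y \<Longrightarrow> \<beta> \<bullet> y = 0"
    by (rule perturb_normal[OF al ft Y(1) c d, of "\<lambda>u. R j (a u)"]) blast
  obtain G1 G2 where G: "norm (G1 - R k (a g1)) < d" "norm (G2 - R k (a g2)) < d"
    "\<And>x y. (x *\<^sub>R G1 + y *\<^sub>R G2) \<bullet> \<alpha> = 0 \<Longrightarrow> (x *\<^sub>R G1 + y *\<^sub>R G2) \<bullet> \<beta> = 0 \<Longrightarrow> x *\<^sub>R G1 + y *\<^sub>R G2 = 0"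
    by (rule two_generators[OF al B(2) d, of "R k (a g1)" "R k (a g2)"]) blast
  define p where "p = (\<lambda>v. if v \<in> t then R_inverse j (B' v) else if v = g1 then R_inverse k G1 else R_inverse k G2)"
  define X where "X = t \<union> g"
  have XT: "T v \<notin> X" if "v \<in> X" for v
    using that disj_orbits_notin[OF tg] face_orbit[OF spread t] face_orbit[OF spread g(2)] unfolding X_def by (metis Un_iff)
  have pn: "norm (p v - a v) < d" if "v \<in> X" for v
  proof (cases "v \<in> t")
    case True
    then show ?thesis using B(1) R_inverse_near by (simp add: p_def)
  next
    case False
    then have "v = g1 \<or> v = g2" using that g(3) by (auto simp: X_def)
    then show ?thesis using False R_inverse_near[OF G(1)] R_inverse_near[OF G(2)] g(1) by (auto simp: p_def)
  qed
  define b where "b = odd_update X p a"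
  note ub = odd_update[where X = X and p = p and a = a and d = d, OF XT pn o d, folded b_def]
  have bt: "R j (b u) = B' u" if "u \<in> t" for u using that ub(2)[of u] by (simp add: X_def p_def)
  have "g1 \<notin> t" "g2 \<notin> t" using disj_orbits_notin(2)[OF tg] g(3) by auto
  then have bg: "R k (b g1) = G1" "R k (b g2) = G2" using ub(2)[of g1] ub(2)[of g2] g by (auto simp: X_def p_def)
  have vg: "vs g nu k b = nu g1 *\<^sub>R G1 + nu g2 *\<^sub>R G2" for nu
    using g by (simp add: vs_def bg)
  show thesis
    by (rule that[of b \<beta>]) (use ub(1) ub(3) B bt G(3) in \<open>auto simp: X_def vg\<close>)
qed

text \<open>With \<alpha> normal to the cone over \<open>s\<close> and \<beta> normal to the one
  over \<open>t\<close>, a common point lies in the span of the two vectors of \<open>r\<close> and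
  is orthogonal to both normals, so after \<open>perturb_three\<close> it vanishes. The vertices of
  \<open>s\<close> stay in place, hence \<alpha> remains a normal.\<close>

lemma dense_sys3:
  assumes ij: "i < n" "j < n" "k < n" "distinct [i,j,k]" and st: "s \<in> faces" "t \<in> faces" "r \<in> faces" and card: "card r = 2"
    and a: "robust spread a" and d: "0 < d"
  shows "\<exists>a'. near d a a' \<and> robust (\<lambda>a. unsolvable (s <+> (t <+> r)) (sys3 i j k a)) a'"
proof -
  have fin: "finite s" "finite t" "finite r" using fin_face st by auto
  obtain e where e: "e > 0" "\<And>b. near e a b \<Longrightarrow> spread b" using a unfolding robust_def by blast
  have o: "odd_assign a" using robust_odd[OF a] .
  have oka: "spread a" using robust_D[OF a] .
  have ij': "i \<noteq> j" "i \<noteq> k" "j \<noteq> k" using ij by auto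
  show ?thesis
  proof (cases "disj_orbits s t \<and> disj_orbits s r \<and> disj_orbits t r")
    case False
    have "unsolvable (s <+> (t <+> r)) (sys3 i j k b)" if b: "near e a b" for b
      unfolding sys3_iff[OF fin]
    proof
      assume "\<exists>lam mu nu. wt s lam \<and> wt t mu \<and> wt r nu \<and> ((\<exists>v. lam v \<noteq> 0) \<or> (\<exists>v. mu v \<noteq> 0) \<or> (\<exists>v. nu v \<noteq> 0)) \<and>
          vs s lam i b = vs t mu j b \<and> vs s lam i b = vs r nu k b"
      then obtain lam mu nu where h: "wt s lam" "wt t mu" "wt r nu" "(\<exists>v. lam v \<noteq> 0) \<or> (\<exists>v. mu v \<noteq> 0) \<or> (\<exists>v. nu v \<noteq> 0)"
          "vs s lam i b = vs t mu j b" "vs s lam i b = vs r nu k b" by blast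
      note okb = e(2)[OF b]
      have l: "\<exists>v. lam v \<noteq> 0" using sol3_pos[OF okb st h] .
      have "disj_orbits s t" unfolding disj_orbits_def using pair_disj[OF okb ij(1,2) ij'(1) st(1,2) h(1,2) disjI1[OF l] h(5)] by blast
      moreover have "disj_orbits s r" unfolding disj_orbits_def using pair_disj[OF okb ij(1,3) ij'(2) st(1,3) h(1,3) disjI1[OF l] h(6)] by blast
      moreover have "disj_orbits t r" unfolding disj_orbits_def using trip_disj[OF okb ij st h(1,1,2,3) l l h(5,6)] by blast
      ultimately show False using False by blast
    qed
    then have "robust (\<lambda>a. unsolvable (s <+> (t <+> r)) (sys3 i j k a)) a" unfolding robust_def using o e(1) by blast
    then show ?thesis using near_refl[OF o d] by blast
  next
    case True
    obtain r1 r2 where r: "r = {r1, r2}" "r1 \<noteq> r2" using card by (auto simp: card_2_iff)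
    obtain \<alpha> where al: "\<alpha> \<noteq> 0" "\<And>u. u \<in> s \<Longrightarrow> \<alpha> \<bullet> R i (a u) = 0" using normal_exists[OF st(1), of i a] by blast
    have tr: "disj_orbits t r" using True by blast
    have cy: "card t + card ({} :: C2 set) < 4" "card ({} :: C2 set) + 1 < 4" using face_card[OF st(2)] by auto
    have dd: "0 < min d e" using d e by simp
    obtain b \<beta> where b: "near (min d e) a b" "\<And>v. v \<notin> t \<Longrightarrow> T v \<notin> t \<Longrightarrow> v \<notin> r \<Longrightarrow> T v \<notin> r \<Longrightarrow> b v = a v"
      "\<And>u. u \<in> t \<Longrightarrow> \<beta> \<bullet> R j (b u) = 0"
      "\<And>nu. vs r nu k b \<bullet> \<alpha> = 0 \<Longrightarrow> vs r nu k b \<bullet> \<beta> = 0 \<Longrightarrow> vs r nu k b = 0"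
      by (rule perturb_three[OF oka al(1) st(2) r(2) st(3) r(1) tr finite.emptyI cy dd, of j k]) blast
    have okb: "spread b" using e(2) near_mono[OF b(1)] by simp
    have bs: "b u = a u" if "u \<in> s" for u
      using that True b(2)[of u] disj_orbits_notin(1)[of s t u] disj_orbits_notin(1)[of s r u] by blast
    have "unsolvable (s <+> (t <+> r)) (sys3 i j k b)"
      unfolding sys3_iff[OF fin]
    proof
      assume "\<exists>lam mu nu. wt s lam \<and> wt t mu \<and> wt r nu \<and> ((\<exists>v. lam v \<noteq> 0) \<or> (\<exists>v. mu v \<noteq> 0) \<or> (\<exists>v. nu v \<noteq> 0)) \<and>
          vs s lam i b = vs t mu j b \<and> vs s lam i b = vs r nu k b"
      then obtain lam mu nu where h: "wt s lam" "wt t mu" "wt r nu" "(\<exists>v. lam v \<noteq> 0) \<or> (\<exists>v. mu v \<noteq> 0) \<or> (\<exists>v. nu v \<noteq> 0)"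
          "vs s lam i b = vs t mu j b" "vs s lam i b = vs r nu k b" by blast
      have l: "\<exists>v. lam v \<noteq> 0" using sol3_pos[OF okb st h] .
      have "vs s lam i b \<bullet> \<alpha> = 0" by (rule vs_inner0) (simp add: bs al(2))
      moreover have "vs t mu j b \<bullet> \<beta> = 0" by (rule vs_inner0) (rule b(3))
      ultimately have "vs s lam i b = 0" using b(4)[of nu] h(5,6) by simp
      then show False using cone0[OF okb st(1) h(1)] l by blast
    qed
    moreover have "odd_assign b" using b(1) by (simp add: near_def)
    ultimately have "robust (\<lambda>a. unsolvable (s <+> (t <+> r)) (sys3 i j k a)) b" using sys3_open st by blast
    then show ?thesis using near_mono[OF b(1), of d] by auto
  qed
qed

definition generic2 where
  "generic2 a \<longleftrightarrow> (\<forall>i<n. \<forall>j<n. i \<noteq> j \<longrightarrow> (\<forall>s\<in>faces. \<forall>t\<in>faces. card s + card t \<le> 4 \<longrightarrow> unsolvable (s <+> t) (sys2 i j a)))"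

text \<open>If \<open>lam\<close> vanished, then so would \<open>nu\<close>, because cones avoid the
  origin; the remaining equation would be a coincidence between the single vertex \<open>v\<close>
  and \<open>t\<close>, which \<open>generic2\<close> forbids.\<close>

lemma sol4_pos:
  assumes spread: "spread b" and g: "generic2 b" and ij: "i < n" "j < n" "i \<noteq> j" and st: "s \<in> faces" "t \<in> faces" "r \<in> faces" "v \<in> V" "card t \<le> 3" "{v} \<in> faces"
    and w: "0 \<le> c" "wt s lam" "wt t mu" "wt r nu"
    and nz: "c \<noteq> 0 \<or> (\<exists>v. lam v \<noteq> 0) \<or> (\<exists>v. mu v \<noteq> 0) \<or> (\<exists>v. nu v \<noteq> 0)"
    and e: "c *\<^sub>R R i (b v) + vs s lam i b = vs t mu j b" "vs s lam i b = vs r nu k b"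
  shows "\<exists>v. lam v \<noteq> 0"
proof (rule ccontr)
  assume l: "\<not> (\<exists>v. lam v \<noteq> 0)"
  then have z: "vs s lam i b = 0" by (simp add: vs_def)
  then have "nu u = 0" for u using cone0[OF spread st(3) w(4), of k] e(2) by simp
  then have n2: "c \<noteq> 0 \<or> (\<exists>v. mu v \<noteq> 0)" using nz l by auto
  define l1 where "l1 = (\<lambda>u. if u = v then c else 0)"
  have "wt {v} l1" using w(1) by (auto simp: wt_def l1_def)
  moreover have "vs {v} l1 i b = vs t mu j b" using e(1) z by (simp add: vs_def l1_def)
  moreover have "(\<exists>u. l1 u \<noteq> 0) \<or> (\<exists>v. mu v \<noteq> 0)" using n2 by (auto simp: l1_def)
  moreover have "unsolvable ({v} <+> t) (sys2 i j b)" using g ij st unfolding generic2_def by simp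
  ultimately show False unfolding sys2_iff[OF finite.insertI[OF finite.emptyI] fin_face[OF st(2)]] using w(3) by blast
qed

text \<open>The normal of \<open>t\<close> is chosen orthogonal to the image of \<open>v\<close>
  too, so it is orthogonal to the point in the cone over \<open>s'\<close>. That point is also in
  the cone over \<open>r\<close>. Whichever of \<open>s'\<close> and \<open>r\<close> has two
  vertices is the pair moved by \<open>perturb_three\<close>, and the other one supplies the normal
  \<alpha>.\<close>

lemma dense_sys4:
  assumes ij: "i < n" "j < n" "k < n" "distinct [i,j,k]" and st: "s \<in> faces" "t \<in> faces" "r \<in> faces" "v \<in> s" "s' \<subseteq> s"
    and card: "card t = 2" "card s' = 3 \<and> card r = 2 \<or> card s' = 2 \<and> card r = 3 \<and> v \<notin> s'"
    and a: "robust (\<lambda>a. spread a \<and> generic2 a) a" and d: "0 < d"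
  shows "\<exists>a'. near d a a' \<and> robust (\<lambda>a. unsolvable ({()} <+> (s' <+> (t <+> r))) (sys4 i j k v a)) a'"
proof -
  have s': "s' \<in> faces" using face_sub st by blast
  have vf: "{v} \<in> faces" "v \<in> V" using face_sub[OF st(1)] st(4) face_V[OF st(1,4)] by auto
  have fin: "finite s'" "finite t" "finite r" using fin_face st s' by auto
  obtain e where e: "e > 0" "\<And>b. near e a b \<Longrightarrow> spread b" "\<And>b. near e a b \<Longrightarrow> generic2 b" using a unfolding robust_def by blast
  have o: "odd_assign a" using robust_odd[OF a] .
  have oka: "spread a" using robust_D[OF a] by blast
  have ij': "i \<noteq> j" "i \<noteq> k" "j \<noteq> k" using ij by auto
  show ?thesis
  proof (cases "disj_orbits s t \<and> disj_orbits s r \<and> disj_orbits t r")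
    case False
    have "unsolvable ({()} <+> (s' <+> (t <+> r))) (sys4 i j k v b)" if b: "near e a b" for b
      unfolding sys4_iff[OF fin]
    proof
      assume "\<exists>c lam mu nu. 0 \<le> c \<and> wt s' lam \<and> wt t mu \<and> wt r nu \<and>
        (c \<noteq> 0 \<or> (\<exists>v. lam v \<noteq> 0) \<or> (\<exists>v. mu v \<noteq> 0) \<or> (\<exists>v. nu v \<noteq> 0)) \<and>
        c *\<^sub>R R i (b v) + vs s' lam i b = vs t mu j b \<and> vs s' lam i b = vs r nu k b"
      then obtain c lam mu nu where h: "0 \<le> c" "wt s' lam" "wt t mu" "wt r nu"
        "c \<noteq> 0 \<or> (\<exists>v. lam v \<noteq> 0) \<or> (\<exists>v. mu v \<noteq> 0) \<or> (\<exists>v. nu v \<noteq> 0)"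
        "c *\<^sub>R R i (b v) + vs s' lam i b = vs t mu j b" "vs s' lam i b = vs r nu k b" by blast
      note okb = e(2)[OF b]
      have l: "\<exists>v. lam v \<noteq> 0"
        by (rule sol4_pos[OF okb e(3)[OF b] ij(1,2) ij'(1) s' st(2,3) vf(2) _ vf(1) h]) (use card in simp)
      \<comment> \<open>With the vertex term included the point lies in the cone over
        \<open>s\<close>. So \<open>pair_disj\<close> and \<open>trip_disj\<close> apply to
        \<open>s\<close> with the two weight functions \<open>l1\<close> and
        \<open>lam\<close>.\<close>
      define l1 where "l1 = (\<lambda>u. (if u = v then c else 0) + lam u)"
      have fs: "finite s" using fin_face[OF st(1)] .
      have ws: "wt s lam" "wt s l1" using h(1,2) st(4,5) by (auto simp: wt_def l1_def)
      have vsl: "vs s lam i b = vs s' lam i b"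
        unfolding vs_def by (rule sum.mono_neutral_right) (use fs st(5) h(2) in \<open>auto simp: wt_def\<close>)
      have "vs s l1 i b = c *\<^sub>R R i (b v) + vs s lam i b"
      proof -
        have "vs s l1 i b = (\<Sum>u\<in>s. (if u = v then c *\<^sub>R R i (b v) else 0)) + vs s lam i b"
          unfolding vs_def l1_def sum.distrib[symmetric] by (rule sum.cong) (auto simp: scaleR_add_left)
        then show ?thesis using fs st(4) by simp
      qed
      then have e1: "vs s l1 i b = vs t mu j b" "vs s lam i b = vs r nu k b" using h(6,7) vsl by auto
      have l1: "\<exists>v. l1 v \<noteq> 0"
      proof -
        obtain u where u: "lam u \<noteq> 0" using l by blast
        then have "lam u > 0" using h(2) by (simp add: wt_def less_le)
        then have "l1 u > 0" using h(1) by (simp add: l1_def add_nonneg_pos)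
        then show ?thesis by (metis less_irrefl)
      qed
      have "disj_orbits s t" unfolding disj_orbits_def using pair_disj[OF okb ij(1,2) ij'(1) st(1,2) ws(2) h(3) disjI1[OF l1] e1(1)] by blast
      moreover have "disj_orbits s r" unfolding disj_orbits_def using pair_disj[OF okb ij(1,3) ij'(2) st(1,3) ws(1) h(4) disjI1[OF l] e1(2)] by blast
      moreover have "disj_orbits t r" unfolding disj_orbits_def using trip_disj[OF okb ij st(1-3) ws(2,1) h(3,4) l1 l e1] by blast
      ultimately show False using False by blast
    qed
    then have "robust (\<lambda>a. unsolvable ({()} <+> (s' <+> (t <+> r))) (sys4 i j k v a)) a" unfolding robust_def using o e(1) by blast
    then show ?thesis using near_refl[OF o d] by blast
  next
    case True
    have cy: "card t + card {R i (a v)} < 4" "card {R i (a v)} + 1 < 4" "finite {R i (a v)}" using card by auto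
    have dd: "0 < min d e" using d e by simp
    have dts: "disj_orbits t s'" using True st(5) unfolding disj_orbits_def by (metis TT subsetD)
    have key: "\<exists>b q. near (min d e) a b \<and> b v = a v \<and> (\<forall>u\<in>t. q \<bullet> R j (b u) = 0) \<and> q \<bullet> R i (a v) = 0 \<and>
      (\<forall>lam nu. vs s' lam i b = vs r nu k b \<longrightarrow> vs s' lam i b \<bullet> q = 0 \<longrightarrow> vs s' lam i b = 0)"
      using card(2)
    proof
      assume c: "card s' = 3 \<and> card r = 2"
      obtain r1 r2 where r: "r = {r1, r2}" "r1 \<noteq> r2" using c by (auto simp: card_2_iff)
      obtain \<alpha> where al: "\<alpha> \<noteq> 0" "\<And>u. u \<in> s \<Longrightarrow> \<alpha> \<bullet> R i (a u) = 0" using normal_exists[OF st(1), of i a] by blast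
      have tr: "disj_orbits t r" using True by blast
      obtain b \<beta> where b: "near (min d e) a b" "\<And>v. v \<notin> t \<Longrightarrow> T v \<notin> t \<Longrightarrow> v \<notin> r \<Longrightarrow> T v \<notin> r \<Longrightarrow> b v = a v"
        "\<And>u. u \<in> t \<Longrightarrow> \<beta> \<bullet> R j (b u) = 0" "\<And>y. y \<in> {R i (a v)} \<Longrightarrow> \<beta> \<bullet> y = 0"
        "\<And>nu. vs r nu k b \<bullet> \<alpha> = 0 \<Longrightarrow> vs r nu k b \<bullet> \<beta> = 0 \<Longrightarrow> vs r nu k b = 0"
        by (rule perturb_three[OF oka al(1) st(2) r(2) st(3) r(1) tr cy(3,1,2) dd, of j k]) blast
      have bs: "b u = a u" if "u \<in> s" for u
        using that True b(2)[of u] disj_orbits_notin(1)[of s t u] disj_orbits_notin(1)[of s r u] by blast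
      have "vs s' lam i b = 0" if "vs s' lam i b = vs r nu k b" "vs s' lam i b \<bullet> \<beta> = 0" for lam nu
      proof -
        have "vs s' lam i b \<bullet> \<alpha> = 0" by (rule vs_inner0) (use st(5) bs al(2) in auto)
        then show ?thesis using b(5)[of nu] that by simp
      qed
      then show ?thesis using b bs[OF st(4)] by blast
    next
      assume c: "card s' = 2 \<and> card r = 3 \<and> v \<notin> s'"
      obtain g1 g2 where g: "s' = {g1, g2}" "g1 \<noteq> g2" using c by (auto simp: card_2_iff)
      obtain \<alpha> where al: "\<alpha> \<noteq> 0" "\<And>u. u \<in> r \<Longrightarrow> \<alpha> \<bullet> R k (a u) = 0" using normal_exists[OF st(3), of k a] by blast
      obtain b \<beta> where b: "near (min d e) a b" "\<And>v. v \<notin> t \<Longrightarrow> T v \<notin> t \<Longrightarrow> v \<notin> s' \<Longrightarrow> T v \<notin> s' \<Longrightarrow> b v = a v"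
        "\<And>u. u \<in> t \<Longrightarrow> \<beta> \<bullet> R j (b u) = 0" "\<And>y. y \<in> {R i (a v)} \<Longrightarrow> \<beta> \<bullet> y = 0"
        "\<And>nu. vs s' nu i b \<bullet> \<alpha> = 0 \<Longrightarrow> vs s' nu i b \<bullet> \<beta> = 0 \<Longrightarrow> vs s' nu i b = 0"
        by (rule perturb_three[OF oka al(1) st(2) g(2) s' g(1) dts cy(3,1,2) dd, of j i]) blast
      have br: "b u = a u" if "u \<in> r" for u
        using that True b(2)[of u] st(5) disj_orbits_notin(2)[of t r u] disj_orbits_notin(2)[of s r u] by blast
      have bv: "b v = a v"
      proof (rule b(2))
        show "v \<notin> t" "T v \<notin> t" using True disj_orbits_notin(1)[of s t v] st(4) by auto
        show "v \<notin> s'" using c by blast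
        show "T v \<notin> s'" using face_orbit[OF oka st(1,4)] st(5) by blast
      qed
      have "vs s' lam i b = 0" if "vs s' lam i b = vs r nu k b" "vs s' lam i b \<bullet> \<beta> = 0" for lam nu
      proof -
        have "vs r nu k b \<bullet> \<alpha> = 0" by (rule vs_inner0) (use br al(2) in auto)
        then show ?thesis using b(5)[of lam] that by simp
      qed
      then show ?thesis using b bv by blast
    qed
    then obtain b q where b: "near (min d e) a b" "b v = a v" "\<forall>u\<in>t. q \<bullet> R j (b u) = 0" "q \<bullet> R i (a v) = 0"
      "\<And>lam nu. vs s' lam i b = vs r nu k b \<Longrightarrow> vs s' lam i b \<bullet> q = 0 \<Longrightarrow> vs s' lam i b = 0" by blast
    have ne: "near e a b" using near_mono[OF b(1)] by simp
    note okb = e(2)[OF ne]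
    have "unsolvable ({()} <+> (s' <+> (t <+> r))) (sys4 i j k v b)"
      unfolding sys4_iff[OF fin]
    proof
      assume "\<exists>c lam mu nu. 0 \<le> c \<and> wt s' lam \<and> wt t mu \<and> wt r nu \<and>
        (c \<noteq> 0 \<or> (\<exists>v. lam v \<noteq> 0) \<or> (\<exists>v. mu v \<noteq> 0) \<or> (\<exists>v. nu v \<noteq> 0)) \<and>
        c *\<^sub>R R i (b v) + vs s' lam i b = vs t mu j b \<and> vs s' lam i b = vs r nu k b"
      then obtain c lam mu nu where h: "0 \<le> c" "wt s' lam" "wt t mu" "wt r nu"
        "c \<noteq> 0 \<or> (\<exists>v. lam v \<noteq> 0) \<or> (\<exists>v. mu v \<noteq> 0) \<or> (\<exists>v. nu v \<noteq> 0)"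
        "c *\<^sub>R R i (b v) + vs s' lam i b = vs t mu j b" "vs s' lam i b = vs r nu k b" by blast
      have l: "\<exists>v. lam v \<noteq> 0"
        by (rule sol4_pos[OF okb e(3)[OF ne] ij(1,2) ij'(1) s' st(2,3) vf(2) _ vf(1) h]) (use card in simp)
      have "vs t mu j b \<bullet> q = 0" by (rule vs_inner0) (use b(3) in auto)
      then have "(c *\<^sub>R R i (b v) + vs s' lam i b) \<bullet> q = 0" using h(6) by simp
      then have "vs s' lam i b \<bullet> q = 0" using b(2,4) by (simp add: inner_add_left inner_add_right inner_commute[of _ q])
      then have "vs s' lam i b = 0" using b(5)[OF h(7)] by blast
      then show False using cone0[OF okb s' h(2)] l by blast
    qed
    moreover have "odd_assign b" using b(1) by (simp add: near_def)
    ultimately have "robust (\<lambda>a. unsolvable ({()} <+> (s' <+> (t <+> r))) (sys4 i j k v a)) b" using sys4_open s' st vf(2) by blast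
    then show ?thesis using near_mono[OF b(1), of d] by auto
  qed
qed

end

section \<open>Existence of generic assignments\<close>

context fine_mesh
begin

definition generic3 where
  "generic3 a \<longleftrightarrow> (\<forall>i j k s t r. i < n \<and> j < n \<and> k < n \<and> distinct [i,j,k] \<and> s \<in> faces \<and> t \<in> faces \<and> r \<in> faces \<and> card r = 2 \<longrightarrow>
     unsolvable (s <+> (t <+> r)) (sys3 i j k a))"

definition generic4 where
  "generic4 a \<longleftrightarrow> (\<forall>i j k s v s' t r. i < n \<and> j < n \<and> k < n \<and> distinct [i,j,k] \<and> s \<in> faces \<and> t \<in> faces \<and> r \<in> faces \<and> v \<in> s \<and> s' \<subseteq> s \<and>
     card t = 2 \<and> (card s' = 3 \<and> card r = 2 \<or> card s' = 2 \<and> card r = 3 \<and> v \<notin> s') \<longrightarrow>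
     unsolvable ({()} <+> (s' <+> (t <+> r))) (sys4 i j k v a))"

text \<open>The order matters: \<open>dense_sys4\<close> presupposes that \<open>generic2\<close>
  already holds robustly.\<close>

lemma generic_exists:
  assumes "robust spread a"
  obtains b where "spread b" "generic2 b" "generic3 b" "generic4 b"
proof -
  define I2x where "I2x = {(i,j,s,t). i < n \<and> j < n \<and> i \<noteq> j \<and> s \<in> faces \<and> t \<in> faces \<and> card s + card t \<le> 4}"
  define I3x where "I3x = {(i,j,k,s,t,r). i < n \<and> j < n \<and> k < n \<and> distinct [i,j,k] \<and> s \<in> faces \<and> t \<in> faces \<and> r \<in> faces \<and> card r = 2}"
  define I4x where "I4x = {(i,j,k,s,v,s',t,r). i < n \<and> j < n \<and> k < n \<and> distinct [i,j,k] \<and> s \<in> faces \<and> t \<in> faces \<and> r \<in> faces \<and> v \<in> s \<and> s' \<subseteq> s \<and>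
     card t = 2 \<and> (card s' = 3 \<and> card r = 2 \<or> card s' = 2 \<and> card r = 3 \<and> v \<notin> s')}"
  have fV: "finite V" unfolding V_def using finite_faces fin_face by blast
  have f2: "finite I2x"
    by (rule finite_subset[of _ "{..<n} \<times> {..<n} \<times> faces \<times> faces"]) (use finite_faces in \<open>auto simp: I2x_def\<close>)
  have f3: "finite I3x"
    by (rule finite_subset[of _ "{..<n} \<times> {..<n} \<times> {..<n} \<times> faces \<times> faces \<times> faces"]) (use finite_faces in \<open>auto simp: I3x_def\<close>)
  have f4: "finite I4x"
    by (rule finite_subset[of _ "{..<n} \<times> {..<n} \<times> {..<n} \<times> faces \<times> V \<times> faces \<times> faces \<times> faces"])
      (use finite_faces fV face_V face_sub in \<open>auto simp: I4x_def\<close>)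
  have "\<exists>a'. near 1 a a' \<and> robust (\<lambda>a. spread a \<and> (\<forall>x\<in>I2x. (\<lambda>(i,j,s,t) a. unsolvable (s <+> t) (sys2 i j a)) x a)) a'"
  proof (rule dense_all[OF f2 _ assms zero_less_one])
    fix x a d assume "x \<in> I2x" "robust spread a" "0 < (d::real)"
    then show "\<exists>a'. near d a a' \<and> robust ((\<lambda>(i,j,s,t) a. unsolvable (s <+> t) (sys2 i j a)) x) a'"
      using dense_sys2 unfolding I2x_def by auto
  qed
  then obtain a1 where "robust (\<lambda>a. spread a \<and> (\<forall>x\<in>I2x. (\<lambda>(i,j,s,t) a. unsolvable (s <+> t) (sys2 i j a)) x a)) a1" by blast
  then have a1: "robust (\<lambda>a. spread a \<and> generic2 a) a1"
    by (rule robust_mono) (auto simp: I2x_def generic2_def)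
  have "\<exists>a'. near 1 a1 a' \<and> robust (\<lambda>a. (spread a \<and> generic2 a) \<and> (\<forall>x\<in>I3x. (\<lambda>(i,j,k,s,t,r) a. unsolvable (s <+> (t <+> r)) (sys3 i j k a)) x a)) a'"
  proof (rule dense_all[OF f3 _ a1 zero_less_one])
    fix x a d assume x: "x \<in> I3x" and i: "robust (\<lambda>a. spread a \<and> generic2 a) a" and d: "0 < (d::real)"
    have "robust spread a" using i by (rule robust_mono) blast
    then show "\<exists>a'. near d a a' \<and> robust ((\<lambda>(i,j,k,s,t,r) a. unsolvable (s <+> (t <+> r)) (sys3 i j k a)) x) a'"
      using dense_sys3[OF _ _ _ _ _ _ _ _ _ d] x unfolding I3x_def by auto
  qed
  then obtain a2 where a2: "robust (\<lambda>a. (spread a \<and> generic2 a) \<and> generic3 a) a2"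
    unfolding I3x_def generic3_def by (auto elim!: robust_mono)
  have "\<exists>a'. near 1 a2 a' \<and> robust (\<lambda>a. ((spread a \<and> generic2 a) \<and> generic3 a) \<and>
      (\<forall>x\<in>I4x. (\<lambda>(i,j,k,s,v,s',t,r) a. unsolvable ({()} <+> (s' <+> (t <+> r))) (sys4 i j k v a)) x a)) a'"
  proof (rule dense_all[OF f4 _ a2 zero_less_one])
    fix x a d assume x: "x \<in> I4x" and i: "robust (\<lambda>a. (spread a \<and> generic2 a) \<and> generic3 a) a" and d: "0 < (d::real)"
    have i': "robust (\<lambda>a. spread a \<and> generic2 a) a" using i by (rule robust_mono) blast
    obtain i j k s v s' t r where xx: "x = (i,j,k,s,v,s',t,r)" by (cases x) auto
    have "\<exists>a'. near d a a' \<and> robust (\<lambda>a. unsolvable ({()} <+> (s' <+> (t <+> r))) (sys4 i j k v a)) a'"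
      by (rule dense_sys4[where s = s, OF _ _ _ _ _ _ _ _ _ _ _ i' d]) (use x in \<open>simp_all add: I4x_def xx\<close>)
    then show "\<exists>a'. near d a a' \<and> robust ((\<lambda>(i,j,k,s,v,s',t,r) a. unsolvable ({()} <+> (s' <+> (t <+> r))) (sys4 i j k v a)) x) a'"
      unfolding xx by simp
  qed
  then obtain a3 where "robust (\<lambda>a. ((spread a \<and> generic2 a) \<and> generic3 a) \<and> generic4 a) a3"
    unfolding I4x_def generic4_def by (auto elim!: robust_mono)
  then show thesis using that robust_D[of "\<lambda>a. ((spread a \<and> generic2 a) \<and> generic3 a) \<and> generic4 a" a3] by blast
qed

definition rot_field where "rot_field a j v = coords (R j (a v))"

lemma rot_field_eta: "rot_field a j = (\<lambda>v. coords (R j (a v)))" by (rule ext) (simp add: rot_field_def)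

lemma sol2_rot_field:
  "sol2 (rot_field a i) (rot_field a j) s t lam mu \<longleftrightarrow> wt s lam \<and> wt t mu \<and> ((\<exists>v. lam v \<noteq> 0) \<or> (\<exists>v. mu v \<noteq> 0)) \<and> vs s lam i a = vs t mu j a"
  unfolding rot_field_eta sol2_coords vs_def ..

lemma sol3_rot_field:
  "sol3 (rot_field a i) (rot_field a j) (rot_field a k) s t r lam mu nu \<longleftrightarrow> wt s lam \<and> wt t mu \<and> wt r nu \<and>
     (\<exists>v. lam v \<noteq> 0 \<or> mu v \<noteq> 0 \<or> nu v \<noteq> 0) \<and> vs s lam i a = vs t mu j a \<and> vs s lam i a = vs r nu k a"
  unfolding rot_field_eta sol3_coords vs_def ..

lemma extend_edge:
  assumes "r \<in> faces" "card r \<le> 2"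
  obtains r' where "r' \<in> faces" "r \<subseteq> r'" "card r' = 2"
proof -
  obtain i where i: "i \<in> I2" "r \<subseteq> s2 i \<or> r \<subseteq> T ` s2 i" using assms(1) unfolding faces_def by blast
  define C where "C = (if r \<subseteq> s2 i then s2 i else T ` s2 i)"
  have C: "r \<subseteq> C" "C \<in> faces" "card C = 3" "finite C"
    using i fin_s2[OF i(1)] face_s2 face_T card3 by (auto simp: C_def card_T)
  obtain B where "r \<subseteq> B" "B \<subseteq> C" "card B = 2" using exists_subset_between[of r 2 C] assms(2) C by auto
  then show thesis using that face_sub[OF C(2)] by blast
qed

lemma vs_mono: "wt s' lam \<Longrightarrow> s' \<subseteq> s \<Longrightarrow> finite s \<Longrightarrow> vs s lam i a = vs s' lam i a"
  unfolding vs_def by (rule sum.mono_neutral_right) (auto simp: wt_def)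

lemma good2_rot_field:
  assumes spread: "spread a" and g: "generic2 a" and ij: "i < n" "j < n" "i \<noteq> j"
  shows "good2 (rot_field a i) (rot_field a j)"
  unfolding good2_def
proof (intro ballI allI impI)
  fix s t lam mu assume st: "s \<in> faces" "t \<in> faces" and sol: "sol2 (rot_field a i) (rot_field a j) s t lam mu"
  have h: "wt s lam" "wt t mu" "(\<exists>v. lam v \<noteq> 0) \<or> (\<exists>v. mu v \<noteq> 0)" "vs s lam i a = vs t mu j a"
    using sol unfolding sol2_rot_field by blast+
  have "\<not> unsolvable (s <+> t) (sys2 i j a)" unfolding sys2_iff[OF fin_face[OF st(1)] fin_face[OF st(2)]] using h by blast
  then have "\<not> card s + card t \<le> 4" using g ij st unfolding generic2_def by blast
  moreover have "sum lam s \<noteq> sum mu t" using pair_sum[OF spread ij st h] .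
  ultimately show "5 \<le> card s + card t \<and> sum lam s \<noteq> sum mu t" by simp
qed

lemma generic3_unsolvable:
  assumes g: "generic3 a" and ij: "i < n" "j < n" "k < n" "distinct [i,j,k]" and st: "s \<in> faces" "t \<in> faces" "r \<in> faces" "card r \<le> 2"
  shows "\<not> sol3 (rot_field a i) (rot_field a j) (rot_field a k) s t r lam mu nu"
proof
  assume sol: "sol3 (rot_field a i) (rot_field a j) (rot_field a k) s t r lam mu nu"
  obtain r' where r': "r' \<in> faces" "r \<subseteq> r'" "card r' = 2" using extend_edge[OF st(3,4)] .
  have fin: "finite s" "finite t" "finite r'" using fin_face st r' by auto
  have "unsolvable (s <+> (t <+> r')) (sys3 i j k a)" using g ij st r' unfolding generic3_def by blast
  moreover have h: "wt s lam" "wt t mu" "wt r nu" "(\<exists>v. lam v \<noteq> 0) \<or> (\<exists>v. mu v \<noteq> 0) \<or> (\<exists>v. nu v \<noteq> 0)"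
    "vs s lam i a = vs t mu j a" "vs s lam i a = vs r nu k a" using sol unfolding sol3_rot_field by blast+
  moreover have "wt r' nu" using h(3) r'(2) by (auto simp: wt_def)
  moreover have "vs r' nu k a = vs r nu k a" using vs_mono[OF h(3) r'(2) fin(3)] .
  ultimately show False unfolding sys3_iff[OF fin] by metis
qed

lemma good3_rot_field:
  assumes g: "generic3 a" and ij: "i < n" "j < n" "k < n" "distinct [i,j,k]"
  shows "good3 (rot_field a i) (rot_field a j) (rot_field a k)"
  unfolding good3_def
proof (intro ballI allI impI)
  fix s t r lam mu nu assume st: "s \<in> faces" "t \<in> faces" "r \<in> faces" and sol: "sol3 (rot_field a i) (rot_field a j) (rot_field a k) s t r lam mu nu"
  have "\<not> card r \<le> 2" using generic3_unsolvable[OF g ij st] sol by blast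
  moreover have "\<not> card t \<le> 2"
    using generic3_unsolvable[OF g, of i k j s r t lam nu mu] ij st sol sol3_perm(1)[of "rot_field a i" "rot_field a j" "rot_field a k" s t r lam mu nu] by auto
  moreover have "\<not> card s \<le> 2"
  proof
    assume c: "card s \<le> 2"
    have "sol3 (rot_field a k) (rot_field a j) (rot_field a i) r t s nu mu lam"
      using sol sol3_perm(3)[of "rot_field a i" "rot_field a j" "rot_field a k" s t r lam mu nu]
        sol3_perm(1)[of "rot_field a k" "rot_field a i" "rot_field a j" r s t nu lam mu] by blast
    then show False using generic3_unsolvable[OF g, of k j i r t s] ij st c by auto
  qed
  ultimately show "9 \<le> card s + card t + card r" by linarith
qed

text \<open>If the total were below eight, the bounds for pairs would leave only
  \<open>card t = 2\<close> and \<open>card s' + card r = 5\<close>, the configurations treated in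
  \<open>generic4\<close>.\<close>

lemma good4_rot_field:
  assumes spread: "spread a" and g2: "generic2 a" and g: "generic4 a" and ij: "i < n" "j < n" "k < n" "distinct [i,j,k]"
  shows "good4 (rot_field a i) (rot_field a j) (rot_field a k)"
  unfolding good4_def
proof (intro ballI allI impI)
  fix s v s' t r and c :: real and lam mu nu
  assume st: "s \<in> faces" "v \<in> s" "s' \<subseteq> s" "t \<in> faces" "r \<in> faces" and w: "0 \<le> c" "wt s' lam" "wt t mu" "wt r nu"
    and l: "\<exists>v. lam v \<noteq> 0" and e1: "\<forall>i'<4. c * rot_field a i v i' + cmb (rot_field a i) s' lam i' = cmb (rot_field a j) t mu i'"
    and e2: "\<forall>i'<4. cmb (rot_field a i) s' lam i' = cmb (rot_field a k) r nu i'"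
  have ij': "i \<noteq> j" "i \<noteq> k" using ij by auto
  have s': "s' \<in> faces" using face_sub[OF st(1,3)] .
  have fs: "finite s" "finite s'" "finite t" "finite r" using fin_face st s' by auto
  have q2: "vs s' lam i a = vs r nu k a"
    using e2 unfolding rot_field_eta coords_sum coords_eq vs_def .
  have q1: "c *\<^sub>R R i (a v) + vs s' lam i a = vs t mu j a"
    using e1 unfolding rot_field_eta coords_sum coords_lin coords_eq vs_def .
  have "sol2 (rot_field a i) (rot_field a k) s' r lam nu" unfolding sol2_rot_field using w l q2 by blast
  then have c1: "5 \<le> card s' + card r" using good2D(1)[OF good2_rot_field[OF spread g2 ij(1,3) ij'(2)] s' st(5)] by blast
  define l1 where "l1 = (\<lambda>u. (if u = v then c else 0) + lam u)"
  define s1' where "s1' = insert v s'"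
  have s1: "s1' \<in> faces" "finite s1'" using face_sub[OF st(1), of s1'] st fs by (auto simp: s1'_def)
  have wl: "wt s1' l1" using w by (auto simp: wt_def l1_def s1'_def)
  have "vs s1' l1 i a = (\<Sum>u\<in>s1'. (if u = v then c *\<^sub>R R i (a v) else 0)) + vs s1' lam i a"
    unfolding vs_def l1_def sum.distrib[symmetric] by (rule sum.cong) (auto simp: scaleR_add_left)
  also have "\<dots> = c *\<^sub>R R i (a v) + vs s' lam i a"
    using s1 vs_mono[OF w(2), of s1'] by (auto simp: s1'_def)
  finally have v1: "vs s1' l1 i a = vs t mu j a" using q1 by simp
  have l1: "\<exists>v. l1 v \<noteq> 0"
  proof -
    obtain u where u: "lam u \<noteq> 0" using l by blast
    then have "lam u > 0" using w(2) by (simp add: wt_def less_le)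
    then have "l1 u > 0" using w(1) by (simp add: l1_def add_nonneg_pos)
    then show ?thesis by (metis less_irrefl)
  qed
  have "sol2 (rot_field a i) (rot_field a j) s1' t l1 mu" unfolding sol2_rot_field using wl w l1 v1 by blast
  then have c2: "5 \<le> card s1' + card t" using good2D(1)[OF good2_rot_field[OF spread g2 ij(1,2) ij'(1)] s1(1) st(4)] by blast
  have c3: "card s1' \<le> 3" "card s' \<le> 3" "card r \<le> 3" using face_card s1(1) s' st(5) by auto
  show "8 \<le> card s' + card t + card r"
  proof (rule ccontr)
    assume "\<not> 8 \<le> card s' + card t + card r"
    then have triangle: "card t = 2" and "card s' + card r = 5" using c1 c2 c3 by linarith+
    then have "card s' = 3 \<and> card r = 2 \<or> card s' = 2 \<and> card r = 3" using c3 by linarith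
    \<comment> \<open>If \<open>v\<close> were in \<open>s'\<close>, the vertex term would not
      enlarge the support, and cones over two pairs of vertices would meet.\<close>
    moreover have "v \<notin> s'" if "card s' = 2"
    proof
      assume "v \<in> s'"
      then have "s1' = s'" by (auto simp: s1'_def)
      then show False using that c2 triangle by simp
    qed
    ultimately have "unsolvable ({()} <+> (s' <+> (t <+> r))) (sys4 i j k v a)"
      using g ij st triangle unfolding generic4_def by blast
    then show False unfolding sys4_iff[OF fs(2,3,4)] using w l q1 q2 by blast
  qed
qed

lemma R_Suc: "R (Suc j) x = twist (pi / real n) (R j x)"
proof -
  have "pi * real (Suc j) / real n = pi / real n + pi * real j / real n" by (simp add: add_divide_distrib distrib_left)
  then show ?thesis unfolding R_def by (simp only: twist_add)
qed

theorem discrete_impossible: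
  assumes "robust spread a"
  shows False
proof -
  obtain b where b: "spread b" "generic2 b" "generic3 b" "generic4 b" using generic_exists[OF assms] .
  have n0: "n > 0" using n2 by simp
  show False
  proof (rule cyclic_impossible[of n "rot_field b"])
    show "odd_field (rot_field b j)" for j
      unfolding odd_field_def rot_field_def using okD(1)[OF b(1)] by (simp add: R_lin coords_minus)
    show "rot_field b n v i = - rot_field b 0 v i" for v i
      using n0 by (simp add: rot_field_def R_def twist_pi coords_minus)
    show "linking (rot_field b (Suc i)) (rot_field b (Suc j)) = linking (rot_field b i) (rot_field b j)" for i j
    proof -
      have s: "vs s lam (Suc i) b = twist (pi / real n) (vs s lam i b)" for s lam i
        unfolding vs_def twist_sum R_Suc ..
      have inj: "twist \<theta> x = twist \<theta> y \<longleftrightarrow> x = y" for \<theta> x y by (metis twist_inverse(2))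
      have "sol2 (rot_field b (Suc i)) (rot_field b (Suc j)) = sol2 (rot_field b i) (rot_field b j)"
        by (intro ext) (simp only: sol2_rot_field s inj)
      then show ?thesis unfolding linking_def below_def by simp
    qed
  qed (use n2 good2_rot_field good3_rot_field good4_rot_field b in auto)
qed

end

section \<open>The grid triangulation\<close>

lemma bit_telescope: "(\<Sum>j<M. (g j :: bit) + g (Suc j)) = g 0 + g M"
proof (induction M)
  case (Suc M)
  then show ?case by (cases "g 0"; cases "g M"; cases "g (Suc M)") auto
qed simp

locale grid =
  fixes M :: nat
  assumes M0: "M > 0"
begin

text \<open>The square, bent to a pillow over the plane \<open>z = 0\<close> with negation as antipodal map.\<close>

definition up :: "nat \<Rightarrow> nat \<Rightarrow> int \<times> int \<times> int" where
  "up i j = (2 * int i - int M, 2 * int j - int M, int M - max \<bar>2 * int i - int M\<bar> \<bar>2 * int j - int M\<bar>)"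

definition triangle :: "nat \<times> nat \<times> bool \<Rightarrow> (int \<times> int \<times> int) set" where
  "triangle x = (case x of (i, j, b) \<Rightarrow> if b then {up i j, up (Suc i) j, up (Suc i) (Suc j)} else {up i j, up i (Suc j), up (Suc i) (Suc j)})"

text \<open>The right side and the top side of the square: together they lead from
  \<open>up M 0\<close> to its antipode \<open>up 0 M\<close>.\<close>

definition edge :: "nat \<times> bool \<Rightarrow> (int \<times> int \<times> int) set" where
  "edge x = (case x of (j, b) \<Rightarrow> if b then {up M j, up M (Suc j)} else {up j M, up (Suc j) M})"

abbreviation "J2 \<equiv> {..<M} \<times> {..<M} \<times> (UNIV :: bool set)"
abbreviation "J1 \<equiv> {..<M} \<times> (UNIV :: bool set)"

lemma up_inj [simp]: "up i j = up i' j' \<longleftrightarrow> i = i' \<and> j = j'"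
  unfolding up_def by auto

lemma up_neg_right: "j \<le> M \<Longrightarrow> - up M j = up 0 (M - j)" "j \<le> M \<Longrightarrow> - up 0 j = up M (M - j)"
  unfolding up_def by (auto simp: of_nat_diff)

lemma up_neg_top: "i \<le> M \<Longrightarrow> - up i M = up (M - i) 0" "i \<le> M \<Longrightarrow> - up i 0 = up (M - i) M"
  unfolding up_def by (auto simp: of_nat_diff)

lemma chsum_J2: "chsum J2 triangle f = (\<Sum>i<M. \<Sum>j<M. f {up i j, up (Suc i) j, up (Suc i) (Suc j)} + f {up i j, up i (Suc j), up (Suc i) (Suc j)})"
proof -
  have "chsum J2 triangle f = (\<Sum>i<M. \<Sum>j<M. \<Sum>b\<in>UNIV. f (triangle (i, j, b)))"
    unfolding chsum_def by (simp add: sum.cartesian_product)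
  then show ?thesis by (simp add: UNIV_bool triangle_def add.commute)
qed

lemma chsum_J1: "chsum J1 edge f = (\<Sum>j<M. f {up M j, up M (Suc j)}) + (\<Sum>i<M. f {up i M, up (Suc i) M})"
proof -
  have "chsum J1 edge f = (\<Sum>j<M. \<Sum>b\<in>UNIV. f (edge (j, b)))"
    unfolding chsum_def by (simp add: sum.cartesian_product)
  then show ?thesis by (simp add: UNIV_bool edge_def sum.distrib add.commute)
qed

lemma bnd2: "a \<noteq> b \<Longrightarrow> cobd f {a, b} = f {a} + f {b}"
proof -
  assume "a \<noteq> b"
  then have "{a,b} - {a} = {b}" "{a,b} - {b} = {a}" by auto
  then show ?thesis using \<open>a \<noteq> b\<close> by (simp add: cobd_def add.commute)
qed

lemma bnd3: "a \<noteq> b \<Longrightarrow> a \<noteq> c \<Longrightarrow> b \<noteq> c \<Longrightarrow> cobd f {a, b, c} = f {b, c} + f {a, c} + f {a, b}"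
proof -
  assume "a \<noteq> b" "a \<noteq> c" "b \<noteq> c"
  then have "{a,b,c} - {a} = {b,c}" "{a,b,c} - {b} = {a,c}" "{a,b,c} - {c} = {a,b}" by auto
  then show ?thesis using \<open>a \<noteq> b\<close> \<open>a \<noteq> c\<close> \<open>b \<noteq> c\<close> by (simp add: cobd_def add.assoc)
qed

lemma square_cobd:
  "cobd f {up i j, up (Suc i) j, up (Suc i) (Suc j)} + cobd f {up i j, up i (Suc j), up (Suc i) (Suc j)} =
   (f {up i j, up (Suc i) j} + f {up i (Suc j), up (Suc i) (Suc j)}) + (f {up i j, up i (Suc j)} + f {up (Suc i) j, up (Suc i) (Suc j)})"
  by (simp add: bnd3 add_ac)

text \<open>Diagonals cancel within each small square and inner edges by telescoping. The left and
  bottom sides of the big square are the antipodes of the right and top ones.\<close>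

lemma grid_bd2: "chsum J2 triangle (cobd f) = chsum J1 edge (\<lambda>s. f s + f (uminus ` s))"
proof -
  define H where "H = (\<lambda>i j. f {up i j, up (Suc i) j})"
  define V where "V = (\<lambda>i j. f {up i j, up i (Suc j)})"
  have "chsum J2 triangle (cobd f) = (\<Sum>i<M. \<Sum>j<M. (H i j + H i (Suc j)) + (V i j + V (Suc i) j))"
    unfolding chsum_J2 square_cobd H_def V_def ..
  also have "\<dots> = (\<Sum>i<M. \<Sum>j<M. H i j + H i (Suc j)) + (\<Sum>j<M. \<Sum>i<M. V i j + V (Suc i) j)"
    unfolding sum.distrib[of "\<lambda>j. H _ j + H _ (Suc j)"] sum.distrib[of "\<lambda>i. \<Sum>j<M. H i j + H i (Suc j)"] by (subst (3) sum.swap) simp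
  also have "\<dots> = (\<Sum>i<M. H i 0 + H i M) + (\<Sum>j<M. V 0 j + V M j)"
    by (simp only: bit_telescope bit_telescope[of "\<lambda>i. V i _"])
  finally have L: "chsum J2 triangle (cobd f) = (\<Sum>i<M. H i 0) + (\<Sum>i<M. H i M) + ((\<Sum>j<M. V 0 j) + (\<Sum>j<M. V M j))"
    by (simp only: sum.distrib)
  have 1: "f (uminus ` {up M j, up M (Suc j)}) = V 0 (M - Suc j)" if "j < M" for j
    using that by (simp add: up_neg_right V_def Suc_diff_Suc insert_commute)
  have 2: "f (uminus ` {up i M, up (Suc i) M}) = H (M - Suc i) 0" if "i < M" for i
    using that by (simp add: up_neg_top H_def Suc_diff_Suc insert_commute)
  have "chsum J1 edge (\<lambda>s. f s + f (uminus ` s)) = (\<Sum>j<M. V M j) + (\<Sum>j<M. V 0 (M - Suc j)) + ((\<Sum>i<M. H i M) + (\<Sum>i<M. H (M - Suc i) 0))"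
    unfolding chsum_J1 using 1 2 by (simp add: sum.distrib V_def H_def)
  also have "\<dots> = (\<Sum>j<M. V M j) + (\<Sum>j<M. V 0 j) + ((\<Sum>i<M. H i M) + (\<Sum>i<M. H i 0))"
    by (simp only: sum.nat_diff_reindex[of "V 0"] sum.nat_diff_reindex[of "\<lambda>i. H i 0"])
  finally show ?thesis using L by (simp add: add_ac)
qed

lemma grid_bd1: "chsum J1 edge (cobd f) = f {up M 0} + f {- up M 0}"
proof -
  have "chsum J1 edge (cobd f) = (\<Sum>j<M. f {up M j} + f {up M (Suc j)}) + (\<Sum>i<M. f {up i M} + f {up (Suc i) M})"
    unfolding chsum_J1 by (simp add: bnd2)
  also have "\<dots> = (f {up M 0} + f {up M M}) + (f {up 0 M} + f {up M M})"
    unfolding bit_telescope[of "\<lambda>j. f {up M j}"] bit_telescope[of "\<lambda>i. f {up i M}"] ..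
  also have "\<dots> = f {up M 0} + f {up 0 M}" by (cases "f {up M M}") (simp_all add: add_ac)
  finally show ?thesis by (simp add: up_neg_right)
qed

text \<open>Integrate the cocycle along the bottom row and up the columns to a potential
  \<open>F\<close>. It descends to the quotient if its defect \<open>D\<close> between antipodal
  boundary points vanishes. The sum over the half circle gives this for one corner, and the
  invariance of \<gamma> carries it around the boundary.\<close>

lemma grid_H1:
  assumes T: "\<And>e. \<gamma> (uminus ` e) = (\<gamma> e :: bit)" and b: "\<And>x. x \<in> J2 \<Longrightarrow> cobd \<gamma> (triangle x) = 0" and k: "chsum J1 edge \<gamma> = 0"
  shows "\<exists>f. (\<forall>v. f (- v) = f v) \<and> (\<forall>x\<in>J2. \<forall>v\<in>triangle x. \<forall>w\<in>triangle x. v \<noteq> w \<longrightarrow> \<gamma> {v, w} = f v + f w)"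
proof -
  define H where "H = (\<lambda>i j. \<gamma> {up i j, up (Suc i) j})"
  define V where "V = (\<lambda>i j. \<gamma> {up i j, up i (Suc j)})"
  have tr: "\<gamma> {up (Suc i) j, up (Suc i) (Suc j)} + \<gamma> {up i j, up (Suc i) (Suc j)} + \<gamma> {up i j, up (Suc i) j} = 0"
    "\<gamma> {up i (Suc j), up (Suc i) (Suc j)} + \<gamma> {up i j, up (Suc i) (Suc j)} + \<gamma> {up i j, up i (Suc j)} = 0" if "i < M" "j < M" for i j
    using b[of "(i,j,True)"] b[of "(i,j,False)"] that by (simp_all add: triangle_def bnd3)
  have sq: "H i j + H i (Suc j) + V i j + V (Suc i) j = 0" if "i < M" "j < M" for i j
    using tr[OF that] unfolding H_def V_def
    by (cases "\<gamma> {up i j, up (Suc i) (Suc j)}"; cases "\<gamma> {up (Suc i) j, up (Suc i) (Suc j)}"; cases "\<gamma> {up i j, up (Suc i) j}";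
        cases "\<gamma> {up i (Suc j), up (Suc i) (Suc j)}"; cases "\<gamma> {up i j, up i (Suc j)}") auto
  define F where "F = (\<lambda>i j. (\<Sum>i'<i. H i' 0) + (\<Sum>j'<j. V i j'))"
  have FV: "F i j + F i (Suc j) = V i j" for i j
    unfolding F_def by (simp add: add.assoc add.left_commute)
  have FH: "F i j + F (Suc i) j = H i j" if "i < M" "j \<le> M" for i j
    using that(2)
  proof (induction j)
    case 0
    show ?case by (simp add: F_def)
  next
    case (Suc j)
    have j: "j < M" using Suc.prems by simp
    have ih: "F i j + F (Suc i) j = H i j" using Suc.IH Suc.prems by simp
    show ?case using ih sq[OF that(1) j] FV[of i j] FV[of "Suc i" j]
      by (cases "F i j"; cases "F (Suc i) j"; cases "F i (Suc j)"; cases "F (Suc i) (Suc j)"; cases "H i (Suc j)") auto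
  qed
  define D where "D = (\<lambda>i j. F i j + F (M - i) (M - j))"
  have sumV: "(\<Sum>j<M. V M j) = F M 0 + F M M" using bit_telescope[of "F M" M] by (simp add: FV)
  have sumH: "(\<Sum>i<M. H i M) = F 0 M + F M M" using bit_telescope[of "\<lambda>i. F i M" M] by (simp add: FH)
  have D0: "D M 0 = 0"
    using k unfolding chsum_J1 H_def[symmetric] V_def[symmetric] sumV[unfolded V_def] sumH[unfolded H_def] D_def
    by (cases "F M 0"; cases "F 0 M"; cases "F M M") auto
  have TV: "V M j = V 0 (M - Suc j)" if "j < M" for j
    using T[of "{up M j, up M (Suc j)}"] that by (simp add: up_neg_right V_def Suc_diff_Suc insert_commute)
  have TH: "H i M = H (M - Suc i) 0" if "i < M" for i
    using T[of "{up i M, up (Suc i) M}"] that by (simp add: up_neg_top H_def Suc_diff_Suc insert_commute)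
  have DM: "D M j = 0" if "j \<le> M" for j
    using that
  proof (induction j)
    case (Suc j)
    then have j: "j < M" and ih: "F M j + F 0 (M - j) = 0" by (auto simp: D_def)
    have "F 0 (M - Suc j) + F 0 (M - j) = V 0 (M - Suc j)" using FV[of 0 "M - Suc j"] j by (simp add: Suc_diff_Suc)
    then show ?case using ih FV[of M j] TV[OF j] unfolding D_def
      by (cases "F M j"; cases "F 0 (M - j)"; cases "F M (Suc j)"; cases "F 0 (M - Suc j)") auto
  qed (use D0 in simp)
  have DT: "D (M - i) M = 0" if "i \<le> M" for i
    using that
  proof (induction i)
    case (Suc i)
    define l where "l = M - Suc i"
    have l: "l < M" "M - i = Suc l" "M - Suc l = i" "M - l = Suc i" "M - Suc i = l" using Suc.prems by (auto simp: l_def)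
    have ih: "F (Suc l) M + F i 0 = 0" using Suc l by (simp add: D_def)
    have "F i 0 + F (Suc i) 0 = H i 0" using FH[of i 0] Suc.prems by simp
    moreover have "F l M + F (Suc l) M = H i 0" using FH[of l M] TH[OF l(1)] l by simp
    ultimately have "F l M + F (Suc i) 0 = 0" using ih
      by (cases "F l M"; cases "F (Suc l) M"; cases "F i 0"; cases "F (Suc i) 0") auto
    then show ?case using l by (simp add: D_def)
  qed (use DM[of M] in simp)
  have Dsym: "D i j = D (M - i) (M - j)" if "i \<le> M" "j \<le> M" for i j
    using that by (simp add: D_def add.commute)
  define U where "U = {up i j |i j. i \<le> M \<and> j \<le> M}"
  \<comment> \<open>The grid indices are recovered from the first two coordinates.\<close>
  define g where "g = (\<lambda>v :: int \<times> int \<times> int. F (nat ((fst v + int M) div 2)) (nat ((fst (snd v) + int M) div 2)))"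
  have gup: "g (up i j) = F i j" for i j unfolding g_def up_def by simp
  have bd: "g v = g (- v)" if v: "v \<in> U" "- v \<in> U" for v
  proof -
    obtain i j where ij: "v = up i j" "i \<le> M" "j \<le> M" using v unfolding U_def by blast
    obtain i' j' where ij': "- v = up i' j'" "i' \<le> M" "j' \<le> M" using v unfolding U_def by blast
    have e: "i' = M - i" "j' = M - j" using ij ij' unfolding up_def by auto
    \<comment> \<open>The third coordinate is nonnegative on \<open>U\<close>, so it is zero at a
      vertex whose antipode is in \<open>U\<close> as well; such vertices are on the boundary of the
      square.\<close>
    have z: "int M - max \<bar>2 * int i - int M\<bar> \<bar>2 * int j - int M\<bar> = 0"
      using ij ij' unfolding up_def by auto
    then have "i = 0 \<or> i = M \<or> j = 0 \<or> j = M" using ij(2,3) by (auto simp: max_def split: if_splits)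
    then have "D i j = 0" using DM[of j] DT[of "M - i"] Dsym[of i j] DM[of "M - j"] DT[of i] ij(2,3) by auto
    then show ?thesis unfolding ij'(1) gup unfolding ij(1) gup e D_def by (simp add: bit_add_eq_0)
  qed
  define f where "f = (\<lambda>v. if v \<in> U then g v else if - v \<in> U then g (- v) else 0)"
  have "f (- v) = f v" for v unfolding f_def using bd[of v] by auto
  moreover have fup: "f (up i j) = F i j" if "i \<le> M" "j \<le> M" for i j
    using that gup unfolding f_def U_def by auto
  have "\<gamma> {v, w} = f v + f w" if x: "x \<in> J2" and vw: "v \<in> triangle x" "w \<in> triangle x" "v \<noteq> w" for x v w
  proof -
    obtain i j c where xx: "x = (i, j, c)" "i < M" "j < M" using x by auto
    note f4 = fup[of i j] fup[of "Suc i" j] fup[of i "Suc j"] fup[of "Suc i" "Suc j"]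
    have e1: "\<gamma> {up i j, up (Suc i) j} = F i j + F (Suc i) j" using FH[of i j] xx by (simp add: H_def)
    have e2: "\<gamma> {up (Suc i) j, up (Suc i) (Suc j)} = F (Suc i) j + F (Suc i) (Suc j)" using FV[of "Suc i" j] by (simp add: V_def)
    have e3: "\<gamma> {up i j, up i (Suc j)} = F i j + F i (Suc j)" using FV[of i j] by (simp add: V_def)
    have e4: "\<gamma> {up i (Suc j), up (Suc i) (Suc j)} = F i (Suc j) + F (Suc i) (Suc j)" using FH[of i "Suc j"] xx by (simp add: H_def)
    have e5: "\<gamma> {up i j, up (Suc i) (Suc j)} = F i j + F (Suc i) (Suc j)"
      using tr(1)[OF xx(2,3)] unfolding e1 e2
      by (cases "\<gamma> {up i j, up (Suc i) (Suc j)}"; cases "F i j"; cases "F (Suc i) j"; cases "F (Suc i) (Suc j)") auto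
    show ?thesis using vw f4 xx e1 e2 e3 e4 e5 unfolding xx(1) triangle_def
      by (auto simp: insert_commute add.commute split: if_splits)
  qed
  ultimately show ?thesis by (intro exI[of _ f]) blast
qed

lemma grid_antipodal_sphere: "antipodal_sphere J2 triangle J1 edge (up M 0) uminus"
proof
  show "\<exists>i\<in>J2. up M 0 \<in> triangle i"
    by (rule bexI[of _ "(M - 1, 0, True)"]) (use M0 in \<open>auto simp: triangle_def\<close>)
  show "\<exists>i\<in>J2. edge j \<subseteq> triangle i" if j: "j \<in> J1" for j
  proof -
    obtain l b where jj: "j = (l, b)" "l < M" using j by auto
    show ?thesis
    proof (cases b)
      case True
      then show ?thesis by (intro bexI[of _ "(M - 1, l, True)"]) (use M0 jj in \<open>auto simp: triangle_def edge_def\<close>)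
    next
      case False
      then show ?thesis by (intro bexI[of _ "(l, M - 1, False)"]) (use M0 jj in \<open>auto simp: triangle_def edge_def\<close>)
    qed
  qed
  show "card (triangle i) = 3" if "i \<in> J2" for i using that by (auto simp: triangle_def)
  show "card (edge j) = 2" if "j \<in> J1" for j using that by (auto simp: edge_def)
  show "\<exists>f. (\<forall>v. f (- v) = f v) \<and> (\<forall>i\<in>J2. \<forall>v\<in>triangle i. \<forall>w\<in>triangle i. v \<noteq> w \<longrightarrow> \<gamma> {v, w} = f v + f w)"
    if "\<And>e. \<gamma> (uminus ` e) = \<gamma> e" "\<And>i. i \<in> J2 \<Longrightarrow> cobd \<gamma> (triangle i) = 0" "chsum J1 edge \<gamma> = 0" for \<gamma>
    by (rule grid_H1) (use that in auto)
qed (auto simp: grid_bd2 grid_bd1)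

end

section \<open>From a continuous map on the disc to a vertex assignment\<close>

lemma uniform_separation:
  fixes B :: "nat \<Rightarrow> 'e::heine_borel set"
  assumes "\<And>i. i < n \<Longrightarrow> compact (B i)" "\<And>i j. i < n \<Longrightarrow> j < n \<Longrightarrow> i \<noteq> j \<Longrightarrow> B i \<inter> B j = {}"
  shows "\<exists>d>0. \<forall>i<n. \<forall>j<n. i \<noteq> j \<longrightarrow> (\<forall>x\<in>B i. \<forall>y\<in>B j. d \<le> dist x y)"
proof -
  have ev: "\<forall>\<^sub>F d in at_right (0::real). \<forall>x\<in>B i. \<forall>y\<in>B j. d \<le> dist x y" if ij: "i < n" "j < n" "i \<noteq> j" for i j
  proof -
    obtain d where d: "d > 0" "\<forall>x\<in>B i. \<forall>y\<in>B j. d \<le> dist x y"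
      using separate_compact_closed[OF assms(1) compact_imp_closed[OF assms(1)] assms(2)] ij by metis
    show ?thesis
      unfolding eventually_at_right_field by (rule exI[of _ d]) (use d in force)
  qed
  have "\<forall>\<^sub>F d in at_right (0::real). \<forall>p\<in>{(i,j). i < n \<and> j < n \<and> i \<noteq> j}. \<forall>x\<in>B (fst p). \<forall>y\<in>B (snd p). d \<le> dist x y"
  proof (rule eventually_ball_finite)
    have "{(i,j). i < n \<and> j < n \<and> i \<noteq> j} \<subseteq> {..<n} \<times> {..<n}" by auto
    then show "finite {(i,j). i < n \<and> j < n \<and> i \<noteq> j}" by (simp add: finite_subset)
  qed (use ev in auto)
  moreover have "\<forall>\<^sub>F d in at_right (0::real). d > 0" by (simp add: eventually_at_right_less)
  ultimately have "\<forall>\<^sub>F d in at_right (0::real). d > 0 \<and> (\<forall>p\<in>{(i,j). i < n \<and> j < n \<and> i \<noteq> j}. \<forall>x\<in>B (fst p). \<forall>y\<in>B (snd p). d \<le> dist x y)"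
    by eventually_elim auto
  then obtain d where "d > 0 \<and> (\<forall>p\<in>{(i,j). i < n \<and> j < n \<and> i \<noteq> j}. \<forall>x\<in>B (fst p). \<forall>y\<in>B (snd p). d \<le> dist x y)"
    using eventually_happens trivial_limit_at_right_real by blast
  then show ?thesis by (intro exI[of _ d]) auto
qed

text \<open>The disc is a closed hemisphere, and its map extends to an odd map of the sphere by
  negation on the other half. This is why \<open>sep\<close> excludes coincidences with both
  signs.\<close>

theorem no_equivariant_disc:
  fixes A :: "complex \<Rightarrow> C2" and n :: nat
  assumes n2: "n \<ge> 2" and cont: "continuous_on (cball 0 1) A" and nz: "\<And>z. norm z \<le> 1 \<Longrightarrow> A z \<noteq> 0"
    and odd: "\<And>z. norm z = 1 \<Longrightarrow> A (- z) = - A z"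
    and sep: "\<And>z w i j. norm z \<le> 1 \<Longrightarrow> norm w \<le> 1 \<Longrightarrow> i < n \<Longrightarrow> j < n \<Longrightarrow> i \<noteq> j \<Longrightarrow>
      twist (pi * real i / real n) (A z) \<noteq> twist (pi * real j / real n) (A w) \<and> twist (pi * real i / real n) (A z) \<noteq> - twist (pi * real j / real n) (A w)"
  shows False
proof -
  define W where "W = A ` cball 0 1 \<union> uminus ` A ` cball 0 1"
  \<comment> \<open>The grid fills the square around the unit disc, so \<open>A\<close> is extended
    by radial retraction. The extension is odd outside the open disc, in particular on the boundary
    of the square.\<close>
  define Q where "Q = (\<lambda>p. A ((1 / max 1 (norm p)) *\<^sub>R p))"
  have cA: "compact (A ` cball 0 1)" using cont by (simp add: compact_continuous_image)
  have cW: "compact W" unfolding W_def using cA cont by (intro compact_Un compact_continuous_image) (auto intro!: continuous_intros)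
  have W0: "0 \<notin> W" unfolding W_def using nz by force
  have Wne: "W \<noteq> {}" unfolding W_def by auto
  obtain x0 where x0: "x0 \<in> W" "\<And>x. x \<in> W \<Longrightarrow> norm x0 \<le> norm x"
    using continuous_attains_inf[OF cW Wne continuous_on_norm_id] by auto
  obtain x1 where x1: "x1 \<in> W" "\<And>x. x \<in> W \<Longrightarrow> norm x \<le> norm x1"
    using continuous_attains_sup[OF cW Wne continuous_on_norm_id] by auto
  define m1 where "m1 = norm x0"
  define M1 where "M1 = norm x1"
  have m1: "m1 > 0" using x0 W0 by (auto simp: m1_def)
  have Wb: "m1 \<le> norm x" "norm x \<le> M1" if "x \<in> W" for x using that x0 x1 by (auto simp: m1_def M1_def)
  have "\<exists>d>0. \<forall>i<n. \<forall>j<n. i \<noteq> j \<longrightarrow> (\<forall>x\<in>twist (pi * real i / real n) ` W. \<forall>y\<in>twist (pi * real j / real n) ` W. d \<le> dist x y)"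
  proof (rule uniform_separation)
    show "compact (twist (pi * real i / real n) ` W)" for i
      by (rule compact_continuous_image[OF _ cW]) (auto simp: twist_def[abs_def] intro!: continuous_intros)
    show "twist (pi * real i / real n) ` W \<inter> twist (pi * real j / real n) ` W = {}" if ij: "i < n" "j < n" "i \<noteq> j" for i j
    proof -
      have "twist (pi * real i / real n) x \<noteq> twist (pi * real j / real n) y" if xy: "x \<in> W" "y \<in> W" for x y
      proof -
        obtain z where z: "norm z \<le> 1" "x = A z \<or> x = - A z"
          using xy(1) by (auto simp: W_def)
        obtain w where w: "norm w \<le> 1" "y = A w \<or> y = - A w"
          using xy(2) by (auto simp: W_def)
        show ?thesis using sep[OF z(1) w(1) ij] z(2) w(2) by (elim disjE; simp add: twist_linear; metis minus_minus)
      qed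
      then show ?thesis by blast
    qed
  qed
  then obtain \<sigma> where \<sigma>0: "\<sigma> > 0" "\<forall>i<n. \<forall>j<n. i \<noteq> j \<longrightarrow> (\<forall>x\<in>twist (pi * real i / real n) ` W. \<forall>y\<in>twist (pi * real j / real n) ` W. \<sigma> \<le> dist x y)"
    by blast
  have \<sigma>: "\<sigma> > 0" "\<And>i j x y. i < n \<Longrightarrow> j < n \<Longrightarrow> i \<noteq> j \<Longrightarrow> x \<in> W \<Longrightarrow> y \<in> W \<Longrightarrow> \<sigma> \<le> dist (twist (pi * real i / real n) x) (twist (pi * real j / real n) y)"
    using \<sigma>0 by blast+
  obtain \<kappa> where \<kappa>: "0 < \<kappa>" "\<kappa> \<le> 1" "\<And>i j. i < n \<Longrightarrow> j < n \<Longrightarrow> i \<noteq> j \<Longrightarrow> \<kappa> \<le> \<bar>sin (pi * real i / real n - pi * real j / real n)\<bar>"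
    using kappa_exists[of n] by blast
  \<comment> \<open>Together with \<open>Mx\<close>, this leaves room for perturbing values whose
    norms lie between \<open>m1\<close> and \<open>M1\<close>.\<close>
  define m where "m = m1 / 2"
  define Mx where "Mx = M1 + m1"
  have M1: "M1 \<ge> m1" using Wb[OF x0(1)] by simp
  have m0: "m > 0" "Mx > 0" using m1 M1 by (auto simp: m_def Mx_def)
  \<comment> \<open>A bound for the factor in \<open>eta_small\<close> as long as
    \<open>\<eta> \<le> m / 2\<close>.\<close>
  define B where "B = 1 + 2 * (Mx + m) / m"
  have B1: "B > 0" unfolding B_def using m0 by (intro add_pos_pos) auto
  \<comment> \<open>The three terms serve the norm bounds, the separation of the copies, and
    \<open>eta_small\<close>.\<close>
  define \<eta> where "\<eta> = min (min (m / 2) (\<sigma> / 4)) (\<kappa> * m / (4 * B))"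
  have eta: "0 < \<eta>" "\<eta> \<le> m / 2" "\<eta> \<le> \<sigma> / 4" "\<eta> \<le> \<kappa> * m / (4 * B)"
    using m0 \<sigma> \<kappa> B1 by (auto simp: \<eta>_def)
  have small: "(1 + (Mx + \<eta>) / (m - \<eta>)) * \<eta> < \<kappa> / 2 * m"
  proof -
    have "(Mx + \<eta>) / (m - \<eta>) \<le> (Mx + m) / (m / 2)" using eta m0 by (intro frac_le) auto
    then have "1 + (Mx + \<eta>) / (m - \<eta>) \<le> B" unfolding B_def by (simp add: algebra_simps)
    then have "(1 + (Mx + \<eta>) / (m - \<eta>)) * \<eta> \<le> B * (\<kappa> * m / (4 * B))"
      using eta B1 \<kappa> m0 by (intro mult_mono) auto
    also have "\<dots> = \<kappa> * m / 4" using B1 by (simp add: field_simps)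
    also have "\<dots> < \<kappa> / 2 * m" using \<kappa> m0 by simp
    finally show ?thesis .
  qed
  have scl: "norm ((1 / max 1 (norm p)) *\<^sub>R p) \<le> 1" for p :: complex
    by (auto simp: divide_simps max_def)
  have Qcont: "continuous_on UNIV Q"
    unfolding Q_def
    by (rule continuous_on_compose2[OF cont]) (use scl in \<open>auto intro!: continuous_intros\<close>)
  have QW: "Q p \<in> W" "- Q p \<in> W" for p unfolding Q_def W_def using scl[of p] by (auto simp: image_image)
  have Qodd: "Q (- p) = - Q p" if "norm p \<ge> 1" for p
  proof -
    have "norm ((1 / max 1 (norm p)) *\<^sub>R p) = 1" using that by (auto simp: max_def)
    from odd[OF this] show ?thesis unfolding Q_def by simp
  qed
  have "uniformly_continuous_on (cball 0 2) Q"
    using Qcont continuous_on_subset by (intro compact_uniformly_continuous) auto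
  then obtain \<delta> where \<delta>0: "\<delta> > 0" "\<forall>q\<in>cball 0 2. \<forall>p\<in>cball 0 2. dist p q < \<delta> \<longrightarrow> dist (Q p) (Q q) < \<eta> / 2"
    unfolding uniformly_continuous_on_def using eta(1) by (meson half_gt_zero)
  have \<delta>: "\<delta> > 0" "\<And>p q. norm p \<le> 2 \<Longrightarrow> norm q \<le> 2 \<Longrightarrow> norm (p - q) < \<delta> \<Longrightarrow> norm (Q p - Q q) < \<eta> / 2"
    using \<delta>0 by (simp_all add: dist_norm)
  \<comment> \<open>The parameters of two vertices of one triangle are at most
    \<open>4 / real M\<close> apart.\<close>
  obtain M where M: "real M > 4 / \<delta>" using reals_Archimedean2 by blast
  have M0: "M > 0" using M \<delta> by (metis divide_pos_pos gr0I less_trans not_less_iff_gr_or_eq of_nat_0 zero_less_numeral)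
  have M4: "4 / real M < \<delta>" using M M0 \<delta> by (simp add: field_simps)
  interpret grid M by unfold_locales fact
  interpret G: antipodal_sphere J2 triangle J1 edge "up M 0" uminus by (rule grid_antipodal_sphere)
  interpret G: fine_mesh J2 triangle J1 edge "up M 0" uminus n \<kappa> m Mx \<eta>
    by unfold_locales (use n2 \<kappa> eta m0 M1 small m1 in \<open>auto simp: Mx_def m_def\<close>)
  define U where "U = {up i j |i j. i \<le> M \<and> j \<le> M}"
  define pt where "pt = (\<lambda>v :: int \<times> int \<times> int. Complex (real_of_int (fst v) / real M) (real_of_int (fst (snd v)) / real M))"
  define a where "a = (\<lambda>v. if v \<in> U then Q (pt v) else if - v \<in> U then - Q (pt (- v)) else 0)"
  have ptm: "pt (- v) = - pt v" for v by (simp add: pt_def complex_eq_iff)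
  have bd: "norm (pt v) \<ge> 1" if v: "v \<in> U" "- v \<in> U" for v
  proof -
    obtain i j where ij: "v = up i j" "i \<le> M" "j \<le> M" using v unfolding U_def by blast
    obtain i' j' where ij': "- v = up i' j'" "i' \<le> M" "j' \<le> M" using v unfolding U_def by blast
    have "int M - max \<bar>2 * int i - int M\<bar> \<bar>2 * int j - int M\<bar> = 0"
      using ij ij' unfolding up_def by auto
    then have "\<bar>fst v\<bar> = int M \<or> \<bar>fst (snd v)\<bar> = int M" unfolding ij(1) up_def by (auto simp: max_def split: if_splits)
    then have "\<bar>real_of_int (fst v)\<bar> = real M \<or> \<bar>real_of_int (fst (snd v))\<bar> = real M"
      by (metis of_int_abs of_int_of_nat_eq)
    then have "\<bar>Re (pt v)\<bar> = 1 \<or> \<bar>Im (pt v)\<bar> = 1" using M0 by (auto simp: pt_def abs_divide)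
    then show ?thesis using abs_Re_le_cmod[of "pt v"] abs_Im_le_cmod[of "pt v"] by auto
  qed
  have odd_assign: "G.odd_assign a"
    unfolding G.odd_assign_def
  proof
    fix v show "a (- v) = - a v"
      unfolding a_def using bd[of v] Qodd[of "pt v"] by (auto simp: ptm)
  qed
  have t2U: "triangle x \<subseteq> U" if "x \<in> J2" for x using that unfolding U_def triangle_def by (auto split: if_splits)
  have UV: "v \<in> U \<or> - v \<in> U" if "v \<in> s" "s \<in> G.faces" for s v
    using that t2U unfolding G.faces_def by fastforce
  have aW: "a v \<in> W" if "v \<in> G.V" for v
  proof -
    have "v \<in> U \<or> - v \<in> U" using that UV unfolding G.V_def by blast
    then show ?thesis unfolding a_def using QW by auto
  qed
  have pt2: "norm (pt (up i j)) \<le> 2" if "i \<le> M" "j \<le> M" for i j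
  proof -
    have "\<bar>Re (pt (up i j))\<bar> \<le> 1" "\<bar>Im (pt (up i j))\<bar> \<le> 1"
      using that M0 by (auto simp: pt_def up_def abs_divide divide_le_eq)
    then show ?thesis using cmod_le[of "pt (up i j)"] by linarith
  qed
  have ptd: "norm (pt (up i j) - pt (up i' j')) \<le> 4 / real M" if "\<bar>int i - int i'\<bar> \<le> 1" "\<bar>int j - int j'\<bar> \<le> 1" for i j i' j'
  proof -
    have k: "\<bar>real_of_int (2 * int x - int M) / real M - real_of_int (2 * int y - int M) / real M\<bar> \<le> 2 / real M" if "\<bar>int x - int y\<bar> \<le> 1" for x y
    proof -
      have "\<bar>real x - real y\<bar> \<le> 1" using that by linarith
      then have "\<bar>2 * real x - 2 * real y\<bar> / real M \<le> 2 / real M" by (intro divide_right_mono) auto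
      then show ?thesis using M0 by (simp add: diff_divide_distrib[symmetric] abs_divide)
    qed
    have "\<bar>Re (pt (up i j) - pt (up i' j'))\<bar> \<le> 2 / real M" "\<bar>Im (pt (up i j) - pt (up i' j'))\<bar> \<le> 2 / real M"
      using k[OF that(1)] k[OF that(2)] by (auto simp: pt_def up_def)
    then show ?thesis using cmod_le[of "pt (up i j) - pt (up i' j')"] by linarith
  qed
  have at2: "norm (a v - a w) < \<eta> / 2" if x: "x \<in> J2" and vw: "v \<in> triangle x" "w \<in> triangle x" for x v w
  proof -
    obtain i j b where xx: "x = (i, j, b)" "i < M" "j < M" using x by auto
    obtain k l where v: "v = up k l" "i \<le> k" "k \<le> Suc i" "j \<le> l" "l \<le> Suc j"
      using vw(1) unfolding xx triangle_def by (auto split: if_splits)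
    obtain k' l' where w: "w = up k' l'" "i \<le> k'" "k' \<le> Suc i" "j \<le> l'" "l' \<le> Suc j"
      using vw(2) unfolding xx triangle_def by (auto split: if_splits)
    have "v \<in> U" "w \<in> U" using t2U[OF x] vw by auto
    then have "a v = Q (pt v)" "a w = Q (pt w)" by (auto simp: a_def)
    moreover have "norm (pt v - pt w) < \<delta>"
    proof -
      have "norm (pt v - pt w) \<le> 4 / real M" unfolding v(1) w(1) by (rule ptd) (use v w in linarith)+
      then show ?thesis using M4 by simp
    qed
    moreover have "norm (pt v) \<le> 2" "norm (pt w) \<le> 2" unfolding v(1) w(1) using v w xx by (auto intro!: pt2)
    ultimately show ?thesis using \<delta>(2) by simp
  qed
  have aface: "norm (a v - a w) < \<eta> / 2" if s: "s \<in> G.faces" and vw: "v \<in> s" "w \<in> s" for s v w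
  proof -
    obtain x where x: "x \<in> J2" "s \<subseteq> triangle x \<or> s \<subseteq> uminus ` triangle x" using s unfolding G.faces_def by blast
    show ?thesis
    proof (cases "s \<subseteq> triangle x")
      case True
      then show ?thesis using at2[OF x(1)] vw by blast
    next
      case False
      then have "- v \<in> triangle x" "- w \<in> triangle x" using x vw by force+
      then have "norm (a (- v) - a (- w)) < \<eta> / 2" using at2[OF x(1)] by blast
      moreover have "a (- v) = - a v" "a (- w) = - a w" using odd_assign unfolding G.odd_assign_def by blast+
      then have "a (- v) - a (- w) = - (a v - a w)" by (simp only: minus_diff_minus)
      ultimately show ?thesis by (metis norm_minus_cancel)
    qed
  qed
  \<comment> \<open>The values on a face differ by less than \<open>\<eta> / 2\<close>, so changes
    below \<open>\<eta> / 4\<close> keep them within \<eta>. The copies are at distance at least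
    \<open>4 * \<eta>\<close>, of which more than \<open>2 * \<eta>\<close> remains.\<close>
  have "G.robust G.spread a"
    unfolding G.robust_def
  proof (intro conjI exI[of _ "\<eta> / 4"] allI impI)
    show "G.odd_assign a" by fact
    show "\<eta> / 4 > 0" using eta by simp
    fix a' assume n': "G.near (\<eta> / 4) a a'"
    then have o': "G.odd_assign a'" and d': "\<And>v. v \<in> G.V \<Longrightarrow> norm (a' v - a v) < \<eta> / 4" unfolding G.near_def by auto
    show "G.spread a'"
      unfolding G.spread_def
    proof (intro conjI ballI allI impI)
      show "G.odd_assign a'" by fact
      fix v assume v: "v \<in> G.V"
      have nm: "norm (a' v) \<le> norm (a v) + norm (a' v - a v)" "norm (a v) \<le> norm (a' v) + norm (a' v - a v)"
        using norm_triangle_sub[of "a' v" "a v"] norm_triangle_sub[of "a v" "a' v"] by (auto simp: norm_minus_commute)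
      show "m \<le> norm (a' v)" using nm d'[OF v] Wb[OF aW[OF v]] eta m0 by (simp add: m_def)
      show "norm (a' v) \<le> Mx" using nm d'[OF v] Wb[OF aW[OF v]] eta m0 by (simp add: m_def Mx_def)
    next
      fix s v w assume s: "s \<in> G.faces" and vw: "v \<in> s" "w \<in> s"
      then have V: "v \<in> G.V" "w \<in> G.V" unfolding G.V_def by auto
      have "norm (a' v - a' w) \<le> norm (a' v - a v) + norm (a v - a w) + norm (a' w - a w)"
        using norm_triangle_ineq4[of "(a' v - a v) + (a v - a w)" "a' w - a w"] norm_triangle_ineq[of "a' v - a v" "a v - a w"] by simp
      then show "norm (a' v - a' w) \<le> \<eta>" using d'[OF V(1)] d'[OF V(2)] aface[OF s vw] by linarith
    next
      fix v w i j assume V: "v \<in> G.V" "w \<in> G.V" and ij: "i < n" "j < n" "i \<noteq> j"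
      have "\<sigma> \<le> norm (G.R i (a v) - G.R j (a w))"
        using \<sigma>(2)[OF ij aW[OF V(1)] aW[OF V(2)]] by (simp add: G.R_def dist_norm)
      also have "G.R i (a v) - G.R j (a w) = (G.R i (a' v) - G.R j (a' w)) - (G.R i (a' v - a v) - G.R j (a' w - a w))"
        by (simp add: G.R_lin)
      also have "norm \<dots> \<le> norm (G.R i (a' v) - G.R j (a' w)) + (norm (a' v - a v) + norm (a' w - a w))"
        using norm_triangle_ineq4[of "G.R i (a' v) - G.R j (a' w)" "G.R i (a' v - a v) - G.R j (a' w - a w)"]
          norm_triangle_ineq4[of "G.R i (a' v - a v)" "G.R j (a' w - a w)"] by simp
      finally show "2 * \<eta> < norm (G.R i (a' v) - G.R j (a' w))" using d'[OF V(1)] d'[OF V(2)] eta by linarith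
    qed
  qed
  then show False by (rule G.discrete_impossible)
qed

section \<open>Jordan curves in the punctured plane\<close>

text \<open>The difference is continuous with values in a discrete set.\<close>

lemma exp_eq_diff_constant:
  fixes f g :: "'a::topological_space \<Rightarrow> complex"
  assumes "connected S" "continuous_on S f" "continuous_on S g" "\<And>x. x \<in> S \<Longrightarrow> exp (f x) = exp (g x)"
  obtains k :: int where "\<And>x. x \<in> S \<Longrightarrow> f x = g x + 2 * pi * \<i> * of_int k"
proof (cases "S = {}")
  case False
  have d: "\<exists>k::int. f x - g x = 2 * pi * \<i> * of_int k" if x: "x \<in> S" for x
  proof -
    obtain k :: int where "f x = g x + (of_int (2 * k) * pi) * \<i>" using assms(4)[OF x] unfolding exp_eq by blast
    then show ?thesis by (intro exI[of _ k]) simp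
  qed
  have "(\<lambda>x. f x - g x) constant_on S"
  proof (rule continuous_discrete_range_constant[OF assms(1)])
    show "continuous_on S (\<lambda>x. f x - g x)" using assms by (intro continuous_intros)
    fix x assume x: "x \<in> S"
    show "\<exists>e>0. \<forall>y. y \<in> S \<and> f y - g y \<noteq> f x - g x \<longrightarrow> e \<le> norm (f y - g y - (f x - g x))"
    proof (intro exI[of _ "2 * pi"] conjI allI impI)
      fix y assume y: "y \<in> S \<and> f y - g y \<noteq> f x - g x"
      obtain k l :: int where kl: "f x - g x = 2 * pi * \<i> * of_int k" "f y - g y = 2 * pi * \<i> * of_int l"
        using d x y by metis
      have "f y - g y - (f x - g x) = 2 * pi * \<i> * of_int (l - k)" unfolding kl by (simp add: algebra_simps)
      then have "norm (f y - g y - (f x - g x)) = 2 * pi * \<bar>of_int (l - k)\<bar>" by (simp add: norm_mult del: of_int_diff)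
      moreover have "l \<noteq> k" using y kl by auto
      then have "\<bar>real_of_int (l - k)\<bar> \<ge> 1" by linarith
      ultimately show "2 * pi \<le> norm (f y - g y - (f x - g x))" by simp
    qed simp
  qed
  then obtain c where c: "\<And>x. x \<in> S \<Longrightarrow> f x - g x = c" unfolding constant_on_def by blast
  obtain x where "x \<in> S" using False by blast
  with d c obtain k :: int where "c = 2 * pi * \<i> * of_int k" by metis
  with c show ?thesis by (intro that[of k]) (simp add: algebra_simps)
qed (use that in simp)

text \<open>Along \<open>cis t\<close> the logarithm differs by a constant from
  \<open>\<i> * t * k\<close>. One turn changes the latter by \<open>2 * pi * \<i> * k\<close> and
  the former not at all.\<close>

lemma no_log_on_circle:
  assumes "continuous_on (sphere 0 1) L" "\<And>z::complex. norm z = 1 \<Longrightarrow> z powi k = exp (L z)"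
  shows "k = 0"
proof -
  have "continuous_on UNIV (\<lambda>t. L (cis t))"
    by (rule continuous_on_compose2[OF assms(1)]) (auto intro: continuous_intros)
  moreover have "continuous_on UNIV (\<lambda>t. \<i> * of_real t * of_int k)" by (intro continuous_intros)
  moreover have "exp (L (cis t)) = exp (\<i> * of_real t * of_int k)" for t
    using assms(2)[of "cis t"] by (simp add: cis_power_int) (simp add: cis_conv_exp mult_ac)
  ultimately obtain m :: int where m: "\<And>t. L (cis t) = \<i> * of_real t * of_int k + 2 * pi * \<i> * of_int m"
    using exp_eq_diff_constant[of UNIV "\<lambda>t. L (cis t)" "\<lambda>t. \<i> * of_real t * of_int k"] by auto
  from m[of 0] m[of "2 * pi"] show "k = 0" by simp
qed

lemma simple_path_cis: "simple_path (\<lambda>t. cis (2 * pi * t))"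
  unfolding simple_path_def loop_free_def
proof (intro conjI ballI impI)
  show "path (\<lambda>t. cis (2 * pi * t))" unfolding path_def by (intro continuous_intros)
  fix x y :: real assume xy: "x \<in> {0..1}" "y \<in> {0..1}" "cis (2 * pi * x) = cis (2 * pi * y)"
  then obtain k :: int where k: "2 * pi * x = 2 * pi * y + 2 * pi * of_int k"
    using sin_cos_eq_iff[of "2 * pi * x" "2 * pi * y"] by (auto simp: complex_eq_iff mult_ac)
  then have "2 * pi * x = 2 * pi * (y + of_int k)" by (simp add: algebra_simps)
  then have "x = y + of_int k" by simp
  moreover have "k \<le> 1" "k \<ge> -1" using xy \<open>x = y + of_int k\<close> by auto
  then have "k = 0 \<or> k = 1 \<or> k = -1" by linarith
  ultimately show "x = y \<or> x = 0 \<and> y = 1 \<or> x = 1 \<and> y = 0" using xy by auto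
qed

lemma path_image_cis: "path_image (\<lambda>t. cis (2 * pi * t)) = sphere 0 1"
proof
  show "path_image (\<lambda>t. cis (2 * pi * t)) \<subseteq> sphere 0 1" by (auto simp: path_image_def)
  show "sphere 0 1 \<subseteq> path_image (\<lambda>t. cis (2 * pi * t))"
  proof
    fix z :: complex assume "z \<in> sphere 0 1"
    then obtain t where t: "0 \<le> t" "t < 2 * pi" "z = cis t"
      using complex_unimodular_polar[of z] by (auto simp: cis.ctr)
    then show "z \<in> path_image (\<lambda>t. cis (2 * pi * t))"
      unfolding path_image_def by (intro image_eqI[of _ _ "t / (2 * pi)"]) (auto simp: field_simps)
  qed
qed

lemma jordan_facts:
  fixes J :: "complex set"
  assumes "J homeomorphic (sphere 0 1 :: complex set)"
  shows "open (inside J)" "connected (inside J)" "open (outside J)" "connected (outside J)" "bounded (inside J)"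
    "\<not> bounded (outside J)" "inside J \<inter> outside J = {}" "inside J \<union> outside J = - J"
    "frontier (inside J) = J" "frontier (outside J) = J" "compact J" "connected J" "inside J \<noteq> {}"
proof -
  obtain f g where fg: "homeomorphism (sphere (0::complex) 1) J f g"
    using assms[unfolded homeomorphic_sym[of J]] unfolding homeomorphic_def by blast
  define c where "c = f \<circ> (\<lambda>t. cis (2 * pi * t))"
  have "simple_path c" unfolding c_def
    using simple_path_cis fg by (intro simple_path_continuous_image) (auto simp: path_image_cis homeomorphism_def intro: inj_on_inverseI)
  moreover have "pathfinish c = pathstart c" by (simp add: c_def pathfinish_def pathstart_def)
  moreover have J: "path_image c = J" unfolding c_def path_image_compose path_image_cis using fg by (simp add: homeomorphism_def)
  ultimately show "open (inside J)" "connected (inside J)" "open (outside J)" "connected (outside J)" "bounded (inside J)"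
    "\<not> bounded (outside J)" "inside J \<inter> outside J = {}" "inside J \<union> outside J = - J"
    "frontier (inside J) = J" "frontier (outside J) = J" "inside J \<noteq> {}"
    using Jordan_inside_outside[of c] by auto
  show "compact J" "connected J" using \<open>simple_path c\<close> J compact_simple_path_image connected_simple_path_image by metis+
qed

text \<open>Suppose that each curve is inside the other. The outside of \<open>K\<close> is
  connected, unbounded and misses \<open>J\<close>, so it is contained in the outside of
  \<open>J\<close>. Then \<open>K\<close>, as its frontier, lies in the closure of the outside of
  \<open>J\<close> and not inside.\<close>

lemma outside_swap:
  fixes J K :: "complex set"
  assumes "J homeomorphic (sphere 0 1 :: complex set)" "K homeomorphic (sphere 0 1 :: complex set)" "J \<inter> K = {}"
  shows "K \<subseteq> outside J \<or> J \<subseteq> outside K"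
proof (rule ccontr)
  assume H: "\<not> ?thesis"
  note J = jordan_facts[OF assms(1)] and K = jordan_facts[OF assms(2)]
  have split: "A \<subseteq> inside J'" if A: "connected A" "A \<inter> J' = {}" "\<not> A \<subseteq> outside J'"
      and F: "open (inside J')" "open (outside J')" "inside J' \<inter> outside J' = {}" "inside J' \<union> outside J' = - J'" for A J' :: "complex set"
    using connectedD[OF A(1) F(1) F(2)] F(3,4) A by blast
  have KJ: "K \<subseteq> inside J" using split[OF K(12) _ _ J(1,3,7,8)] H assms(3) by blast
  have JK: "J \<subseteq> inside K" using split[OF J(12) _ _ K(1,3,7,8)] H assms(3) by blast
  have "outside K \<subseteq> outside J"
  proof -
    have "outside K \<inter> J = {}" using JK K(7) by blast
    moreover have "\<not> outside K \<subseteq> inside J" using K(6) J(5) bounded_subset by blast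
    ultimately show ?thesis using split[OF K(4)] J(1,3,7,8) by blast
  qed
  then have "closure (outside K) \<subseteq> closure (outside J)" by (rule closure_mono)
  moreover have "K \<subseteq> closure (outside K)" using K(10) by (auto simp: frontier_def)
  moreover have "closure (outside J) = outside J \<union> J" using J(10) closure_Un_frontier by metis
  moreover have "K \<noteq> {}" using assms(2) by (auto simp: homeomorphic_def homeomorphism_def)
  ultimately show False using KJ J(7) assms(3) by blast
qed

text \<open>The antipodal map of the Riemann sphere; the junk value \<open>antip 0 = 0\<close> replaces the point at infinity.\<close>

definition antip :: "complex \<Rightarrow> complex" where "antip w = - (1 / cnj w)"

lemma antip_antip [simp]: "antip (antip w) = w" by (simp add: antip_def)
lemma antip_eq_0 [simp]: "antip w = 0 \<longleftrightarrow> w = 0" by (simp add: antip_def)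
lemma norm_antip: "norm (antip w) = 1 / norm w" by (simp add: antip_def norm_divide)
lemma antip_unit: "norm w = 1 \<Longrightarrow> antip w = - w"
proof -
  assume "norm w = 1"
  then have "w * cnj w = 1" using complex_norm_square[of w] by simp
  then have "1 / cnj w = w" by (metis mult_zero_right nonzero_eq_divide_eq zero_neq_one)
  then show ?thesis by (simp add: antip_def)
qed
lemma continuous_antip: "0 \<notin> S \<Longrightarrow> continuous_on S antip"
  unfolding antip_def[abs_def] by (intro continuous_intros) auto
text \<open>\<open>V w ^ (2 * n)\<close> and \<open>Z w\<close> are the coordinates of the point of the surface with parameter \<open>w\<close> in a chart in
  which \<open>N\<close> is the set where the former has norm at most 1.\<close>

locale odd_pair =
  fixes n :: nat and Z V :: "complex \<Rightarrow> complex"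
  assumes n2: "n \<ge> 2"
    and cZ: "continuous_on (- {0}) Z" and cV: "continuous_on (- {0}) V"
    and Z_antip: "\<And>w. w \<noteq> 0 \<Longrightarrow> Z (antip w) = Z w" and V_antip: "\<And>w. w \<noteq> 0 \<Longrightarrow> V (antip w) = - V w"
    and V0: "\<And>w. w \<noteq> 0 \<Longrightarrow> V w \<noteq> 0"
    and inj: "\<And>w w'. w \<noteq> 0 \<Longrightarrow> w' \<noteq> 0 \<Longrightarrow> 1 \<le> norm (V w) \<Longrightarrow> Z w = Z w' \<Longrightarrow> V w ^ (2 * n) = V w' ^ (2 * n) \<Longrightarrow> w' = w \<or> w' = antip w"
    and bd: "\<And>w. w \<noteq> 0 \<Longrightarrow> norm (V w) = 1 \<Longrightarrow> norm (Z w) = 1 \<and> Z w ^ (2 * n) = V w ^ (2 * n)"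
    and onto: "\<And>z. norm z = 1 \<Longrightarrow> \<exists>w. w \<noteq> 0 \<and> norm (V w) = 1 \<and> Z w = z"
    and near0: "\<exists>e>0. \<forall>w. w \<noteq> 0 \<longrightarrow> norm w < e \<longrightarrow> norm (V w) < 1"
    and outer: "\<exists>w. w \<noteq> 0 \<and> norm (V w) > 1"
begin

section \<open>The two curves over the boundary of the neighbourhood\<close>

definition "C = {w. w \<noteq> 0 \<and> norm (V w) = 1}"
text \<open>On \<open>C\<close> the values of \<open>Z\<close> and \<open>V\<close> have norm 1 and
  equal \<open>2 * n\<close>-th powers, so \<open>u\<close> is their quotient and a root of unity.
  Elsewhere the conjugate, in place of an inverse, makes \<open>u\<close> turn against
  \<open>V\<close> in the way \<open>twist\<close> expects.\<close>

definition u where "u w = Z w * cnj (V w)"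
definition "cv c = {w \<in> C. u w = c}"

lemma C0: "0 \<notin> C" by (simp add: C_def)

lemma antip_C: "antip w \<in> C \<longleftrightarrow> w \<in> C"
  using V_antip[of w] by (auto simp: C_def)

text \<open>The curve stays away from 0 by \<open>near0\<close>, and by the symmetry
  \<open>antip\<close> also from infinity.\<close>

lemma compact_C: "compact C"
proof -
  obtain e where e: "e > 0" "\<And>w. w \<noteq> 0 \<Longrightarrow> norm w < e \<Longrightarrow> norm (V w) < 1" using near0 by blast
  define K where "K = {w :: complex. e \<le> norm w} \<inter> cball 0 (1 / e)"
  have K: "w \<in> K" if "w \<in> C" for w
  proof -
    have w: "w \<noteq> 0" "norm (V w) = 1" using that by (auto simp: C_def)
    have a: "\<not> norm w < e" using e(2)[OF w(1)] w(2) by auto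
    have "\<not> norm (antip w) < e" using e(2)[of "antip w"] w V_antip by auto
    then have "norm w \<le> 1 / e" using e(1) w(1) by (simp add: norm_antip field_simps)
    then show ?thesis using a by (simp add: K_def)
  qed
  have "closed {w :: complex. e \<le> norm w}" by (intro closed_Collect_le continuous_intros)
  then have cK: "compact K" unfolding K_def by (simp add: closed_Int_compact)
  have "0 \<notin> K" using e(1) by (simp add: K_def)
  then have "K \<subseteq> - {0}" by auto
  then have "continuous_on K (\<lambda>w. norm (V w))" using cV continuous_on_subset by (intro continuous_intros) blast
  then have "closed (K \<inter> (\<lambda>w. norm (V w)) -` {1})"
    using cK by (intro continuous_closed_preimage) (auto simp: compact_imp_closed)
  moreover have "C = K \<inter> (\<lambda>w. norm (V w)) -` {1}" using K \<open>0 \<notin> K\<close> by (auto simp: C_def)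
  ultimately show ?thesis using cK by (metis Int_lower1 closed_Int_compact inf.absorb2 compact_Int_closed inf.idem)
qed

lemma u_pow: "w \<in> C \<Longrightarrow> u w ^ (2 * n) = 1"
proof -
  assume "w \<in> C"
  then have "Z w ^ (2 * n) = V w ^ (2 * n)" "V w * cnj (V w) = 1" using bd complex_norm_square[of "V w"] by (auto simp: C_def)
  then show ?thesis unfolding u_def power_mult_distrib by (simp flip: power_mult_distrib)
qed

lemma u0: "w \<in> C \<Longrightarrow> u w \<noteq> 0"
  using u_pow n2 by (metis power_0_left zero_neq_one mult_is_0 not_numeral_le_zero zero_neq_numeral)

lemma cont_C: "continuous_on C Z" "continuous_on C V" "continuous_on C u"
proof -
  have "C \<subseteq> - {0}" using C0 by auto
  then show Z: "continuous_on C Z" and V: "continuous_on C V" using cZ cV continuous_on_subset by blast+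
  show "continuous_on C u" unfolding u_def[abs_def] by (intro continuous_intros Z V)
qed

lemma u_antip: "w \<noteq> 0 \<Longrightarrow> u (antip w) = - u w" by (simp add: u_def Z_antip V_antip)

lemma Z_fibre: "w \<in> C \<Longrightarrow> w' \<in> C \<Longrightarrow> Z w = Z w' \<Longrightarrow> w' = w \<or> w' = antip w"
proof -
  assume w: "w \<in> C" "w' \<in> C" "Z w = Z w'"
  have "V w ^ (2 * n) = Z w ^ (2 * n)" "V w' ^ (2 * n) = Z w' ^ (2 * n)" using bd[of w] bd[of w'] w by (auto simp: C_def)
  then show ?thesis using inj[of w w'] w by (auto simp: C_def)
qed

lemma closed_u: "closed X \<Longrightarrow> compact {w \<in> C. u w \<in> X}"
proof -
  assume "closed X"
  then have "closed (C \<inter> u -` X)"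
    using cont_C compact_C by (intro continuous_closed_preimage) (auto simp: compact_imp_closed)
  moreover have "{w \<in> C. u w \<in> X} = C \<inter> (C \<inter> u -` X)" by auto
  ultimately show ?thesis using compact_C by (metis compact_Int_closed)
qed

text \<open>The fibres of \<open>Z\<close> on \<open>C\<close> are antipodal pairs, on which
  \<open>u\<close> changes sign. So the square of \<open>u\<close> is a function on the unit circle;
  it takes finitely many values on closed sets, and the circle is connected.\<close>

lemma u_sq: assumes "w0 \<in> C" "w1 \<in> C" shows "(u w1)\<^sup>2 = (u w0)\<^sup>2"
proof (rule ccontr)
  assume ne: "(u w1)\<^sup>2 \<noteq> (u w0)\<^sup>2"
  define X where "X = {x :: complex. x\<^sup>2 = (u w0)\<^sup>2}"
  define Y where "Y = {x :: complex. x ^ (2 * n) = 1 \<and> x\<^sup>2 \<noteq> (u w0)\<^sup>2}"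
  have "closed X" unfolding X_def by (intro closed_Collect_eq continuous_intros)
  have "finite {x :: complex. x ^ (2 * n) = 1}" using n2 by (intro finite_roots_unity) auto
  then have "finite Y" unfolding Y_def by (rule finite_subset[rotated]) auto
  then have "closed Y" by (rule finite_imp_closed)
  define A where "A = Z ` {w \<in> C. u w \<in> X}"
  define B where "B = Z ` {w \<in> C. u w \<in> Y}"
  have "compact A" "compact B" unfolding A_def B_def
    using closed_u[OF \<open>closed X\<close>] closed_u[OF \<open>closed Y\<close>] cont_C(1) by (auto intro!: compact_continuous_image continuous_on_subset[OF cont_C(1)])
  then have cl: "closed A" "closed B" by (auto intro: compact_imp_closed)
  have coords: "connected (sphere (0::complex) 1)" by (intro connected_sphere) simp
  have su: "sphere 0 1 \<subseteq> A \<union> B"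
  proof
    fix z :: complex assume "z \<in> sphere 0 1"
    then obtain w where "w \<in> C" "Z w = z" using onto[of z] by (auto simp: C_def)
    then show "z \<in> A \<union> B" using u_pow[of w] by (auto simp: A_def B_def X_def Y_def)
  qed
  have di: "A \<inter> B \<inter> sphere 0 1 = {}"
  proof -
    have False if w: "w \<in> C" "w' \<in> C" "Z w = Z w'" "u w \<in> X" "u w' \<in> Y" for w w'
    proof -
      have "w \<noteq> 0" using w(1) C0 by auto
      then have "u w' = u w \<or> u w' = - u w" using Z_fibre[OF w(1-3)] u_antip[of w] by auto
      then show False using w(4,5) by (auto simp: X_def Y_def)
    qed
    then show ?thesis unfolding A_def B_def by blast
  qed
  have in1: "Z w0 \<in> A" "Z w1 \<in> B" using assms ne u_pow by (auto simp: A_def B_def X_def Y_def)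
  have in2: "Z w0 \<in> sphere 0 1" "Z w1 \<in> sphere 0 1" using assms bd by (auto simp: C_def)
  show False using connected_closedD[OF coords di su cl] in1 in2 by blast
qed

lemma u_pm: "w0 \<in> C \<Longrightarrow> w1 \<in> C \<Longrightarrow> u w1 = u w0 \<or> u w1 = - u w0"
  using u_sq[of w0 w1] by (simp add: power2_eq_iff)

lemma C_split: "w0 \<in> C \<Longrightarrow> C = cv (u w0) \<union> cv (- u w0)" "w0 \<in> C \<Longrightarrow> cv (u w0) \<inter> cv (- u w0) = {}"
  using u_pm u0 by (auto simp: cv_def)

lemma cv_antip: "antip ` cv c = cv (- c)"
proof -
  have *: "antip w \<in> cv (- c)" if "w \<in> cv c" for w c
    using that antip_C[of w] u_antip[of w] C0 by (cases "w = 0") (auto simp: cv_def)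
  show ?thesis
  proof
    show "antip ` cv c \<subseteq> cv (- c)" using * by blast
    show "cv (- c) \<subseteq> antip ` cv c" using *[of _ "- c"] by (metis antip_antip image_eqI minus_minus subsetI)
  qed
qed

text \<open>A fibre of \<open>Z\<close> on \<open>C\<close> is an antipodal pair, and
  \<open>u\<close> takes the value \<open>u w0\<close> at exactly one of its two points.\<close>

lemma cv_homeo: assumes "w0 \<in> C" shows "\<exists>g. homeomorphism (cv (u w0)) (sphere 0 1) Z g"
proof (rule homeomorphism_compact)
  show "compact (cv (u w0))" using closed_u[of "{u w0}"] by (simp add: cv_def)
  show "continuous_on (cv (u w0)) Z" using cont_C(1) by (rule continuous_on_subset) (auto simp: cv_def)
  show "Z ` cv (u w0) = sphere 0 1"
  proof
    show "Z ` cv (u w0) \<subseteq> sphere 0 1" using bd by (auto simp: cv_def C_def)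
    show "sphere 0 1 \<subseteq> Z ` cv (u w0)"
    proof
      fix z :: complex assume "z \<in> sphere 0 1"
      then obtain w where w: "w \<in> C" "Z w = z" using onto[of z] by (auto simp: C_def)
      have "w \<in> cv (u w0) \<or> antip w \<in> cv (u w0)"
        using u_pm[OF assms w(1)] antip_C[of w] u_antip[of w] w(1) C0 by (cases "w = 0") (auto simp: cv_def)
      moreover have "Z (antip w) = z" using Z_antip[of w] w C0 by (cases "w = 0") auto
      ultimately show "z \<in> Z ` cv (u w0)" using w(2) by (auto intro: rev_image_eqI)
    qed
  qed
  show "inj_on Z (cv (u w0))"
  proof (rule inj_onI)
    fix x y assume xy: "x \<in> cv (u w0)" "y \<in> cv (u w0)" "Z x = Z y"
    then have "x \<in> C" "y \<in> C" "x \<noteq> 0" using C0 by (auto simp: cv_def)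
    then show "x = y" using Z_fibre[of x y] xy u_antip[of x] u0[of x] by (auto simp: cv_def)
  qed
qed

end

lemma antip_inj: "inj antip" by (metis antip_antip injI)

text \<open>Points of \<open>S\<close> near 0 are sent towards infinity, so no limit point is lost
  by leaving out 0.\<close>

lemma antip_compact_closed:
  assumes "bounded S" "closed S"
  shows "closed (antip ` (S - {0}))"
proof -
  obtain R where R: "R > 0" "\<And>x. x \<in> S \<Longrightarrow> norm x \<le> R" using assms(1) unfolding bounded_pos by blast
  define K where "K = {w :: complex. 1 / R \<le> norm w}"
  have "closed K" unfolding K_def by (intro closed_Collect_le continuous_intros)
  moreover have "continuous_on K antip" using R(1) by (intro continuous_antip) (simp add: K_def)
  ultimately have "closed (K \<inter> antip -` S)" using assms(2) by (intro continuous_closed_preimage)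
  moreover have "antip ` (S - {0}) = K \<inter> antip -` S"
  proof (intro equalityI subsetI)
    fix w assume "w \<in> antip ` (S - {0})"
    then obtain x where x: "x \<in> S" "x \<noteq> 0" "w = antip x" by blast
    have "1 / R \<le> 1 / norm x" using R x by (intro divide_left_mono) auto
    then show "w \<in> K \<inter> antip -` S" using x by (simp add: K_def norm_antip)
  next
    fix w assume w: "w \<in> K \<inter> antip -` S"
    then have "norm w > 0" using R(1) unfolding K_def by (metis (mono_tags) IntD1 divide_pos_pos less_le_trans mem_Collect_eq zero_less_one)
    then show "w \<in> antip ` (S - {0})" using w by (intro image_eqI[of _ _ "antip w"]) auto
  qed
  ultimately show ?thesis by simp
qed

lemma antip_image_open: "open S \<Longrightarrow> 0 \<notin> S \<Longrightarrow> open (antip ` S)"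
proof -
  assume S: "open S" "0 \<notin> S"
  have "open (- {0} \<inter> antip -` S)" using S by (intro continuous_open_preimage continuous_antip) auto
  moreover have "antip ` S = - {0} \<inter> antip -` S"
  proof (intro equalityI subsetI)
    fix w assume "w \<in> - {0} \<inter> antip -` S"
    then show "w \<in> antip ` S" by (intro image_eqI[of _ _ "antip w"]) auto
  qed (use S in auto)
  ultimately show ?thesis by simp
qed

lemma connected_delete_point: "connected (S - {a})" if "open S" "connected S" for S :: "complex set"
  using connected_open_diff_countable[of S "{a}"] that by simp

context odd_pair
begin

text \<open>The map \<open>(u, V)\<close> is used between the curves; on the disc bounded by \<open>cv c\<close> its first component is the
  constant \<open>c\<close>, and the second extends \<open>V\<close> into the unit disc.\<close>

lemma cap_case:
  assumes c: "c \<in> u ` C" and out: "cv (- c) \<subseteq> outside (cv c)"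
  shows False
proof -
  obtain w0 where w0: "w0 \<in> C" "c = u w0" using c by blast
  have cne: "c \<noteq> 0" using u0[OF w0(1)] w0(2) by simp
  define c1 where "c1 = cv c"
  define c2 where "c2 = cv (- c)"
  define I where "I = inside c1"
  define O' where "O' = outside c1"
  obtain g1 where g1: "homeomorphism c1 (sphere 0 1) Z g1" using cv_homeo[OF w0(1)] w0(2) unfolding c1_def by blast
  note J = jordan_facts[of c1, folded I_def O'_def]
  have hom: "c1 homeomorphic (sphere 0 1 :: complex set)" using g1 unfolding homeomorphic_def by blast
  note J = J[OF hom]
  have C12: "C = c1 \<union> c2" "c1 \<inter> c2 = {}" using C_split[OF w0(1)] w0(2) by (auto simp: c1_def c2_def)
  have c2: "c2 = antip ` c1" "c1 = antip ` c2" using cv_antip[of c] cv_antip[of "- c"] by (auto simp: c1_def c2_def)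
  have c1_0: "0 \<notin> c1" "0 \<notin> c2" using C0 C12 by auto
  have c2O: "c2 \<subseteq> O'" using out by (simp add: c2_def c1_def O'_def)
  have c2ne: "c2 \<noteq> {}" using J(13) c2(1) w0 by (auto simp: c1_def cv_def)
  define S where "S = closure I"
  have S: "S = I \<union> c1" unfolding S_def using J(9) closure_Un_frontier by metis
  have cptS: "compact S" unfolding S_def using J(5) by (simp add: compact_closure)
  have SO: "- S = O'" using J(7,8) S by blast
  \<comment> \<open>The antipodal cap. It surrounds infinity if 0 is in \<open>I\<close>, which is
    shown only later; the junk value of \<open>antip\<close> at 0 has to be kept out.\<close>
  define D where "D = antip ` (I - {0})"
  have conI: "connected (I - {0})" using J(1,2) by (rule connected_delete_point)
  have conD: "connected D" unfolding D_def by (intro connected_continuous_image continuous_antip conI) simp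
  have antip_iff: "antip x \<in> antip ` X \<longleftrightarrow> x \<in> X" for x X using antip_inj by (rule inj_image_mem_iff)
  have Dc1: "D \<inter> c1 = {}"
  proof -
    have False if "x \<in> I" "antip x \<in> c1" for x
    proof -
      have "x \<in> c2" using that c2 by (metis antip_antip image_eqI)
      then show False using c2O that J(7) by blast
    qed
    then show ?thesis unfolding D_def by blast
  qed
  \<comment> \<open>The connected set \<open>D\<close> misses \<open>c1\<close>, so it is on one
    side of it. On the inside its limit points \<open>c2\<close> would be in the closed disc
    \<open>S\<close>, contrary to \<open>out\<close>.\<close>
  have DO: "D \<subseteq> O'"
  proof (rule ccontr)
    assume H: "\<not> D \<subseteq> O'"
    then have DI: "D \<subseteq> I" using connectedD[OF conD J(1,3)] J(7,8) Dc1 by blast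
    have "c2 \<subseteq> S"
    proof
      fix z assume "z \<in> c2"
      then obtain y where y: "y \<in> c1" "z = antip y" using c2 by blast
      have "I \<subseteq> insert 0 (I - {0})" by blast
      then have "closure I \<subseteq> insert 0 (closure (I - {0}))" using closure_mono closure_insert by metis
      moreover have "y \<in> closure I" using y S S_def by blast
      ultimately have "y \<in> closure (I - {0})" using c1_0 y by blast
      then obtain X where X: "\<And>k. X k \<in> I - {0}" "X \<longlonglongrightarrow> y" unfolding closure_sequential by blast
      have "isCont antip y" using c1_0 y continuous_antip[of "- {0}"] by (auto simp: continuous_on_eq_continuous_at open_Compl)
      then have "(\<lambda>k. antip (X k)) \<longlonglongrightarrow> z" unfolding y(2) using X(2) by (rule isCont_tendsto_compose)
      moreover have "antip (X k) \<in> I" for k using X(1)[of k] DI by (auto simp: D_def)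
      ultimately show "z \<in> S" unfolding S_def closure_sequential by (intro exI[of _ "\<lambda>k. antip (X k)"]) simp
    qed
    then show False using c2O c2ne SO by blast
  qed
  define T where "T = D \<union> c2"
  have T: "T = antip ` (S - {0})" unfolding T_def D_def S c2(1) using c1_0 by blast
  have T0: "0 \<notin> T" unfolding T by auto
  have clT: "closed T" unfolding T using cptS by (intro antip_compact_closed) (auto simp: compact_imp_bounded compact_imp_closed)
  have ST: "S \<inter> T = {}" using DO c2O SO unfolding T_def by blast
  have TS: "antip w \<in> S" if "w \<in> T" for w using that unfolding T by auto
  have TS': "antip w \<in> T" if "w \<in> S" "w \<noteq> 0" for w using that unfolding T by auto
  \<comment> \<open>Up to the point 0, the complement of \<open>T\<close> is the image of the
    outside of \<open>c1\<close> under \<open>antip\<close>; as 0 is one of its limit points, adding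
    it preserves connectedness.\<close>
  have conT: "connected (- T)"
  proof -
    have coords: "connected (antip ` (O' - {0}))"
      by (intro connected_continuous_image continuous_antip connected_delete_point J(3,4)) simp
    have eq: "- T - {0} = antip ` (O' - {0})"
    proof -
      have "x \<in> - T - {0} \<longleftrightarrow> antip x \<in> O' - {0}" for x
        using TS[of x] TS'[of "antip x"] unfolding SO[symmetric] by (simp, blast)
      moreover have "x \<in> antip ` (O' - {0}) \<longleftrightarrow> antip x \<in> O' - {0}" for x
        using antip_iff[of "antip x"] by simp
      ultimately show ?thesis by blast
    qed
    have "0 islimpt (- T)" using T0 clT by (intro interior_limit_point) (simp add: interior_open open_Compl)
    then have "0 \<in> closure (- T - {0})" by (simp add: islimpt_in_closure)
    then have z: "0 \<in> closure (antip ` (O' - {0}))" unfolding eq .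
    show ?thesis
    proof (rule connected_intermediate_closure[OF coords])
      show "antip ` (O' - {0}) \<subseteq> - T" unfolding eq[symmetric] by (rule Diff_subset)
      show "- T \<subseteq> closure (antip ` (O' - {0}))"
      proof
        fix x assume "x \<in> - T"
        then have "x \<noteq> 0 \<Longrightarrow> x \<in> antip ` (O' - {0})" unfolding eq[symmetric] by simp
        then show "x \<in> closure (antip ` (O' - {0}))" using z closure_subset[THEN subsetD] by (cases "x = 0") simp_all
      qed
    qed
  qed
  define Mid where "Mid = - (S \<union> T)"
  have oM: "open Mid" unfolding Mid_def using cptS clT by (intro open_Compl closed_Un) (auto simp: compact_imp_closed)
  \<comment> \<open>Janiszewski's theorem: neither of the disjoint sets \<open>S\<close> and
    \<open>T\<close> separates the plane, hence neither does their union.\<close>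
  have conM: "connected Mid"
    unfolding Mid_def by (rule Janiszewski_connected) (use cptS clT ST conT SO J(4) in auto)
  have dich: "norm (V w') > 1" if X: "connected X" "X \<inter> C = {}" "0 \<notin> X" and w: "w \<in> X" "norm (V w) > 1" "w' \<in> X" for X w w'
  proof (rule ccontr)
    assume "\<not> norm (V w') > 1"
    have "X \<subseteq> - {0}" using X(3) by blast
    then have "continuous_on X (\<lambda>x. norm (V x))" using cV continuous_on_subset by (intro continuous_intros) blast
    then have "connected ((\<lambda>x. norm (V x)) ` X)" using X(1) by (rule connected_continuous_image)
    then have "1 \<in> (\<lambda>x. norm (V x)) ` X"
      using connectedD_interval[of _ "norm (V w')" "norm (V w)" 1] w \<open>\<not> norm (V w') > 1\<close> by auto
    then show False using X(2,3) unfolding C_def by force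
  qed
  have near: "0 \<notin> U" if U: "open U" "\<And>w. w \<in> U - {0} \<Longrightarrow> norm (V w) > 1" for U
  proof
    assume "0 \<in> U"
    obtain e where e: "e > 0" "\<And>w. w \<noteq> 0 \<Longrightarrow> norm w < e \<Longrightarrow> norm (V w) < 1" using near0 by blast
    obtain d where d: "d > 0" "ball 0 d \<subseteq> U" using U(1) \<open>0 \<in> U\<close> openE by blast
    define w where "w = complex_of_real (min e d / 2)"
    have "w \<noteq> 0" "norm w < e" "norm w < d" using e d by (auto simp: w_def)
    then show False using e(2)[of w] U(2)[of w] d by force
  qed
  \<comment> \<open>Otherwise the norm of \<open>V\<close> exceeds 1 somewhere in a cap, by symmetry
    in \<open>I\<close>, and then on all of \<open>I\<close> outside 0. So 0 is not in
    \<open>I\<close>, and \<open>V\<close> has a continuous logarithm on the closed disc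
    \<open>S\<close>. But on \<open>c1\<close> the \<open>2 * n\<close>-th power of \<open>V\<close>
    is that of the circle coordinate \<open>Z\<close>, which has winding number
    \<open>2 * n\<close>.\<close>
  have "\<exists>w \<in> Mid - {0}. norm (V w) > 1"
  proof (rule ccontr)
    assume H: "\<not> ?thesis"
    obtain w where w: "w \<noteq> 0" "norm (V w) > 1" using outer by blast
    have "w \<notin> C" using w by (auto simp: C_def)
    then have "w \<in> I - {0} \<or> w \<in> D" using H w C12 unfolding Mid_def T_def S by blast
    then obtain w' where w': "w' \<in> I - {0}" "norm (V w') > 1"
    proof
      assume "w \<in> D"
      then obtain x where "x \<in> I - {0}" "w = antip x" unfolding D_def by blast
      then show ?thesis using w V_antip[of x] that[of x] by auto
    qed (use w that in blast)
    have IC: "(I - {0}) \<inter> C = {}" using C12 c2O J(7,8) by blast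
    have IV: "norm (V x) > 1" if "x \<in> I - {0}" for x using dich[OF conI IC _ w'] that by simp
    then have I0: "0 \<notin> I" using near[OF J(1)] by blast
    then have S0: "S \<subseteq> - {0}" unfolding S using c1_0 by auto
    have "connected (- S)" using SO J(4) by simp
    then have B: "Borsukian S" using Borsukian_separation_compact[OF cptS] by simp
    have V: "continuous_on S V \<and> V \<in> S \<rightarrow> - {0}"
      using continuous_on_subset[OF cV S0] V0 subsetD[OF S0] by (intro conjI Pi_I) auto
    obtain L where L: "continuous_on S L" "\<And>x. x \<in> S \<Longrightarrow> V x = exp (L x)"
      using B[unfolded Borsukian_continuous_logarithm, rule_format, OF V] by auto
    have "int (2 * n) = 0"
    proof (rule no_log_on_circle)
      show "continuous_on (sphere 0 1) (\<lambda>z. of_nat (2 * n) * L (g1 z))"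
        using g1 S by (intro continuous_intros continuous_on_compose2[OF L(1)]) (auto simp: homeomorphism_def)
      fix z :: complex assume z: "norm z = 1"
      then have gz: "g1 z \<in> c1" "Z (g1 z) = z" using g1 by (auto simp: homeomorphism_def)
      then have "z ^ (2 * n) = V (g1 z) ^ (2 * n)" using bd[of "g1 z"] C12 by (auto simp: C_def)
      also have "\<dots> = exp (of_nat (2 * n) * L (g1 z))" unfolding exp_of_nat_mult using L(2) gz S by simp
      finally show "z powi int (2 * n) = exp (of_nat (2 * n) * L (g1 z))" by (simp only: power_int_of_nat)
    qed
    then show False using n2 by simp
  qed
  then obtain wM where wM: "wM \<in> Mid - {0}" "norm (V wM) > 1" by blast
  have "(Mid - {0}) \<inter> C = {}" using C12 unfolding Mid_def T_def S by blast
  then have MV: "norm (V x) > 1" if "x \<in> Mid - {0}" for x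
    using dich[OF connected_delete_point[OF oM conM] _ _ wM that] by simp
  then have M0: "0 \<notin> Mid" using near[OF oM] by blast
  then have S0: "0 \<in> S" "0 \<in> I" using T0 c1_0 unfolding Mid_def S by auto
  have "closedin (top_of_set S) c1" using J(11) S by (intro closed_subset) (auto simp: compact_imp_closed)
  moreover have "continuous_on c1 V" using cont_C(2) by (rule continuous_on_subset) (use C12 in auto)
  moreover have "V ` c1 \<subseteq> cball 0 1"
  proof -
    have "norm (V x) = 1" if "x \<in> c1" for x using that by (simp add: c1_def cv_def C_def)
    then show ?thesis by auto
  qed
  \<comment> \<open>The values stay in the closed unit disc, so the norm of the second component of
    \<open>A\<close> distinguishes the caps from \<open>Mid\<close>.\<close>
  ultimately obtain g where g: "continuous_on S g" "g ` S \<subseteq> cball 0 1" "\<And>x. x \<in> c1 \<Longrightarrow> g x = V x"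
    using Dugundji[of "cball 0 1" S c1 V] by (metis cball_eq_empty convex_cball not_one_less_zero)
  define A where "A = (\<lambda>w. if w \<in> S then (c, g w) else if w \<in> T then - (c, g (antip w)) else (u w, V w))"
  define E where "E = - (I \<union> D)"
  have clE: "closed E" unfolding E_def
    using antip_image_open[of "I - {0}"] J(1) by (auto simp: D_def open_Compl open_Un open_delete closed_def)
  have E0: "E \<subseteq> - {0}" using S0 by (auto simp: E_def)
  have ES: "E \<inter> S = c1" using S DO c2O SO J(7,8) Dc1 unfolding E_def by blast
  have c2I: "c2 \<inter> D = {}"
  proof -
    have False if "x \<in> c2" "x \<in> D" for x
    proof -
      obtain y where "y \<in> I" "x = antip y" using \<open>x \<in> D\<close> unfolding D_def by blast
      then have "y \<in> c1" using \<open>x \<in> c2\<close> c2(1) antip_iff by blast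
      then show False using \<open>y \<in> I\<close> J(7,8) by blast
    qed
    then show ?thesis by blast
  qed
  have ET: "E \<inter> T = c2" using c2O J(7) c2I unfolding E_def T_def by blast
  have uV: "u x = c" if "x \<in> c1" for x using that by (simp add: c1_def cv_def)
  have contA: "continuous_on UNIV A"
  proof -
    have 1: "continuous_on S (\<lambda>w. (c, g w))" by (intro continuous_intros g)
    have "continuous_on T antip" using T0 by (rule continuous_antip)
    then have 2: "continuous_on T (\<lambda>w. - (c, g (antip w)))"
      using TS by (intro continuous_intros continuous_on_compose2[OF g(1)]) auto
    have "continuous_on E u" "continuous_on E V"
      unfolding u_def[abs_def] using continuous_on_subset[OF cZ E0] continuous_on_subset[OF cV E0] by (auto intro!: continuous_intros)
    then have 3: "continuous_on E (\<lambda>w. (u w, V w))" by (intro continuous_intros)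
    have 4: "continuous_on (T \<union> E) (\<lambda>w. if w \<in> T then - (c, g (antip w)) else (u w, V w))"
    proof (rule continuous_on_cases[OF clT clE 2 3], intro allI impI)
      fix x assume "x \<in> T \<and> x \<notin> T \<or> x \<in> E \<and> x \<in> T"
      then have x: "x \<in> c2" using ET by blast
      then have "antip x \<in> c1" "x \<noteq> 0" using c2(2) c1_0 by auto
      then have "g (antip x) = - V x" "u x = - c" using g(3) V_antip[of x] x by (auto simp: c2_def cv_def)
      then show "- (c, g (antip x)) = (u x, V x)" by simp
    qed
    have "continuous_on (S \<union> (T \<union> E)) A"
      unfolding A_def
    proof (rule continuous_on_cases[OF _ _ 1 4], goal_cases)
      case 3
      show ?case
      proof (intro allI impI)
        fix x assume x: "x \<in> S \<and> x \<notin> S \<or> x \<in> T \<union> E \<and> x \<in> S"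
        then have "x \<in> c1" "x \<notin> T" using ES ST by blast+
        then show "(c, g x) = (if x \<in> T then - (c, g (antip x)) else (u x, V x))" using g(3) uV by simp
      qed
    qed (use cptS clT clE in \<open>auto simp: compact_imp_closed closed_Un\<close>)
    moreover have "S \<union> (T \<union> E) = UNIV" unfolding E_def T_def S by blast
    ultimately show ?thesis by simp
  qed
  have capA: "(fst (A w) = c \<or> fst (A w) = - c) \<and> norm (snd (A w)) \<le> 1" if "w \<in> S \<union> T" for w
    using that g(2) TS[of w] ST by (auto simp: A_def image_subset_iff)
  have midA: "A w = (u w, V w)" "w \<noteq> 0" "norm (V w) > 1" if "w \<notin> S \<union> T" for w
    using that MV[of w] M0 by (auto simp: A_def Mid_def)
  have oddA: "A (antip w) = - A w" if w: "w \<noteq> 0" for w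
  proof -
    consider "w \<in> S" "antip w \<in> T" "antip w \<notin> S" | "w \<in> T" "w \<notin> S" "antip w \<in> S" | "w \<notin> S" "w \<notin> T" "antip w \<notin> S" "antip w \<notin> T"
      using TS'[OF _ w] TS[of w] TS[of "antip w"] TS'[of "antip w"] ST w by (metis antip_antip antip_eq_0 disjoint_iff)
    then show ?thesis by cases (auto simp: A_def V_antip[OF w] u_antip[OF w])
  qed
  \<comment> \<open>Since \<omega> has norm 1, the second components have equal norm, so
    \<open>x\<close> and \<open>y\<close> are both in the caps or both in \<open>Mid\<close>. In the
    caps the first component is \<open>c\<close> or \<open>- c\<close>, which leaves only a sign for
    \<omega>. In \<open>Mid\<close> the equations give equal \<open>Z\<close> and equal
    \<open>2 * n\<close>-th powers of \<open>V\<close>, and \<open>inj\<close> makes the points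
    equal or antipodal.\<close>
  have key: "\<omega> = 1 \<or> \<omega> = - 1" if x: "A x = (cnj \<omega> * fst (A y), \<omega> * snd (A y))" and om: "\<omega> ^ (2 * n) = 1" for x y \<omega>
  proof -
    have om1: "norm \<omega> = 1" using om n2 by (metis norm_one norm_power power_eq_1_iff norm_ge_zero mult_is_0 not_numeral_le_zero zero_neq_numeral)
    have nn: "norm (snd (A x)) = norm (snd (A y))" using x om1 by (simp add: norm_mult)
    show ?thesis
    proof (cases "x \<in> S \<union> T")
      case True
      then have "norm (snd (A y)) \<le> 1" using capA[of x] nn by simp
      then have y: "y \<in> S \<union> T" using midA[of y] by fastforce
      have "cnj \<omega> * c = c \<or> cnj \<omega> * c = - c" using capA[OF True, THEN conjunct1] capA[OF y, THEN conjunct1] x[THEN arg_cong[where f = fst]]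
        by (elim disjE) (metis fst_conv minus_minus mult_minus_right)+
      then have "(cnj \<omega> - 1) * c = 0 \<or> (cnj \<omega> + 1) * c = 0" by (auto simp: algebra_simps)
      then have "cnj \<omega> = 1 \<or> cnj \<omega> = - 1" using cne by (auto simp: add_eq_0_iff2)
      then show ?thesis by (metis complex_cnj_cnj complex_cnj_minus complex_cnj_one)
    next
      case False
      note mx = midA[OF False]
      then have "norm (snd (A y)) > 1" using nn by simp
      then have "y \<notin> S \<union> T" using capA[of y] by force
      note my = midA[OF this]
      have e1: "u x = cnj \<omega> * u y" "V x = \<omega> * V y" using x unfolding mx my by simp_all
      have ne: "V x \<noteq> 0" "V y \<noteq> 0" "\<omega> \<noteq> 0" using V0[OF mx(2)] V0[OF my(2)] om1 by auto
      have "Z x * cnj (\<omega> * V y) = cnj \<omega> * (Z y * cnj (V y))" using e1 unfolding u_def by (simp only:)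
      then have "(Z x - Z y) * (cnj \<omega> * cnj (V y)) = 0" by (simp add: algebra_simps)
      then have "Z x = Z y" using ne by simp
      moreover have "V x ^ (2 * n) = V y ^ (2 * n)" unfolding e1(2) power_mult_distrib om by simp
      ultimately have "y = x \<or> y = antip x" using inj[of x y] mx my by simp
      then have "V x = V y \<or> V x = - V y" using V_antip[OF mx(2)] by auto
      then have "(\<omega> - 1) * V y = 0 \<or> (\<omega> + 1) * V y = 0" unfolding e1(2) by (simp add: algebra_simps add_eq_0_iff)
      then show ?thesis using ne by (simp add: add_eq_0_iff2)
    qed
  qed
  show False
  proof (rule no_equivariant_disc[OF n2, of A])
    show "continuous_on (cball 0 1) A" using contA continuous_on_subset by blast
    show "A z \<noteq> 0" for z
      using capA[of z] cne midA[of z] V0[of z] by (cases "z \<in> S \<union> T") (auto simp: prod_eq_iff)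
    show "A (- z) = - A z" if "norm z = 1" for z
      using oddA[of z] antip_unit[OF that] that by (metis norm_zero zero_neq_one)
    fix z w i j assume ij: "i < n" "j < n" "(i::nat) \<noteq> j"
    define a where "a = pi * real i / real n"
    define b where "b = pi * real j / real n"
    have False if e: "e = 1 \<or> e = - 1" and H: "twist a (A z) = e *\<^sub>R twist b (A w)" for e :: real
    proof -
      define \<omega> where "\<omega> = e *\<^sub>R cis (b - a)"
      have "A z = twist (- a) (twist a (A z))" by simp
      also have "\<dots> = e *\<^sub>R twist (b - a) (A w)" unfolding H twist_linear by (simp add: twist_add[symmetric])
      finally have Az: "A z = (cnj \<omega> * fst (A w), \<omega> * snd (A w))" by (auto simp: twist_def \<omega>_def cis_cnj)
      have "real (2 * n) * (b - a) = 2 * pi * real_of_int (int j - int i)" using n2 by (simp add: a_def b_def field_simps)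
      then have "cis (b - a) ^ (2 * n) = cis (2 * pi * real_of_int (int j - int i))" by (simp only: Complex.DeMoivre)
      also have "\<dots> = 1" by (rule cis_multiple_2pi) (rule Ints_of_int)
      finally have "cis (b - a) ^ (2 * n) = 1" .
      then have "\<omega> ^ (2 * n) = 1" using e by (auto simp: \<omega>_def scaleR_conv_of_real)
      from key[OF Az this] have "Im (cis (b - a)) = 0" using e by (auto simp: \<omega>_def complex_eq_iff)
      then have "sin (b - a) = 0" by simp
      moreover obtain \<kappa> where "\<kappa> > 0" "\<kappa> \<le> \<bar>sin (b - a)\<bar>" using kappa_exists[of n] ij unfolding a_def b_def by metis
      ultimately show False by simp
    qed
    from this[of 1] this[of "-1"] show "twist (pi * real i / real n) (A z) \<noteq> twist (pi * real j / real n) (A w) \<and> twist (pi * real i / real n) (A z) \<noteq> - twist (pi * real j / real n) (A w)"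
      unfolding a_def b_def by auto
  qed
qed

theorem odd_pair_impossible: False
proof -
  obtain w where w: "w \<in> C" using onto[of 1] by (auto simp: C_def)
  have w': "antip w \<in> C" "u (antip w) = - u w" using w antip_C u_antip C0 by (cases "w = 0"; auto)+
  have "cv (u w) homeomorphic (sphere 0 1 :: complex set)" "cv (- u w) homeomorphic (sphere 0 1 :: complex set)"
    using cv_homeo[OF w] cv_homeo[OF w'(1)] w'(2) unfolding homeomorphic_def by auto
  from outside_swap[OF this C_split(2)[OF w]] show False
    using cap_case[of "u w"] cap_case[of "- u w"] w w' by (metis image_eqI minus_minus)
qed

end

section \<open>Straightening the neighbourhood\<close>

abbreviation Om :: "C2 set" where "Om \<equiv> UNIV \<times> (- {0})"

text \<open>On the universal covering, with second coordinate \<open>exp z\<close>, the map has a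
  logarithm. The deck transformation changes it by a constant multiple of
  \<open>2 * pi * \<i>\<close>, which defines \<open>k\<close>; after subtracting \<open>k\<close>
  times \<open>z\<close> the rest descends to \<open>Om\<close>.\<close>

lemma log_winding:
  fixes f :: "C2 \<Rightarrow> complex"
  assumes cf: "continuous_on Om f" and f0: "\<And>y. y \<in> Om \<Longrightarrow> f y \<noteq> 0"
  obtains k :: int and \<rho> where "continuous_on Om \<rho>" "\<And>y. y \<in> Om \<Longrightarrow> f y = snd y powi k * exp (\<rho> y)"
proof -
  have "continuous_on UNIV (\<lambda>y. f (fst y, exp (snd y)))"
    by (rule continuous_on_compose2[OF cf]) (auto intro!: continuous_intros)
  moreover have "contractible (UNIV :: C2 set)" by (simp add: convex_imp_contractible)
  moreover have "f (fst y, exp (snd y)) \<noteq> 0" for y by (rule f0) simp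
  ultimately obtain L where L: "continuous_on UNIV L" "\<And>y. f (fst y, exp (snd y)) = exp (L y)"
    by (rule continuous_logarithm_on_contractible) auto
  have cLs: "continuous_on UNIV (\<lambda>y. L (fst y, snd y + 2 * pi * \<i>))"
    by (rule continuous_on_compose2[OF L(1)]) (auto intro!: continuous_intros)
  have "exp (L (fst y, snd y + 2 * pi * \<i>)) = exp (L y)" for y
    unfolding L(2)[symmetric] by (simp add: exp_add)
  then obtain k :: int where k: "\<And>y. L (fst y, snd y + 2 * pi * \<i>) = L y + 2 * pi * \<i> * of_int k"
    using exp_eq_diff_constant[OF connected_UNIV cLs L(1)] by auto
  define P where "P = (\<lambda>y. L y - of_int k * snd y)"
  have cP: "continuous_on UNIV P" unfolding P_def by (intro continuous_intros L)
  have P1: "P (p, z + 2 * pi * \<i>) = P (p, z)" for p z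
    using k[of "(p, z)"] by (simp add: P_def algebra_simps)
  have Pn: "P (p, z + of_nat m * (2 * pi * \<i>)) = P (p, z)" for p z m
  proof (induction m)
    case (Suc m)
    then show ?case using P1[of p "z + of_nat m * (2 * pi * \<i>)"] by (simp add: algebra_simps)
  qed simp
  have Pe: "P (p, z) = P (p, z')" if e: "exp z = exp z'" for p z z'
  proof -
    obtain m :: int where m: "z = z' + (of_int (2 * m) * pi) * \<i>" using e unfolding exp_eq by blast
    show ?thesis
    proof (cases "m \<ge> 0")
      case True
      then have "z = z' + of_nat (nat m) * (2 * pi * \<i>)" unfolding m by (simp add: algebra_simps)
      then show ?thesis using Pn by simp
    next
      case False
      then have "z' = z + of_nat (nat (- m)) * (2 * pi * \<i>)" unfolding m by (simp add: algebra_simps)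
      then show ?thesis using Pn by simp
    qed
  qed
  \<comment> \<open>\<open>Ln\<close> jumps at the negative axis, but \<open>P\<close> is periodic.
    Continuity is verified on two slit domains that cover \<open>Om\<close>, on the second with the
    branch \<open>Ln (- z) + pi * \<i>\<close>.\<close>
  define \<rho> where "\<rho> = (\<lambda>y. P (fst y, Ln (snd y)))"
  have "continuous_on (UNIV \<times> (- \<real>\<^sub>\<le>\<^sub>0)) \<rho>"
    unfolding \<rho>_def by (rule continuous_on_compose2[OF cP]) (auto intro!: continuous_intros)
  moreover have "continuous_on (UNIV \<times> (- uminus ` \<real>\<^sub>\<le>\<^sub>0)) \<rho>"
  proof -
    have "continuous_on (UNIV \<times> (- uminus ` \<real>\<^sub>\<le>\<^sub>0)) (\<lambda>y. P (fst y, Ln (- snd y) + pi * \<i>))"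
    proof (rule continuous_on_compose2[OF cP])
      have "- snd y \<notin> \<real>\<^sub>\<le>\<^sub>0" if "y \<in> UNIV \<times> (- uminus ` \<real>\<^sub>\<le>\<^sub>0)" for y :: C2
        using that by (metis ComplD mem_Times_iff image_eqI minus_minus)
      then show "continuous_on (UNIV \<times> (- uminus ` \<real>\<^sub>\<le>\<^sub>0)) (\<lambda>y::C2. (fst y, Ln (- snd y) + pi * \<i>))"
        by (intro continuous_intros) auto
    qed simp
    moreover have "P (fst y, Ln (- snd y) + pi * \<i>) = \<rho> y" if "y \<in> UNIV \<times> (- uminus ` \<real>\<^sub>\<le>\<^sub>0)" for y
    proof -
      have "snd y \<noteq> 0" using that by force
      then show ?thesis unfolding \<rho>_def by (intro Pe) (simp add: exp_add)
    qed
    ultimately show ?thesis by (rule continuous_on_eq)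
  qed
  moreover have "open (UNIV \<times> (- \<real>\<^sub>\<le>\<^sub>0) :: C2 set)" "open (UNIV \<times> (- uminus ` \<real>\<^sub>\<le>\<^sub>0) :: C2 set)"
    by (intro open_Times open_UNIV open_Compl closed_nonpos_Reals_complex closed_negations)+
  moreover have "(UNIV \<times> (- \<real>\<^sub>\<le>\<^sub>0)) \<union> (UNIV \<times> (- uminus ` \<real>\<^sub>\<le>\<^sub>0)) = Om"
  proof -
    have "x \<in> uminus ` \<real>\<^sub>\<le>\<^sub>0 \<longleftrightarrow> - x \<in> \<real>\<^sub>\<le>\<^sub>0" for x :: complex
      by (metis image_iff minus_minus)
    then have "- \<real>\<^sub>\<le>\<^sub>0 \<union> - uminus ` \<real>\<^sub>\<le>\<^sub>0 = - {0::complex}"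
      by (auto simp: complex_nonpos_Reals_iff complex_eq_iff)
    then show ?thesis by blast
  qed
  ultimately have "continuous_on Om \<rho>" using continuous_on_open_Un by metis
  moreover have "f y = snd y powi k * exp (\<rho> y)" if "y \<in> Om" for y
  proof -
    have s: "snd y \<noteq> 0" using that by auto
    have "f y = exp (L (fst y, Ln (snd y)))" using L(2)[of "(fst y, Ln (snd y))"] s by simp
    also have "L (fst y, Ln (snd y)) = of_int k * Ln (snd y) + \<rho> y" by (simp add: \<rho>_def P_def)
    also have "exp (of_int k * Ln (snd y) + \<rho> y) = snd y powi k * exp (\<rho> y)" using s by (simp add: exp_add flip: exp_power_int)
    finally show ?thesis .
  qed
  ultimately show ?thesis by (rule that)
qed

text \<open>The winding numbers of a homeomorphism and of its inverse have product 1, by comparing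
  logarithms on one fibre circle. Oddness is what makes the \<open>2 * n\<close>-th root extracted
  later change sign when the two points of a pair are exchanged.\<close>

lemma odd_winding:
  assumes h: "homeomorphism Om Om \<Phi> \<Phi>'"
  obtains k :: int and \<rho> where "odd k" "continuous_on Om \<rho>" "\<And>y. y \<in> Om \<Longrightarrow> snd (\<Phi> y) = snd y powi k * exp (\<rho> y)"
proof -
  have h': "\<And>y. y \<in> Om \<Longrightarrow> \<Phi> y \<in> Om" "\<And>y. y \<in> Om \<Longrightarrow> \<Phi>' y \<in> Om" "\<And>y. y \<in> Om \<Longrightarrow> \<Phi> (\<Phi>' y) = y"
    "continuous_on Om \<Phi>" "continuous_on Om \<Phi>'"
    using h unfolding homeomorphism_def by blast+
  have ck: "continuous_on Om (\<lambda>y. snd (\<Phi> y))" by (intro continuous_intros h')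
  have nk: "snd (\<Phi> y) \<noteq> 0" if "y \<in> Om" for y using h'(1)[OF that] by (auto simp: mem_Times_iff)
  obtain k \<rho> where k: "continuous_on Om \<rho>" "\<And>y. y \<in> Om \<Longrightarrow> snd (\<Phi> y) = snd y powi k * exp (\<rho> y)"
    by (rule log_winding[OF ck]) (use nk in blast, (rule that; assumption))
  have cl: "continuous_on Om (\<lambda>y. snd (\<Phi>' y))" by (intro continuous_intros h')
  have nl: "snd (\<Phi>' y) \<noteq> 0" if "y \<in> Om" for y using h'(2)[OF that] by (auto simp: mem_Times_iff)
  obtain l \<rho>' where l: "continuous_on Om \<rho>'" "\<And>y. y \<in> Om \<Longrightarrow> snd (\<Phi>' y) = snd y powi l * exp (\<rho>' y)"
    by (rule log_winding[OF cl]) (use nl in blast, (rule that; assumption))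
  have "1 - l * k = 0"
  proof (rule no_log_on_circle)
    have "continuous_on Om (\<lambda>y. of_int k * \<rho>' y + \<rho> (\<Phi>' y))"
      by (intro continuous_intros l(1) continuous_on_compose2[OF k(1) h'(5)] image_subsetI h'(2))
    then show "continuous_on (sphere 0 1) (\<lambda>z. of_int k * \<rho>' (0, z) + \<rho> (\<Phi>' (0, z)))"
      by (rule continuous_on_compose2) (auto intro!: continuous_intros)
    fix z :: complex assume z: "norm z = 1"
    then have y: "(0, z) \<in> Om" and z0: "z \<noteq> 0" by auto
    have "z = snd (\<Phi> (\<Phi>' (0, z)))" using h'(3)[OF y] by simp
    also have "\<dots> = (z powi l * exp (\<rho>' (0, z))) powi k * exp (\<rho> (\<Phi>' (0, z)))"
      using k(2)[OF h'(2)[OF y]] l(2)[OF y] by simp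
    also have "\<dots> = z powi (l * k) * exp (of_int k * \<rho>' (0, z) + \<rho> (\<Phi>' (0, z)))"
      by (simp add: power_int_mult_distrib power_int_mult exp_power_int exp_add)
    finally have "z / z powi (l * k) = exp (of_int k * \<rho>' (0, z) + \<rho> (\<Phi>' (0, z)))" using z0 by (simp add: field_simps)
    then show "z powi (1 - l * k) = exp (of_int k * \<rho>' (0, z) + \<rho> (\<Phi>' (0, z)))"
      using z0 by (simp add: power_int_diff)
  qed
  then have "odd (l * k)" by (metis eq_iff_diff_eq_0 odd_one)
  then have "odd k" by simp
  then show ?thesis using that k by blast
qed

lemma homeomorphic_map_euclidean:
  assumes "homeomorphic_map (top_of_set S) (top_of_set T) f"
  obtains g where "homeomorphism S T f g"
proof -
  obtain g where "homeomorphic_maps (top_of_set S) (top_of_set T) f g"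
    using assms[unfolded homeomorphic_map_maps] by (rule exE)
  then have "homeomorphism S T f g"
    by (intro homeomorphismI) (auto simp: homeomorphic_maps_def)
  then show ?thesis by (rule that)
qed

text \<open>After straightening by \<open>h\<close>, every point off the plane
  \<open>snd y = 0\<close> has a radial projection \<open>X\<close> to the frontier of
  \<open>N\<close>, and \<open>g\<close> is extended along the radii. The homeomorphism, given on
  the frontier only, thus reaches all of \<open>Om\<close>, where winding numbers are
  available.\<close>

lemma collar_homeomorphism:
  assumes N: "regular_closed_nbhd N" and g: "homeomorphism (frontier N) (UNIV \<times> sphere 0 1) g g'"
  obtains \<Phi> \<Phi>' where "homeomorphism Om Om \<Phi> \<Phi>'" "frontier N \<subseteq> Om" "\<And>y. y \<in> frontier N \<Longrightarrow> \<Phi> y = g y"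
    "\<And>y. y \<in> Om \<Longrightarrow> y \<in> N \<longleftrightarrow> norm (snd (\<Phi> y)) \<le> 1" "\<And>y. y \<in> Om \<Longrightarrow> y \<in> interior N \<longleftrightarrow> norm (snd (\<Phi> y)) < 1"
proof -
  obtain r and h :: "C2 \<Rightarrow> C2" where rh: "r > 0 \<and> homeomorphic_map euclidean euclidean h \<and> h ` N = UNIV \<times> cball 0 r \<and> (\<forall>z. h (z, 0) = (z, 0))"
    using N[unfolded regular_closed_nbhd_def] by (elim exE conjE) (rule that, intro conjI)
  then have r: "r > 0" and h: "homeomorphic_map euclidean euclidean h" "h ` N = UNIV \<times> cball 0 r" "\<And>z. h (z, 0) = (z, 0)"
    by simp_all
  have "homeomorphic_map (top_of_set UNIV) (top_of_set UNIV) h" using h(1) by simp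
  then obtain h' where hh: "homeomorphism UNIV UNIV h h'" by (rule homeomorphic_map_euclidean)
  then have h': "\<And>y. h' (h y) = y" "\<And>y. h (h' y) = y" "continuous_on UNIV h" "continuous_on UNIV h'"
    unfolding homeomorphism_def by auto
  have inj: "h y \<in> h ` X \<longleftrightarrow> y \<in> X" for y X using h'(1) by (metis image_iff)
  have fr: "y \<in> frontier N \<longleftrightarrow> norm (snd (h y)) = r" for y
  proof -
    have cb: "closure (UNIV \<times> cball 0 r) = (UNIV \<times> cball 0 r :: C2 set)" by (intro closure_closed closed_Times) auto
    have "h ` frontier N = frontier (h ` N)" using homeomorphic_map_frontier_of[OF h(1), of N] by simp
    also have "\<dots> = UNIV \<times> sphere 0 r" unfolding h(2) frontier_def cb interior_Times using r by auto
    finally show ?thesis using inj[of y "frontier N"] by (auto simp: mem_Times_iff)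
  qed
  have int: "y \<in> interior N \<longleftrightarrow> norm (snd (h y)) < r" for y
  proof -
    have "h ` interior N = interior (h ` N)" using homeomorphic_map_interior_of[OF h(1), of N] by simp
    also have "\<dots> = UNIV \<times> ball 0 r" unfolding h(2) interior_Times using r by auto
    finally show ?thesis using inj[of y "interior N"] by (auto simp: mem_Times_iff)
  qed
  have mem: "y \<in> N \<longleftrightarrow> norm (snd (h y)) \<le> r" for y using inj[of y N] h(2) by (auto simp: mem_Times_iff)
  have h0: "snd (h y) = 0 \<longleftrightarrow> snd y = 0" for y
    using h'(1)[of y] h'(1)[of "(fst y, 0)"] h'(1)[of "(fst (h y), 0)"] h(3) by (metis prod.collapse snd_conv)
  have h0': "snd (h' y) = 0 \<longleftrightarrow> snd y = 0" for y using h0[of "h' y"] h'(2) by simp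
  have g': "\<And>y. y \<in> frontier N \<Longrightarrow> g' (g y) = y" "\<And>x. norm (snd x) = 1 \<Longrightarrow> g (g' x) = x"
    "\<And>y. y \<in> frontier N \<Longrightarrow> norm (snd (g y)) = 1" "\<And>x. norm (snd x) = 1 \<Longrightarrow> g' x \<in> frontier N"
    "continuous_on (frontier N) g" "continuous_on (UNIV \<times> sphere 0 1) g'"
  proof -
    have G: "\<And>y. y \<in> frontier N \<Longrightarrow> g y \<in> UNIV \<times> sphere 0 1" "\<And>x. x \<in> UNIV \<times> sphere 0 1 \<Longrightarrow> g' x \<in> frontier N"
      using g unfolding homeomorphism_def by blast+
    then show "norm (snd (g y)) = 1" if "y \<in> frontier N" for y using that by (auto simp: mem_Times_iff)
    show "g (g' x) = x" if "norm (snd x) = 1" for x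
      using g that by (cases x) (simp add: homeomorphism_def)
    show "g' x \<in> frontier N" if "norm (snd x) = 1" for x using G(2)[of x] that by (simp add: mem_Times_iff)
  qed (use g in \<open>simp_all add: homeomorphism_def mem_Times_iff\<close>)
  define X where "X = (\<lambda>y. h' (fst y, r *\<^sub>R sgn (snd y)))"
  have XN: "X y \<in> frontier N" if "snd y \<noteq> 0" for y unfolding fr X_def h'(2) using that r by (simp add: norm_sgn)
  have cX: "continuous_on Om X" unfolding X_def
    by (rule continuous_on_compose2[OF h'(4)]) (auto intro!: continuous_intros)
  define \<Phi> where "\<Phi> = (\<lambda>y. (fst (g (X (h y))), (norm (snd (h y)) / r) *\<^sub>R snd (g (X (h y)))))"
  define W where "W = (\<lambda>x. h (g' (fst x, sgn (snd x))))"
  define \<Phi>' where "\<Phi>' = (\<lambda>x. h' (fst (W x), norm (snd x) *\<^sub>R snd (W x)))"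
  have hOm: "h y \<in> Om \<longleftrightarrow> y \<in> Om" for y using h0[of y] by (auto simp: mem_Times_iff)
  have nW: "norm (snd (W x)) = r" if "snd x \<noteq> 0" for x
    unfolding W_def using g'(4)[of "(fst x, sgn (snd x))"] that fr by (simp add: norm_sgn)
  have n\<Phi>: "norm (snd (\<Phi> y)) = norm (snd (h y)) / r" if "snd y \<noteq> 0" for y
    using g'(3)[OF XN[of "h y"]] that r h0 by (simp add: \<Phi>_def)
  have hX: "continuous_on Om (\<lambda>y. g (X (h y)))"
  proof (rule continuous_on_compose2[OF g'(5)])
    show "continuous_on Om (\<lambda>y. X (h y))"
      by (rule continuous_on_compose2[OF cX continuous_on_subset[OF h'(3)] image_subsetI]) (use hOm in blast)+
    show "(\<lambda>y. X (h y)) ` Om \<subseteq> frontier N"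
      by (intro image_subsetI XN) (auto simp only: h0 mem_Times_iff)
  qed
  have c\<Phi>: "continuous_on Om \<Phi>" unfolding \<Phi>_def
    using r by (intro continuous_intros hX continuous_on_subset[OF h'(3)]) auto
  have cW: "continuous_on Om W" unfolding W_def
  proof (rule continuous_on_compose2[OF h'(3)])
    show "continuous_on Om (\<lambda>x. g' (fst x, sgn (snd x)))"
      by (rule continuous_on_compose2[OF g'(6)]) (auto intro!: continuous_intros simp: norm_sgn)
  qed simp
  have c\<Phi>': "continuous_on Om \<Phi>'" unfolding \<Phi>'_def
    by (rule continuous_on_compose2[OF h'(4)]) (auto intro!: continuous_intros cW)
  have \<Phi>Om: "\<Phi> y \<in> Om" if "y \<in> Om" for y
  proof -
    have "snd y \<noteq> 0" using that by (simp add: mem_Times_iff)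
    then have "norm (snd (\<Phi> y)) \<noteq> 0" using n\<Phi>[of y] h0[of y] r by simp
    then show ?thesis by (auto simp: mem_Times_iff)
  qed
  have \<Phi>'Om: "\<Phi>' x \<in> Om" if "x \<in> Om" for x
  proof -
    have x: "snd x \<noteq> 0" using that by (simp add: mem_Times_iff)
    then have "snd (W x) \<noteq> 0" using nW[of x] r by auto
    then show ?thesis unfolding \<Phi>'_def using h0' x by (simp add: mem_Times_iff)
  qed
  have 1: "\<Phi>' (\<Phi> y) = y" if "y \<in> Om" for y
  proof -
    have y: "snd y \<noteq> 0" "snd (h y) \<noteq> 0" using that h0 by (auto simp: mem_Times_iff)
    have XNy: "X (h y) \<in> frontier N" using XN y by simp
    have n1: "norm (snd (g (X (h y)))) = 1" using g'(3)[OF XNy] .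
    have "sgn (snd (\<Phi> y)) = snd (g (X (h y)))"
      using y r n1 by (simp add: \<Phi>_def sgn_scaleR) (simp add: sgn_div_norm)
    then have "W (\<Phi> y) = h (g' (g (X (h y))))" by (simp add: W_def \<Phi>_def)
    also have "\<dots> = (fst (h y), r *\<^sub>R sgn (snd (h y)))" using g'(1)[OF XNy] by (simp add: X_def h'(2))
    finally have "\<Phi>' (\<Phi> y) = h' (fst (h y), (norm (snd (h y)) / r) *\<^sub>R (r *\<^sub>R sgn (snd (h y))))"
      unfolding \<Phi>'_def n\<Phi>[OF y(1)] by simp
    also have "(norm (snd (h y)) / r) *\<^sub>R (r *\<^sub>R sgn (snd (h y))) = snd (h y)" using r y by (simp add: sgn_div_norm)
    finally show ?thesis using h'(1) by simp
  qed
  have 2: "\<Phi> (\<Phi>' x) = x" if "x \<in> Om" for x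
  proof -
    have x: "snd x \<noteq> 0" using that by (auto simp: mem_Times_iff)
    have s1: "norm (sgn (snd x)) = 1" using x by (simp add: norm_sgn)
    have hx: "h (\<Phi>' x) = (fst (W x), norm (snd x) *\<^sub>R snd (W x))" unfolding \<Phi>'_def h'(2) ..
    have "sgn (norm (snd x) *\<^sub>R snd (W x)) = sgn (snd (W x))" using x by (simp add: sgn_scaleR)
    then have "X (h (\<Phi>' x)) = h' (fst (W x), r *\<^sub>R sgn (snd (W x)))" unfolding X_def hx by simp
    also have "r *\<^sub>R sgn (snd (W x)) = snd (W x)" using nW[OF x] r by (simp add: sgn_div_norm)
    also have "h' (fst (W x), snd (W x)) = g' (fst x, sgn (snd x))" by (simp add: W_def h'(1))
    finally have "g (X (h (\<Phi>' x))) = (fst x, sgn (snd x))" using g'(2)[of "(fst x, sgn (snd x))"] s1 by simp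
    moreover have "norm (snd (h (\<Phi>' x))) / r = norm (snd x)" unfolding hx using nW[OF x] r by simp
    ultimately have "\<Phi> (\<Phi>' x) = (fst x, norm (snd x) *\<^sub>R sgn (snd x))" unfolding \<Phi>_def by simp
    then show ?thesis using x by (simp add: sgn_div_norm)
  qed
  show ?thesis
  proof (rule that[of \<Phi> \<Phi>'])
    show "homeomorphism Om Om \<Phi> \<Phi>'" 
      by (intro homeomorphismI image_subsetI \<Phi>Om \<Phi>'Om 1 2 c\<Phi> c\<Phi>')
    show fO: "frontier N \<subseteq> Om" using fr r h0 by (force simp: mem_Times_iff)
    show "\<Phi> y = g y" if "y \<in> frontier N" for y
    proof -
      have n: "norm (snd (h y)) = r" using that fr by simp
      then have "r *\<^sub>R sgn (snd (h y)) = snd (h y)" using r by (simp add: sgn_div_norm)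
      then have "X (h y) = y" by (simp add: X_def h'(1))
      then show ?thesis using n r by (simp add: \<Phi>_def)
    qed
    show "y \<in> N \<longleftrightarrow> norm (snd (\<Phi> y)) \<le> 1" "y \<in> interior N \<longleftrightarrow> norm (snd (\<Phi> y)) < 1" if "y \<in> Om" for y
      using that n\<Phi>[of y] mem[of y] int[of y] r by (simp_all add: mem_Times_iff)
  qed
qed

section \<open>Transversality\<close>

text \<open>Charts take values in sequences; the passage to a product type provides a normed space
  with convex balls.\<close>

definition vec4 :: "real \<times> real \<times> real \<times> real \<Rightarrow> nat \<Rightarrow> real" where
  "vec4 x = (\<lambda>i. if i = 0 then fst x else if i = 1 then fst (snd x) else if i = 2 then fst (snd (snd x)) else if i = 3 then snd (snd (snd x)) else 0)"

definition coords4 :: "(nat \<Rightarrow> real) \<Rightarrow> real \<times> real \<times> real \<times> real" where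
  "coords4 y = (y 0, y 1, y 2, y 3)"

lemma coords4_vec4: "coords4 (vec4 x) = x" by (simp add: coords4_def vec4_def)

lemma vec4_coords4: "y \<in> topspace (Euclidean_space 4) \<Longrightarrow> vec4 (coords4 y) = y"
proof
  fix i assume "y \<in> topspace (Euclidean_space 4)"
  then have z: "y j = 0" if "j \<ge> 4" for j using that by (simp add: topspace_Euclidean_space)
  show "vec4 (coords4 y) i = y i"
  proof (cases "i < 4")
    case True
    then have "i \<in> {0, 1, 2, 3}" by auto
    then show ?thesis by (auto simp: vec4_def coords4_def)
  qed (use z in \<open>simp add: vec4_def coords4_def\<close>)
qed

lemma vec4_in: "vec4 x \<in> topspace (Euclidean_space 4)"
  by (simp add: topspace_Euclidean_space vec4_def)

lemma continuous_coords4: "continuous_on UNIV coords4"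
  unfolding coords4_def[abs_def] by (intro continuous_intros continuous_on_product_coordinates)

lemma continuous_vec4: "continuous_on UNIV vec4"
proof (rule continuous_on_coordinatewise_then_product)
  show "continuous_on UNIV (\<lambda>x. vec4 x i)" for i
    unfolding vec4_def by (cases "i = 0"; cases "i = 1"; cases "i = 2"; cases "i = 3") (auto intro!: continuous_intros)
qed

text \<open>In a transverse chart the frontier is the hyperplane where the first coordinate
  vanishes, and \<open>F\<close> is a plane that crosses it. Each open half ball contains a point of
  \<open>F\<close> and misses the frontier. So if \<open>F\<close> were contained in
  \<open>N\<close>, both half balls would be too, and \<open>x\<close> would be an interior
  point.\<close>

lemma transverse_not_subset:
  fixes N F :: "C2 set"
  assumes tr: "intersect_transversely 4 euclidean 2 F 3 (frontier N)" and x: "x \<in> F" "x \<in> frontier N"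
    and clo: "frontier N \<subseteq> N"
  shows "\<not> F \<subseteq> N"
proof
  assume FN: "F \<subseteq> N"
  obtain U V h where U: "x \<in> U" "openin euclidean U" and V: "openin (Euclidean_space 4) V"
    and h: "homeomorphic_map (subtopology euclidean U) (subtopology (Euclidean_space 4) V) h"
    and hF: "h ` (U \<inter> F) = V \<inter> {y. \<forall>i\<in>{2..<4}. y i = 0}" and hN: "h ` (U \<inter> frontier N) = V \<inter> {y. \<forall>i<4 - 3. y i = 0}"
    using tr x unfolding intersect_transversely_def by blast
  have VE: "V \<subseteq> topspace (Euclidean_space 4)" using V by (rule openin_subset)
  have "subtopology (Euclidean_space 4) V = top_of_set V"
    using VE unfolding Euclidean_space_def euclidean_product_topology[symmetric]
    by (simp add: subtopology_subtopology inf_absorb2 topspace_subtopology)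
  then obtain k where k: "homeomorphism U V h k" using h homeomorphic_map_euclidean by metis
  have k': "\<And>y. y \<in> U \<Longrightarrow> k (h y) = y" "\<And>y. y \<in> U \<Longrightarrow> h y \<in> V" "\<And>v. v \<in> V \<Longrightarrow> h (k v) = v" "\<And>v. v \<in> V \<Longrightarrow> k v \<in> U"
    "continuous_on U h" "continuous_on V k"
    using k unfolding homeomorphism_def by blast+
  obtain Q where Q: "open Q" "V = Q \<inter> {x. \<forall>i\<ge>4. x i = 0}"
    using V unfolding Euclidean_space_def euclidean_product_topology by (auto simp: openin_subtopology)
  have vQ: "vec4 q \<in> V \<longleftrightarrow> q \<in> vec4 -` Q" for q
    using vec4_in[of q] by (simp add: Q(2) topspace_Euclidean_space)
  have "open (vec4 -` Q)" using open_vimage[OF Q(1) continuous_vec4] .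
  define H where "H = (\<lambda>y. coords4 (h y))"
  have vH: "vec4 (H y) = h y" if "y \<in> U" for y
    unfolding H_def using vec4_coords4 VE k'(2)[OF that] by blast
  have "H x \<in> vec4 -` Q" using vQ vH U(1) k'(2) by metis
  then obtain e where e: "e > 0" "ball (H x) e \<subseteq> vec4 -` Q" using \<open>open (vec4 -` Q)\<close> openE by blast
  define G where "G = (\<lambda>q. k (vec4 q))"
  have GU: "G q \<in> U" "h (G q) = vec4 q" "H (G q) = q" if "q \<in> ball (H x) e" for q
  proof -
    have "vec4 q \<in> V" using that e(2) vQ by blast
    then show "G q \<in> U" "h (G q) = vec4 q" "H (G q) = q"
      using k'(3,4) by (simp_all add: G_def H_def coords4_vec4)
  qed
  have GH: "G (H y) = y" if "y \<in> U" for y using that vH k' by (simp add: G_def)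
  have injh: "inj_on h U" by (rule inj_on_inverseI[where g = k]) (rule k'(1))
  have fN: "y \<in> frontier N \<longleftrightarrow> fst (H y) = 0" if "y \<in> U" for y
  proof -
    have "y \<in> frontier N \<longleftrightarrow> h y \<in> h ` (U \<inter> frontier N)" using inj_on_image_mem_iff[OF injh that Int_lower1] that by simp
    then show ?thesis unfolding hN using k'(2)[OF that] by (simp add: H_def coords4_def)
  qed
  have fF: "y \<in> F \<longleftrightarrow> snd (snd (H y)) = 0" if "y \<in> U" for y
  proof -
    have "y \<in> F \<longleftrightarrow> h y \<in> h ` (U \<inter> F)" using inj_on_image_mem_iff[OF injh that Int_lower1] that by simp
    moreover have "{2..<4} = {2, 3::nat}" by auto
    ultimately show ?thesis unfolding hF using k'(2)[OF that] by (simp add: H_def coords4_def zero_prod_def)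
  qed
  have cG: "continuous_on (ball (H x) e) G"
    unfolding G_def using e(2) vQ
    by (intro continuous_on_compose2[OF k'(6) continuous_on_subset[OF continuous_vec4]]) auto
  have Hx: "fst (H x) = 0" "snd (snd (H x)) = 0" using fN fF U(1) x by auto
  have half: "G ` B \<subseteq> N" if B: "B \<subseteq> ball (H x) e" "connected B" "\<And>q. q \<in> B \<Longrightarrow> fst q \<noteq> 0"
    and q: "q \<in> B" "snd (snd q) = 0" for B q
  proof (rule ccontr)
    assume "\<not> G ` B \<subseteq> N"
    then have ne: "G ` B - N \<noteq> {}" by blast
    have qb: "q \<in> ball (H x) e" using q B(1) by blast
    have "G q \<in> F" unfolding fF[OF GU(1)[OF qb]] GU(3)[OF qb] by (rule q(2))
    then have "G ` B \<inter> N \<noteq> {}" using FN q by blast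
    moreover have "connected (G ` B)" using B cG by (intro connected_continuous_image) (auto intro: continuous_on_subset)
    ultimately have "G ` B \<inter> frontier N \<noteq> {}" using ne connected_Int_frontier by blast
    then obtain b where b: "b \<in> B" "G b \<in> frontier N" by blast
    then have bb: "b \<in> ball (H x) e" using B(1) by blast
    have "fst b = 0" using b(2) unfolding fN[OF GU(1)[OF bb]] GU(3)[OF bb] .
    then show False using B(3) b by blast
  qed
  have cv: "connected (ball (H x) e \<inter> {q. inner (c, 0) q > 0})" for c :: real
    by (intro convex_connected convex_Int convex_ball convex_halfspace_gt)
  have pos: "G ` (ball (H x) e \<inter> {q. fst q > 0}) \<subseteq> N"
  proof (rule half[of _ "H x + (e / 2, 0)"])
    show "connected (ball (H x) e \<inter> {q. 0 < fst q})" using cv[of 1] by (simp add: inner_prod_def)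
  qed (use e Hx in \<open>auto simp: dist_norm norm_prod_def\<close>)
  have neg: "G ` (ball (H x) e \<inter> {q. fst q < 0}) \<subseteq> N"
  proof (rule half[of _ "H x + (- e / 2, 0)"])
    show "connected (ball (H x) e \<inter> {q. fst q < 0})" using cv[of "-1"] by (simp add: inner_prod_def)
  qed (use e Hx in \<open>auto simp: dist_norm norm_prod_def\<close>)
  define W where "W = U \<inter> H -` ball (H x) e"
  have "continuous_on U H" unfolding H_def
    by (rule continuous_on_compose2[OF continuous_coords4 k'(5)]) simp
  then have "open W" unfolding W_def using U(2) by (intro continuous_open_preimage) auto
  moreover have "x \<in> W" using U(1) e(1) by (simp add: W_def)
  moreover have "W \<subseteq> N"
  proof
    fix y assume y: "y \<in> W"
    then have yU: "y \<in> U" and yb: "H y \<in> ball (H x) e" by (auto simp: W_def)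
    consider "fst (H y) = 0" | "fst (H y) > 0" | "fst (H y) < 0" by linarith
    then show "y \<in> N"
    proof cases
      case 1
      then show ?thesis using fN[OF yU] clo by blast
    next
      case 2
      then have "G (H y) \<in> N" using pos yb by blast
      then show ?thesis using GH[OF yU] by simp
    next
      case 3
      then have "G (H y) \<in> N" using neg yb by blast
      then show ?thesis using GH[OF yU] by simp
    qed
  qed
  ultimately have "x \<in> interior N" by (rule interiorI)
  then show False using x(2) by (simp add: frontier_def)
qed

section \<open>Parameters for pairs of points of the circle\<close>

text \<open>Half the length of the arc from \<open>pole_s w\<close> to \<open>pole_t w\<close>,
  whose midpoint is the direction of \<open>w\<close>. The antipodal map passes to the complementary
  arc, which exchanges the two ends, and \<open>w\<close> near 0 gives pairs near the
  diagonal.\<close>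

definition colat :: "complex \<Rightarrow> real" where "colat w = pi * norm w / (1 + norm w)"

definition pole_s :: "complex \<Rightarrow> complex" where "pole_s w = sgn w * cis (- colat w)"
definition pole_t :: "complex \<Rightarrow> complex" where "pole_t w = sgn w * cis (colat w)"

lemma colat_bounds: "w \<noteq> 0 \<Longrightarrow> 0 < colat w" "w \<noteq> 0 \<Longrightarrow> colat w < pi" "colat w \<le> pi * norm w"
proof -
  have p: "1 + norm w > 0" using norm_ge_zero[of w] by linarith
  show "w \<noteq> 0 \<Longrightarrow> 0 < colat w" "w \<noteq> 0 \<Longrightarrow> colat w < pi" using p by (auto simp: colat_def divide_less_eq)
  have "norm w / (1 + norm w) \<le> norm w" using p by (simp add: divide_le_eq mult_left_le algebra_simps)
  then have "pi * (norm w / (1 + norm w)) \<le> pi * norm w" by (intro mult_left_mono) auto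
  then show "colat w \<le> pi * norm w" by (simp add: colat_def)
qed

lemma pole_antip:
  assumes "w \<noteq> 0" shows "pole_s (antip w) = pole_t w" "pole_t (antip w) = pole_s w"
proof -
  have "antip w = - ((1 / (norm w)\<^sup>2) *\<^sub>R w)"
    using complex_norm_square[of w] assms by (simp add: antip_def scaleR_conv_of_real field_simps)
  then have s: "sgn (antip w) = - sgn w" using assms by (simp add: sgn_minus sgn_scaleR)
  have p: "1 + norm w > 0" using norm_ge_zero[of w] by linarith
  have c: "colat (antip w) = pi - colat w" using assms p by (simp add: colat_def norm_antip field_simps)
  have "cis (pi - a) = - cis (- a)" "cis (- (pi - a)) = - cis a" for a
    by (simp_all add: complex_eq_iff cos_diff sin_diff)
  then show "pole_s (antip w) = pole_t w" "pole_t (antip w) = pole_s w"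
    unfolding pole_s_def pole_t_def s c by simp_all
qed

lemma pole_norm: "w \<noteq> 0 \<Longrightarrow> norm (pole_s w) = 1" "w \<noteq> 0 \<Longrightarrow> norm (pole_t w) = 1"
  by (simp_all add: pole_s_def pole_t_def norm_mult norm_sgn)

lemma continuous_pole: "continuous_on (- {0}) pole_s" "continuous_on (- {0}) pole_t"
proof -
  have "1 + norm w \<noteq> 0" for w :: complex using norm_ge_zero[of w] by linarith
  then have c: "continuous_on (- {0}) colat" unfolding colat_def[abs_def] by (intro continuous_intros) auto
  show "continuous_on (- {0}) pole_s" "continuous_on (- {0}) pole_t"
    unfolding pole_s_def[abs_def] pole_t_def[abs_def] by (intro continuous_intros c; simp)+
qed

lemma cis_double_eq:
  assumes "cis (2 * a) = cis (2 * b)" "0 < a" "a < pi" "0 < b" "b < pi" shows "a = b"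
proof -
  obtain m :: int where m: "2 * a = 2 * b + 2 * pi * m"
    using assms(1) sin_cos_eq_iff[of "2 * a" "2 * b"] by (auto simp: complex_eq_iff)
  then have "a - b = pi * m" by simp
  then have "\<bar>pi * m\<bar> < pi * 1" using assms by linarith
  then have "\<bar>real_of_int m\<bar> < 1" by (simp add: abs_mult)
  then have "m = 0" by linarith
  then show ?thesis using m by simp
qed

lemma pole_quot: "w \<noteq> 0 \<Longrightarrow> pole_t w = pole_s w * cis (2 * colat w)"
  by (simp add: pole_s_def pole_t_def mult.assoc cis_mult)

lemma pole_distinct: "w \<noteq> 0 \<Longrightarrow> pole_s w \<noteq> pole_t w"
proof
  assume w: "w \<noteq> 0" "pole_s w = pole_t w"
  then have "pole_s w \<noteq> 0" using pole_norm by force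
  then have "cis (2 * colat w) = 1" using pole_quot[OF w(1)] w(2) by (metis mult_cancel_left1)
  then have "cos (2 * colat w) = 1" by (simp add: complex_eq_iff)
  then obtain m :: int where "2 * colat w = 2 * pi * m" using cos_one_2pi_int[of "2 * colat w"] by (auto simp: mult_ac)
  then have "0 < pi * m" "pi * m < pi * 1" using colat_bounds(1,2)[OF w(1)] by simp_all
  then have "0 < real_of_int m" "real_of_int m < 1" by (simp_all add: zero_less_mult_iff)
  then have "0 < m" "m < 1" by simp_all
  then show False by linarith
qed

lemma pole_inj:
  assumes "w \<noteq> 0" "w' \<noteq> 0" "pole_s w = pole_s w'" "pole_t w = pole_t w'"
  shows "w = w'"
proof -
  have "pole_s w \<noteq> 0" using pole_norm[OF assms(1)] by force
  then have "cis (2 * colat w) = cis (2 * colat w')" using pole_quot assms by (metis mult_left_cancel)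
  then have c: "colat w = colat w'" using colat_bounds assms by (intro cis_double_eq) auto
  have p: "1 + norm w > 0" "1 + norm w' > 0" using norm_ge_zero[of w] norm_ge_zero[of w'] by linarith+
  have n: "norm w = norm w'" using c p by (simp add: colat_def field_simps)
  have "sgn w = sgn w'" using assms(4) c by (simp add: pole_t_def)
  then have "norm w *\<^sub>R sgn w = norm w' *\<^sub>R sgn w'" using n by simp
  then show ?thesis using assms(1,2) by (simp add: sgn_div_norm)
qed

lemma pole_surj:
  assumes "norm s = 1" "norm t = 1" "s \<noteq> t"
  obtains w where "w \<noteq> 0" "pole_s w = s" "pole_t w = t"
proof -
  have "norm (t / s) = 1" using assms by (simp add: norm_divide)
  then obtain \<theta> where \<theta>: "0 \<le> \<theta>" "\<theta> < 2 * pi" "t / s = cis \<theta>"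
    using complex_unimodular_polar[of "t / s"] by (auto simp: cis.ctr)
  have s0: "s \<noteq> 0" using assms by auto
  have "\<theta> \<noteq> 0" using \<theta>(3) assms(3) s0 by (auto simp: field_simps)
  then have "\<theta> > 0" using \<theta>(1) by simp
  \<comment> \<open>The arc from \<open>s\<close> to \<open>t\<close> has length
    \<open>2 * pi * u\<close>, so the colatitude must be \<open>pi * u\<close>; solving for the norm
    gives \<open>u / (1 - u)\<close>.\<close>
  define u where "u = \<theta> / (2 * pi)"
  have u: "0 < u" "u < 1" using \<open>\<theta> > 0\<close> \<theta>(2) by (auto simp: u_def divide_less_eq)
  define w where "w = (u / (1 - u)) *\<^sub>R (s * cis (pi * u))"
  have q: "u / (1 - u) > 0" using u by simp
  have n: "norm w = u / (1 - u)" using u assms by (simp add: w_def norm_mult)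
  have c: "colat w = pi * u" unfolding colat_def n using u by (simp add: field_simps)
  have "sgn w = s * cis (pi * u)" 
    unfolding w_def sgn_scaleR sgn_pos[OF q] using assms by (simp add: sgn_div_norm norm_mult)
  then have ps: "pole_s w = s" "pole_t w = s * cis (2 * (pi * u))"
    unfolding pole_s_def pole_t_def c by (simp_all add: mult.assoc cis_mult)
  have "pole_t w = t" unfolding ps(2) using \<theta>(3) s0 by (simp add: u_def field_simps)
  moreover have "w \<noteq> 0" using n q by auto
  ultimately show ?thesis using that ps(1) by blast
qed

lemma pole_near: "norm (pole_s w - pole_t w) \<le> 2 * pi * norm w" if "w \<noteq> 0"
proof -
  have "pole_s w - pole_t w = sgn w * (- (2 * \<i> * of_real (sin (colat w))))"
    by (simp add: pole_s_def pole_t_def complex_eq_iff algebra_simps)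
  then have "norm (pole_s w - pole_t w) = 2 * \<bar>sin (colat w)\<bar>" using that by (simp add: norm_mult norm_sgn)
  also have "\<dots> \<le> 2 * \<bar>colat w\<bar>" using abs_sin_x_le_abs_x by simp
  also have "\<dots> \<le> 2 * (pi * norm w)" using colat_bounds[of w] that by simp
  finally show ?thesis by simp
qed

text \<open>Conjugation in the circle factor exchanges the torus curves with slopes \<open>m\<close>
  and \<open>- m\<close>.\<close>

lemma homeomorphic_pairs_orient:
  assumes "homeomorphic_pairs (top_of_set B) A (top_of_set (UNIV \<times> unit_circle)) (torus_curve q)" "q \<in> {m, - m}"
  obtains g g' where "homeomorphism B (UNIV \<times> sphere 0 1) g g'" "g ` A = torus_curve m"
proof -
  obtain h where h: "homeomorphic_map (top_of_set B) (top_of_set (UNIV \<times> unit_circle)) h" "h ` A = torus_curve q"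
    using assms(1) unfolding homeomorphic_pairs_def by blast
  obtain h' where h': "homeomorphism B (UNIV \<times> sphere 0 1) h h'" using h(1) by (rule homeomorphic_map_euclidean)
  show ?thesis
  proof (cases "q = m")
    case True
    then show ?thesis using that h' h(2) by blast
  next
    case False
    then have q: "q = - m" using assms(2) by simp
    define c where "c = (\<lambda>x :: C2. (fst x, cnj (snd x)))"
    have c: "homeomorphism (UNIV \<times> sphere 0 1) (UNIV \<times> sphere 0 1) c c"
      unfolding c_def by (rule homeomorphismI) (auto intro!: continuous_intros)
    have "c ` torus_curve q = torus_curve m"
      unfolding torus_curve_def image_image q by (simp add: c_def cis_cnj)
    then have "(c \<circ> h) ` A = torus_curve m" using h(2) by (metis image_comp)
    then show ?thesis using that[OF homeomorphism_compose[OF h' c]] by blast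
  qed
qed

section \<open>The coincidence outside the interior of the neighbourhood\<close>

lemma topspace_moebius: "topspace moebius_band = {Upair s t |s t. norm s = 1 \<and> norm t = 1}"
  unfolding moebius_band_def topspace_quotient_topology by (auto; blast)

lemma powi_power_even:
  fixes x :: complex assumes "odd k" shows "(- x) powi k = - (x powi k)"
  using assms by (simp add: power_int_minus_left)

theorem intersection_exists:
  fixes \<alpha> :: "complex \<Rightarrow> complex" and n :: nat and d :: real and N :: "C2 set"
  assumes cont: "continuous_on unit_circle \<alpha>" and inja: "inj_on \<alpha> unit_circle"
    and n2: "n \<ge> 2" and d0: "d > 0"
    and N: "regular_closed_nbhd N" and sub: "UNIV \<times> cball 0 (d ^ (2 * n)) \<subseteq> N"
    and tr: "Psi_transverse \<alpha> n (frontier N)"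
    and q: "q \<in> {int (2 * n), - int (2 * n)}"
    and pair: "homeomorphic_pairs
             (top_of_set (frontier N)) (Psi \<alpha> n ` topspace moebius_band \<inter> frontier N)
             (top_of_set (UNIV \<times> unit_circle)) (torus_curve q)"
  shows "\<exists>a\<in>topspace moebius_band. \<exists>b\<in>topspace moebius_band. a \<noteq> b \<and> Psi \<alpha> n a = Psi \<alpha> n b \<and> Psi \<alpha> n a \<notin> interior N"
proof (rule ccontr)
  assume H: "\<not> ?thesis"
  obtain g g' where g: "homeomorphism (frontier N) (UNIV \<times> sphere 0 1) g g'"
    and gA: "g ` (Psi \<alpha> n ` topspace moebius_band \<inter> frontier N) = torus_curve (int (2 * n))"
    using homeomorphic_pairs_orient[OF pair q] .
  obtain \<Phi> \<Phi>' where \<Phi>: "homeomorphism Om Om \<Phi> \<Phi>'" and fO: "frontier N \<subseteq> Om" and \<Phi>g: "\<And>y. y \<in> frontier N \<Longrightarrow> \<Phi> y = g y"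
    and \<Phi>N: "\<And>y. y \<in> Om \<Longrightarrow> y \<in> N \<longleftrightarrow> norm (snd (\<Phi> y)) \<le> 1" and \<Phi>i: "\<And>y. y \<in> Om \<Longrightarrow> y \<in> interior N \<longleftrightarrow> norm (snd (\<Phi> y)) < 1"
    using collar_homeomorphism[OF N g] by blast
  obtain k \<rho> where k: "odd k" and c\<rho>: "continuous_on Om \<rho>" and \<Phi>2: "\<And>y. y \<in> Om \<Longrightarrow> snd (\<Phi> y) = snd y powi k * exp (\<rho> y)"
    using odd_winding[OF \<Phi>] by blast
  have c\<Phi>: "continuous_on Om \<Phi>" and \<Phi>inj: "\<And>x y. x \<in> Om \<Longrightarrow> y \<in> Om \<Longrightarrow> \<Phi> x = \<Phi> y \<Longrightarrow> x = y"
    using \<Phi> unfolding homeomorphism_def by metis+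
  have "g ` frontier N = UNIV \<times> sphere 0 1" using g unfolding homeomorphism_def by simp
  then have "g y \<in> UNIV \<times> sphere 0 1" if "y \<in> frontier N" for y using that by blast
  then have gn: "norm (snd (g y)) = 1" if "y \<in> frontier N" for y using that by (auto simp: mem_Times_iff)
  define D where "D = (\<lambda>w. \<alpha> (pole_s w) - \<alpha> (pole_t w))"
  define F where "F = (\<lambda>w. Psi \<alpha> n (Upair (pole_s w) (pole_t w)))"
  \<comment> \<open>An explicit \<open>2 * n\<close>-th root of the second coordinate after
    straightening: as \<open>snd (F w)\<close> is the \<open>2 * n\<close>-th power of
    \<open>D w\<close>, the factor \<open>snd (F w) powi k\<close> has the root
    \<open>D w powi k\<close>, and the exponential factor is divided in the exponent.\<close>
  define V where "V = (\<lambda>w. D w powi k * exp (\<rho> (F w) / of_nat (2 * n)))"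
  define Z where "Z = (\<lambda>w. fst (\<Phi> (F w)))"
  have Fw: "F w = ((\<alpha> (pole_s w) + \<alpha> (pole_t w)) / 2, D w ^ (2 * n))" for w
    by (simp add: F_def Psi_Upair D_def)
  have D0: "D w \<noteq> 0" if "w \<noteq> 0" for w
    using inj_onD[OF inja, of "pole_s w" "pole_t w"] pole_norm[OF that] pole_distinct[OF that] by (auto simp: D_def)
  have FO: "F w \<in> Om" if "w \<noteq> 0" for w using D0[OF that] by (simp add: Fw)
  have cs: "continuous_on (- {0}) (\<lambda>w. \<alpha> (pole_s w))" "continuous_on (- {0}) (\<lambda>w. \<alpha> (pole_t w))"
    by (rule continuous_on_compose2[OF cont continuous_pole(1)], use pole_norm in force)
      (rule continuous_on_compose2[OF cont continuous_pole(2)], use pole_norm in force)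
  have cD: "continuous_on (- {0}) D" unfolding D_def by (intro continuous_intros cs)
  have cF: "continuous_on (- {0}) F" unfolding Fw[abs_def] by (intro continuous_intros cs cD) auto
  have FO': "F ` (- {0}) \<subseteq> Om" by (intro image_subsetI FO) simp
  have n0: "of_nat (2 * n) \<noteq> (0 :: complex)" using n2 by simp
  have V2n: "V w ^ (2 * n) = snd (\<Phi> (F w))" if "w \<noteq> 0" for w
  proof -
    have "V w ^ (2 * n) = (D w powi k) ^ (2 * n) * exp (of_nat (2 * n) * (\<rho> (F w) / of_nat (2 * n)))"
      unfolding V_def power_mult_distrib exp_of_nat_mult ..
    also have "of_nat (2 * n) * (\<rho> (F w) / of_nat (2 * n)) = \<rho> (F w)" using n0 by simp
    also have "(D w powi k) ^ (2 * n) = (D w ^ (2 * n)) powi k"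
      by (metis mult.commute power_int_mult power_int_of_nat)
    finally show ?thesis using \<Phi>2[OF FO[OF that]] by (simp add: Fw)
  qed
  have nV: "norm (V w) < 1 \<longleftrightarrow> norm (snd (\<Phi> (F w))) < 1" "norm (V w) \<le> 1 \<longleftrightarrow> norm (snd (\<Phi> (F w))) \<le> 1" if "w \<noteq> 0" for w
    unfolding V2n[OF that, symmetric] norm_power using n2
    by (simp_all add: power_less_one_iff power_le_one_iff)
  have Vin: "F w \<in> interior N \<longleftrightarrow> norm (V w) < 1" "F w \<in> N \<longleftrightarrow> norm (V w) \<le> 1" if "w \<noteq> 0" for w
    using \<Phi>N[OF FO[OF that]] \<Phi>i[OF FO[OF that]] nV[OF that] by auto
  have frV: "F w \<in> frontier N \<longleftrightarrow> norm (V w) = 1" if "w \<noteq> 0" for w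
  proof
    assume f: "F w \<in> frontier N"
    then have "norm (snd (\<Phi> (F w))) = 1" using \<Phi>g gn by simp
    then show "norm (V w) = 1" using nV[OF that] by auto
  next
    assume "norm (V w) = 1"
    then have "F w \<in> N" "F w \<notin> interior N" using Vin[OF that] by simp_all
    then show "F w \<in> frontier N" unfolding frontier_def using closure_subset[of N] by blast
  qed
  have H': "a = b" if "a \<in> topspace moebius_band" "b \<in> topspace moebius_band" "Psi \<alpha> n a = Psi \<alpha> n b" "Psi \<alpha> n a \<notin> interior N" for a b
    using H that by blast
  have mo: "Upair (pole_s w) (pole_t w) \<in> topspace moebius_band" if "w \<noteq> 0" for w
    unfolding topspace_moebius using pole_norm[OF that] by blast
  have Fsurj: "\<exists>w. w \<noteq> 0 \<and> F w = Psi \<alpha> n a" if a: "a \<in> topspace moebius_band" "snd (Psi \<alpha> n a) \<noteq> 0" for a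
  proof -
    obtain s t where st: "a = Upair s t" "norm s = 1" "norm t = 1" using a(1) unfolding topspace_moebius by blast
    have "s \<noteq> t" using a(2) n2 unfolding st Psi_Upair by auto
    then obtain w where "w \<noteq> 0" "pole_s w = s" "pole_t w = t" using pole_surj st by metis
    then show ?thesis unfolding F_def st by metis
  qed
  have N0: "snd y \<noteq> 0" if "y \<notin> N" for y
  proof
    assume "snd y = 0"
    then have "y \<in> UNIV \<times> cball 0 (d ^ (2 * n))" using d0 by (auto simp: mem_Times_iff)
    then show False using sub that by blast
  qed
  interpret odd_pair n Z V
  proof
    show "n \<ge> 2" by fact
    show "continuous_on (- {0}) Z" unfolding Z_def
      by (intro continuous_intros continuous_on_compose2[OF c\<Phi> cF FO'])
    show "continuous_on (- {0}) V" unfolding V_def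
      using D0 n0 by (intro continuous_intros cD continuous_on_compose2[OF c\<rho> cF FO']) auto
    fix w :: complex assume w: "w \<noteq> 0"
    have Fa: "F (antip w) = F w" unfolding F_def pole_antip[OF w] by (rule arg_cong[of _ _ "Psi \<alpha> n"]) auto
    have Da: "D (antip w) = - D w" by (simp add: D_def pole_antip[OF w])
    show "Z (antip w) = Z w" by (simp add: Z_def Fa)
    show "V (antip w) = - V w" by (simp add: V_def Fa Da powi_power_even[OF k])
    show "V w \<noteq> 0" using D0[OF w] by (simp add: V_def)
    show "w' = w \<or> w' = antip w" if "w' \<noteq> 0" "1 \<le> norm (V w)" "Z w = Z w'" "V w ^ (2 * n) = V w' ^ (2 * n)" for w'
    proof -
      have "\<Phi> (F w) = \<Phi> (F w')" using that V2n[OF w] V2n[OF that(1)] by (simp add: Z_def prod_eq_iff)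
      then have "F w = F w'" using \<Phi>inj FO w that(1) by metis
      moreover have "F w \<notin> interior N" using Vin(1)[OF w] that(2) by simp
      ultimately have "Upair (pole_s w) (pole_t w) = Upair (pole_s w') (pole_t w')"
        using H'[OF mo[OF w] mo[OF that(1)]] unfolding F_def by blast
      then consider "pole_s w' = pole_s w" "pole_t w' = pole_t w" | "pole_s w' = pole_t w" "pole_t w' = pole_s w" by auto
      then show ?thesis
      proof cases
        case 1
        then show ?thesis using pole_inj[OF that(1) w] by blast
      next
        case 2
        then show ?thesis using pole_inj[OF that(1), of "antip w"] w pole_antip[OF w] by simp
      qed
    qed
    show "norm (Z w) = 1 \<and> Z w ^ (2 * n) = V w ^ (2 * n)" if "norm (V w) = 1"
    proof -
      have f: "F w \<in> frontier N" using frV[OF w] that by simp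
      then have "g (F w) \<in> torus_curve (int (2 * n))" unfolding gA[symmetric] using mo[OF w] unfolding F_def by blast
      then obtain t where "g (F w) = (cis (2 * pi * t), cis (2 * pi * of_int (int (2 * n)) * t))" unfolding torus_curve_def by blast
      then have t: "Z w = cis (2 * pi * t)" "V w ^ (2 * n) = cis (2 * pi * of_int (int (2 * n)) * t)"
        using \<Phi>g[OF f] V2n[OF w] by (simp_all add: Z_def)
      then show ?thesis by (simp add: Complex.DeMoivre mult_ac)
    qed
  next
    fix z :: complex assume "norm z = 1"
    then have "z \<in> (\<lambda>t. cis (2 * pi * t)) ` {0..1}" using path_image_cis by (simp add: path_image_def)
    then obtain t where t: "z = cis (2 * pi * t)" by blast
    have "(cis (2 * pi * t), cis (2 * pi * of_int (int (2 * n)) * t)) \<in> torus_curve (int (2 * n))" unfolding torus_curve_def by blast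
    then obtain a where a: "a \<in> topspace moebius_band" "Psi \<alpha> n a \<in> frontier N" "g (Psi \<alpha> n a) = (cis (2 * pi * t), cis (2 * pi * of_int (int (2 * n)) * t))"
      unfolding gA[symmetric] by auto
    have "snd (Psi \<alpha> n a) \<noteq> 0" using a(2) fO by (auto simp: mem_Times_iff)
    then obtain w where w: "w \<noteq> 0" "F w = Psi \<alpha> n a" using Fsurj[OF a(1)] by blast
    then show "\<exists>w. w \<noteq> 0 \<and> norm (V w) = 1 \<and> Z w = z"
      using frV[OF w(1)] a \<Phi>g[OF a(2)] t by (intro exI[of _ w]) (simp add: Z_def)
  next
    have "uniformly_continuous_on unit_circle \<alpha>" using cont by (rule compact_uniformly_continuous) simp
    then obtain e where e: "e > 0" "\<And>x y. norm x = 1 \<Longrightarrow> norm y = 1 \<Longrightarrow> dist x y < e \<Longrightarrow> dist (\<alpha> x) (\<alpha> y) < d"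
      unfolding uniformly_continuous_on_def using d0 by (metis dist_0_norm mem_sphere)
    show "\<exists>e>0. \<forall>w. w \<noteq> 0 \<longrightarrow> norm w < e \<longrightarrow> norm (V w) < 1"
    \<comment> \<open>By \<open>pole_near\<close> the two points of the pair are at most
      \<open>2 * pi * norm w\<close> apart.\<close>
    proof (intro exI[of _ "e / (2 * pi)"] conjI allI impI)
      fix w :: complex assume w: "w \<noteq> 0" "norm w < e / (2 * pi)"
      have "2 * pi * norm w < e" using w(2) by (simp add: field_simps)
      then have "norm (D w) < d" using pole_near[OF w(1)] e(2)[of "pole_s w" "pole_t w"] pole_norm[OF w(1)] by (simp add: D_def dist_norm)
      then have "norm (D w ^ (2 * n)) < d ^ (2 * n)" unfolding norm_power using n2 by (intro power_strict_mono) auto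
      then have Fb: "F w \<in> UNIV \<times> ball 0 (d ^ (2 * n))" by (simp add: Fw)
      have "UNIV \<times> ball 0 (d ^ (2 * n)) \<subseteq> interior N"
        using interior_mono[OF sub] d0 by (simp add: interior_Times)
      then have "F w \<in> interior N" using Fb by (rule subsetD)
      then show "norm (V w) < 1" unfolding Vin(1)[OF w(1)] .
    qed (use e in simp)
  next
    \<comment> \<open>The torus curve is nonempty, so \<open>Psi\<close> meets the frontier; by
      transversality it also has values outside \<open>N\<close>.\<close>
    have "(cis (2 * pi * 0), cis (2 * pi * of_int (int (2 * n)) * 0)) \<in> torus_curve (int (2 * n))" unfolding torus_curve_def by blast
    then obtain a where a: "a \<in> topspace moebius_band" "Psi \<alpha> n a \<in> frontier N" unfolding gA[symmetric] by blast
    then obtain U where U: "openin moebius_band U" "a \<in> U" "intersect_transversely 4 euclidean 2 (Psi \<alpha> n ` U) 3 (frontier N)"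
      using tr unfolding Psi_transverse_def by blast
    have "frontier N \<subseteq> N"
    proof
      fix y assume y: "y \<in> frontier N"
      then have "norm (snd (\<Phi> y)) = 1" using \<Phi>g gn by simp
      then show "y \<in> N" using \<Phi>N[OF subsetD[OF fO y]] by simp
    qed
    then have "\<not> Psi \<alpha> n ` U \<subseteq> N" using transverse_not_subset[OF U(3) imageI[OF U(2)] a(2)] by blast
    then obtain b where b: "b \<in> U" "Psi \<alpha> n b \<notin> N" by blast
    then have "b \<in> topspace moebius_band" using openin_subset[OF U(1)] by blast
    then obtain w where w: "w \<noteq> 0" "F w = Psi \<alpha> n b" using Fsurj N0 b(2) by blast
    then show "\<exists>w. w \<noteq> 0 \<and> 1 < norm (V w)" using Vin(2)[OF w(1)] b(2) by (intro exI[of _ w]) auto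
  qed
  show False by (rule odd_pair_impossible)
qed

section \<open>Inscribed rectangles\<close>

lemma norm_cis_pm_1: "norm (cis x - 1) = 2 * \<bar>sin (x / 2)\<bar>" "norm (cis x + 1) = 2 * \<bar>cos (x / 2)\<bar>"
proof -
  have "cis x = cis (x / 2) * cis (x / 2)" by (simp add: cis_mult)
  moreover have "cis (x / 2) * cis (- (x / 2)) = 1" by (simp add: cis_mult)
  ultimately have 1: "cis x - 1 = cis (x / 2) * (cis (x / 2) - cis (- (x / 2)))" "cis x + 1 = cis (x / 2) * (cis (x / 2) + cis (- (x / 2)))"
    by (simp_all only: right_diff_distrib distrib_left)
  have 2: "cis y - cis (- y) = 2 * \<i> * of_real (sin y)" "cis y + cis (- y) = 2 * of_real (cos y)" for y
    by (simp_all add: complex_eq_iff)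
  show "norm (cis x - 1) = 2 * \<bar>sin (x / 2)\<bar>" "norm (cis x + 1) = 2 * \<bar>cos (x / 2)\<bar>"
    unfolding 1 2 by (simp_all add: norm_mult)
qed

text \<open>For \<open>\<omega> = cis \<theta>\<close> the ratio is the absolute value of
  \<open>tan (\<theta> / 2)\<close>, and \<theta> is \<open>pi * j / n\<close> for an integer
  \<open>j\<close> with \<open>0 < \<bar>j\<bar>\<close> and
  \<open>\<bar>j\<bar> < n\<close>.\<close>

lemma root_of_unity_ratio:
  fixes \<omega> :: complex and n :: nat
  assumes "\<omega> ^ (2 * n) = 1" "\<omega> \<noteq> 1" "\<omega> \<noteq> - 1" "n \<ge> 1"
  obtains k where "1 \<le> k" "k \<le> n - 1" "norm (\<omega> - 1) / norm (\<omega> + 1) = tan (real k * pi / (2 * real n))"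
proof -
  have n1: "norm \<omega> = 1" using power_eq_1_iff[OF assms(1)] assms(4) by simp
  define \<theta> where "\<theta> = Arg \<omega>"
  have "\<omega> \<noteq> 0" using n1 by auto
  then have w: "\<omega> = cis \<theta>" unfolding \<theta>_def using cis_Arg[of \<omega>] n1 by (simp add: sgn_div_norm)
  have \<theta>: "- pi < \<theta>" "\<theta> \<le> pi" using Arg_bounded[of \<omega>] by (auto simp: \<theta>_def)
  have "cis (real (2 * n) * \<theta>) = 1" using assms(1) unfolding w by (simp only: Complex.DeMoivre)
  then have "cos (real (2 * n) * \<theta>) = 1" by (simp add: complex_eq_iff)
  then obtain j :: int where "real (2 * n) * \<theta> = real_of_int j * 2 * pi" using cos_one_2pi_int by blast
  then have j: "\<theta> = pi * real_of_int j / real n" using assms(4) by (simp add: field_simps)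
  have "real_of_int j \<noteq> 0" using assms(2) w j by auto
  have jn: "real_of_int j \<noteq> real n" using assms(3,4) w j by auto
  have "pi * - real n < pi * real_of_int j" "pi * real_of_int j \<le> pi * real n" using \<theta> assms(4) unfolding j by (auto simp: field_simps)
  then have "- real n < real_of_int j" "real_of_int j \<le> real n" by (simp_all only: mult_less_cancel_left_pos[OF pi_gt_zero] mult_le_cancel_left_pos[OF pi_gt_zero])
  then have b: "\<bar>real_of_int j\<bar> < real n" using jn by linarith
  define k where "k = nat \<bar>j\<bar>"
  have k: "real k = \<bar>real_of_int j\<bar>" by (simp add: k_def)
  have k1: "1 \<le> k" "k \<le> n - 1" using b k \<open>real_of_int j \<noteq> 0\<close> by (auto simp: k_def)
  have t: "\<bar>\<theta> / 2\<bar> = real k * pi / (2 * real n)" unfolding j k by (simp add: abs_mult mult_ac)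
  have "real k * pi / (2 * real n) < pi / 2" using b k assms(4) by (simp add: field_simps)
  moreover have "0 < real k * pi / (2 * real n)" using k1 assms(4) by simp
  ultimately have tp: "tan (real k * pi / (2 * real n)) > 0" by (intro tan_gt_zero)
  have "norm (\<omega> - 1) / norm (\<omega> + 1) = \<bar>tan (\<theta> / 2)\<bar>" unfolding w norm_cis_pm_1 by (simp add: tan_def abs_divide)
  also have "\<dots> = \<bar>tan \<bar>\<theta> / 2\<bar>\<bar>" by (cases "\<theta> / 2 \<ge> 0") (simp_all add: abs_if)
  also have "\<dots> = tan (real k * pi / (2 * real n))" unfolding t using tp by simp
  finally show ?thesis using that k1 by blast
qed

text \<open>Equal midpoints make the two chords the diagonals of a parallelogram, and equal
  \<open>2 * n\<close>-th powers make them equally long, so it is a rectangle. The quotient \<omega>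
  of the diagonals is a root of unity that encodes the angle between them.\<close>

lemma rectangle_of_intersection:
  assumes inj: "inj_on \<alpha> unit_circle" and n: "n \<ge> 1" and d: "d > 0"
    and a: "a \<in> topspace moebius_band" and b: "b \<in> topspace moebius_band" and ab: "a \<noteq> b" "Psi \<alpha> n a = Psi \<alpha> n b"
    and large: "norm (snd (Psi \<alpha> n a)) \<ge> d ^ (2 * n)"
  shows "\<exists>k::nat. 1 \<le> k \<and> k \<le> n - 1 \<and> has_inscribed_rectangle (\<alpha> ` unit_circle) (tan (real k * pi / (2 * real n))) d"
proof -
  obtain s t where st: "a = Upair s t" "norm s = 1" "norm t = 1" using a unfolding topspace_moebius by blast
  obtain x y where xy: "b = Upair x y" "norm x = 1" "norm y = 1" using b unfolding topspace_moebius by blast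
  define p where "p = \<alpha> s"
  define q where "q = \<alpha> x"
  define r where "r = \<alpha> t"
  define w where "w = \<alpha> y"
  have "(p + r) / 2 = (q + w) / 2" and pow: "(p - r) ^ (2 * n) = (q - w) ^ (2 * n)"
    using ab(2) unfolding st xy Psi_Upair p_def q_def r_def w_def by (blast dest: Pair_inject)+
  then have mid: "p + r = q + w" by (simp only: divide_cancel_right) simp
  have "d ^ (2 * n) \<le> norm (p - r) ^ (2 * n)" using large unfolding st Psi_Upair by (simp add: p_def r_def norm_power)
  then have dist: "d \<le> norm (p - r)" using n d by (subst (asm) power_mono_iff) auto
  then have ne: "p - r \<noteq> 0" using d by auto
  have pq: "p \<noteq> q"
  proof
    assume "p = q"
    then have "s = x" "t = y" using inj st xy mid by (auto simp: p_def q_def r_def w_def dest: inj_onD)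
    then show False using ab(1) st xy by simp
  qed
  have qr: "q \<noteq> r"
  proof
    assume "q = r"
    then have "x = t" "s = y" using inj st xy mid by (auto simp: p_def q_def r_def w_def dest: inj_onD)
    then show False using ab(1) st xy by auto
  qed
  define \<omega> where "\<omega> = (q - w) / (p - r)"
  have om: "q - w = \<omega> * (p - r)" using ne by (simp add: \<omega>_def)
  \<comment> \<open>The sides are half the difference and half the sum of the diagonals, so the
    aspect ratio is that of \<open>\<omega> - 1\<close> to \<open>\<omega> + 1\<close>.\<close>
  have e1: "q - p = (\<omega> - 1) * ((p - r) / 2)" and e2: "r - q = - ((\<omega> + 1) * ((p - r) / 2))"
  proof -
    have "2 * (q - p) = (q - w) - (p - r)" using mid by (simp add: algebra_simps)
    then show "q - p = (\<omega> - 1) * ((p - r) / 2)" unfolding om by (simp add: field_simps)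
    have "2 * (r - q) = - ((q - w) + (p - r))" using mid by (simp add: algebra_simps)
    then show "r - q = - ((\<omega> + 1) * ((p - r) / 2))" unfolding om by (simp add: field_simps)
  qed
  have "\<omega> ^ (2 * n) = 1" unfolding \<omega>_def power_divide pow[symmetric] using ne by simp
  moreover have "\<omega> \<noteq> 1" using e1 pq by auto
  moreover have "\<omega> \<noteq> - 1" using e2 qr by auto
  ultimately obtain k where k: "1 \<le> k" "k \<le> n - 1" "norm (\<omega> - 1) / norm (\<omega> + 1) = tan (real k * pi / (2 * real n))"
    using root_of_unity_ratio n by metis
  have "norm (p - r) = norm (q - w)"
    using arg_cong[OF pow, of norm] n by (simp add: norm_power power_eq_iff_eq_base)
  then have sq: "(p - r) \<bullet> (p - r) = (q - w) \<bullet> (q - w)" by (simp add: dot_square_norm)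
  have "(2 *\<^sub>R (q - p)) \<bullet> (2 *\<^sub>R (r - q)) = ((q - w) - (p - r)) \<bullet> - ((q - w) + (p - r))"
  proof -
    have w: "w = p + r - q" using mid by (simp add: algebra_simps)
    show ?thesis unfolding w by (simp add: scaleR_2)
  qed
  also have "\<dots> = (p - r) \<bullet> (p - r) - (q - w) \<bullet> (q - w)"
    unfolding inner_minus_right inner_add_right inner_diff_left[of "q - w"] by (simp add: inner_commute)
  finally have orth: "(q - p) \<bullet> (r - q) = 0" using sq by simp
  have "dist p q / dist q r = (norm (\<omega> - 1) * norm ((p - r) / 2)) / (norm (\<omega> + 1) * norm ((p - r) / 2))"
    unfolding dist_norm norm_minus_commute[of p] norm_minus_commute[of q r] e1 e2 norm_minus_cancel norm_mult ..
  also have "\<dots> = tan (real k * pi / (2 * real n))" using k(3) ne by simp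
  finally have ratio: "dist p q / dist q r = tan (real k * pi / (2 * real n))" .
  have "rectangle p q r w" unfolding rectangle_def using pq qr mid orth by (simp add: algebra_simps)
  moreover have "{p, q, r, w} \<subseteq> \<alpha> ` unit_circle" using st xy by (simp add: p_def q_def r_def w_def)
  ultimately have "has_inscribed_rectangle (\<alpha> ` unit_circle) (tan (real k * pi / (2 * real n))) d"
    unfolding has_inscribed_rectangle_def using ratio dist by (metis dist_norm)
  then show ?thesis using k by blast
qed

theorem proposition2p5:
  fixes \<Gamma> :: "complex set" and \<alpha> :: "complex \<Rightarrow> complex"
    and n :: nat and d :: real and N :: "(complex \<times> complex) set"
  assumes "continuous_on unit_circle \<alpha>" and "inj_on \<alpha> unit_circle" and "\<Gamma> = \<alpha> ` unit_circle"
    and "n \<ge> 2" and "d > 0"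
    and "regular_closed_nbhd N" and "UNIV \<times> cball 0 (d ^ (2 * n)) \<subseteq> N"
    and "Psi_transverse \<alpha> n (frontier N)"
    and "\<exists>q \<in> {int (2 * n), - int (2 * n)}.
           homeomorphic_pairs
             (top_of_set (frontier N)) (Psi \<alpha> n ` topspace moebius_band \<inter> frontier N)
             (top_of_set (UNIV \<times> unit_circle)) (torus_curve q)"
  shows "(\<exists>a\<in>topspace moebius_band. \<exists>b\<in>topspace moebius_band. a \<noteq> b \<and>
            Psi \<alpha> n a = Psi \<alpha> n b \<and>
            Psi \<alpha> n a \<in> UNIV \<times> (- interior (cball 0 (d ^ (2 * n))))) \<and>
         (\<exists>k::nat. 1 \<le> k \<and> k \<le> n - 1 \<and>
            has_inscribed_rectangle \<Gamma> (tan (real k * pi / (2 * real n))) d)"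
proof -
  obtain q where q: "q \<in> {int (2 * n), - int (2 * n)}"
    "homeomorphic_pairs (top_of_set (frontier N)) (Psi \<alpha> n ` topspace moebius_band \<inter> frontier N)
             (top_of_set (UNIV \<times> unit_circle)) (torus_curve q)"
    using assms(9) by blast
  obtain a b where ab: "a \<in> topspace moebius_band" "b \<in> topspace moebius_band" "a \<noteq> b" "Psi \<alpha> n a = Psi \<alpha> n b"
    and out: "Psi \<alpha> n a \<notin> interior N"
    using intersection_exists[OF assms(1,2,4-8) q] by blast
  have "UNIV \<times> interior (cball 0 (d ^ (2 * n))) \<subseteq> interior N"
    using interior_mono[OF assms(7)] by (simp only: interior_Times interior_UNIV)
  then have far: "Psi \<alpha> n a \<in> UNIV \<times> (- interior (cball 0 (d ^ (2 * n))))"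
    using out by (auto simp: mem_Times_iff)
  then have "norm (snd (Psi \<alpha> n a)) \<ge> d ^ (2 * n)" using \<open>d > 0\<close> by (auto simp: mem_Times_iff)
  then have rect: "\<exists>k::nat. 1 \<le> k \<and> k \<le> n - 1 \<and> has_inscribed_rectangle \<Gamma> (tan (real k * pi / (2 * real n))) d"
    unfolding assms(3) using assms(4) by (intro rectangle_of_intersection[OF assms(2) _ assms(5) ab]) auto
  show ?thesis
    by (rule conjI[OF _ rect], rule bexI[OF _ ab(1)], rule bexI[OF _ ab(2)]) (intro conjI ab(3,4) far)
qed

end
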